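(* Let $m\neq n$ and $\ell\in\{1,\ldots,m+n\}$. The subalgebra $\mathrm{DB}(\mathfrak{gl}_{m|n})$ is a left coideal in $\widetilde{\mathrm{DY}}_0(\mathfrak{gl}_{m|n})$, i.e. $$\Delta\big(\mathrm{DB}(\mathfrak{gl}_{m|n})\big)\subseteq\widetilde{\mathrm{DY}}_0(\mathfrak{gl}_{m|n})\otimes\mathrm{DB}(\mathfrak{gl}_{m|n}).$$
   Context: Everything is over $\mathbb{C}$; $m,n$ are nonnegative integers with $m\neq n$. Put $\bar i=0$ for $i=1,\ldots,m$ and $\bar i=1$ for $i=m+1,\ldots,m+n$. The matrix units $e_{ij}\in\mathrm{End}\,\mathbb{C}^{m|n}$ have parity $\bar i+\bar j$. Tensor products of superalgebras have multiplication $(a\otimes b)(c\otimes d)=(-1)^{|b||c|}ac\otimes bd$. $R(u)=1-Pu^{-1}$ with $P=\sum_{i,j=1}^{m+n}e_{ij}\otimes e_{ji}(-1)^{\bar j}$. Subscripts $1,2$ on matrices indicate the copy of $\mathrm{End}\,\mathbb{C}^{m|n}$ on which they act. Level 0 double Yangian: $\mathrm{DY}_0(\mathfrak{gl}_{m|n})$ is the $\mathbb{Z}_2$-graded unital associative algebra generated by $t_{ij}^{(r)},t_{ij}^{(-r)}$ ($i,j=1,\ldots,m+n$, $r=1,2,\ldots$) of parity $\bar i+\bar j$ with defining relations $$R(u-v)T_1(u)T_2(v)=T_2(v)T_1(u)R(u-v),\quad R(u-v)T_1^+(u)T_2^+(v)=T_2^+(v)T_1^+(u)R(u-v),$$ $$R(u-v)T_1(u)T_2^+(v)=T_2^+(v)T_1(u)R(u-v),$$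 where $T(u)=\sum_{i,j}(-1)^{\bar i\bar j+\bar j}e_{ij}\otimes t_{ij}(u)$, $t_{ij}(u)=\delta_{ij}+\sum_{r\geqslant1}t_{ij}^{(r)}u^{-r}$, $T^+(u)=\sum_{i,j}(-1)^{\bar i\bar j+\bar j}e_{ij}\otimes t_{ij}^+(u)$, $t^+_{ij}(u)=\delta_{ij}-\sum_{r\geqslant1}t_{ij}^{(-r)}u^{r-1}$. Let $\mathrm{Y}$ (resp. $\mathrm{Y}^+$) be the unital subalgebra generated by all $t_{ij}^{(r)}$ (resp. $t_{ij}^{(-r)}$), $r\geqslant1$, and $\widetilde{\mathrm{Y}}^+$ the completion of $\mathrm{Y}^+$ with respect to the descending filtration giving $t_{ij}^{(-r)}$ degree $r$. The extended double Yangian at level 0, $\widetilde{\mathrm{DY}}_0(\mathfrak{gl}_{m|n})$, is the space of finite linear combinations of products $xy$, $x\in\widetilde{\mathrm{Y}}^+$, $y\in\mathrm{Y}$, with multiplication extended by continuity. Its Hopf superalgebra structure has coproduct $$\Delta(t_{ij}(u))=\sum_{k=1}^{m+n}t_{ik}(u)\otimes t_{kj}(u),\qquad\Delta(t^+_{ij}(u))=\sum_{k=1}^{m+n}t^+_{ik}(u)\otimes t^+_{kj}(u),$$ antipode $S(T(u))=T(u)^{-1}$, $S(T^+(u))=T^+(u)^{-1}$ and counit $\varepsilon(T(u))=\varepsilon(T^+(u))=1$. Reflection algebra: let $G=(g_{ij})=\mathrm{diag}(\varepsilon_1,\ldots,\varepsilon_{m+n})$ with $\varepsilon_i=1$ for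 $i\leqslant\ell$ and $\varepsilon_i=-1$ for $i>\ell$, and $$B(u)=T(u)GT(-u)^{-1}=\sum_{i,j}(-1)^{\bar i\bar j+\bar j}e_{ij}\otimes b_{ij}(u),\quad B^+(u)=T^+(u)GT^+(-u)^{-1}=\sum_{i,j}(-1)^{\bar i\bar j+\bar j}e_{ij}\otimes b^+_{ij}(u),$$ $b_{ij}(u)=g_{ij}+\sum_{r\geqslant1}b_{ij}^{(r)}u^{-r}$, $b_{ij}^+(u)=g_{ij}-\sum_{r\geqslant1}b_{ij}^{(-r)}u^{r-1}$. $\mathrm{DB}(\mathfrak{gl}_{m|n})$ is the unital subalgebra of $\widetilde{\mathrm{DY}}_0(\mathfrak{gl}_{m|n})$ generated by all $b_{ij}^{(r)},b_{ij}^{(-r)}$, $r\geqslant1$. *)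

theory Defs
  imports
    Complex_Main
    "HOL-Library.Poly_Mapping"
    "HOL-Algebra.QuotRing"
    "HOL-Algebra.Generated_Rings"
begin

section \<open>Complex superalgebras\<close>

text \<open>
  A complex superalgebra is a ring record with a scalar multiplication and the projections
  \<open>homog A 0\<close>, \<open>homog A 1\<close> onto the even and the odd part.
\<close>

record 'a superalg = "'a ring" +
  scal :: "complex \<Rightarrow> 'a \<Rightarrow> 'a"
  homog :: "nat \<Rightarrow> 'a \<Rightarrow> 'a"

text \<open>
  \<open>twist A d x\<close> is \<open>(-1)\<close> to the power \<open>d |x|\<close> times \<open>x\<close>, extended linearly; it is the sign that
  appears when \<open>x\<close> is moved past an element of parity \<open>d\<close>.
\<close>

definition twist :: "('a, 'x) superalg_scheme \<Rightarrow> nat \<Rightarrow> 'a \<Rightarrow> 'a" where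
  "twist A d x = homog A 0 x \<oplus>\<^bsub>A\<^esub> scal A ((-1) ^ d) (homog A 1 x)"

inductive_set lspan :: "('a, 'x) superalg_scheme \<Rightarrow> 'a set \<Rightarrow> 'a set"
  for A :: "('a, 'x) superalg_scheme" and S :: "'a set" where
  zero: "\<zero>\<^bsub>A\<^esub> \<in> lspan A S"
| incl: "x \<in> S \<Longrightarrow> x \<in> lspan A S"
| add: "x \<in> lspan A S \<Longrightarrow> y \<in> lspan A S \<Longrightarrow> x \<oplus>\<^bsub>A\<^esub> y \<in> lspan A S"
| scal: "x \<in> lspan A S \<Longrightarrow> scal A c x \<in> lspan A S"

definition subalg :: "('a, 'x) superalg_scheme \<Rightarrow> 'a set \<Rightarrow> 'a set" where
  "subalg A S = generate_ring A (range (\<lambda>c. scal A c \<one>\<^bsub>A\<^esub>) \<union> S)"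

definition quot_superalg :: "'a superalg \<Rightarrow> 'a set \<Rightarrow> 'a set superalg" where
  "quot_superalg A I = ring.extend (A Quot I) (superalg.fields
     (\<lambda>c X. \<Union>x\<in>X. I +>\<^bsub>A\<^esub> scal A c x)
     (\<lambda>p X. \<Union>x\<in>X. I +>\<^bsub>A\<^esub> homog A p x))"


section \<open>Completion with respect to a descending filtration\<close>

definition cauchy_seqs :: "'a superalg \<Rightarrow> (nat \<Rightarrow> 'a set) \<Rightarrow> (nat \<Rightarrow> 'a) set" where
  "cauchy_seqs A F = {s. (\<forall>k. s k \<in> carrier A) \<and>
     (\<forall>p. \<exists>K. \<forall>k\<ge>K. \<forall>l\<ge>K. s k \<ominus>\<^bsub>A\<^esub> s l \<in> F p)}"

definition null_seqs :: "'a superalg \<Rightarrow> (nat \<Rightarrow> 'a set) \<Rightarrow> (nat \<Rightarrow> 'a) set" where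
  "null_seqs A F = {s. (\<forall>k. s k \<in> carrier A) \<and> (\<forall>p. \<exists>K. \<forall>k\<ge>K. s k \<in> F p)}"

definition cauchy_superalg :: "'a superalg \<Rightarrow> (nat \<Rightarrow> 'a set) \<Rightarrow> (nat \<Rightarrow> 'a) superalg" where
  "cauchy_superalg A F = \<lparr>carrier = cauchy_seqs A F,
     mult = (\<lambda>s t k. s k \<otimes>\<^bsub>A\<^esub> t k), one = (\<lambda>k. \<one>\<^bsub>A\<^esub>),
     zero = (\<lambda>k. \<zero>\<^bsub>A\<^esub>), add = (\<lambda>s t k. s k \<oplus>\<^bsub>A\<^esub> t k),
     scal = (\<lambda>c s k. scal A c (s k)), homog = (\<lambda>p s k. homog A p (s k))\<rparr>"

definition completion :: "'a superalg \<Rightarrow> (nat \<Rightarrow> 'a set) \<Rightarrow> (nat \<Rightarrow> 'a) set superalg" where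
  "completion A F = quot_superalg (cauchy_superalg A F) (null_seqs A F)"

definition lim_class :: "'a superalg \<Rightarrow> (nat \<Rightarrow> 'a set) \<Rightarrow> (nat \<Rightarrow> 'a) \<Rightarrow> (nat \<Rightarrow> 'a) set" where
  "lim_class A F s = null_seqs A F +>\<^bsub>cauchy_superalg A F\<^esub> s"

definition cembed :: "'a superalg \<Rightarrow> (nat \<Rightarrow> 'a set) \<Rightarrow> 'a \<Rightarrow> (nat \<Rightarrow> 'a) set" where
  "cembed A F x = lim_class A F (\<lambda>k. x)"

text \<open>The basic neighbourhoods of zero in the completion.\<close>

definition cnbhd :: "'a superalg \<Rightarrow> (nat \<Rightarrow> 'a set) \<Rightarrow> nat \<Rightarrow> (nat \<Rightarrow> 'a) set set" where
  "cnbhd A F p = lim_class A F ` {s \<in> cauchy_seqs A F. \<forall>k. s k \<in> F p}"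


section \<open>Tensor products of superalgebras\<close>

text \<open>
  \<open>A \<otimes> B\<close> is the vector space with basis \<open>A \<times> B\<close> modulo the bilinearity relations. The
  multiplication is \<open>(a \<otimes> b)(c \<otimes> d) = (-1)\<^sup>|\<^sup>b\<^sup>|\<^sup>|\<^sup>c\<^sup>| ac \<otimes> bd\<close>, where \<open>p\<close> and \<open>q\<close> below run through
  the parities of the homogeneous components of \<open>b\<close> and \<open>c\<close>. On the free vector space it need not
  be associative; only the quotient is a superalgebra.
\<close>

definition pretensor :: "'a superalg \<Rightarrow> 'b superalg \<Rightarrow> ('a \<times> 'b \<Rightarrow>\<^sub>0 complex) superalg" where
  "pretensor A B = \<lparr>carrier = {f. Poly_Mapping.keys f \<subseteq> carrier A \<times> carrier B},
     mult = (\<lambda>f g. \<Sum>(a, b)\<in>Poly_Mapping.keys f. \<Sum>(c, d)\<in>Poly_Mapping.keys g.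
       \<Sum>p\<in>{0, 1}. \<Sum>q\<in>{0, 1}.
         Poly_Mapping.single (a \<otimes>\<^bsub>A\<^esub> homog A q c, homog B p b \<otimes>\<^bsub>B\<^esub> d)
           ((-1) ^ (p * q) * Poly_Mapping.lookup f (a, b) * Poly_Mapping.lookup g (c, d))),
     one = Poly_Mapping.single (\<one>\<^bsub>A\<^esub>, \<one>\<^bsub>B\<^esub>) 1,
     zero = 0, add = (+),
     scal = (\<lambda>c. Poly_Mapping.map ((*) c)),
     homog = (\<lambda>r f. \<Sum>(a, b)\<in>Poly_Mapping.keys f. \<Sum>p\<in>{0, 1}.
       Poly_Mapping.single (homog A p a, homog B ((p + r) mod 2) b)
         (Poly_Mapping.lookup f (a, b)))\<rparr>"

definition bilinear_rels :: "'a superalg \<Rightarrow> 'b superalg \<Rightarrow> ('a \<times> 'b \<Rightarrow>\<^sub>0 complex) set" where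
  "bilinear_rels A B =
     {Poly_Mapping.single (a \<oplus>\<^bsub>A\<^esub> a', b) 1 - Poly_Mapping.single (a, b) 1
        - Poly_Mapping.single (a', b) 1 | a a' b.
        a \<in> carrier A \<and> a' \<in> carrier A \<and> b \<in> carrier B} \<union>
     {Poly_Mapping.single (a, b \<oplus>\<^bsub>B\<^esub> b') 1 - Poly_Mapping.single (a, b) 1
        - Poly_Mapping.single (a, b') 1 | a b b'.
        a \<in> carrier A \<and> b \<in> carrier B \<and> b' \<in> carrier B} \<union>
     {Poly_Mapping.single (scal A c a, b) 1 - Poly_Mapping.single (a, b) c | a b c.
        a \<in> carrier A \<and> b \<in> carrier B} \<union>
     {Poly_Mapping.single (a, scal B c b) 1 - Poly_Mapping.single (a, b) c | a b c.
        a \<in> carrier A \<and> b \<in> carrier B}"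

definition tensor :: "'a superalg \<Rightarrow> 'b superalg \<Rightarrow> ('a \<times> 'b \<Rightarrow>\<^sub>0 complex) set superalg" where
  "tensor A B = quot_superalg (pretensor A B) (lspan (pretensor A B) (bilinear_rels A B))"

definition tens ::
  "'a superalg \<Rightarrow> 'b superalg \<Rightarrow> 'a \<Rightarrow> 'b \<Rightarrow> ('a \<times> 'b \<Rightarrow>\<^sub>0 complex) set" where
  "tens A B a b = lspan (pretensor A B) (bilinear_rels A B)
     +>\<^bsub>pretensor A B\<^esub> Poly_Mapping.single (a, b) 1"


section \<open>Free superalgebras\<close>

datatype 'a word = Word "'a list"

instantiation word :: (type) monoid_add
begin

definition zero_word :: "'a word" where "0 = Word []"

fun plus_word :: "'a word \<Rightarrow> 'a word \<Rightarrow> 'a word" where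
  "Word xs + Word ys = Word (xs @ ys)"

instance
proof
  fix a b c :: "'a word"
  show "a + b + c = a + (b + c)" by (cases a; cases b; cases c) simp
  show "0 + a = a" by (cases a) (simp add: zero_word_def)
  show "a + 0 = a" by (cases a) (simp add: zero_word_def)
qed

end

type_synonym 'a free_alg = "'a word \<Rightarrow>\<^sub>0 complex"

definition gen_elem :: "'a \<Rightarrow> 'a free_alg" where
  "gen_elem x = Poly_Mapping.single (Word [x]) 1"

fun word_parity :: "('a \<Rightarrow> nat) \<Rightarrow> 'a word \<Rightarrow> nat" where
  "word_parity \<pi> (Word xs) = sum_list (map \<pi> xs) mod 2"

definition free_superalg :: "'a set \<Rightarrow> ('a \<Rightarrow> nat) \<Rightarrow> 'a free_alg superalg" where
  "free_superalg S \<pi> = \<lparr>carrier = {f. Poly_Mapping.keys f \<subseteq> Word ` lists S},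
     mult = (*), one = 1, zero = 0, add = (+),
     scal = (\<lambda>c. Poly_Mapping.map ((*) c)),
     homog = (\<lambda>p f. \<Sum>w\<in>{w \<in> Poly_Mapping.keys f. word_parity \<pi> w = p}.
       Poly_Mapping.single w (Poly_Mapping.lookup f w))\<rparr>"


section \<open>The double Yangian at level 0\<close>

definition bar :: "nat \<Rightarrow> nat \<Rightarrow> nat" where
  "bar m i = (if i \<le> m then 0 else 1)"

text \<open>\<open>(i, j, r)\<close> with \<open>r \<noteq> 0\<close> stands for the generator \<open>t\<^sub>i\<^sub>j\<close> with upper index \<open>r\<close>.\<close>

type_synonym ygen = "nat \<times> nat \<times> int"

definition ygens :: "nat \<Rightarrow> nat \<Rightarrow> ygen set" where
  "ygens m n = {1..m + n} \<times> {1..m + n} \<times> {r. r \<noteq> 0}"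

fun ygen_parity :: "nat \<Rightarrow> ygen \<Rightarrow> nat" where
  "ygen_parity m (i, j, r) = (bar m i + bar m j) mod 2"

definition FreeY :: "nat \<Rightarrow> nat \<Rightarrow> ygen free_alg superalg" where
  "FreeY m n = free_superalg (ygens m n) (ygen_parity m)"

text \<open>
  \<open>t_coeff i j r\<close> is the coefficient of \<open>u\<^sup>-\<^sup>r\<close> in \<open>t\<^sub>i\<^sub>j(u)\<close>, and \<open>tp_coeff i j r\<close> is the
  coefficient of \<open>u\<^sup>r\<close> in \<open>t\<^sup>+\<^sub>i\<^sub>j(u)\<close>.
\<close>

definition t_coeff :: "nat \<Rightarrow> nat \<Rightarrow> nat \<Rightarrow> ygen free_alg" where
  "t_coeff i j r = (if r = 0 then (if i = j then 1 else 0) else gen_elem (i, j, int r))"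

definition tp_coeff :: "nat \<Rightarrow> nat \<Rightarrow> nat \<Rightarrow> ygen free_alg" where
  "tp_coeff i j r = (if r = 0 \<and> i = j then 1 else 0) - gen_elem (i, j, - int (Suc r))"

text \<open>Coefficients of \<open>u\<^sup>a\<close> for an arbitrary integer \<open>a\<close>.\<close>

definition t_ser :: "int \<Rightarrow> nat \<Rightarrow> nat \<Rightarrow> ygen free_alg" where
  "t_ser a i j = (if a \<le> 0 then t_coeff i j (nat (- a)) else 0)"

definition tp_ser :: "int \<Rightarrow> nat \<Rightarrow> nat \<Rightarrow> ygen free_alg" where
  "tp_ser a i j = (if a \<ge> 0 then tp_coeff i j (nat a) else 0)"

text \<open>
  An element \<open>\<Sum> e\<^sub>i\<^sub>j \<otimes> e\<^sub>k\<^sub>l \<otimes> x\<^sub>i\<^sub>j\<^sub>k\<^sub>l\<close> of the superalgebra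
  \<open>End \<otimes> End \<otimes> A\<close> is represented by the family of its components \<open>x i j k l\<close>. The product of
  \<open>e\<^sub>i\<^sub>j \<otimes> e\<^sub>k\<^sub>l \<otimes> x\<close> and \<open>e\<^sub>j\<^sub>q \<otimes> e\<^sub>l\<^sub>s \<otimes> y\<close> is \<open>e\<^sub>i\<^sub>q \<otimes> e\<^sub>k\<^sub>s \<otimes> xy\<close> with the sign of
  exponent \<open>|e\<^sub>k\<^sub>l||e\<^sub>j\<^sub>q| + |x|(|e\<^sub>j\<^sub>q| + |e\<^sub>l\<^sub>s|)\<close>.
\<close>

type_synonym mat2 = "nat \<Rightarrow> nat \<Rightarrow> nat \<Rightarrow> nat \<Rightarrow> ygen free_alg"

definition mat2_mult :: "nat \<Rightarrow> nat \<Rightarrow> mat2 \<Rightarrow> mat2 \<Rightarrow> mat2" where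
  "mat2_mult m n X Y = (\<lambda>i q k s. \<Sum>j\<in>{1..m + n}. \<Sum>l\<in>{1..m + n}.
     (-1) ^ ((bar m k + bar m l) * (bar m j + bar m q)) *
     twist (FreeY m n) (bar m j + bar m q + bar m l + bar m s) (X i j k l) * Y j q l s)"

definition in_first :: "nat \<Rightarrow> (nat \<Rightarrow> nat \<Rightarrow> ygen free_alg) \<Rightarrow> mat2" where
  "in_first m t = (\<lambda>i j k l. if k = l then (-1) ^ (bar m i * bar m j + bar m j) * t i j else 0)"

definition in_second :: "nat \<Rightarrow> (nat \<Rightarrow> nat \<Rightarrow> ygen free_alg) \<Rightarrow> mat2" where
  "in_second m t = (\<lambda>i j k l. if i = j then (-1) ^ (bar m k * bar m l + bar m l) * t k l else 0)"

definition Pmat :: "nat \<Rightarrow> mat2" where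
  "Pmat m = (\<lambda>i j k l. if k = j \<and> l = i then (-1) ^ bar m j else 0)"

text \<open>
  Entries of \<open>R(u-v) T\<^sub>1(u) T'\<^sub>2(v) - T'\<^sub>2(v) T\<^sub>1(u) R(u-v)\<close>, multiplied by \<open>u - v\<close>: the
  relation is understood as an identity of formal series, with \<open>R(u-v)\<close> replaced by the polynomial
  \<open>(u-v) R(u-v) = u - v - P\<close>, and compared at \<open>u\<^sup>a v\<^sup>b\<close>.
\<close>

definition RTT_rels ::
  "nat \<Rightarrow> nat \<Rightarrow> (int \<Rightarrow> nat \<Rightarrow> nat \<Rightarrow> ygen free_alg) \<Rightarrow>
   (int \<Rightarrow> nat \<Rightarrow> nat \<Rightarrow> ygen free_alg) \<Rightarrow> ygen free_alg set" where
  "RTT_rels m n T T' =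
     (let X = (\<lambda>a b. mat2_mult m n (in_first m (T a)) (in_second m (T' b)));
          Z = (\<lambda>a b. mat2_mult m n (in_second m (T' b)) (in_first m (T a)))
      in {(X (a - 1) b i j k l - X a (b - 1) i j k l - mat2_mult m n (Pmat m) (X a b) i j k l)
          - (Z (a - 1) b i j k l - Z a (b - 1) i j k l - mat2_mult m n (Z a b) (Pmat m) i j k l)
         | a b i j k l. {i, j, k, l} \<subseteq> {1..m + n}})"

definition DY_ideal :: "nat \<Rightarrow> nat \<Rightarrow> ygen free_alg set" where
  "DY_ideal m n = Idl\<^bsub>FreeY m n\<^esub>
     (RTT_rels m n t_ser t_ser \<union> RTT_rels m n tp_ser tp_ser \<union> RTT_rels m n t_ser tp_ser)"

definition DY :: "nat \<Rightarrow> nat \<Rightarrow> ygen free_alg set superalg" where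
  "DY m n = quot_superalg (FreeY m n) (DY_ideal m n)"

definition DY_class :: "nat \<Rightarrow> nat \<Rightarrow> ygen free_alg \<Rightarrow> ygen free_alg set" where
  "DY_class m n x = DY_ideal m n +>\<^bsub>FreeY m n\<^esub> x"

definition Ysub :: "nat \<Rightarrow> nat \<Rightarrow> ygen free_alg set set" where
  "Ysub m n = subalg (DY m n)
     {DY_class m n (gen_elem (i, j, r)) | i j r. (i, j, r) \<in> ygens m n \<and> r > 0}"

definition Yplus :: "nat \<Rightarrow> nat \<Rightarrow> ygen free_alg set set" where
  "Yplus m n = subalg (DY m n)
     {DY_class m n (gen_elem (i, j, r)) | i j r. (i, j, r) \<in> ygens m n \<and> r < 0}"


section \<open>The extended double Yangian at level 0\<close>

text \<open>
  The filtration of \<open>Y\<^sup>+\<close>: the \<open>p\<close>-th term is spanned by the monomials in the \<open>t\<^sub>i\<^sub>j\<close> with negative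
  upper indices \<open>-r\<close> whose sum of the \<open>r\<close> is at least \<open>p\<close>.
\<close>

definition Yplus_filt :: "nat \<Rightarrow> nat \<Rightarrow> nat \<Rightarrow> ygen free_alg set set" where
  "Yplus_filt m n p = lspan (DY m n)
     {DY_class m n (Poly_Mapping.single (Word w) 1) | w.
        w \<in> lists {(i, j, r) \<in> ygens m n. r < 0} \<and> int p \<le> (\<Sum>(i, j, r)\<leftarrow>w. - r)}"

text \<open>
  To have one ring in which the products \<open>xy\<close>, with \<open>x\<close> in the completion of \<open>Y\<^sup>+\<close> and \<open>y\<close> in
  \<open>Y\<close>, live and are multiplied by continuity, we complete the double Yangian itself along the
  subspaces spanned by the products of the \<open>p\<close>-th term of the filtration of \<open>Y\<^sup>+\<close> with \<open>Y\<close>.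
  These are right ideals, and the left multiplications are continuous.
\<close>

definition DY_filt :: "nat \<Rightarrow> nat \<Rightarrow> nat \<Rightarrow> ygen free_alg set set" where
  "DY_filt m n p = lspan (DY m n)
     {x \<otimes>\<^bsub>DY m n\<^esub> y | x y. x \<in> Yplus_filt m n p \<and> y \<in> Ysub m n}"

type_synonym dyc = "(nat \<Rightarrow> ygen free_alg set) set"

definition DYc :: "nat \<Rightarrow> nat \<Rightarrow> dyc superalg" where
  "DYc m n = completion (DY m n) (DY_filt m n)"

definition Yplus_compl :: "nat \<Rightarrow> nat \<Rightarrow> dyc set" where
  "Yplus_compl m n = lim_class (DY m n) (DY_filt m n) `
     {s \<in> cauchy_seqs (DY m n) (Yplus_filt m n). \<forall>k. s k \<in> Yplus m n}"

definition EDY :: "nat \<Rightarrow> nat \<Rightarrow> dyc superalg" where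
  "EDY m n = (DYc m n)\<lparr>carrier := lspan (DYc m n)
     {x \<otimes>\<^bsub>DYc m n\<^esub> cembed (DY m n) (DY_filt m n) y | x y.
        x \<in> Yplus_compl m n \<and> y \<in> Ysub m n}\<rparr>"

definition EDY_class :: "nat \<Rightarrow> nat \<Rightarrow> ygen free_alg \<Rightarrow> dyc" where
  "EDY_class m n x = cembed (DY m n) (DY_filt m n) (DY_class m n x)"


section \<open>The coproduct\<close>

text \<open>
  The coproduct of an element of the completion of \<open>Y\<^sup>+\<close> is in general an infinite sum of tensors,
  so it takes values in the completed tensor product.
\<close>

type_synonym dyt = "(ygen free_alg set \<times> ygen free_alg set \<Rightarrow>\<^sub>0 complex) set"

definition DY2 :: "nat \<Rightarrow> nat \<Rightarrow> dyt superalg" where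
  "DY2 m n = tensor (DY m n) (DY m n)"

definition DY2_filt :: "nat \<Rightarrow> nat \<Rightarrow> nat \<Rightarrow> dyt set" where
  "DY2_filt m n p = lspan (DY2 m n)
     {tens (DY m n) (DY m n) x y | x y a b.
        x \<in> DY_filt m n a \<and> y \<in> DY_filt m n b \<and> p \<le> a + b}"

definition DY2c :: "nat \<Rightarrow> nat \<Rightarrow> (nat \<Rightarrow> dyt) set superalg" where
  "DY2c m n = completion (DY2 m n) (DY2_filt m n)"

definition ctens :: "nat \<Rightarrow> nat \<Rightarrow> dyc \<Rightarrow> dyc \<Rightarrow> (nat \<Rightarrow> dyt) set" where
  "ctens m n X Y = (\<Union>x\<in>X. \<Union>y\<in>Y.
     lim_class (DY2 m n) (DY2_filt m n) (\<lambda>k. tens (DY m n) (DY m n) (x k) (y k)))"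

text \<open>The algebraic tensor product of two subspaces, inside the completed tensor product.\<close>

definition tensor_subspace :: "nat \<Rightarrow> nat \<Rightarrow> dyc set \<Rightarrow> dyc set \<Rightarrow> (nat \<Rightarrow> dyt) set set" where
  "tensor_subspace m n V W = lspan (DY2c m n) {ctens m n x y | x y. x \<in> V \<and> y \<in> W}"

text \<open>
  The coproduct is the continuous homomorphism of superalgebras with the given values on the
  generators; these conditions determine it uniquely. The last two conditions compare coefficients
  in \<open>\<Delta>(t\<^sub>i\<^sub>j(u)) = \<Sum> t\<^sub>i\<^sub>k(u) \<otimes> t\<^sub>k\<^sub>j(u)\<close> and in the same formula for \<open>t\<^sup>+\<close>.
\<close>

definition is_coproduct :: "nat \<Rightarrow> nat \<Rightarrow> (dyc \<Rightarrow> (nat \<Rightarrow> dyt) set) \<Rightarrow> bool" where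
  "is_coproduct m n \<Delta> \<longleftrightarrow>
     \<Delta> \<in> ring_hom (EDY m n) (DY2c m n) \<and>
     (\<forall>c. \<forall>x\<in>carrier (EDY m n). \<Delta> (scal (EDY m n) c x) = scal (DY2c m n) c (\<Delta> x)) \<and>
     (\<forall>p\<in>{0, 1}. \<forall>x\<in>carrier (EDY m n).
        \<Delta> (homog (EDY m n) p x) = homog (DY2c m n) p (\<Delta> x)) \<and>
     (\<forall>p. \<exists>q. \<forall>x\<in>carrier (EDY m n) \<inter> cnbhd (DY m n) (DY_filt m n) q.
        \<Delta> x \<in> cnbhd (DY2 m n) (DY2_filt m n) p) \<and>
     (\<forall>i\<in>{1..m + n}. \<forall>j\<in>{1..m + n}. \<forall>r.
        \<Delta> (EDY_class m n (t_coeff i j r)) =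
          (\<Oplus>\<^bsub>DY2c m n\<^esub>k\<in>{1..m + n}. \<Oplus>\<^bsub>DY2c m n\<^esub>a\<in>{..r}.
            ctens m n (EDY_class m n (t_coeff i k a)) (EDY_class m n (t_coeff k j (r - a))))) \<and>
     (\<forall>i\<in>{1..m + n}. \<forall>j\<in>{1..m + n}. \<forall>r.
        \<Delta> (EDY_class m n (tp_coeff i j r)) =
          (\<Oplus>\<^bsub>DY2c m n\<^esub>k\<in>{1..m + n}. \<Oplus>\<^bsub>DY2c m n\<^esub>a\<in>{..r}.
            ctens m n (EDY_class m n (tp_coeff i k a)) (EDY_class m n (tp_coeff k j (r - a)))))"


section \<open>The reflection algebra\<close>

text \<open>
  A formal power series in \<open>w\<close> with coefficients \<open>\<Sum> e\<^sub>i\<^sub>j \<otimes> x\<^sub>i\<^sub>j\<close> in the superalgebra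
  \<open>End \<otimes> EDY\<close> is represented by the components \<open>M r i j\<close> of its coefficients of \<open>w\<^sup>r\<close>;
  here \<open>w = u\<^sup>-\<^sup>1\<close> for \<open>T(u)\<close>, \<open>B(u)\<close> and \<open>w = u\<close> for \<open>T\<^sup>+(u)\<close>, \<open>B\<^sup>+(u)\<close>.
  Only indices in \<open>{1..m + n}\<close> are relevant.
\<close>

type_synonym smat = "nat \<Rightarrow> nat \<Rightarrow> nat \<Rightarrow> dyc"

definition smat_mult :: "nat \<Rightarrow> nat \<Rightarrow> smat \<Rightarrow> smat \<Rightarrow> smat" where
  "smat_mult m n M L = (\<lambda>r i j. \<Oplus>\<^bsub>EDY m n\<^esub>k\<in>{1..m + n}. \<Oplus>\<^bsub>EDY m n\<^esub>a\<in>{..r}.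
     twist (EDY m n) (bar m k + bar m j) (M a i k) \<otimes>\<^bsub>EDY m n\<^esub> L (r - a) k j)"

definition smat_const :: "nat \<Rightarrow> nat \<Rightarrow> (nat \<Rightarrow> nat \<Rightarrow> complex) \<Rightarrow> smat" where
  "smat_const m n g = (\<lambda>r i j. if r = 0 then scal (EDY m n) (g i j) \<one>\<^bsub>EDY m n\<^esub>
     else \<zero>\<^bsub>EDY m n\<^esub>)"

definition smat_is_inverse :: "nat \<Rightarrow> nat \<Rightarrow> smat \<Rightarrow> smat \<Rightarrow> bool" where
  "smat_is_inverse m n M L \<longleftrightarrow> (\<forall>r. \<forall>i\<in>{1..m + n}. \<forall>j\<in>{1..m + n}.
     L r i j \<in> carrier (EDY m n) \<and>
     smat_mult m n M L r i j = smat_const m n (\<lambda>i j. of_bool (i = j)) r i j \<and>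
     smat_mult m n L M r i j = smat_const m n (\<lambda>i j. of_bool (i = j)) r i j)"

definition smat_inv :: "nat \<Rightarrow> nat \<Rightarrow> smat \<Rightarrow> smat" where
  "smat_inv m n M = (SOME L. smat_is_inverse m n M L)"

text \<open>The substitution of \<open>-u\<close> for \<open>u\<close>.\<close>

definition smat_neg :: "nat \<Rightarrow> nat \<Rightarrow> smat \<Rightarrow> smat" where
  "smat_neg m n M = (\<lambda>r i j. scal (EDY m n) ((-1) ^ r) (M r i j))"

definition Tmat :: "nat \<Rightarrow> nat \<Rightarrow> smat" where
  "Tmat m n = (\<lambda>r i j. scal (EDY m n) ((-1) ^ (bar m i * bar m j + bar m j))
     (EDY_class m n (t_coeff i j r)))"

definition Tpmat :: "nat \<Rightarrow> nat \<Rightarrow> smat" where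
  "Tpmat m n = (\<lambda>r i j. scal (EDY m n) ((-1) ^ (bar m i * bar m j + bar m j))
     (EDY_class m n (tp_coeff i j r)))"

definition gmat :: "nat \<Rightarrow> nat \<Rightarrow> nat \<Rightarrow> complex" where
  "gmat ell i j = (if i = j then (if i \<le> ell then 1 else -1) else 0)"

definition Bmat :: "nat \<Rightarrow> nat \<Rightarrow> nat \<Rightarrow> smat" where
  "Bmat m n ell = smat_mult m n (smat_mult m n (Tmat m n) (smat_const m n (gmat ell)))
     (smat_inv m n (smat_neg m n (Tmat m n)))"

definition Bpmat :: "nat \<Rightarrow> nat \<Rightarrow> nat \<Rightarrow> smat" where
  "Bpmat m n ell = smat_mult m n (smat_mult m n (Tpmat m n) (smat_const m n (gmat ell)))
     (smat_inv m n (smat_neg m n (Tpmat m n)))"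

text \<open>
  The coefficients of \<open>u\<^sup>-\<^sup>r\<close> in \<open>b\<^sub>i\<^sub>j(u)\<close> and of \<open>u\<^sup>r\<close> in \<open>b\<^sup>+\<^sub>i\<^sub>j(u)\<close>.
\<close>

definition b_coeff :: "nat \<Rightarrow> nat \<Rightarrow> nat \<Rightarrow> nat \<Rightarrow> nat \<Rightarrow> nat \<Rightarrow> dyc" where
  "b_coeff m n ell i j r =
     scal (EDY m n) ((-1) ^ (bar m i * bar m j + bar m j)) (Bmat m n ell r i j)"

definition bp_coeff :: "nat \<Rightarrow> nat \<Rightarrow> nat \<Rightarrow> nat \<Rightarrow> nat \<Rightarrow> nat \<Rightarrow> dyc" where
  "bp_coeff m n ell i j r =
     scal (EDY m n) ((-1) ^ (bar m i * bar m j + bar m j)) (Bpmat m n ell r i j)"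

text \<open>
  The generators \<open>b\<^sub>i\<^sub>j\<close> with upper index \<open>-r\<close>, read off from
  \<open>b\<^sup>+\<^sub>i\<^sub>j(u) = g\<^sub>i\<^sub>j - \<Sum> b\<^sub>i\<^sub>j u\<^sup>r\<^sup>-\<^sup>1\<close>.
\<close>

definition b_neg :: "nat \<Rightarrow> nat \<Rightarrow> nat \<Rightarrow> nat \<Rightarrow> nat \<Rightarrow> nat \<Rightarrow> dyc" where
  "b_neg m n ell i j r = smat_const m n (gmat ell) (r - 1) i j
     \<ominus>\<^bsub>EDY m n\<^esub> bp_coeff m n ell i j (r - 1)"

definition DB :: "nat \<Rightarrow> nat \<Rightarrow> nat \<Rightarrow> dyc set" where
  "DB m n ell = subalg (EDY m n)
     ({b_coeff m n ell i j r | i j r. i \<in> {1..m + n} \<and> j \<in> {1..m + n} \<and> r \<ge> 1} \<union>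
      {b_neg m n ell i j r | i j r. i \<in> {1..m + n} \<and> j \<in> {1..m + n} \<and> r \<ge> 1})"

end

theory Submission
  imports Defs
begin

text \<open>
  Absorbing the signs \<open>(-1)\<^sup>i\<^sup>j\<^sup>+\<^sup>j\<close> into the entries turns products of even matrices over
  \<open>End \<otimes> EDY\<close> into plain matrix products, so that \<open>b(u) = t(u) g t(-u)\<^sup>-\<^sup>1\<close>. With
  \<open>P = t(u) \<otimes> 1\<close> and \<open>Q = 1 \<otimes> t(u)\<close> the coproduct reads \<open>\<Delta>(t(u)) = P Q\<close>. Since an
  inverse matrix is unique, \<open>\<Delta>\<close> maps \<open>t(-u)\<^sup>-\<^sup>1\<close> to \<open>Q'P'\<close>, where
  \<open>P' = t(-u)\<^sup>-\<^sup>1 \<otimes> 1\<close> and \<open>Q' = 1 \<otimes> t(-u)\<^sup>-\<^sup>1\<close>. Hence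
  \<open>\<Delta>(b(u)) = P (Q g Q') P' = P (1 \<otimes> b(u)) P'\<close>, whose entries lie in \<open>EDY \<otimes> DB\<close>. The same
  computation applies to \<open>t\<^sup>+(u)\<close>.

  For this to make sense the extended double Yangian has to be closed under multiplication: by the
  relation between \<open>T\<close> and \<open>T\<^sup>+\<close>, moving the coefficient of \<open>u\<^sup>-\<^sup>r\<close> in \<open>t\<^sub>i\<^sub>j(u)\<close> to the right of an
  element of filtration degree \<open>p\<close> produces only coefficients of order at most \<open>r\<close>, with left
  factors of degree at least \<open>p - r\<close>. The matrix \<open>T\<^sup>+(u)\<close> is invertible because its constant
  term is \<open>1\<close> plus a matrix of positive degree.
\<close>

text \<open>Two obstacles shape the proof. The inverse of \<open>T^+(u)\<close> exists only after
  completion, so generators of \<open>DB\<close> may be limits and their coproducts infinite sums of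
  tensors. The image of the inverse matrix under \<open>\<Delta>\<close> is therefore not computed
  but pinned down by uniqueness of inverses over the completed tensor square. The same uniqueness
  controls \<open>smat_inv\<close>, which is a mere choice. The second obstacle is the sign rule. In
  \<open>P (1 \<otimes> b(u)) P'\<close> the entries of \<open>P'\<close> stand to the right of
  \<open>1 \<otimes> b\<close>, and moving them into the first factor would cost signs. They are not
  moved: the span of the tensors \<open>x \<otimes> b\<close> is shown to be a subalgebra, which
  works because both factors are stable under the parity projections. For \<open>DB\<close> this
  stability comes from its generators being homogeneous. Constant terms need separate care: that of
  \<open>b(u)\<close> is \<open>g\<close>, while that of \<open>b^+(u)\<close> is \<open>g\<close>
  minus a generator. Hence every coefficient of both series lies in \<open>DB\<close>, although the
  generators of the first kind start at order 1.\<close>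

section \<open>Superalgebras and their homomorphisms\<close>

text \<open>
  \<open>presuperalgebra\<close> collects the linear part of the structure, which the free vector space
  underlying a tensor product already has.
\<close>

locale presuperalgebra = abelian_group A for A :: "('a, 'x) superalg_scheme" (structure) +
  assumes scal_closed [simp, intro]: "x \<in> carrier A \<Longrightarrow> scal A c x \<in> carrier A"
    and scal_add: "x \<in> carrier A \<Longrightarrow> y \<in> carrier A \<Longrightarrow> scal A c (x \<oplus> y) = scal A c x \<oplus> scal A c y"
    and scal_plus: "x \<in> carrier A \<Longrightarrow> scal A (c + d) x = scal A c x \<oplus> scal A d x"
    and scal_scal: "x \<in> carrier A \<Longrightarrow> scal A c (scal A d x) = scal A (c * d) x"
    and scal_1 [simp]: "x \<in> carrier A \<Longrightarrow> scal A 1 x = x"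
    and mult_closed [simp, intro]: "x \<in> carrier A \<Longrightarrow> y \<in> carrier A \<Longrightarrow> x \<otimes> y \<in> carrier A"
    and one_mem [simp, intro]: "\<one> \<in> carrier A"
    and distr_r: "x \<in> carrier A \<Longrightarrow> y \<in> carrier A \<Longrightarrow> z \<in> carrier A \<Longrightarrow>
      (x \<oplus> y) \<otimes> z = x \<otimes> z \<oplus> y \<otimes> z"
    and distr_l: "x \<in> carrier A \<Longrightarrow> y \<in> carrier A \<Longrightarrow> z \<in> carrier A \<Longrightarrow>
      z \<otimes> (x \<oplus> y) = z \<otimes> x \<oplus> z \<otimes> y"
    and scal_mult_l: "x \<in> carrier A \<Longrightarrow> y \<in> carrier A \<Longrightarrow> scal A c x \<otimes> y = scal A c (x \<otimes> y)"
    and scal_mult_r: "x \<in> carrier A \<Longrightarrow> y \<in> carrier A \<Longrightarrow> x \<otimes> scal A c y = scal A c (x \<otimes> y)"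
    and homog_closed [simp, intro]: "p < 2 \<Longrightarrow> x \<in> carrier A \<Longrightarrow> homog A p x \<in> carrier A"
    and homog_add: "p < 2 \<Longrightarrow> x \<in> carrier A \<Longrightarrow> y \<in> carrier A \<Longrightarrow>
      homog A p (x \<oplus> y) = homog A p x \<oplus> homog A p y"
    and homog_scal: "p < 2 \<Longrightarrow> x \<in> carrier A \<Longrightarrow> homog A p (scal A c x) = scal A c (homog A p x)"

locale superalgebra = ring A + presuperalgebra A for A :: "('a, 'x) superalg_scheme" (structure) +
  assumes homog_decomp: "x \<in> carrier A \<Longrightarrow> homog A 0 x \<oplus> homog A (Suc 0) x = x"
    and homog_homog: "p < 2 \<Longrightarrow> q < 2 \<Longrightarrow> x \<in> carrier A \<Longrightarrow>
      homog A p (homog A q x) = (if p = q then homog A q x else \<zero>)"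
    and homog_mult: "p < 2 \<Longrightarrow> q < 2 \<Longrightarrow> x \<in> carrier A \<Longrightarrow> y \<in> carrier A \<Longrightarrow>
      homog A ((p + q) mod 2) (homog A p x \<otimes> homog A q y) = homog A p x \<otimes> homog A q y"
    and homog_one: "homog A 0 \<one> = \<one>"

text \<open>No axiom is required of the target: the predicate serves to transport the axioms from
  \<open>A\<close> to an image \<open>B\<close> whose operations are only known as raw functions,
  such as a quotient or a completion.\<close>

definition salg_hom :: "('a, 'x) superalg_scheme \<Rightarrow> ('b, 'y) superalg_scheme \<Rightarrow> ('a \<Rightarrow> 'b) \<Rightarrow> bool" where
  "salg_hom A B f \<longleftrightarrow> (\<forall>x\<in>carrier A. f x \<in> carrier B) \<and>
     (\<forall>x\<in>carrier A. \<forall>y\<in>carrier A. f (x \<oplus>\<^bsub>A\<^esub> y) = f x \<oplus>\<^bsub>B\<^esub> f y) \<and>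
     (\<forall>x\<in>carrier A. \<forall>y\<in>carrier A. f (x \<otimes>\<^bsub>A\<^esub> y) = f x \<otimes>\<^bsub>B\<^esub> f y) \<and>
     f \<zero>\<^bsub>A\<^esub> = \<zero>\<^bsub>B\<^esub> \<and> f \<one>\<^bsub>A\<^esub> = \<one>\<^bsub>B\<^esub> \<and>
     (\<forall>c. \<forall>x\<in>carrier A. f (scal A c x) = scal B c (f x)) \<and>
     (\<forall>p<2. \<forall>x\<in>carrier A. f (homog A p x) = homog B p (f x))"

lemma salg_homD:
  assumes "salg_hom A B f"
  shows "x \<in> carrier A \<Longrightarrow> f x \<in> carrier B"
    and "x \<in> carrier A \<Longrightarrow> y \<in> carrier A \<Longrightarrow> f (x \<oplus>\<^bsub>A\<^esub> y) = f x \<oplus>\<^bsub>B\<^esub> f y"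
    and "x \<in> carrier A \<Longrightarrow> y \<in> carrier A \<Longrightarrow> f (x \<otimes>\<^bsub>A\<^esub> y) = f x \<otimes>\<^bsub>B\<^esub> f y"
    and "f \<zero>\<^bsub>A\<^esub> = \<zero>\<^bsub>B\<^esub>" and "f \<one>\<^bsub>A\<^esub> = \<one>\<^bsub>B\<^esub>"
    and "x \<in> carrier A \<Longrightarrow> f (scal A c x) = scal B c (f x)"
    and "p < 2 \<Longrightarrow> x \<in> carrier A \<Longrightarrow> f (homog A p x) = homog B p (f x)"
  using assms unfolding salg_hom_def by blast+

lemma salg_hom_comp:
  assumes "salg_hom A B f" "salg_hom B C g"
  shows "salg_hom A C (\<lambda>x. g (f x))"
  using assms unfolding salg_hom_def by simp

text \<open>Every axiom is an equation or a closure property, hence passes to a surjective image.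
  Quotients are handled this way, so that no axiom has to be checked on cosets.\<close>

lemma presuperalgebra_surj:
  assumes "presuperalgebra A" and h: "salg_hom A B f" and s: "carrier B = f ` carrier A"
  shows "presuperalgebra B"
proof -
  interpret presuperalgebra A by fact
  \<comment> \<open>Reversed, the homomorphism equations rewrite an operation of \<open>B\<close> on
    images into \<open>f\<close> of an operation of \<open>A\<close>, where the axioms are
    available.\<close>
  note hs = salg_homD(2-7)[OF h, symmetric]
  have "abelian_group B"
  proof (rule abelian_groupI)
    fix x assume "x \<in> carrier B"
    then obtain a where a: "a \<in> carrier A" "x = f a" using s by auto
    then have "f (\<ominus>\<^bsub>A\<^esub> a) \<oplus>\<^bsub>B\<^esub> x = \<zero>\<^bsub>B\<^esub>" by (simp add: hs l_neg)
    moreover have "f (\<ominus>\<^bsub>A\<^esub> a) \<in> carrier B" using a s by auto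
    ultimately show "\<exists>y\<in>carrier B. y \<oplus>\<^bsub>B\<^esub> x = \<zero>\<^bsub>B\<^esub>" by blast
  qed (auto simp: s hs a_assoc intro!: arg_cong[of _ _ f] a_comm)
  then interpret B: abelian_group B .
  show ?thesis
    by unfold_locales
      (auto simp: s hs scal_add scal_plus scal_scal distr_r distr_l scal_mult_l scal_mult_r
        homog_add homog_scal)
qed

lemma superalgebra_surj:
  assumes "superalgebra A" and h: "salg_hom A B f" and s: "carrier B = f ` carrier A"
  shows "superalgebra B"
proof -
  interpret superalgebra A by fact
  note hs = salg_homD(2-7)[OF h, symmetric]
  interpret B: presuperalgebra B
    using presuperalgebra_surj[OF presuperalgebra_axioms h s] .
  show ?thesis
  proof (intro superalgebra.intro ringI superalgebra_axioms.intro)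
    show "Group.monoid B"
      by (unfold_locales) (auto simp: s hs m_assoc)
    show "abelian_group B" "presuperalgebra B" by unfold_locales
    fix p q :: nat and x y
    show "x \<in> carrier B \<Longrightarrow> homog B 0 x \<oplus>\<^bsub>B\<^esub> homog B (Suc 0) x = x"
      by (auto simp: s hs homog_decomp)
    show "p < 2 \<Longrightarrow> q < 2 \<Longrightarrow> x \<in> carrier B \<Longrightarrow>
      homog B p (homog B q x) = (if p = q then homog B q x else \<zero>\<^bsub>B\<^esub>)"
      by (auto simp: s hs homog_homog)
    show "p < 2 \<Longrightarrow> q < 2 \<Longrightarrow> x \<in> carrier B \<Longrightarrow> y \<in> carrier B \<Longrightarrow>
      homog B ((p + q) mod 2) (homog B p x \<otimes>\<^bsub>B\<^esub> homog B q y) = homog B p x \<otimes>\<^bsub>B\<^esub> homog B q y"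
      by (auto simp: s hs homog_mult)
    show "homog B 0 \<one>\<^bsub>B\<^esub> = \<one>\<^bsub>B\<^esub>" by (simp add: hs homog_one)
  qed (auto simp: B.distr_l B.distr_r)
qed

section \<open>Linear algebra in a presuperalgebra: subspaces and spans\<close>

context presuperalgebra
begin

lemma zero_l [simp]: "x \<in> carrier A \<Longrightarrow> \<zero> \<otimes> x = \<zero>"
  by (metis distr_r add.l_cancel_one' add.one_closed l_zero mult_closed)

lemma zero_r [simp]: "x \<in> carrier A \<Longrightarrow> x \<otimes> \<zero> = \<zero>"
  by (metis distr_l add.l_cancel_one' add.one_closed l_zero mult_closed)

lemma scal_0 [simp]: "x \<in> carrier A \<Longrightarrow> scal A 0 x = \<zero>"
  by (metis scal_plus add.l_cancel_one' add.one_closed add_0 scal_closed)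

lemma scal_zero [simp]: "scal A c \<zero> = \<zero>"
  by (metis scal_add add.l_cancel_one' add.one_closed l_zero scal_closed)

lemma homog_zero [simp]: "p < 2 \<Longrightarrow> homog A p \<zero> = \<zero>"
  by (metis homog_scal homog_closed add.one_closed scal_0)

lemma scal_neg1: "x \<in> carrier A \<Longrightarrow> scal A (-1) x = \<ominus> x"
proof -
  assume x: "x \<in> carrier A"
  have "scal A (-1) x \<oplus> x = scal A (-1 + 1) x" by (simp only: scal_plus[OF x] scal_1[OF x])
  also have "\<dots> = \<zero>" using x by simp
  finally show ?thesis using x minus_equality by auto
qed

lemma minus_scal: "x \<in> carrier A \<Longrightarrow> y \<in> carrier A \<Longrightarrow> x \<ominus> y = x \<oplus> scal A (-1) y"
  by (simp add: minus_eq scal_neg1)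

lemma homog_minus:
  "p < 2 \<Longrightarrow> x \<in> carrier A \<Longrightarrow> y \<in> carrier A \<Longrightarrow> homog A p (x \<ominus> y) = homog A p x \<ominus> homog A p y"
  by (simp add: minus_scal homog_add homog_scal)

lemma scal_minus:
  "x \<in> carrier A \<Longrightarrow> y \<in> carrier A \<Longrightarrow> scal A c (x \<ominus> y) = scal A c x \<ominus> scal A c y"
  by (simp add: minus_scal scal_add scal_scal)

lemma minus_distr_l:
  "x \<in> carrier A \<Longrightarrow> y \<in> carrier A \<Longrightarrow> z \<in> carrier A \<Longrightarrow> z \<otimes> (x \<ominus> y) = z \<otimes> x \<ominus> z \<otimes> y"
  by (simp add: minus_scal distr_l scal_mult_r)

lemma minus_distr_r:
  "x \<in> carrier A \<Longrightarrow> y \<in> carrier A \<Longrightarrow> z \<in> carrier A \<Longrightarrow> (x \<ominus> y) \<otimes> z = x \<otimes> z \<ominus> y \<otimes> z"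
  by (simp add: minus_scal distr_r scal_mult_l)

lemma minus_telescope:
  "x \<in> carrier A \<Longrightarrow> y \<in> carrier A \<Longrightarrow> z \<in> carrier A \<Longrightarrow> (x \<ominus> y) \<oplus> (y \<ominus> z) = x \<ominus> z"
  by (simp add: minus_eq a_assoc r_neg1)

lemma minus_0 [simp]: "x \<in> carrier A \<Longrightarrow> x \<ominus> \<zero> = x"
  by (simp add: minus_scal)

definition subspace :: "'a set \<Rightarrow> bool" where
  "subspace V \<longleftrightarrow> V \<subseteq> carrier A \<and> \<zero> \<in> V \<and> (\<forall>x\<in>V. \<forall>y\<in>V. x \<oplus> y \<in> V) \<and> (\<forall>c. \<forall>x\<in>V. scal A c x \<in> V)"

lemma subspaceD:
  assumes "subspace V"
  shows "x \<in> V \<Longrightarrow> x \<in> carrier A" "\<zero> \<in> V" "x \<in> V \<Longrightarrow> y \<in> V \<Longrightarrow> x \<oplus> y \<in> V"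
    "x \<in> V \<Longrightarrow> scal A c x \<in> V" "x \<in> V \<Longrightarrow> \<ominus> x \<in> V" "x \<in> V \<Longrightarrow> y \<in> V \<Longrightarrow> x \<ominus> y \<in> V"
proof -
  show *: "x \<in> V \<Longrightarrow> x \<in> carrier A" "\<zero> \<in> V" "x \<in> V \<Longrightarrow> y \<in> V \<Longrightarrow> x \<oplus> y \<in> V"
    "x \<in> V \<Longrightarrow> scal A c x \<in> V" for x y c
    using assms by (auto simp: subspace_def)
  show "x \<in> V \<Longrightarrow> \<ominus> x \<in> V" using * by (metis scal_neg1)
  show "x \<in> V \<Longrightarrow> y \<in> V \<Longrightarrow> x \<ominus> y \<in> V" using * by (metis minus_scal)
qed

lemma subspace_finsum:
  assumes "subspace V" "\<And>i. i \<in> I \<Longrightarrow> f i \<in> V"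
  shows "finsum A f I \<in> V"
proof (cases "finite I")
  case True
  then show ?thesis using assms(2)
  proof (induction I)
    case (insert i I)
    then have "f \<in> I \<rightarrow> carrier A" "f i \<in> carrier A" using subspaceD[OF assms(1)] by auto
    then show ?case using insert subspaceD[OF assms(1)] by simp
  qed (use subspaceD[OF assms(1)] in simp)
qed (use subspaceD[OF assms(1)] in simp)

lemma lspan_subspace:
  assumes "S \<subseteq> carrier A"
  shows "subspace (lspan A S)"
proof -
  have "x \<in> carrier A" if "x \<in> lspan A S" for x
    using that assms by induction auto
  then show ?thesis unfolding subspace_def by (auto intro: lspan.intros)
qed

lemma lspan_least:
  assumes "subspace V" "S \<subseteq> V"
  shows "lspan A S \<subseteq> V"
proof
  fix x assume "x \<in> lspan A S"
  then show "x \<in> V" using assms by induction (auto dest: subspaceD)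
qed

text \<open>Preimages of a subspace under linear maps. Fed into \<open>lspan_least\<close> they
  replace induction over spans: a claim linear in an element only has to be checked on
  generators.\<close>

lemma subspace_mult_l: "subspace V \<Longrightarrow> a \<in> carrier A \<Longrightarrow> subspace {x \<in> carrier A. a \<otimes> x \<in> V}"
  by (auto simp: subspace_def distr_l scal_mult_r)

lemma subspace_mult_r: "subspace V \<Longrightarrow> a \<in> carrier A \<Longrightarrow> subspace {x \<in> carrier A. x \<otimes> a \<in> V}"
  by (auto simp: subspace_def distr_r scal_mult_l)

lemma subspace_homog: "subspace V \<Longrightarrow> p < 2 \<Longrightarrow> subspace {x \<in> carrier A. homog A p x \<in> V}"
  by (auto simp: subspace_def homog_add homog_scal)

lemma lspan_homog:
  assumes "S \<subseteq> carrier A" "p < 2" "\<And>x. x \<in> S \<Longrightarrow> homog A p x \<in> lspan A S" "x \<in> lspan A S"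
  shows "homog A p x \<in> lspan A S"
  using lspan_least[OF subspace_homog[OF lspan_subspace[OF assms(1)] assms(2)], of S] assms by auto

text \<open>Bilinearity in two passes: for a fixed generator on the left the claim spreads over the
  span of \<open>T\<close>, and then, with \<open>y\<close> fixed, over the span of
  \<open>S\<close>.\<close>

lemma lspan_mult:
  assumes "S \<subseteq> carrier A" "T \<subseteq> carrier A" "subspace V"
    and "\<And>x y. x \<in> S \<Longrightarrow> y \<in> T \<Longrightarrow> x \<otimes> y \<in> V" "x \<in> lspan A S" "y \<in> lspan A T"
  shows "x \<otimes> y \<in> V"
proof -
  have "y \<in> {y \<in> carrier A. s \<otimes> y \<in> V}" if "s \<in> S" for s
    using lspan_least[OF subspace_mult_l[OF assms(3)], of s T] that assms by auto
  then have "S \<subseteq> {x \<in> carrier A. x \<otimes> y \<in> V}" using assms(1) by auto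
  moreover have "y \<in> carrier A" using subspaceD(1)[OF lspan_subspace[OF assms(2)]] assms(6) .
  ultimately show ?thesis using lspan_least[OF subspace_mult_r[OF assms(3)], of y S] assms(5) by auto
qed

end

subsection \<open>Quotients\<close>

text \<open>Quotients are needed already for the product on the free vector space under a tensor
  product, which need not be associative, so only \<open>presuperalgebra\<close> is assumed.
  Stability under the projections makes the quotient graded.\<close>

locale superideal = presuperalgebra A for A :: "'a superalg" (structure) +
  fixes I :: "'a set"
  assumes sub: "subspace I"
    and mult_l: "a \<in> carrier A \<Longrightarrow> x \<in> I \<Longrightarrow> a \<otimes> x \<in> I"
    and mult_r: "a \<in> carrier A \<Longrightarrow> x \<in> I \<Longrightarrow> x \<otimes> a \<in> I"
    and homog_I: "p < 2 \<Longrightarrow> x \<in> I \<Longrightarrow> homog A p x \<in> I"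
begin

abbreviation cls :: "'a \<Rightarrow> 'a set" where "cls x \<equiv> I +> x"

lemma abelian_subgroup_I: "abelian_subgroup I A"
proof (rule abelian_subgroupI3)
  show "additive_subgroup I A"
    by (rule additive_subgroupI, rule add.subgroupI) (use subspaceD[OF sub] in auto)
qed unfold_locales

sublocale I: abelian_subgroup I A by (rule abelian_subgroup_I)

lemma cls_eq_iff: "x \<in> carrier A \<Longrightarrow> y \<in> carrier A \<Longrightarrow> cls x = cls y \<longleftrightarrow> x \<ominus> y \<in> I"
  using I.a_rcos_module_minus[of y x] I.a_repr_independenceD I.a_repr_independence' I.a_rcos_self
    I.a_subset ring_axioms_def
  by (metis I.a_rcos_const I.a_rcos_module minus_eq)

lemma mem_cls: "x \<in> carrier A \<Longrightarrow> y \<in> cls x \<Longrightarrow> y \<in> carrier A \<and> y \<ominus> x \<in> I"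
  by (metis I.a_elemrcos_carrier I.a_rcos_module_imp minus_eq)

text \<open>The scalar multiplication and the projections of \<open>quot_superalg\<close> are unions
  of cosets over all representatives; such a union is a single coset as soon as its members do not
  depend on the representative.\<close>

lemma cls_const:
  assumes "x \<in> carrier A" "\<And>y. y \<in> carrier A \<Longrightarrow> y \<ominus> x \<in> I \<Longrightarrow> cls (f y) = cls (f x)"
  shows "(\<Union>y\<in>cls x. cls (f y)) = cls (f x)"
  using assms mem_cls I.a_rcos_self by blast

lemma salg_hom_cls: "salg_hom A (quot_superalg A I) cls"
proof -
  note d = quot_superalg_def ring.defs superalg.defs FactRing_def A_RCOSETS_def' rcoset_mult_def
  have add: "cls (x \<oplus> y) = cls x <+> cls y" if "x \<in> carrier A" "y \<in> carrier A" for x y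
    using that by (simp add: I.a_rcos_sum)
  have mult: "cls (x \<otimes> y) = (\<Union>a\<in>cls x. \<Union>b\<in>cls y. cls (a \<otimes> b))"
    if xy: "x \<in> carrier A" "y \<in> carrier A" for x y
  proof -
    have "cls (a \<otimes> b) = cls (x \<otimes> y)" if "a \<in> cls x" "b \<in> cls y" for a b
    proof -
      have ab: "a \<in> carrier A" "b \<in> carrier A" "a \<ominus> x \<in> I" "b \<ominus> y \<in> I"
        using that xy mem_cls by auto
      have "a \<otimes> b \<ominus> x \<otimes> y = (a \<ominus> x) \<otimes> b \<oplus> x \<otimes> (b \<ominus> y)"
        using ab xy by (simp add: minus_distr_l minus_distr_r minus_telescope)
      also have "\<dots> \<in> I" using ab xy mult_l mult_r subspaceD[OF sub] by auto
      finally show ?thesis using ab xy by (simp add: cls_eq_iff)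
    qed
    then show ?thesis using xy I.a_rcos_self by blast
  qed
  have scal: "cls (scal A c x) = (\<Union>y\<in>cls x. cls (scal A c y))" if "x \<in> carrier A" for c x
    by (rule cls_const[symmetric], fact)
      (use that subspaceD(4)[OF sub] in \<open>auto simp: cls_eq_iff simp flip: scal_minus\<close>)
  have homog: "cls (homog A p x) = (\<Union>y\<in>cls x. cls (homog A p y))" if "x \<in> carrier A" "p < 2" for p x
    by (rule cls_const[symmetric], fact)
      (use that homog_I in \<open>auto simp: cls_eq_iff simp flip: homog_minus\<close>)
  show ?thesis
    unfolding salg_hom_def
    using a_coset_add_zero[OF I.a_subset]
    by (auto simp: d add mult scal homog simp del: a_coset_add_zero)
qed

lemma carrier_quot: "carrier (quot_superalg A I) = cls ` carrier A"
  by (auto simp: quot_superalg_def ring.defs superalg.defs FactRing_def A_RCOSETS_def')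

lemma presuperalgebra_quot: "presuperalgebra (quot_superalg A I)"
  using presuperalgebra_surj[OF presuperalgebra_axioms salg_hom_cls carrier_quot] .

lemma superalgebra_quot: "superalgebra A \<Longrightarrow> superalgebra (quot_superalg A I)"
  using superalgebra_surj[OF _ salg_hom_cls carrier_quot] .

lemma cls_eq_zero_iff: "x \<in> carrier A \<Longrightarrow> cls x = \<zero>\<^bsub>quot_superalg A I\<^esub> \<longleftrightarrow> x \<in> I"
  using cls_eq_iff[of x \<zero>] salg_homD(4)[OF salg_hom_cls] by simp

end

subsection \<open>Homogeneous elements and subalgebras\<close>

context superalgebra
begin

definition ishom :: "nat \<Rightarrow> 'a \<Rightarrow> bool" where
  "ishom p x \<longleftrightarrow> p < 2 \<and> x \<in> carrier A \<and> homog A p x = x"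

lemma ishom_homog: "p < 2 \<Longrightarrow> x \<in> carrier A \<Longrightarrow> ishom p (homog A p x)"
  by (simp add: ishom_def homog_homog)

lemma ishomD: "ishom p x \<Longrightarrow> q < 2 \<Longrightarrow> homog A q x = (if p = q then x else \<zero>)"
  unfolding ishom_def by (metis homog_homog)

lemma ishom_closed: "ishom p x \<Longrightarrow> x \<in> carrier A"
  by (simp add: ishom_def)

lemma ishom_add: "ishom p x \<Longrightarrow> ishom p y \<Longrightarrow> ishom p (x \<oplus> y)"
  by (auto simp: ishom_def homog_add)

lemma ishom_zero: "p < 2 \<Longrightarrow> ishom p \<zero>"
  by (auto simp: ishom_def)

lemma ishom_one: "ishom 0 \<one>"
  by (auto simp: ishom_def homog_one)

lemma ishom_scal: "ishom p x \<Longrightarrow> ishom p (scal A c x)"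
  by (auto simp: ishom_def homog_scal)

lemma ishom_mult: "ishom p x \<Longrightarrow> ishom q y \<Longrightarrow> ishom ((p + q) mod 2) (x \<otimes> y)"
  unfolding ishom_def using homog_mult[of p q x y] by auto

lemma ishom_finsum:
  assumes "p < 2" "\<And>i. i \<in> I \<Longrightarrow> ishom p (f i)"
  shows "ishom p (finsum A f I)"
proof -
  have "subspace {x \<in> carrier A. ishom p x}"
    using assms(1) by (auto simp: subspace_def ishom_add ishom_scal ishom_zero)
  from subspace_finsum[OF this, of I f] show ?thesis using assms ishom_closed by auto
qed

lemma twist_ishom: "ishom p x \<Longrightarrow> twist A d x = scal A ((-1) ^ (d * p)) x"
  by (cases "p = 0"; cases "p = 1")
    (auto simp: twist_def ishomD ishom_closed, auto simp: ishom_def)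

lemma twist_closed: "x \<in> carrier A \<Longrightarrow> twist A d x \<in> carrier A"
  by (auto simp: twist_def)

text \<open>Splitting both factors gives four homogeneous products, and each projection picks the
  two of matching parity.\<close>

lemma homog_prod:
  assumes "x \<in> carrier A" "y \<in> carrier A"
  shows "homog A 0 (x \<otimes> y) =
      homog A 0 x \<otimes> homog A 0 y \<oplus> homog A (Suc 0) x \<otimes> homog A (Suc 0) y"
    and "homog A (Suc 0) (x \<otimes> y) =
      homog A 0 x \<otimes> homog A (Suc 0) y \<oplus> homog A (Suc 0) x \<otimes> homog A 0 y"
proof -
  have xy: "x \<otimes> y = (homog A 0 x \<otimes> homog A 0 y \<oplus> homog A (Suc 0) x \<otimes> homog A 0 y) \<oplus>
      (homog A 0 x \<otimes> homog A (Suc 0) y \<oplus> homog A (Suc 0) x \<otimes> homog A (Suc 0) y)"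
    using homog_decomp[OF assms(1)] homog_decomp[OF assms(2)] assms
    by (metis distr_l distr_r homog_closed lessI mult_closed zero_less_numeral numeral_2_eq_2)
  have h: "homog A r (homog A p x \<otimes> homog A q y) =
      (if r = (p + q) mod 2 then homog A p x \<otimes> homog A q y else \<zero>)"
    if "p < 2" "q < 2" "r < 2" for p q r
    using ishomD[OF ishom_mult[OF ishom_homog[OF that(1) assms(1)] ishom_homog[OF that(2) assms(2)]] that(3)]
    by auto
  show "homog A 0 (x \<otimes> y) =
      homog A 0 x \<otimes> homog A 0 y \<oplus> homog A (Suc 0) x \<otimes> homog A (Suc 0) y"
    by (subst xy) (use assms in \<open>simp add: homog_add h\<close>)
  show "homog A (Suc 0) (x \<otimes> y) =
      homog A 0 x \<otimes> homog A (Suc 0) y \<oplus> homog A (Suc 0) x \<otimes> homog A 0 y"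
    by (subst xy) (use assms in \<open>simp add: homog_add h a_comm\<close>)
qed

definition subalgebra :: "'a set \<Rightarrow> bool" where
  "subalgebra V \<longleftrightarrow> subspace V \<and> \<one> \<in> V \<and> (\<forall>x\<in>V. \<forall>y\<in>V. x \<otimes> y \<in> V)"

definition graded :: "'a set \<Rightarrow> bool" where
  "graded V \<longleftrightarrow> (\<forall>p<2. \<forall>x\<in>V. homog A p x \<in> V)"

lemma subalg_subalgebra:
  assumes "S \<subseteq> carrier A"
  shows "subalgebra (subalg A S)" "S \<subseteq> subalg A S"
proof -
  have sub: "x \<in> carrier A" if "x \<in> subalg A S" for x
    using that unfolding subalg_def by induction (use assms in auto)
  have const: "scal A c \<one> \<in> subalg A S" for c
    unfolding subalg_def by (rule generate_ring.incl) auto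
  have mult: "x \<otimes> y \<in> subalg A S" if "x \<in> subalg A S" "y \<in> subalg A S" for x y
    using that unfolding subalg_def by (rule generate_ring.eng_mult)
  have "x \<oplus> y \<in> subalg A S" if "x \<in> subalg A S" "y \<in> subalg A S" for x y
    using that unfolding subalg_def by (rule generate_ring.eng_add)
  moreover have "scal A c x \<in> subalg A S" if "x \<in> subalg A S" for c x
    using mult[OF const that, of c] sub[OF that] by (simp add: scal_mult_l)
  ultimately show "subalgebra (subalg A S)"
    unfolding subalgebra_def subspace_def using sub mult const[of 0] const[of 1] by auto
  show "S \<subseteq> subalg A S" unfolding subalg_def by (auto intro: generate_ring.incl)
qed

lemma subalg_least:
  assumes "subalgebra V" "S \<subseteq> V"
  shows "subalg A S \<subseteq> V"
proof
  have V: "subspace V" "\<one> \<in> V" "\<And>x y. x \<in> V \<Longrightarrow> y \<in> V \<Longrightarrow> x \<otimes> y \<in> V"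
    using assms(1) by (auto simp: subalgebra_def)
  fix x assume "x \<in> subalg A S"
  then show "x \<in> V" unfolding subalg_def
    by induction (use V subspaceD[OF V(1)] assms(2) in auto)
qed

text \<open>If \<open>V\<close> is generated by homogeneous elements, this subalgebra contains the
  generators; minimality of \<open>V\<close> then makes \<open>V\<close> stable under the
  projections.\<close>

lemma subalgebra_homog:
  assumes "subalgebra V"
  shows "subalgebra {x \<in> carrier A. homog A 0 x \<in> V \<and> homog A (Suc 0) x \<in> V}"
proof -
  have V: "subspace V" "\<one> \<in> V" "\<And>x y. x \<in> V \<Longrightarrow> y \<in> V \<Longrightarrow> x \<otimes> y \<in> V"
    using assms(1) by (auto simp: subalgebra_def)
  show ?thesis unfolding subalgebra_def subspace_def
    using subspaceD[OF V(1)] V(2,3) ishomD[OF ishom_one]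
    by (auto simp: homog_add homog_scal homog_prod)
qed

lemma subalg_graded:
  assumes "\<And>x. x \<in> S \<Longrightarrow> \<exists>p. ishom p x"
  shows "graded (subalg A S)"
proof -
  have S: "S \<subseteq> carrier A" using assms ishom_closed by blast
  have "homog A p x \<in> subalg A S" if "x \<in> S" "p < 2" for p x
    using assms[OF that(1)] ishomD[OF _ that(2)] that(1) subalg_subalgebra[OF S]
    by (metis subalgebra_def subspaceD(2) subsetD)
  then show ?thesis
    using subalg_least[OF subalgebra_homog[OF subalg_subalgebra(1)[OF S]], of S] S
    by (fastforce simp: graded_def less_2_cases_iff)
qed

lemma superalgebra_sub:
  assumes "subalgebra V" "graded V"
  shows "superalgebra (A\<lparr>carrier := V\<rparr>)"
proof -
  have V: "subspace V" "\<one> \<in> V" "\<And>x y. x \<in> V \<Longrightarrow> y \<in> V \<Longrightarrow> x \<otimes> y \<in> V"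
    using assms(1) by (auto simp: subalgebra_def)
  have sub: "\<And>x. x \<in> V \<Longrightarrow> x \<in> carrier A" using subspaceD(1)[OF V(1)] .
  have grp: "abelian_group (A\<lparr>carrier := V\<rparr>)"
  proof (rule abelian_groupI)
    fix x assume "x \<in> carrier (A\<lparr>carrier := V\<rparr>)"
    then show "\<exists>y\<in>carrier (A\<lparr>carrier := V\<rparr>). y \<oplus>\<^bsub>A\<lparr>carrier := V\<rparr>\<^esub> x = \<zero>\<^bsub>A\<lparr>carrier := V\<rparr>\<^esub>"
      using subspaceD(5)[OF V(1), of x] sub l_neg by auto
  qed (use subspaceD[OF V(1)] a_assoc a_comm in auto)
  then interpret B: abelian_group "A\<lparr>carrier := V\<rparr>" .
  have pre: "presuperalgebra (A\<lparr>carrier := V\<rparr>)"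
    by unfold_locales
      (use V subspaceD[OF V(1)] assms(2) in
        \<open>auto simp: scal_add scal_plus scal_scal distr_l distr_r scal_mult_l scal_mult_r homog_add
          homog_scal graded_def\<close>)
  have ring: "ring (A\<lparr>carrier := V\<rparr>)"
  proof (rule ringI[OF grp])
    show "Group.monoid (A\<lparr>carrier := V\<rparr>)"
      by unfold_locales (use V sub in \<open>auto simp: m_assoc\<close>)
  qed (use sub in \<open>auto simp: distr_l distr_r\<close>)
  show ?thesis
    by (intro superalgebra.intro superalgebra_axioms.intro ring pre)
      (use sub in \<open>auto simp: homog_decomp homog_homog homog_mult homog_one\<close>)
qed

end

section \<open>Completions\<close>

text \<open>The terms are right ideals, but left multiplication by \<open>y\<close> is only
  continuous: the index \<open>q\<close> may depend on \<open>y\<close>. This is how the double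
  Yangian behaves for the filtration by products of \<open>Y^+\<close> and \<open>Y\<close>, where
  an element of \<open>Y\<close> on the left can lower the degree.\<close>

locale filtered_superalgebra = superalgebra A for A :: "'a superalg" (structure) +
  fixes F :: "nat \<Rightarrow> 'a set"
  assumes F_sub: "subspace (F p)"
    and F_Suc: "F (Suc p) \<subseteq> F p"
    and F_homog: "graded (F p)"
    and F_right: "x \<in> F p \<Longrightarrow> y \<in> carrier A \<Longrightarrow> x \<otimes> y \<in> F p"
    and F_left: "y \<in> carrier A \<Longrightarrow> \<exists>q. \<forall>x\<in>F q. y \<otimes> x \<in> F p"
begin

lemma F_mono: "p \<le> q \<Longrightarrow> F q \<subseteq> F p"
  by (rule lift_Suc_antimono_le[of F]) (use F_Suc in auto)

abbreviation C :: "(nat \<Rightarrow> 'a) superalg" where "C \<equiv> cauchy_superalg A F"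
abbreviation lim :: "(nat \<Rightarrow> 'a) \<Rightarrow> (nat \<Rightarrow> 'a) set" where "lim \<equiv> lim_class A F"
abbreviation null :: "(nat \<Rightarrow> 'a) set" where "null \<equiv> null_seqs A F"

lemma C_simps [simp]:
  "carrier C = cauchy_seqs A F" "s \<oplus>\<^bsub>C\<^esub> t = (\<lambda>k. s k \<oplus> t k)" "s \<otimes>\<^bsub>C\<^esub> t = (\<lambda>k. s k \<otimes> t k)"
  "\<zero>\<^bsub>C\<^esub> = (\<lambda>k. \<zero>)" "\<one>\<^bsub>C\<^esub> = (\<lambda>k. \<one>)" "scal C c s = (\<lambda>k. scal A c (s k))"
  "homog C p s = (\<lambda>k. homog A p (s k))"
  by (simp_all add: cauchy_superalg_def)

lemma cauchyD: "s \<in> cauchy_seqs A F \<Longrightarrow> s k \<in> carrier A"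
  by (auto simp: cauchy_seqs_def)

lemma nullD: "s \<in> null \<Longrightarrow> s k \<in> carrier A"
  by (auto simp: null_seqs_def)

lemma cauchyD2:
  "s \<in> cauchy_seqs A F \<Longrightarrow> \<exists>K. \<forall>k\<ge>K. \<forall>l\<ge>K. s k \<ominus> s l \<in> F p"
  by (auto simp: cauchy_seqs_def)

lemma cauchyI:
  "(\<And>k. s k \<in> carrier A) \<Longrightarrow> (\<And>p. \<exists>K. \<forall>k\<ge>K. \<forall>l\<ge>K. s k \<ominus> s l \<in> F p) \<Longrightarrow> s \<in> cauchy_seqs A F"
  by (auto simp: cauchy_seqs_def)

lemma nullI:
  "(\<And>k. s k \<in> carrier A) \<Longrightarrow> (\<And>p. \<exists>K. \<forall>k\<ge>K. s k \<in> F p) \<Longrightarrow> s \<in> null"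
  by (auto simp: null_seqs_def)

lemma nullD2: "s \<in> null \<Longrightarrow> \<exists>K. \<forall>k\<ge>K. s k \<in> F p"
  by (auto simp: null_seqs_def)

lemma cauchy_const: "x \<in> carrier A \<Longrightarrow> (\<lambda>k. x) \<in> cauchy_seqs A F"
  using subspaceD(2)[OF F_sub] by (auto simp: cauchy_seqs_def minus_eq r_neg)

lemma cauchy_add:
  assumes "s \<in> cauchy_seqs A F" "t \<in> cauchy_seqs A F"
  shows "(\<lambda>k. s k \<oplus> t k) \<in> cauchy_seqs A F"
proof (rule cauchyI)
  note st = cauchyD[OF assms(1)] cauchyD[OF assms(2)]
  then show "s k \<oplus> t k \<in> carrier A" for k by simp
  fix p
  obtain K L where KL: "\<forall>k\<ge>K. \<forall>l\<ge>K. s k \<ominus> s l \<in> F p" "\<forall>k\<ge>L. \<forall>l\<ge>L. t k \<ominus> t l \<in> F p"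
    using cauchyD2[OF assms(1)] cauchyD2[OF assms(2)] by metis
  have "(s k \<oplus> t k) \<ominus> (s l \<oplus> t l) = (s k \<ominus> s l) \<oplus> (t k \<ominus> t l)" for k l
    using st by (simp add: minus_eq minus_add a_ac)
  then show "\<exists>K. \<forall>k\<ge>K. \<forall>l\<ge>K. (s k \<oplus> t k) \<ominus> (s l \<oplus> t l) \<in> F p"
    using KL subspaceD(3)[OF F_sub] by (intro exI[of _ "max K L"]) auto
qed

lemma cauchy_scal: "s \<in> cauchy_seqs A F \<Longrightarrow> (\<lambda>k. scal A c (s k)) \<in> cauchy_seqs A F"
proof (rule cauchyI)
  assume s: "s \<in> cauchy_seqs A F"
  then show "scal A c (s k) \<in> carrier A" for k using cauchyD by auto
  show "\<exists>K. \<forall>k\<ge>K. \<forall>l\<ge>K. scal A c (s k) \<ominus> scal A c (s l) \<in> F p" for p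
    using cauchyD2[OF s, of p] cauchyD[OF s] subspaceD(4)[OF F_sub] by (metis scal_minus)
qed

lemma cauchy_homog: "p < 2 \<Longrightarrow> s \<in> cauchy_seqs A F \<Longrightarrow> (\<lambda>k. homog A p (s k)) \<in> cauchy_seqs A F"
proof (rule cauchyI)
  assume s: "s \<in> cauchy_seqs A F" and p: "p < 2"
  then show "homog A p (s k) \<in> carrier A" for k using cauchyD by auto
  show "\<exists>K. \<forall>k\<ge>K. \<forall>l\<ge>K. homog A p (s k) \<ominus> homog A p (s l) \<in> F q" for q
    using cauchyD2[OF s, of q] cauchyD[OF s] F_homog p by (metis homog_minus graded_def)
qed

lemma cauchy_mult:
  assumes "s \<in> cauchy_seqs A F" "t \<in> cauchy_seqs A F"
  shows "(\<lambda>k. s k \<otimes> t k) \<in> cauchy_seqs A F"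
proof (rule cauchyI)
  note st = cauchyD[OF assms(1)] cauchyD[OF assms(2)]
  then show "s k \<otimes> t k \<in> carrier A" for k by simp
  fix p
  obtain K where K: "\<forall>k\<ge>K. \<forall>l\<ge>K. s k \<ominus> s l \<in> F p" using cauchyD2[OF assms(1)] by metis
  \<comment> \<open>\<open>F_left\<close> is not uniform in the left factor, so it is applied to the
    single element \<open>s K\<close>; the differences from \<open>s K\<close> stand on the left of
    a product and are absorbed by the right ideal \<open>F p\<close>.\<close>
  obtain q where q: "\<forall>x\<in>F q. s K \<otimes> x \<in> F p" using F_left st by metis
  obtain L where L: "\<forall>k\<ge>L. \<forall>l\<ge>L. t k \<ominus> t l \<in> F q" using cauchyD2[OF assms(2)] by metis
  have "s k \<otimes> t k \<ominus> s l \<otimes> t l \<in> F p" if "k \<ge> max K L" "l \<ge> max K L" for k l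
  proof -
    have "s k \<otimes> t k \<ominus> s l \<otimes> t l = (s k \<ominus> s K) \<otimes> t k \<oplus> s K \<otimes> (t k \<ominus> t l) \<oplus> (s K \<ominus> s l) \<otimes> t l"
      using st by (simp add: minus_distr_l minus_distr_r minus_telescope)
    also have "\<dots> \<in> F p"
      using that K L q st
      by (intro subspaceD(3)[OF F_sub] F_right[of "s k \<ominus> s K"] F_right[of "s K \<ominus> s l"]) auto
    finally show ?thesis .
  qed
  then show "\<exists>K. \<forall>k\<ge>K. \<forall>l\<ge>K. s k \<otimes> t k \<ominus> s l \<otimes> t l \<in> F p" by blast
qed

lemmas cauchy_intros = cauchy_const cauchy_add cauchy_scal cauchy_homog cauchy_mult

lemma superalgebra_C: "superalgebra C"
proof -
  have grp: "abelian_group C"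
  proof (rule abelian_groupI)
    fix s assume "s \<in> carrier C"
    then have "(\<lambda>k. scal A (-1) (s k)) \<in> carrier C" "(\<lambda>k. scal A (-1) (s k)) \<oplus>\<^bsub>C\<^esub> s = \<zero>\<^bsub>C\<^esub>"
      using cauchy_scal[of s "-1"] by (auto simp: scal_neg1 l_neg cauchyD)
    then show "\<exists>y\<in>carrier C. y \<oplus>\<^bsub>C\<^esub> s = \<zero>\<^bsub>C\<^esub>" by blast
  qed (auto intro!: cauchy_intros simp: a_ac cauchyD)
  then interpret C: abelian_group C .
  have pre: "presuperalgebra C"
    by unfold_locales
      (auto intro!: cauchy_intros simp: cauchyD scal_add scal_plus scal_scal distr_l distr_r
        scal_mult_l scal_mult_r homog_add homog_scal)
  have ring: "ring C"
  proof (rule ringI[OF grp])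
    show "Group.monoid C"
      by unfold_locales (auto intro!: cauchy_intros simp: m_assoc cauchyD)
  qed (auto simp: distr_l distr_r cauchyD)
  show ?thesis
    by (intro superalgebra.intro superalgebra_axioms.intro ring pre)
      (auto simp: homog_decomp homog_homog homog_mult homog_one cauchyD)
qed

sublocale C: superalgebra C by (rule superalgebra_C)

lemma C_minus: "s \<in> cauchy_seqs A F \<Longrightarrow> t \<in> cauchy_seqs A F \<Longrightarrow> s \<ominus>\<^bsub>C\<^esub> t = (\<lambda>k. s k \<ominus> t k)"
  using C.minus_scal[of s t] by (simp add: minus_scal cauchyD)

lemma null_cauchy: "s \<in> null \<Longrightarrow> s \<in> cauchy_seqs A F"
proof (rule cauchyI)
  assume s: "s \<in> null"
  then show "s k \<in> carrier A" for k by (rule nullD)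
  show "\<exists>K. \<forall>k\<ge>K. \<forall>l\<ge>K. s k \<ominus> s l \<in> F p" for p
    using nullD2[OF s, of p] subspaceD(6)[OF F_sub] by metis
qed

lemma superideal_null: "superideal C null"
proof (unfold_locales)
  show "C.subspace null" unfolding C.subspace_def
  proof (intro conjI ballI allI)
    show "null \<subseteq> carrier C" using null_cauchy by auto
    show "\<zero>\<^bsub>C\<^esub> \<in> null" using subspaceD(2)[OF F_sub] by (auto intro: nullI)
    fix s t c assume s: "s \<in> null" and t: "t \<in> null"
    show "s \<oplus>\<^bsub>C\<^esub> t \<in> null"
    proof (rule nullI)
      show "(s \<oplus>\<^bsub>C\<^esub> t) k \<in> carrier A" for k using nullD s t by simp
      fix p
      obtain K L where "\<forall>k\<ge>K. s k \<in> F p" "\<forall>k\<ge>L. t k \<in> F p"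
        using nullD2[OF s] nullD2[OF t] by metis
      then show "\<exists>K. \<forall>k\<ge>K. (s \<oplus>\<^bsub>C\<^esub> t) k \<in> F p"
        using subspaceD(3)[OF F_sub] by (intro exI[of _ "max K L"]) auto
    qed
    show "scal C c s \<in> null"
    proof (rule nullI)
      show "scal C c s k \<in> carrier A" for k using nullD s by simp
      show "\<exists>K. \<forall>k\<ge>K. scal C c s k \<in> F p" for p
        using nullD2[OF s, of p] subspaceD(4)[OF F_sub] by (metis C_simps(6))
    qed
  qed
  fix a s assume a: "a \<in> carrier C" and s: "s \<in> null"
  show "a \<otimes>\<^bsub>C\<^esub> s \<in> null"
  proof (rule nullI)
    have a': "a k \<in> carrier A" for k using a cauchyD by auto
    show "(a \<otimes>\<^bsub>C\<^esub> s) k \<in> carrier A" for k using a' nullD s by simp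
    fix p
    obtain K where K: "\<forall>k\<ge>K. \<forall>l\<ge>K. a k \<ominus> a l \<in> F p" using cauchyD2 a by fastforce
    \<comment> \<open>As for products of Cauchy sequences, the left factor is frozen at an index
      \<open>K\<close> at which it is already close to its tail.\<close>
    obtain q where q: "\<forall>x\<in>F q. a K \<otimes> x \<in> F p" using F_left a' by metis
    obtain L where L: "\<forall>k\<ge>L. s k \<in> F q" using nullD2[OF s] by metis
    have "a k \<otimes> s k \<in> F p" if "k \<ge> max K L" for k
    proof -
      have "a k \<otimes> s k = (a k \<ominus> a K) \<otimes> s k \<oplus> a K \<otimes> s k"
        using minus_telescope[of "a k" "a K" \<zero>] a' nullD[OF s] by (simp flip: distr_r)
      also have "\<dots> \<in> F p" using that K L q nullD[OF s]
          by (intro subspaceD(3)[OF F_sub] F_right[of "a k \<ominus> a K"]) auto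
      finally show ?thesis .
    qed
    then show "\<exists>K. \<forall>k\<ge>K. (a \<otimes>\<^bsub>C\<^esub> s) k \<in> F p" unfolding C_simps by blast
  qed
  show "s \<otimes>\<^bsub>C\<^esub> a \<in> null"
  proof (rule nullI)
    have a': "a k \<in> carrier A" for k using a cauchyD by auto
    show "(s \<otimes>\<^bsub>C\<^esub> a) k \<in> carrier A" for k using a' nullD s by simp
    show "\<exists>K. \<forall>k\<ge>K. (s \<otimes>\<^bsub>C\<^esub> a) k \<in> F p" for p
      using nullD2[OF s, of p] F_right a' unfolding C_simps by blast
  qed
next
  fix p :: nat and s assume p: "p < 2" and s: "s \<in> null"
  show "homog C p s \<in> null"
  proof (rule nullI)
    show "homog C p s k \<in> carrier A" for k using nullD s p by simp
    show "\<exists>K. \<forall>k\<ge>K. homog C p s k \<in> F q" for q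
      using nullD2[OF s, of q] F_homog p unfolding graded_def C_simps by blast
  qed
qed

sublocale N: superideal C null by (rule superideal_null)

lemma superalgebra_completion: "superalgebra (completion A F)"
  unfolding completion_def by (rule N.superalgebra_quot[OF superalgebra_C])

lemma carrier_completion: "carrier (completion A F) = lim ` cauchy_seqs A F"
  unfolding completion_def N.carrier_quot by (simp add: lim_class_def)

lemma salg_hom_lim: "salg_hom C (completion A F) lim"
  using N.salg_hom_cls by (simp add: completion_def lim_class_def[abs_def])

lemma lim_eqI:
  assumes "s \<in> cauchy_seqs A F" "t \<in> cauchy_seqs A F" "(\<lambda>k. s k \<ominus> t k) \<in> null"
  shows "lim s = lim t"
  unfolding lim_class_def using assms by (subst N.cls_eq_iff) (auto simp: C_minus)

lemma mem_lim:
  "s \<in> cauchy_seqs A F \<Longrightarrow> t \<in> lim s \<Longrightarrow> t \<in> cauchy_seqs A F \<and> (\<lambda>k. t k \<ominus> s k) \<in> null"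
  unfolding lim_class_def using N.mem_cls[of s t] by (auto simp: C_minus)

lemma lim_self: "s \<in> cauchy_seqs A F \<Longrightarrow> s \<in> lim s"
  unfolding lim_class_def using N.I.a_rcos_self by simp

lemma salg_hom_cembed: "salg_hom A (completion A F) (cembed A F)"
proof -
  have "salg_hom A C (\<lambda>x k. x)" unfolding salg_hom_def by (auto intro: cauchy_const)
  from salg_hom_comp[OF this salg_hom_lim] show ?thesis by (simp add: cembed_def[abs_def])
qed

end

section \<open>Tensor products\<close>

text \<open>The remaining axioms are linear in each argument, hence follow from a spanning set of
  homogeneous elements. Parity is a relation \<open>H\<close> and not a function because an element
  such as a pure tensor can be presented in several ways; one parity is chosen inside the
  proof.\<close>

lemma (in presuperalgebra) superalgebra_spanI:
  assumes S: "S \<subseteq> carrier A" "carrier A \<subseteq> lspan A S"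
    and assoc: "\<And>x y z. x \<in> S \<Longrightarrow> y \<in> S \<Longrightarrow> z \<in> S \<Longrightarrow> (x \<otimes> y) \<otimes> z = x \<otimes> (y \<otimes> z)"
    and one: "\<And>x. x \<in> S \<Longrightarrow> \<one> \<otimes> x = x" "\<And>x. x \<in> S \<Longrightarrow> x \<otimes> \<one> = x"
    and ex_par: "\<And>x. x \<in> S \<Longrightarrow> \<exists>r. H r x"
    and H: "\<And>r x. H r x \<Longrightarrow> r < 2"
      "\<And>r x p. H r x \<Longrightarrow> p < 2 \<Longrightarrow> homog A p x = (if p = r then x else \<zero>)"
    and H_mult: "\<And>r s x y. H r x \<Longrightarrow> H s y \<Longrightarrow> homog A ((r + s) mod 2) (x \<otimes> y) = x \<otimes> y"
    and par_one: "homog A 0 \<one> = \<one>"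
  shows "superalgebra A"
proof -
  have ind: "P x" if "x \<in> carrier A" "subspace {x \<in> carrier A. P x}" "\<And>x. x \<in> S \<Longrightarrow> P x" for P x
    using lspan_least[OF that(2), of S] S that by auto
  define \<pi> where "\<pi> x = (SOME r. H r x)" for x
  have \<pi>: "H (\<pi> x) x" if "x \<in> S" for x
    unfolding \<pi>_def using ex_par[OF that] by (rule someI_ex)
  have par: "\<And>x. x \<in> S \<Longrightarrow> \<pi> x < 2"
      "\<And>x p. x \<in> S \<Longrightarrow> p < 2 \<Longrightarrow> homog A p x = (if p = \<pi> x then x else \<zero>)"
    and par_mult: "\<And>x y. x \<in> S \<Longrightarrow> y \<in> S \<Longrightarrow> homog A ((\<pi> x + \<pi> y) mod 2) (x \<otimes> y) = x \<otimes> y"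
    using H H_mult \<pi> by blast+
  have inS: "x \<in> carrier A" if "x \<in> S" for x using S(1) that by auto
  have a1: "(x \<otimes> y) \<otimes> z = x \<otimes> (y \<otimes> z)" if "x \<in> S" "y \<in> S" "z \<in> carrier A" for x y z
    by (rule ind[OF that(3)])
      (use that inS assoc in \<open>auto simp: subspace_def distr_l scal_mult_r\<close>)
  have a2: "(x \<otimes> y) \<otimes> z = x \<otimes> (y \<otimes> z)" if "x \<in> S" "y \<in> carrier A" "z \<in> carrier A" for x y z
    by (rule ind[OF that(2)])
      (use that inS a1 in \<open>auto simp: subspace_def distr_l distr_r scal_mult_r scal_mult_l\<close>)
  have a3: "(x \<otimes> y) \<otimes> z = x \<otimes> (y \<otimes> z)"
    if "x \<in> carrier A" "y \<in> carrier A" "z \<in> carrier A" for x y z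
    by (rule ind[OF that(1)])
      (use that a2 in \<open>auto simp: subspace_def distr_r scal_mult_l\<close>)
  have o1: "\<one> \<otimes> x = x" if "x \<in> carrier A" for x
    by (rule ind[OF that]) (use one in \<open>auto simp: subspace_def distr_l scal_mult_r\<close>)
  have o2: "x \<otimes> \<one> = x" if "x \<in> carrier A" for x
    by (rule ind[OF that]) (use one in \<open>auto simp: subspace_def distr_r scal_mult_l\<close>)
  have ring: "ring A"
  proof (rule ringI)
    show "Group.monoid A" by unfold_locales (auto simp: a3 o1 o2)
  qed (unfold_locales, auto simp: distr_l distr_r)
  show ?thesis
  proof (intro superalgebra.intro superalgebra_axioms.intro ring presuperalgebra_axioms)
    fix p q :: nat and x y
    show "homog A 0 x \<oplus> homog A (Suc 0) x = x" if "x \<in> carrier A"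
    proof (rule ind[OF that])
      show "subspace {x \<in> carrier A. homog A 0 x \<oplus> homog A (Suc 0) x = x}"
        by (auto simp: subspace_def homog_add homog_scal a_ac simp flip: scal_add)
      fix x assume x: "x \<in> S"
      then show "homog A 0 x \<oplus> homog A (Suc 0) x = x"
        using par(1)[OF x] inS[OF x] by (auto simp: par less_2_cases_iff)
    qed
    show "homog A p (homog A q x) = (if p = q then homog A q x else \<zero>)"
      if "p < 2" "q < 2" "x \<in> carrier A"
      by (rule ind[OF that(3)])
        (use that par in \<open>auto simp: subspace_def homog_add homog_scal\<close>)
    have m1: "homog A ((p + q) mod 2) (homog A p x \<otimes> homog A q y) = homog A p x \<otimes> homog A q y"
      if "p < 2" "q < 2" "x \<in> S" "y \<in> carrier A" for x y
      by (rule ind[OF that(4)])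
        (use that par inS par_mult in
          \<open>auto simp: subspace_def homog_add homog_scal distr_l scal_mult_r\<close>)
    show "homog A ((p + q) mod 2) (homog A p x \<otimes> homog A q y) = homog A p x \<otimes> homog A q y"
      if "p < 2" "q < 2" "x \<in> carrier A" "y \<in> carrier A"
      by (rule ind[OF that(3)])
        (use that m1 in \<open>auto simp: subspace_def homog_add homog_scal distr_r scal_mult_l\<close>)
  qed (fact par_one)
qed

section \<open>Free vector spaces and linear extension from a basis\<close>

abbreviation cscal :: "complex \<Rightarrow> ('k \<Rightarrow>\<^sub>0 complex) \<Rightarrow> 'k \<Rightarrow>\<^sub>0 complex" where
  "cscal c \<equiv> Poly_Mapping.map ((*) c)"

lemma lookup_cscal [simp]: "Poly_Mapping.lookup (cscal c f) k = c * Poly_Mapping.lookup f k"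
  by (simp add: Poly_Mapping.map.rep_eq when_def)

lemma cscal_simps:
  "cscal c (f + g) = cscal c f + cscal c g" "cscal c (f - g) = cscal c f - cscal c g"
  "cscal (c + d) f = cscal c f + cscal d f" "cscal c (cscal d f) = cscal (c * d) f" "cscal 1 f = f"
  "cscal c 0 = 0" "cscal c (- f) = - cscal c f"
  by (rule poly_mapping_eqI, simp add: lookup_add lookup_minus algebra_simps)+

lemma cscal_sum: "cscal c (sum f I) = (\<Sum>i\<in>I. cscal c (f i))"
  by (rule poly_mapping_eqI) (simp add: lookup_sum sum_distrib_left)

lemma cscal_single: "cscal c (Poly_Mapping.single k d) = Poly_Mapping.single k (c * d)"
  by (simp add: map_single)

text \<open>The linear map with prescribed values on the basis vectors; nested, it produces bilinear
  maps.\<close>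

definition ext :: "('k \<Rightarrow> 'l \<Rightarrow>\<^sub>0 complex) \<Rightarrow> ('k \<Rightarrow>\<^sub>0 complex) \<Rightarrow> 'l \<Rightarrow>\<^sub>0 complex" where
  "ext \<phi> f = (\<Sum>x\<in>Poly_Mapping.keys f. cscal (Poly_Mapping.lookup f x) (\<phi> x))"

lemma ext_superset:
  "finite S \<Longrightarrow> Poly_Mapping.keys f \<subseteq> S \<Longrightarrow> ext \<phi> f = (\<Sum>x\<in>S. cscal (Poly_Mapping.lookup f x) (\<phi> x))"
  unfolding ext_def
  by (rule sum.mono_neutral_left) (auto simp: in_keys_iff intro!: poly_mapping_eqI)

lemma ext_add: "ext \<phi> (f + g) = ext \<phi> f + ext \<phi> g"
proof -
  let ?S = "Poly_Mapping.keys f \<union> Poly_Mapping.keys g"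
  have "ext \<phi> h = (\<Sum>x\<in>?S. cscal (Poly_Mapping.lookup h x) (\<phi> x))" if "h \<in> {f, g, f + g}" for h
    by (rule ext_superset) (use that keys_add[of f g] in auto)
  then show ?thesis by (simp add: lookup_add cscal_simps sum.distrib)
qed

lemma ext_cscal: "ext \<phi> (cscal c f) = cscal c (ext \<phi> f)"
proof -
  have "ext \<phi> (cscal c f) = (\<Sum>x\<in>Poly_Mapping.keys f. cscal (Poly_Mapping.lookup (cscal c f) x) (\<phi> x))"
    by (rule ext_superset) (auto simp: in_keys_iff)
  then show ?thesis by (simp add: ext_def cscal_sum cscal_simps)
qed

lemma ext_minus: "ext \<phi> (f - g) = ext \<phi> f - ext \<phi> g"
proof -
  have "f - g = f + cscal (-1) g" by (rule poly_mapping_eqI) (simp add: lookup_add lookup_minus)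
  moreover have "ext \<phi> f - ext \<phi> g = ext \<phi> f + cscal (-1) (ext \<phi> g)"
    by (rule poly_mapping_eqI) (simp add: lookup_add lookup_minus)
  ultimately show ?thesis by (simp only: ext_add ext_cscal)
qed

lemma ext_single: "ext \<phi> (Poly_Mapping.single k c) = cscal c (\<phi> k)"
  by (cases "c = 0") (auto simp: ext_def intro!: poly_mapping_eqI)

text \<open>A bilinear extension may be expanded in either variable first; linearity in the inner
  variable is thereby reduced to linearity in the outer one.\<close>

lemma ext_swap: "ext (\<lambda>x. ext (\<phi> x) g) f = ext (\<lambda>y. ext (\<lambda>x. \<phi> x y) f) g"
  unfolding ext_def cscal_sum by (subst sum.swap) (simp add: cscal_simps mult.commute)

lemma keys_sum_subset:
  assumes "\<And>i. i \<in> I \<Longrightarrow> Poly_Mapping.keys (f i) \<subseteq> V"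
  shows "Poly_Mapping.keys (sum f I) \<subseteq> V"
  using assms by (induction I rule: infinite_finite_induct) (use keys_add in fastforce)+

lemma keys_cscal: "Poly_Mapping.keys (cscal c f) \<subseteq> Poly_Mapping.keys f"
  by (auto simp: in_keys_iff)

lemma keys_ext:
  assumes "\<And>x. x \<in> Poly_Mapping.keys f \<Longrightarrow> Poly_Mapping.keys (\<phi> x) \<subseteq> V"
  shows "Poly_Mapping.keys (ext \<phi> f) \<subseteq> V"
  unfolding ext_def by (rule keys_sum_subset) (use assms keys_cscal in fast)

lemma poly_mapping_sum_single:
  "f = (\<Sum>x\<in>Poly_Mapping.keys f. cscal (Poly_Mapping.lookup f x) (Poly_Mapping.single x 1))"
proof (rule poly_mapping_eqI)
  fix k
  show "Poly_Mapping.lookup f k = Poly_Mapping.lookup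
      (\<Sum>x\<in>Poly_Mapping.keys f. cscal (Poly_Mapping.lookup f x) (Poly_Mapping.single x 1)) k"
    by (simp add: lookup_sum lookup_single when_def in_keys_iff if_distrib sum.delta cong: if_cong)
qed

section \<open>The tensor product of two superalgebras\<close>

locale tensor_product = A: superalgebra A + B: superalgebra B
  for A :: "'a superalg" and B :: "'b superalg"
begin

abbreviation PT :: "('a \<times> 'b \<Rightarrow>\<^sub>0 complex) superalg" where "PT \<equiv> pretensor A B"

text \<open>The product of two basis vectors: the multiplication on the free vector space is its
  bilinear extension, by \<open>PT_simps\<close>.\<close>

definition bm :: "'a \<times> 'b \<Rightarrow> 'a \<times> 'b \<Rightarrow> 'a \<times> 'b \<Rightarrow>\<^sub>0 complex" where
  "bm = (\<lambda>(a, b) (c, d). \<Sum>p\<in>{0, 1}. \<Sum>q\<in>{0, 1}. cscal ((-1) ^ (p * q))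
     (Poly_Mapping.single (a \<otimes>\<^bsub>A\<^esub> homog A q c, homog B p b \<otimes>\<^bsub>B\<^esub> d) 1))"

definition hm :: "nat \<Rightarrow> 'a \<times> 'b \<Rightarrow> 'a \<times> 'b \<Rightarrow>\<^sub>0 complex" where
  "hm r = (\<lambda>(a, b). \<Sum>p\<in>{0, 1}. Poly_Mapping.single (homog A p a, homog B ((p + r) mod 2) b) 1)"

lemma PT_simps:
  "carrier PT = {f. Poly_Mapping.keys f \<subseteq> carrier A \<times> carrier B}"
  "f \<oplus>\<^bsub>PT\<^esub> g = f + g" "\<zero>\<^bsub>PT\<^esub> = 0" "\<one>\<^bsub>PT\<^esub> = Poly_Mapping.single (\<one>\<^bsub>A\<^esub>, \<one>\<^bsub>B\<^esub>) 1"
  "scal PT c = cscal c" "f \<otimes>\<^bsub>PT\<^esub> g = ext (\<lambda>y. ext (bm y) g) f" "homog PT r f = ext (hm r) f"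
proof -
  show "f \<otimes>\<^bsub>PT\<^esub> g = ext (\<lambda>y. ext (bm y) g) f"
    unfolding pretensor_def ext_def bm_def cscal_sum monoid.simps
    by (intro sum.cong refl) (auto simp: cscal_sum cscal_single cscal_simps mult_ac split_beta)
  show "homog PT r f = ext (hm r) f"
    unfolding pretensor_def ext_def hm_def cscal_sum superalg.simps
    by (intro sum.cong refl) (auto simp: cscal_sum cscal_single cscal_simps mult_ac split_beta)
qed (simp_all add: pretensor_def)

lemma keys_bm:
  "x \<in> carrier A \<times> carrier B \<Longrightarrow> y \<in> carrier A \<times> carrier B \<Longrightarrow>
    Poly_Mapping.keys (bm x y) \<subseteq> carrier A \<times> carrier B"
  unfolding bm_def by (cases x; cases y) (auto simp only: prod.case intro!: keys_sum_subset, auto simp: cscal_single)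

lemma keys_hm:
  "x \<in> carrier A \<times> carrier B \<Longrightarrow> Poly_Mapping.keys (hm r x) \<subseteq> carrier A \<times> carrier B"
  unfolding hm_def by (cases x) (auto simp only: prod.case intro!: keys_sum_subset, auto)

lemma presuperalgebra_PT: "presuperalgebra PT"
proof -
  have grp: "abelian_group PT"
  proof (rule abelian_groupI)
    fix f assume "f \<in> carrier PT"
    then have "- f \<in> carrier PT" "(- f) \<oplus>\<^bsub>PT\<^esub> f = \<zero>\<^bsub>PT\<^esub>"
      by (auto simp: PT_simps in_keys_iff)
    then show "\<exists>g\<in>carrier PT. g \<oplus>\<^bsub>PT\<^esub> f = \<zero>\<^bsub>PT\<^esub>" by blast
  qed (use keys_add in \<open>fastforce simp: PT_simps add_ac\<close>)+
  then interpret PT: abelian_group PT .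
  show ?thesis
  proof unfold_locales
    fix x y assume "x \<in> carrier PT" "y \<in> carrier PT"
    then show "x \<otimes>\<^bsub>PT\<^esub> y \<in> carrier PT"
      unfolding PT_simps mem_Collect_eq by (intro keys_ext keys_bm) auto
  next
    fix r :: nat and x assume "x \<in> carrier PT"
    then show "homog PT r x \<in> carrier PT"
      unfolding PT_simps mem_Collect_eq by (intro keys_ext keys_hm) auto
  next
    fix x y z
    have "ext (\<lambda>u. ext (bm u) (x + y)) z = ext (\<lambda>u. ext (bm u) x) z + ext (\<lambda>u. ext (bm u) y) z"
      by (subst (1 2 3) ext_swap) (rule ext_add)
    then show "z \<otimes>\<^bsub>PT\<^esub> (x \<oplus>\<^bsub>PT\<^esub> y) = z \<otimes>\<^bsub>PT\<^esub> x \<oplus>\<^bsub>PT\<^esub> z \<otimes>\<^bsub>PT\<^esub> y" by (simp add: PT_simps)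
  next
    fix x y c
    have "ext (\<lambda>u. ext (bm u) (cscal c y)) x = cscal c (ext (\<lambda>u. ext (bm u) y) x)"
      by (subst (1 2) ext_swap) (rule ext_cscal)
    then show "x \<otimes>\<^bsub>PT\<^esub> scal PT c y = scal PT c (x \<otimes>\<^bsub>PT\<^esub> y)" by (simp add: PT_simps)
  qed (use keys_cscal in \<open>fastforce simp: PT_simps cscal_simps ext_add ext_cscal\<close>)+
qed

sublocale PT: presuperalgebra PT by (rule presuperalgebra_PT)

lemma PT_minus: "f \<in> carrier PT \<Longrightarrow> g \<in> carrier PT \<Longrightarrow> f \<ominus>\<^bsub>PT\<^esub> g = f - g"
  using PT.minus_scal[of f g] by (auto simp: PT_simps lookup_add lookup_minus intro!: poly_mapping_eqI)

definition I :: "('a \<times> 'b \<Rightarrow>\<^sub>0 complex) set" where "I = lspan PT (bilinear_rels A B)"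

lemma single_carrier: "a \<in> carrier A \<Longrightarrow> b \<in> carrier B \<Longrightarrow> Poly_Mapping.single (a, b) c \<in> carrier PT"
  by (auto simp: PT_simps)

lemma rels_carrier: "bilinear_rels A B \<subseteq> carrier PT"
  unfolding bilinear_rels_def
  by (auto simp flip: PT_minus simp: single_carrier intro!: PT.minus_closed)

lemma subspace_I: "PT.subspace I"
  unfolding I_def by (rule PT.lspan_subspace[OF rels_carrier])

lemma I_closed:
  "f \<in> I \<Longrightarrow> f \<in> carrier PT" "0 \<in> I" "f \<in> I \<Longrightarrow> g \<in> I \<Longrightarrow> f + g \<in> I" "f \<in> I \<Longrightarrow> cscal c f \<in> I"
  "f \<in> I \<Longrightarrow> g \<in> I \<Longrightarrow> f - g \<in> I"
proof -
  show "f \<in> I \<Longrightarrow> f \<in> carrier PT" "0 \<in> I" "f \<in> I \<Longrightarrow> g \<in> I \<Longrightarrow> f + g \<in> I" "f \<in> I \<Longrightarrow> cscal c f \<in> I"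
    using PT.subspaceD[OF subspace_I] by (auto simp: PT_simps(2-5))
  show "f \<in> I \<Longrightarrow> g \<in> I \<Longrightarrow> f - g \<in> I"
    using PT.subspaceD[OF subspace_I] PT_minus by metis
qed

lemma I_sum: "(\<And>i. i \<in> J \<Longrightarrow> f i \<in> I) \<Longrightarrow> sum f J \<in> I"
  by (induction J rule: infinite_finite_induct) (auto intro: I_closed)

lemma rel_mem:
  "a \<in> carrier A \<Longrightarrow> a' \<in> carrier A \<Longrightarrow> b \<in> carrier B \<Longrightarrow>
    Poly_Mapping.single (a \<oplus>\<^bsub>A\<^esub> a', b) 1 - Poly_Mapping.single (a, b) 1
      - Poly_Mapping.single (a', b) 1 \<in> I"
  "a \<in> carrier A \<Longrightarrow> b \<in> carrier B \<Longrightarrow> b' \<in> carrier B \<Longrightarrow>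
    Poly_Mapping.single (a, b \<oplus>\<^bsub>B\<^esub> b') 1 - Poly_Mapping.single (a, b) 1
      - Poly_Mapping.single (a, b') 1 \<in> I"
  "a \<in> carrier A \<Longrightarrow> b \<in> carrier B \<Longrightarrow>
    Poly_Mapping.single (scal A c a, b) 1 - Poly_Mapping.single (a, b) c \<in> I"
  "a \<in> carrier A \<Longrightarrow> b \<in> carrier B \<Longrightarrow>
    Poly_Mapping.single (a, scal B c b) 1 - Poly_Mapping.single (a, b) c \<in> I"
  unfolding I_def bilinear_rels_def by (rule lspan.incl, blast)+

text \<open>Bilinearity is required modulo the relations only; this is the condition under which the
  linear extension of \<open>\<phi>\<close> descends to the tensor product.\<close>

definition bilin :: "('a \<times> 'b \<Rightarrow> 'a \<times> 'b \<Rightarrow>\<^sub>0 complex) \<Rightarrow> bool" where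
  "bilin \<phi> \<longleftrightarrow>
    (\<forall>a\<in>carrier A. \<forall>a'\<in>carrier A. \<forall>b\<in>carrier B. \<phi> (a \<oplus>\<^bsub>A\<^esub> a', b) - \<phi> (a, b) - \<phi> (a', b) \<in> I) \<and>
    (\<forall>a\<in>carrier A. \<forall>b\<in>carrier B. \<forall>b'\<in>carrier B. \<phi> (a, b \<oplus>\<^bsub>B\<^esub> b') - \<phi> (a, b) - \<phi> (a, b') \<in> I) \<and>
    (\<forall>c. \<forall>a\<in>carrier A. \<forall>b\<in>carrier B. \<phi> (scal A c a, b) - cscal c (\<phi> (a, b)) \<in> I) \<and>
    (\<forall>c. \<forall>a\<in>carrier A. \<forall>b\<in>carrier B. \<phi> (a, scal B c b) - cscal c (\<phi> (a, b)) \<in> I)"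

lemma ext_bilin:
  assumes "bilin \<phi>" "\<And>x. x \<in> carrier A \<times> carrier B \<Longrightarrow> \<phi> x \<in> carrier PT" "f \<in> I"
  shows "ext \<phi> f \<in> I"
proof -
  have cl: "ext \<phi> f \<in> carrier PT" if "f \<in> carrier PT" for f
    using that assms(2) unfolding PT_simps mem_Collect_eq by (intro keys_ext) auto
  have "PT.subspace {f \<in> carrier PT. ext \<phi> f \<in> I}"
    unfolding PT.subspace_def
    using I_closed PT.a_closed PT.scal_closed
    by (auto simp: PT_simps(2,3,5) ext_add ext_cscal ext_def[of _ 0])
  moreover have "bilinear_rels A B \<subseteq> {f \<in> carrier PT. ext \<phi> f \<in> I}"
  proof
    fix g assume g: "g \<in> bilinear_rels A B"
    then have "ext \<phi> g \<in> I"
      using assms(1) unfolding bilinear_rels_def bilin_def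
      by (elim UnE) (auto simp: ext_minus ext_single cscal_simps)
    then show "g \<in> {f \<in> carrier PT. ext \<phi> f \<in> I}" using rels_carrier g by auto
  qed
  ultimately have "I \<subseteq> {f \<in> carrier PT. ext \<phi> f \<in> I}"
    unfolding I_def using PT.lspan_least by simp
  then show ?thesis using assms(3) by auto
qed

lemma bilin_sum:
  assumes "\<And>i. i \<in> J \<Longrightarrow> bilin (\<phi> i)"
  shows "bilin (\<lambda>x. \<Sum>i\<in>J. \<phi> i x)"
  using assms unfolding bilin_def
  by (auto simp: cscal_sum intro!: I_sum simp flip: sum_subtractf)

lemma bilin_cscal: "bilin \<phi> \<Longrightarrow> bilin (\<lambda>x. cscal c (\<phi> x))"
  unfolding bilin_def cscal_simps(4) mult.commute[of _ c]
  by (simp only: cscal_simps(4)[symmetric] cscal_simps(2)[symmetric] simp_thms)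
    (blast intro: I_closed(4))

text \<open>Products with a fixed basis vector and parity projections are signed sums of such maps,
  with \<open>\<alpha>\<close> and \<open>\<beta>\<close> built from multiplications and
  projections.\<close>

lemma bilin_single:
  assumes "\<And>x. x \<in> carrier A \<Longrightarrow> \<alpha> x \<in> carrier A"
    "\<And>x y. x \<in> carrier A \<Longrightarrow> y \<in> carrier A \<Longrightarrow> \<alpha> (x \<oplus>\<^bsub>A\<^esub> y) = \<alpha> x \<oplus>\<^bsub>A\<^esub> \<alpha> y"
    "\<And>c x. x \<in> carrier A \<Longrightarrow> \<alpha> (scal A c x) = scal A c (\<alpha> x)"
    "\<And>x. x \<in> carrier B \<Longrightarrow> \<beta> x \<in> carrier B"
    "\<And>x y. x \<in> carrier B \<Longrightarrow> y \<in> carrier B \<Longrightarrow> \<beta> (x \<oplus>\<^bsub>B\<^esub> y) = \<beta> x \<oplus>\<^bsub>B\<^esub> \<beta> y"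
    "\<And>c x. x \<in> carrier B \<Longrightarrow> \<beta> (scal B c x) = scal B c (\<beta> x)"
  shows "bilin (\<lambda>x. Poly_Mapping.single (\<alpha> (fst x), \<beta> (snd x)) 1)"
  unfolding bilin_def using assms by (auto simp: cscal_single intro!: rel_mem)

lemma superideal_I: "superideal PT I"
proof unfold_locales
  show "PT.subspace I" by (rule subspace_I)
next
  fix f g assume f: "f \<in> carrier PT" and g: "g \<in> I"
  have g': "g \<in> carrier PT" using I_closed(1) g .
  have "ext (bm x) g \<in> I" if x: "x \<in> carrier A \<times> carrier B" for x
  proof (rule ext_bilin[OF _ _ g])
    show "bilin (bm x)"
    proof -
      obtain a b where ab: "x = (a, b)" by fastforce
      have *: "bm x = (\<lambda>y. \<Sum>p\<in>{0, 1}. \<Sum>q\<in>{0, 1}. cscal ((-1) ^ (p * q))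
          (Poly_Mapping.single (a \<otimes>\<^bsub>A\<^esub> homog A q (fst y), homog B p b \<otimes>\<^bsub>B\<^esub> snd y) 1))"
        by (auto simp: bm_def ab)
      show ?thesis
        unfolding * using x ab
        by (intro bilin_sum bilin_cscal bilin_single)
          (auto simp: A.homog_add A.distr_l A.homog_scal A.scal_mult_r B.distr_l B.scal_mult_r)
    qed
    show "bm x y \<in> carrier PT" if "y \<in> carrier A \<times> carrier B" for y
      using keys_bm[OF x that] by (simp add: PT_simps)
  qed
  then show "f \<otimes>\<^bsub>PT\<^esub> g \<in> I"
    using f unfolding PT_simps(6) ext_def[of _ f] by (auto simp: PT_simps(1) intro!: I_sum I_closed(4))
  \<comment> \<open>With \<open>g\<close> as the left factor, \<open>ext_swap\<close> exchanges the
    order of expansion, so that \<open>g\<close> is again the variable in which the map is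
    extended.\<close>
  have "ext (\<lambda>y. bm y x) g \<in> I" if x: "x \<in> carrier A \<times> carrier B" for x
  proof (rule ext_bilin[OF _ _ g])
    show "bilin (\<lambda>y. bm y x)"
    proof -
      obtain c d where cd: "x = (c, d)" by fastforce
      have *: "(\<lambda>y. bm y x) = (\<lambda>y. \<Sum>p\<in>{0, 1}. \<Sum>q\<in>{0, 1}. cscal ((-1) ^ (p * q))
          (Poly_Mapping.single (fst y \<otimes>\<^bsub>A\<^esub> homog A q c, homog B p (snd y) \<otimes>\<^bsub>B\<^esub> d) 1))"
        by (auto simp: bm_def cd)
      show ?thesis
        unfolding * using x cd
        by (intro bilin_sum bilin_cscal bilin_single)
          (auto simp: A.distr_r A.scal_mult_l B.homog_add B.homog_scal B.distr_r B.scal_mult_l)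
    qed
    show "bm y x \<in> carrier PT" if "y \<in> carrier A \<times> carrier B" for y
      using keys_bm[OF that x] by (simp add: PT_simps)
  qed
  then show "g \<otimes>\<^bsub>PT\<^esub> f \<in> I"
    using f ext_def[of "\<lambda>x. ext (\<lambda>y. bm y x) g" f]
    by (auto simp: PT_simps(1,6) ext_swap[of bm f g] intro!: I_sum I_closed(4))
next
  fix r :: nat and g assume r: "r < 2" and g: "g \<in> I"
  show "homog PT r g \<in> I"
    unfolding PT_simps(7)
  proof (rule ext_bilin[OF _ _ g])
    have *: "hm r = (\<lambda>x. \<Sum>p\<in>{0, 1}. Poly_Mapping.single
        (homog A p (fst x), homog B ((p + r) mod 2) (snd x)) 1)"
      by (auto simp: hm_def)
    show "bilin (hm r)"
      unfolding * by (intro bilin_sum bilin_single)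
        (auto simp: A.homog_add A.homog_scal B.homog_add B.homog_scal)
    show "hm r y \<in> carrier PT" if "y \<in> carrier A \<times> carrier B" for y
      using keys_hm[OF that] by (simp add: PT_simps)
  qed
qed

end

context tensor_product
begin

sublocale TI: superideal PT I by (rule superideal_I)

abbreviation T :: "('a \<times> 'b \<Rightarrow>\<^sub>0 complex) set superalg" where "T \<equiv> tensor A B"
abbreviation tn :: "'a \<Rightarrow> 'b \<Rightarrow> ('a \<times> 'b \<Rightarrow>\<^sub>0 complex) set" where "tn \<equiv> tens A B"

lemma T_eq: "T = quot_superalg PT I"
  by (simp add: tensor_def I_def)

lemma tn_eq: "tn a b = TI.cls (Poly_Mapping.single (a, b) 1)"
  by (simp add: tens_def I_def)

lemma presuperalgebra_T: "presuperalgebra T"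
  unfolding T_eq by (rule TI.presuperalgebra_quot)

sublocale T: presuperalgebra T by (rule presuperalgebra_T)

lemmas cls_hom = salg_homD[OF TI.salg_hom_cls[folded T_eq]]

lemma cls_eqI: "f \<in> carrier PT \<Longrightarrow> g \<in> carrier PT \<Longrightarrow> f - g \<in> I \<Longrightarrow> TI.cls f = TI.cls g"
  using TI.cls_eq_iff PT_minus by simp

lemma cls_addI:
  assumes "f \<in> carrier PT" "g \<in> carrier PT" "h \<in> carrier PT" "f - g - h \<in> I"
  shows "TI.cls f = TI.cls g \<oplus>\<^bsub>T\<^esub> TI.cls h"
proof -
  have "TI.cls f = TI.cls (g \<oplus>\<^bsub>PT\<^esub> h)"
    using assms PT.a_closed[of g h] by (intro cls_eqI) (auto simp: PT_simps(2) diff_diff_eq)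
  then show ?thesis using assms by (simp add: cls_hom(2))
qed

lemma cls_scalI:
  assumes "f \<in> carrier PT" "g \<in> carrier PT" "f - cscal c g \<in> I"
  shows "TI.cls f = scal T c (TI.cls g)"
proof -
  have "TI.cls f = TI.cls (scal PT c g)"
    using assms PT.scal_closed[of g c] by (intro cls_eqI) (auto simp: PT_simps(5))
  then show ?thesis using assms by (simp add: cls_hom(6))
qed

lemma tn_closed [simp, intro]: "a \<in> carrier A \<Longrightarrow> b \<in> carrier B \<Longrightarrow> tn a b \<in> carrier T"
  unfolding tn_eq by (intro cls_hom(1) single_carrier)

lemma tn_add_l:
  "a \<in> carrier A \<Longrightarrow> a' \<in> carrier A \<Longrightarrow> b \<in> carrier B \<Longrightarrow> tn (a \<oplus>\<^bsub>A\<^esub> a') b = tn a b \<oplus>\<^bsub>T\<^esub> tn a' b"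
  unfolding tn_eq
  by (rule cls_addI) (simp_all add: single_carrier rel_mem)

lemma tn_add_r:
  "a \<in> carrier A \<Longrightarrow> b \<in> carrier B \<Longrightarrow> b' \<in> carrier B \<Longrightarrow> tn a (b \<oplus>\<^bsub>B\<^esub> b') = tn a b \<oplus>\<^bsub>T\<^esub> tn a b'"
  unfolding tn_eq
  by (rule cls_addI) (simp_all add: single_carrier rel_mem)

lemma tn_scal_l: "a \<in> carrier A \<Longrightarrow> b \<in> carrier B \<Longrightarrow> tn (scal A c a) b = scal T c (tn a b)"
  unfolding tn_eq
  by (rule cls_scalI) (simp_all add: single_carrier cscal_single rel_mem)

lemma tn_scal_r: "a \<in> carrier A \<Longrightarrow> b \<in> carrier B \<Longrightarrow> tn a (scal B c b) = scal T c (tn a b)"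
  unfolding tn_eq
  by (rule cls_scalI) (simp_all add: single_carrier cscal_single rel_mem)

lemma tn_zero [simp]: "b \<in> carrier B \<Longrightarrow> tn \<zero>\<^bsub>A\<^esub> b = \<zero>\<^bsub>T\<^esub>" "a \<in> carrier A \<Longrightarrow> tn a \<zero>\<^bsub>B\<^esub> = \<zero>\<^bsub>T\<^esub>"
  using tn_scal_l[of "\<zero>\<^bsub>A\<^esub>" b 0] tn_scal_r[of a "\<zero>\<^bsub>B\<^esub>" 0] by simp_all

lemma one_T: "\<one>\<^bsub>T\<^esub> = tn \<one>\<^bsub>A\<^esub> \<one>\<^bsub>B\<^esub>"
  unfolding tn_eq using cls_hom(5) by (simp add: PT_simps(4))

text \<open>Homogeneity of \<open>c\<close> leaves one \<open>q\<close> in the sum over its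
  components; the sum over the components of \<open>b\<close>, which need not be homogeneous, is
  what \<open>twist\<close> abbreviates.\<close>

lemma tn_mult:
  assumes "a \<in> carrier A" "b \<in> carrier B" "A.ishom q c" "d \<in> carrier B"
  shows "tn a b \<otimes>\<^bsub>T\<^esub> tn c d = tn (a \<otimes>\<^bsub>A\<^esub> c) (twist B q b \<otimes>\<^bsub>B\<^esub> d)"
proof -
  have c: "c \<in> carrier A" using assms A.ishom_closed by blast
  let ?s = "\<lambda>q p. Poly_Mapping.single (a \<otimes>\<^bsub>A\<^esub> homog A q c, homog B p b \<otimes>\<^bsub>B\<^esub> d) (1::complex)"
  have s: "?s q p \<in> carrier PT" if "q < 2" "p < 2" for p q
    using assms c that by (intro single_carrier) auto
  have "tn a b \<otimes>\<^bsub>T\<^esub> tn c d = TI.cls (bm (a, b) (c, d))"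
    unfolding tn_eq using assms c
    by (subst cls_hom(3)[symmetric]) (auto simp: single_carrier PT_simps(6) ext_single cscal_simps)
  also have "bm (a, b) (c, d) = (?s 0 0 \<oplus>\<^bsub>PT\<^esub> ?s (Suc 0) 0) \<oplus>\<^bsub>PT\<^esub> (?s 0 (Suc 0) \<oplus>\<^bsub>PT\<^esub> scal PT (-1) (?s (Suc 0) (Suc 0)))"
    by (simp add: bm_def PT_simps cscal_simps)
  also have "TI.cls \<dots> = (tn (a \<otimes>\<^bsub>A\<^esub> homog A 0 c) (homog B 0 b \<otimes>\<^bsub>B\<^esub> d) \<oplus>\<^bsub>T\<^esub>
      tn (a \<otimes>\<^bsub>A\<^esub> homog A (Suc 0) c) (homog B 0 b \<otimes>\<^bsub>B\<^esub> d)) \<oplus>\<^bsub>T\<^esub>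
      (tn (a \<otimes>\<^bsub>A\<^esub> homog A 0 c) (homog B (Suc 0) b \<otimes>\<^bsub>B\<^esub> d) \<oplus>\<^bsub>T\<^esub>
      scal T (-1) (tn (a \<otimes>\<^bsub>A\<^esub> homog A (Suc 0) c) (homog B (Suc 0) b \<otimes>\<^bsub>B\<^esub> d)))"
    unfolding tn_eq by (simp add: cls_hom(2,6) s)
  also have "\<dots> = tn (a \<otimes>\<^bsub>A\<^esub> c) (twist B q b \<otimes>\<^bsub>B\<^esub> d)"
  proof -
    have "q = 0 \<or> q = 1" using assms(3) by (auto simp: A.ishom_def less_2_cases_iff)
    then show ?thesis
      using assms c
      by (elim disjE)
        (auto simp: A.ishomD[OF assms(3)] twist_def B.distr_r tn_add_r tn_scal_r B.scal_mult_l)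
  qed
  finally show ?thesis .
qed

lemma homog_tn:
  assumes ab: "a \<in> carrier A" "b \<in> carrier B" and "r < 2"
  shows "homog T r (tn a b) = tn (homog A 0 a) (homog B (r mod 2) b) \<oplus>\<^bsub>T\<^esub>
    tn (homog A (Suc 0) a) (homog B (Suc r mod 2) b)"
proof -
  let ?s = "\<lambda>p. Poly_Mapping.single (homog A p a, homog B ((p + r) mod 2) b) (1::complex)"
  have s: "?s q \<in> carrier PT" if "q < 2" for q
    using ab that by (intro single_carrier) auto
  have "homog T r (tn a b) = TI.cls (hm r (a, b))"
    unfolding tn_eq using assms
    by (subst cls_hom(7)[symmetric]) (auto simp: single_carrier PT_simps(7) ext_single cscal_simps)
  also have "hm r (a, b) = ?s 0 \<oplus>\<^bsub>PT\<^esub> ?s (Suc 0)"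
    by (simp add: hm_def PT_simps)
  also have "TI.cls \<dots> = tn (homog A 0 a) (homog B (r mod 2) b) \<oplus>\<^bsub>T\<^esub>
      tn (homog A (Suc 0) a) (homog B (Suc r mod 2) b)"
    unfolding tn_eq using cls_hom(2)[OF s s, of 0 "Suc 0"] by simp
  finally show ?thesis .
qed

lemma tn_homog:
  assumes "A.ishom p a" "B.ishom q b" "r < 2"
  shows "homog T r (tn a b) = (if r = (p + q) mod 2 then tn a b else \<zero>\<^bsub>T\<^esub>)"
proof -
  have ab: "a \<in> carrier A" "b \<in> carrier B" using assms A.ishom_closed B.ishom_closed by blast+
  have "p = 0 \<or> p = 1" "q = 0 \<or> q = 1" "r = 0 \<or> r = 1"
    using assms by (auto simp: A.ishom_def B.ishom_def less_2_cases_iff)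
  then show ?thesis
    unfolding homog_tn[OF ab assms(3)]
    using ab by (elim disjE) (auto simp: A.ishomD[OF assms(1)] B.ishomD[OF assms(2)])
qed

definition pure :: "nat \<Rightarrow> ('a \<times> 'b \<Rightarrow>\<^sub>0 complex) set \<Rightarrow> bool" where
  "pure r x \<longleftrightarrow> (\<exists>a b p q. A.ishom p a \<and> B.ishom q b \<and> x = tn a b \<and> r = (p + q) mod 2)"

abbreviation pures :: "('a \<times> 'b \<Rightarrow>\<^sub>0 complex) set set" where "pures \<equiv> {x. \<exists>r. pure r x}"

lemma pures_carrier: "pures \<subseteq> carrier T"
  unfolding pure_def using A.ishom_closed B.ishom_closed by blast

lemma pure_tn: "A.ishom p a \<Longrightarrow> B.ishom q b \<Longrightarrow> tn a b \<in> pures"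
  unfolding pure_def by blast

text \<open>Splitting both factors into components shows that tensors of homogeneous elements
  already span, so linear claims need only be checked where the sign rule is explicit.\<close>

lemma T_ind:
  assumes "T.subspace V" "\<And>a b p q. A.ishom p a \<Longrightarrow> B.ishom q b \<Longrightarrow> tn a b \<in> V"
  shows "carrier T \<subseteq> V"
proof -
  have tn: "tn a b \<in> V" if ab: "a \<in> carrier A" "b \<in> carrier B" for a b
  proof -
    have "tn a b = tn (homog A 0 a \<oplus>\<^bsub>A\<^esub> homog A (Suc 0) a) (homog B 0 b \<oplus>\<^bsub>B\<^esub> homog B (Suc 0) b)"
      using ab by (simp add: A.homog_decomp B.homog_decomp)
    also have "\<dots> \<in> V"
      using ab assms(2)[OF A.ishom_homog B.ishom_homog]
      by (auto simp: tn_add_l tn_add_r intro!: T.subspaceD(3)[OF assms(1)])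
    finally show ?thesis .
  qed
  show ?thesis
  proof
    fix x assume "x \<in> carrier T"
    then obtain f where f: "x = TI.cls f" "f \<in> carrier PT" unfolding T_eq TI.carrier_quot by auto
    let ?g = "\<lambda>x. cscal (Poly_Mapping.lookup f x) (Poly_Mapping.single x 1)"
    have "sum ?g J \<in> carrier PT \<and> TI.cls (sum ?g J) \<in> V" if "finite J" "J \<subseteq> Poly_Mapping.keys f" for J
      using that
    proof (induction J)
      case empty
      show ?case
        using cls_hom(4) T.subspaceD(2)[OF assms(1)] by (simp add: PT_simps)
    next
      case (insert y J)
      obtain a b where y: "y = (a, b)" by fastforce
      have ab: "a \<in> carrier A" "b \<in> carrier B" using insert f(2) y by (auto simp: PT_simps)
      have g: "?g y = scal PT (Poly_Mapping.lookup f y) (Poly_Mapping.single (a, b) 1)"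
        by (simp add: PT_simps y)
      have "?g y \<in> carrier PT" unfolding g using ab by (intro PT.scal_closed single_carrier)
      moreover have "TI.cls (?g y) \<in> V" unfolding g
        using ab cls_hom(6)[OF single_carrier] tn[OF ab] T.subspaceD(4)[OF assms(1)] by (simp add: tn_eq)
      ultimately show ?case
        using insert PT.a_closed[of "?g y" "sum ?g J"] cls_hom(2)[of "?g y" "sum ?g J"]
          T.subspaceD(3)[OF assms(1)]
        by (simp add: PT_simps(2))
    qed
    from this[of "Poly_Mapping.keys f"] show "x \<in> V"
      using poly_mapping_sum_single[of f] f by simp
  qed
qed

lemma carrier_T: "carrier T \<subseteq> lspan T pures"
  by (rule T_ind[OF T.lspan_subspace[OF pures_carrier]]) (rule lspan.incl, rule pure_tn)

lemma tn_mult_hom: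
  assumes "A.ishom p a" "B.ishom q b" "A.ishom r c" "B.ishom s d"
  shows "tn a b \<otimes>\<^bsub>T\<^esub> tn c d = scal T ((-1) ^ (r * q)) (tn (a \<otimes>\<^bsub>A\<^esub> c) (b \<otimes>\<^bsub>B\<^esub> d))"
  using assms A.ishom_closed B.ishom_closed
  by (simp add: tn_mult B.twist_ishom B.scal_mult_l tn_scal_r)

lemma neg1_power_mod2: "(-1 :: complex) ^ ((p + q) mod 2 * r) = (-1) ^ (p * r) * (-1) ^ (q * r)"
  "(-1 :: complex) ^ (r * ((p + q) mod 2)) = (-1) ^ (r * p) * (-1) ^ (r * q)"
  by (cases "even r"; cases "even p"; cases "even q"; simp add: mod_2_eq_odd)+

lemma superalgebra_T: "superalgebra T"
proof (rule T.superalgebra_spanI[OF pures_carrier carrier_T])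
  show "x \<otimes>\<^bsub>T\<^esub> y \<otimes>\<^bsub>T\<^esub> z = x \<otimes>\<^bsub>T\<^esub> (y \<otimes>\<^bsub>T\<^esub> z)" if xyz: "x \<in> pures" "y \<in> pures" "z \<in> pures" for x y z
  proof -
    obtain a b p q where x: "A.ishom p a" "B.ishom q b" "x = tn a b" using xyz unfolding pure_def by blast
    obtain c d r s where y: "A.ishom r c" "B.ishom s d" "y = tn c d" using xyz unfolding pure_def by blast
    obtain e f t u where z: "A.ishom t e" "B.ishom u f" "z = tn e f" using xyz unfolding pure_def by blast
    have cl: "a \<in> carrier A" "c \<in> carrier A" "e \<in> carrier A" "b \<in> carrier B" "d \<in> carrier B" "f \<in> carrier B"
      using x y z A.ishom_closed B.ishom_closed by blast+
    let ?u = "tn (a \<otimes>\<^bsub>A\<^esub> (c \<otimes>\<^bsub>A\<^esub> e)) (b \<otimes>\<^bsub>B\<^esub> (d \<otimes>\<^bsub>B\<^esub> f))"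
    have "x \<otimes>\<^bsub>T\<^esub> y \<otimes>\<^bsub>T\<^esub> z = scal T ((-1) ^ (r * q) * (-1) ^ (t * ((q + s) mod 2))) ?u"
      using cl tn_mult_hom[OF A.ishom_mult[OF x(1) y(1)] B.ishom_mult[OF x(2) y(2)] z(1,2)]
      by (simp add: x(3) y(3) z(3) tn_mult_hom[OF x(1,2) y(1,2)] T.scal_mult_l T.scal_scal
          A.m_assoc B.m_assoc)
    \<comment> \<open>Both bracketings carry the sign of exponent \<open>r q + t q + t s\<close>:
      \<open>c\<close> passes \<open>b\<close>, and \<open>e\<close> passes \<open>b\<close> and
      \<open>d\<close>.\<close>
    also have "(-1) ^ (r * q) * (-1) ^ (t * ((q + s) mod 2)) =
        ((-1) ^ (t * s) * (-1) ^ ((r + t) mod 2 * q) :: complex)"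
      unfolding neg1_power_mod2 mult.commute[of q] by (simp only: ac_simps)
    also have "scal T \<dots> ?u = x \<otimes>\<^bsub>T\<^esub> (y \<otimes>\<^bsub>T\<^esub> z)"
      using cl tn_mult_hom[OF x(1,2) A.ishom_mult[OF y(1) z(1)] B.ishom_mult[OF y(2) z(2)]]
      by (simp add: x(3) y(3) z(3) tn_mult_hom[OF y(1,2) z(1,2)] T.scal_mult_r T.scal_scal)
    finally show ?thesis .
  qed
  show "\<one>\<^bsub>T\<^esub> \<otimes>\<^bsub>T\<^esub> x = x" "x \<otimes>\<^bsub>T\<^esub> \<one>\<^bsub>T\<^esub> = x" if x: "x \<in> pures" for x
    using x tn_mult_hom[OF A.ishom_one B.ishom_one] tn_mult_hom[OF _ _ A.ishom_one B.ishom_one]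
      A.ishom_closed B.ishom_closed
    by (auto simp: pure_def one_T)
  show "homog T 0 \<one>\<^bsub>T\<^esub> = \<one>\<^bsub>T\<^esub>"
    using tn_homog[OF A.ishom_one B.ishom_one, of 0] by (simp add: one_T)
  show "\<exists>r. pure r x" if "x \<in> pures" for x using that by auto
  show "r < 2" if "pure r x" for r x using that by (auto simp: pure_def)
  show "homog T p x = (if p = r then x else \<zero>\<^bsub>T\<^esub>)" if "pure r x" "p < 2" for r x p
    using that tn_homog by (auto simp: pure_def)
  show "homog T ((r + s) mod 2) (x \<otimes>\<^bsub>T\<^esub> y) = x \<otimes>\<^bsub>T\<^esub> y" if xy: "pure r x" "pure s y" for r s x y
  proof -
    obtain a b p q where x: "A.ishom p a" "B.ishom q b" "x = tn a b" "r = (p + q) mod 2"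
      using xy unfolding pure_def by blast
    obtain c d p' q' where y: "A.ishom p' c" "B.ishom q' d" "y = tn c d" "s = (p' + q') mod 2"
      using xy unfolding pure_def by blast
    have cl: "a \<in> carrier A" "c \<in> carrier A" "b \<in> carrier B" "d \<in> carrier B"
      using x y A.ishom_closed B.ishom_closed by blast+
    have "(r + s) mod 2 = ((p + p') mod 2 + (q + q') mod 2) mod 2"
      unfolding x(4) y(4) mod_add_eq by (simp only: ac_simps)
    then show ?thesis
      using tn_homog[OF A.ishom_mult[OF x(1) y(1)] B.ishom_mult[OF x(2) y(2)], of "(r + s) mod 2"] cl
      by (simp add: x(3) y(3) tn_mult_hom[OF x(1,2) y(1,2)] T.homog_scal)
  qed
qed

end

subsection \<open>The completed tensor square\<close>

text \<open>With \<open>F 0\<close> equal to the whole algebra, an arbitrary element counts as one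
  of degree 0, so that a tensor with one factor in \<open>F p\<close> lies in
  \<open>F2 p\<close>.\<close>

locale tensor_square = filtered_superalgebra A F for A :: "'a superalg" (structure) and F +
  assumes F_0: "F 0 = carrier A"
begin

sublocale tensor_product A A by unfold_locales

sublocale T: superalgebra T by (rule superalgebra_T)

definition F2 :: "nat \<Rightarrow> ('a \<times> 'a \<Rightarrow>\<^sub>0 complex) set set" where
  "F2 p = lspan T {tn x y | x y a b. x \<in> F a \<and> y \<in> F b \<and> p \<le> a + b}"

lemma F_carrier: "x \<in> F p \<Longrightarrow> x \<in> carrier A"
  using subspaceD(1)[OF F_sub] .

lemma F2_gens: "{tn x y | x y a b. x \<in> F a \<and> y \<in> F b \<and> p \<le> a + b} \<subseteq> carrier T"
  using F_carrier by blast

lemma F2_sub: "T.subspace (F2 p)"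
  unfolding F2_def by (rule T.lspan_subspace[OF F2_gens])

lemma F2_tn: "x \<in> F a \<Longrightarrow> y \<in> F b \<Longrightarrow> p \<le> a + b \<Longrightarrow> tn x y \<in> F2 p"
  unfolding F2_def by (rule lspan.incl) blast

lemma F2_least:
  assumes "T.subspace V" "\<And>x y a b. x \<in> F a \<Longrightarrow> y \<in> F b \<Longrightarrow> p \<le> a + b \<Longrightarrow> tn x y \<in> V"
  shows "F2 p \<subseteq> V"
  unfolding F2_def by (rule T.lspan_least[OF assms(1)]) (use assms(2) in blast)

lemma F2_mono: "p \<le> q \<Longrightarrow> F2 q \<subseteq> F2 p"
  by (rule F2_least[OF F2_sub]) (auto intro: F2_tn)

lemma F_twist: "x \<in> F p \<Longrightarrow> twist A d x \<in> F p"
  unfolding twist_def using F_homog F_sub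
  by (auto simp: graded_def intro!: subspaceD(3,4)[OF F_sub])

lemma filtered_T: "filtered_superalgebra T F2"
proof unfold_locales
  fix p
  show "T.subspace (F2 p)" by (rule F2_sub)
  show "F2 (Suc p) \<subseteq> F2 p" by (rule F2_mono) simp
  show "T.graded (F2 p)"
    unfolding T.graded_def
  proof (intro allI impI ballI)
    fix r x assume r: "r < (2::nat)" and x: "x \<in> F2 p"
    have "F2 p \<subseteq> {x \<in> carrier T. homog T r x \<in> F2 p}"
    proof (rule F2_least[OF T.subspace_homog[OF F2_sub r]])
      fix x y a b assume xy: "x \<in> F a" "y \<in> F b" "p \<le> a + b"
      have "homog A i x \<in> F a" "homog A i y \<in> F b" if "i < 2" for i
        using F_homog xy that by (auto simp: graded_def)
      then have "homog T r (tn x y) \<in> F2 p"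
        unfolding homog_tn[OF F_carrier[OF xy(1)] F_carrier[OF xy(2)] r]
        by (intro T.subspaceD(3)[OF F2_sub] F2_tn) (use xy in auto)
      then show "tn x y \<in> {x \<in> carrier T. homog T r x \<in> F2 p}" using F_carrier xy by blast
    qed
    then show "homog T r x \<in> F2 p" using x by auto
  qed
  show "x \<otimes>\<^bsub>T\<^esub> y \<in> F2 p" if "x \<in> F2 p" "y \<in> carrier T" for x y
  proof (rule T.lspan_mult[OF F2_gens pures_carrier F2_sub])
    show "x \<in> lspan T {tn x y |x y a b. x \<in> F a \<and> y \<in> F b \<and> p \<le> a + b}"
      using that(1) by (simp add: F2_def)
    show "y \<in> lspan T pures" using that(2) carrier_T by auto
    fix u v assume "u \<in> {tn x y |x y a b. x \<in> F a \<and> y \<in> F b \<and> p \<le> a + b}" "v \<in> pures"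
    then obtain x y a b c d i j where u: "u = tn x y" "x \<in> F a" "y \<in> F b" "p \<le> a + b"
      and v: "v = tn c d" "ishom i c" "ishom j d"
      unfolding pure_def by blast
    show "u \<otimes>\<^bsub>T\<^esub> v \<in> F2 p"
      unfolding u(1) v(1) tn_mult[OF F_carrier[OF u(2)] F_carrier[OF u(3)] v(2) ishom_closed[OF v(3)]]
      using u v ishom_closed by (intro F2_tn[OF _ _ u(4)] F_right F_twist)
  qed
  show "\<exists>q. \<forall>x\<in>F2 q. y \<otimes>\<^bsub>T\<^esub> x \<in> F2 p" if "y \<in> carrier T" for y
  proof -
    let ?V = "{y \<in> carrier T. \<exists>q. \<forall>x\<in>F2 q. y \<otimes>\<^bsub>T\<^esub> x \<in> F2 p}"
    have F2c: "x \<in> carrier T" if "x \<in> F2 q" for x q using T.subspaceD(1)[OF F2_sub that] .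
    have "carrier T \<subseteq> ?V"
    proof (rule T_ind)
      show "T.subspace ?V"
        unfolding T.subspace_def
      proof (intro conjI ballI allI)
        show "\<zero>\<^bsub>T\<^esub> \<in> ?V" using F2c T.subspaceD(2)[OF F2_sub] by auto
        fix x y assume "x \<in> ?V" "y \<in> ?V"
        then obtain i j where ij: "x \<in> carrier T" "y \<in> carrier T"
          "\<forall>z\<in>F2 i. x \<otimes>\<^bsub>T\<^esub> z \<in> F2 p" "\<forall>z\<in>F2 j. y \<otimes>\<^bsub>T\<^esub> z \<in> F2 p" by auto
        have "F2 (max i j) \<subseteq> F2 i" "F2 (max i j) \<subseteq> F2 j" by (auto intro!: F2_mono)
        then have "\<forall>z\<in>F2 (max i j). (x \<oplus>\<^bsub>T\<^esub> y) \<otimes>\<^bsub>T\<^esub> z \<in> F2 p"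
          using ij F2c by (auto simp: T.distr_r intro!: T.subspaceD(3)[OF F2_sub])
        then show "x \<oplus>\<^bsub>T\<^esub> y \<in> ?V" using ij by auto
        fix c
        have "\<forall>z\<in>F2 i. scal T c x \<otimes>\<^bsub>T\<^esub> z \<in> F2 p"
          using ij F2c by (auto simp: T.scal_mult_l intro!: T.subspaceD(4)[OF F2_sub])
        then show "scal T c x \<in> ?V" using ij by auto
      qed auto
      fix c d i j assume cd: "ishom i c" "ishom j d"
      then have cl: "c \<in> carrier A" "d \<in> carrier A" using ishom_closed by auto
      \<comment> \<open>Moduli of continuity for the two factors. In total degree
        \<open>k + l\<close> one of the tensor factors reaches its own bound, because
        \<open>a < k\<close> and \<open>b < l\<close> would give
        \<open>a + b < k + l\<close>.\<close>
      obtain k l where kl: "\<forall>x\<in>F k. c \<otimes> x \<in> F p" "\<forall>x\<in>F l. d \<otimes> x \<in> F p"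
        using F_left cl by metis
      have "F2 (k + l) \<subseteq> {x \<in> carrier T. tn c d \<otimes>\<^bsub>T\<^esub> x \<in> F2 p}"
      proof (rule F2_least[OF T.subspace_mult_l[OF F2_sub tn_closed[OF cl]]])
        fix x y a b assume xy: "x \<in> F a" "y \<in> F b" "k + l \<le> a + b"
        \<comment> \<open>The sign in the product depends on the parity of the first factor of the
          right tensor, so \<open>x\<close> is treated component by component.\<close>
        have pr: "tn c d \<otimes>\<^bsub>T\<^esub> tn x' y \<in> F2 p" if x': "x' \<in> F a" "ishom r x'" for r x'
        proof -
          have xc: "x' \<in> carrier A" "y \<in> carrier A" using x' xy F_carrier by auto
          have "tn c d \<otimes>\<^bsub>T\<^esub> tn x' y = scal T ((-1) ^ (r * j)) (tn (c \<otimes> x') (d \<otimes> y))"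
            using cl xc x'(2) cd
            by (simp add: tn_mult twist_ishom scal_mult_l tn_scal_r)
          also have "\<dots> \<in> F2 p"
          proof (rule T.subspaceD(4)[OF F2_sub])
            consider "k \<le> a" | "l \<le> b" using xy(3) by linarith
            then show "tn (c \<otimes> x') (d \<otimes> y) \<in> F2 p"
            proof cases
              case 1
              then have "c \<otimes> x' \<in> F p" using kl x' F_mono by blast
              then show ?thesis by (rule F2_tn[where b = 0]) (use F_0 cl xc in auto)
            next
              case 2
              then have "d \<otimes> y \<in> F p" using kl xy F_mono by blast
              then show ?thesis by (rule F2_tn[where a = 0, rotated]) (use F_0 cl xc in auto)
            qed
          qed
          finally show ?thesis .
        qed
        have xc: "x \<in> carrier A" "y \<in> carrier A" using xy F_carrier by auto
        have "tn c d \<otimes>\<^bsub>T\<^esub> tn x y =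
            tn c d \<otimes>\<^bsub>T\<^esub> tn (homog A 0 x) y \<oplus>\<^bsub>T\<^esub> tn c d \<otimes>\<^bsub>T\<^esub> tn (homog A (Suc 0) x) y"
          using xc cl by (simp flip: T.distr_l tn_add_l add: homog_decomp)
        also have "\<dots> \<in> F2 p"
          using F_homog xy xc
          by (intro T.subspaceD(3)[OF F2_sub] pr[OF _ ishom_homog]) (auto simp: graded_def)
        finally show "tn x y \<in> {x \<in> carrier T. tn c d \<otimes>\<^bsub>T\<^esub> x \<in> F2 p}" using xc by blast
      qed
      then show "tn c d \<in> ?V" using cl by blast
    qed
    then show ?thesis using that by auto
  qed
qed

sublocale T2: filtered_superalgebra T F2 by (rule filtered_T)

abbreviation EC :: "(nat \<Rightarrow> 'a) set superalg" where "EC \<equiv> completion A F"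
abbreviation E2 :: "(nat \<Rightarrow> ('a \<times> 'a \<Rightarrow>\<^sub>0 complex) set) set superalg" where "E2 \<equiv> completion T F2"

sublocale EC: superalgebra EC by (rule superalgebra_completion)
sublocale E2: superalgebra E2 by (rule T2.superalgebra_completion)

definition ct :: "(nat \<Rightarrow> 'a) set \<Rightarrow> (nat \<Rightarrow> 'a) set \<Rightarrow> (nat \<Rightarrow> ('a \<times> 'a \<Rightarrow>\<^sub>0 complex) set) set" where
  "ct X Y = (\<Union>x\<in>X. \<Union>y\<in>Y. T2.lim (\<lambda>k. tn (x k) (y k)))"

lemma tn_minus:
  assumes "x \<in> carrier A" "y \<in> carrier A" "x' \<in> carrier A" "y' \<in> carrier A"
  shows "tn x y \<ominus>\<^bsub>T\<^esub> tn x' y' = tn (x \<ominus> x') y \<oplus>\<^bsub>T\<^esub> tn x' (y \<ominus> y')"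
proof -
  have "tn (x \<ominus> x') y = tn x y \<ominus>\<^bsub>T\<^esub> tn x' y" "tn x' (y \<ominus> y') = tn x' y \<ominus>\<^bsub>T\<^esub> tn x' y'"
    using assms by (simp_all add: minus_scal T.minus_scal tn_add_l tn_add_r tn_scal_l tn_scal_r)
  then show ?thesis using assms by (simp add: T.minus_telescope)
qed

lemma tn_minus_F2:
  assumes "x \<in> carrier A" "y \<in> carrier A" "x' \<in> carrier A" "y' \<in> carrier A"
    "x \<ominus> x' \<in> F p" "y \<ominus> y' \<in> F p"
  shows "tn x y \<ominus>\<^bsub>T\<^esub> tn x' y' \<in> F2 p"
  unfolding tn_minus[OF assms(1-4)] using assms F_0
  by (intro T.subspaceD(3)[OF F2_sub] F2_tn[of "x \<ominus> x'" p y 0] F2_tn[of x' 0 "y \<ominus> y'" p]) auto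

lemma cauchy_tn:
  assumes "s \<in> cauchy_seqs A F" "t \<in> cauchy_seqs A F"
  shows "(\<lambda>k. tn (s k) (t k)) \<in> cauchy_seqs T F2"
proof (rule T2.cauchyI)
  note st = cauchyD[OF assms(1)] cauchyD[OF assms(2)]
  then show "tn (s k) (t k) \<in> carrier T" for k by simp
  fix p
  obtain K L where KL: "\<forall>k\<ge>K. \<forall>l\<ge>K. s k \<ominus> s l \<in> F p" "\<forall>k\<ge>L. \<forall>l\<ge>L. t k \<ominus> t l \<in> F p"
    using cauchyD2[OF assms(1)] cauchyD2[OF assms(2)] by metis
  then show "\<exists>K. \<forall>k\<ge>K. \<forall>l\<ge>K. tn (s k) (t k) \<ominus>\<^bsub>T\<^esub> tn (s l) (t l) \<in> F2 p"
    using st by (intro exI[of _ "max K L"] allI impI tn_minus_F2) auto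
qed

text \<open>Other representatives change the sequence of tensors by a null sequence, by
  \<open>tn_minus_F2\<close>; hence the union that defines \<open>ct\<close> is one coset.\<close>

lemma ct_lim:
  assumes "s \<in> cauchy_seqs A F" "t \<in> cauchy_seqs A F"
  shows "ct (lim s) (lim t) = T2.lim (\<lambda>k. tn (s k) (t k))"
proof -
  have "T2.lim (\<lambda>k. tn (x k) (y k)) = T2.lim (\<lambda>k. tn (s k) (t k))"
    if x: "x \<in> lim s" and y: "y \<in> lim t" for x y
  proof (rule T2.lim_eqI[OF cauchy_tn cauchy_tn])
    have xy: "x \<in> cauchy_seqs A F" "y \<in> cauchy_seqs A F"
      "(\<lambda>k. x k \<ominus> s k) \<in> null" "(\<lambda>k. y k \<ominus> t k) \<in> null"
      using mem_lim assms x y by auto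
    then show "x \<in> cauchy_seqs A F" "y \<in> cauchy_seqs A F" by simp_all
    note cl = cauchyD[OF xy(1)] cauchyD[OF xy(2)] cauchyD[OF assms(1)] cauchyD[OF assms(2)]
    show "(\<lambda>k. tn (x k) (y k) \<ominus>\<^bsub>T\<^esub> tn (s k) (t k)) \<in> T2.null"
    proof (rule T2.nullI)
      show "tn (x k) (y k) \<ominus>\<^bsub>T\<^esub> tn (s k) (t k) \<in> carrier T" for k using cl by simp
      fix p
      obtain K L where "\<forall>k\<ge>K. x k \<ominus> s k \<in> F p" "\<forall>k\<ge>L. y k \<ominus> t k \<in> F p"
        using nullD2[OF xy(3)] nullD2[OF xy(4)] by metis
      then show "\<exists>K. \<forall>k\<ge>K. tn (x k) (y k) \<ominus>\<^bsub>T\<^esub> tn (s k) (t k) \<in> F2 p"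
        using cl by (intro exI[of _ "max K L"] allI impI tn_minus_F2) auto
    qed
  qed (use assms in auto)
  then show ?thesis unfolding ct_def using lim_self assms by blast
qed

lemma EC_elem: "x \<in> carrier EC \<Longrightarrow> \<exists>s. s \<in> cauchy_seqs A F \<and> x = lim s"
  by (auto simp: carrier_completion)

lemmas lim_hom = salg_homD[OF salg_hom_lim, unfolded C_simps]
lemmas lim2_hom = salg_homD[OF T2.salg_hom_lim, unfolded T2.C_simps]

lemma ct_closed [simp, intro]: "x \<in> carrier EC \<Longrightarrow> y \<in> carrier EC \<Longrightarrow> ct x y \<in> carrier E2"
  by (auto dest!: EC_elem simp: ct_lim cauchy_tn lim2_hom)

lemma ct_add_l:
  assumes "x \<in> carrier EC" "x' \<in> carrier EC" "y \<in> carrier EC"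
  shows "ct (x \<oplus>\<^bsub>EC\<^esub> x') y = ct x y \<oplus>\<^bsub>E2\<^esub> ct x' y"
proof -
  obtain s s' t where st: "s \<in> cauchy_seqs A F" "x = lim s" "s' \<in> cauchy_seqs A F" "x' = lim s'"
    "t \<in> cauchy_seqs A F" "y = lim t" using assms EC_elem by metis
  then show ?thesis
    by (simp add: ct_lim cauchy_tn cauchy_add cauchyD tn_add_l flip: lim_hom(2-7) lim2_hom(2-7))
qed

lemma ct_add_r:
  assumes "x \<in> carrier EC" "y \<in> carrier EC" "y' \<in> carrier EC"
  shows "ct x (y \<oplus>\<^bsub>EC\<^esub> y') = ct x y \<oplus>\<^bsub>E2\<^esub> ct x y'"
proof -
  obtain s t' t where st: "s \<in> cauchy_seqs A F" "x = lim s" "t' \<in> cauchy_seqs A F" "y' = lim t'"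
    "t \<in> cauchy_seqs A F" "y = lim t" using assms EC_elem by metis
  then show ?thesis
    by (simp add: ct_lim cauchy_tn cauchy_add cauchyD tn_add_r flip: lim_hom(2-7) lim2_hom(2-7))
qed

lemma ct_scal:
  assumes "x \<in> carrier EC" "y \<in> carrier EC"
  shows "ct (scal EC c x) y = scal E2 c (ct x y)" "ct x (scal EC c y) = scal E2 c (ct x y)"
proof -
  obtain s t where st: "s \<in> cauchy_seqs A F" "x = lim s" "t \<in> cauchy_seqs A F" "y = lim t"
    using assms EC_elem by metis
  then show "ct (scal EC c x) y = scal E2 c (ct x y)" "ct x (scal EC c y) = scal E2 c (ct x y)"
    by (simp_all add: ct_lim cauchy_tn cauchy_scal cauchyD tn_scal_l tn_scal_r flip: lim_hom(2-7) lim2_hom(2-7))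
qed

lemma ct_one: "ct \<one>\<^bsub>EC\<^esub> \<one>\<^bsub>EC\<^esub> = \<one>\<^bsub>E2\<^esub>"
  by (simp add: ct_lim cauchy_const one_T flip: lim_hom(2-7) lim2_hom(2-7))

lemma twist_lim: "s \<in> cauchy_seqs A F \<Longrightarrow> twist EC q (lim s) = lim (\<lambda>k. twist A q (s k))"
  unfolding twist_def by (simp add: cauchy_intros flip: lim_hom(2-7))

lemma ct_mult:
  assumes "x \<in> carrier EC" "y \<in> carrier EC" "EC.ishom q x'" "y' \<in> carrier EC"
  shows "ct x y \<otimes>\<^bsub>E2\<^esub> ct x' y' = ct (x \<otimes>\<^bsub>EC\<^esub> x') (twist EC q y \<otimes>\<^bsub>EC\<^esub> y')"
proof -
  have x': "q < 2" "x' \<in> carrier EC" "homog EC q x' = x'" using assms by (auto simp: EC.ishom_def)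
  obtain s s' t t' where st: "s \<in> cauchy_seqs A F" "x = lim s" "s' \<in> cauchy_seqs A F" "x' = lim s'"
    "t \<in> cauchy_seqs A F" "y = lim t" "t' \<in> cauchy_seqs A F" "y' = lim t'"
    using assms x' EC_elem by metis
  \<comment> \<open>A homogeneous limit need not have homogeneous terms; projecting the terms gives
    another representative of \<open>x'\<close> to which the sign rule applies at every
    index.\<close>
  define s'' where "s'' = (\<lambda>k. homog A q (s' k))"
  have s'': "s'' \<in> cauchy_seqs A F" "x' = lim s''" "ishom q (s'' k)" for k
    using x' st unfolding s''_def by (auto simp: cauchy_homog lim_hom ishom_homog cauchyD)
  have tw: "(\<lambda>k. twist A q (t k)) \<in> cauchy_seqs A F"
    unfolding twist_def using st by (intro cauchy_intros) auto
  note cl = cauchyD[OF st(1)] cauchyD[OF st(5)] cauchyD[OF st(7)] cauchyD[OF s''(1)]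
  have "tn (s k) (t k) \<otimes>\<^bsub>T\<^esub> tn (s'' k) (t' k) = tn (s k \<otimes> s'' k) (twist A q (t k) \<otimes> t' k)" for k
    using cl s''(3) by (intro tn_mult)
  then show ?thesis
    unfolding st(2,6,8) s''(2) twist_lim[OF st(5)]
    using st(1,5,7) s''(1) tw by (simp add: ct_lim cauchy_tn cauchy_mult flip: lim_hom(2-7) lim2_hom(2-7))
qed

lemma EC_one: "EC.ishom 0 \<one>\<^bsub>EC\<^esub>" by (rule EC.ishom_one)

lemma twist_one: "twist EC q \<one>\<^bsub>EC\<^esub> = \<one>\<^bsub>EC\<^esub>"
  by (simp add: EC.twist_ishom[OF EC_one])

lemma twist_0: "x \<in> carrier EC \<Longrightarrow> twist EC 0 x = x"
  unfolding twist_def by (simp add: EC.homog_decomp)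

lemma ct_decomp:
  assumes "x \<in> carrier EC" "y \<in> carrier EC"
  shows "ct x y = ct (homog EC 0 x) y \<oplus>\<^bsub>E2\<^esub> ct (homog EC (Suc 0) x) y"
  using assms by (simp flip: ct_add_l add: EC.homog_decomp)

text \<open>The sign rule treats the two components of \<open>x'\<close> differently, so membership
  is tested for each of them and the results are added.\<close>

lemma ct_mult_subspace:
  assumes "E2.subspace W" "x \<in> carrier EC" "y \<in> carrier EC" "x' \<in> carrier EC" "y' \<in> carrier EC"
    and "\<And>q. q < 2 \<Longrightarrow> ct (x \<otimes>\<^bsub>EC\<^esub> homog EC q x') (twist EC q y \<otimes>\<^bsub>EC\<^esub> y') \<in> W"
  shows "ct x y \<otimes>\<^bsub>E2\<^esub> ct x' y' \<in> W"
  using assms E2.subspaceD(3)[OF assms(1)] ct_mult[OF _ _ EC.ishom_homog]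
  by (subst ct_decomp[of x' y']) (auto simp: E2.distr_l)

lemma ct_l_hom:
  assumes "x \<in> carrier EC" "x' \<in> carrier EC"
  shows "ct x \<one>\<^bsub>EC\<^esub> \<otimes>\<^bsub>E2\<^esub> ct x' \<one>\<^bsub>EC\<^esub> = ct (x \<otimes>\<^bsub>EC\<^esub> x') \<one>\<^bsub>EC\<^esub>"
proof -
  have "ct x \<one>\<^bsub>EC\<^esub> \<otimes>\<^bsub>E2\<^esub> ct x' \<one>\<^bsub>EC\<^esub> = ct (x \<otimes>\<^bsub>EC\<^esub> homog EC 0 x') \<one>\<^bsub>EC\<^esub> \<oplus>\<^bsub>E2\<^esub>
      ct (x \<otimes>\<^bsub>EC\<^esub> homog EC (Suc 0) x') \<one>\<^bsub>EC\<^esub>"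
    using assms ct_mult[OF _ _ EC.ishom_homog]
    by (subst ct_decomp[of x']) (auto simp: E2.distr_l twist_one)
  also have "\<dots> = ct (x \<otimes>\<^bsub>EC\<^esub> x') \<one>\<^bsub>EC\<^esub>"
    using assms by (simp flip: ct_add_l EC.distr_l add: EC.homog_decomp)
  finally show ?thesis .
qed

lemma ct_r_hom:
  "y \<in> carrier EC \<Longrightarrow> y' \<in> carrier EC \<Longrightarrow>
    ct \<one>\<^bsub>EC\<^esub> y \<otimes>\<^bsub>E2\<^esub> ct \<one>\<^bsub>EC\<^esub> y' = ct \<one>\<^bsub>EC\<^esub> (y \<otimes>\<^bsub>EC\<^esub> y')"
  by (simp add: ct_mult[OF _ _ EC_one] twist_0)

text \<open>In this order the two elements that pass each other are units, hence even, and no sign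
  appears; the opposite order can produce one.\<close>

lemma ct_split:
  "x \<in> carrier EC \<Longrightarrow> y \<in> carrier EC \<Longrightarrow> ct x \<one>\<^bsub>EC\<^esub> \<otimes>\<^bsub>E2\<^esub> ct \<one>\<^bsub>EC\<^esub> y = ct x y"
  by (simp add: ct_mult[OF _ _ EC_one] twist_one)

text \<open>The product of two tensors involves the components of the new first factor and the twist
  of the old second factor; gradedness of \<open>V\<close> and \<open>W\<close> keeps both
  inside.\<close>

lemma subalgebra_ct:
  assumes V: "EC.subalgebra V" "EC.graded V" and W: "EC.subalgebra W" "EC.graded W"
  shows "E2.subalgebra (lspan E2 {ct x y | x y. x \<in> V \<and> y \<in> W})"
proof -
  have VW: "EC.subspace V" "EC.subspace W" "\<one>\<^bsub>EC\<^esub> \<in> V" "\<one>\<^bsub>EC\<^esub> \<in> W"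
    "\<And>x y. x \<in> V \<Longrightarrow> y \<in> V \<Longrightarrow> x \<otimes>\<^bsub>EC\<^esub> y \<in> V" "\<And>x y. x \<in> W \<Longrightarrow> y \<in> W \<Longrightarrow> x \<otimes>\<^bsub>EC\<^esub> y \<in> W"
    using V W by (auto simp: EC.subalgebra_def)
  note cl = EC.subspaceD(1)[OF VW(1)] EC.subspaceD(1)[OF VW(2)]
  let ?S = "{ct x y | x y. x \<in> V \<and> y \<in> W}"
  have S: "?S \<subseteq> carrier E2" using cl by blast
  have sub: "E2.subspace (lspan E2 ?S)" by (rule E2.lspan_subspace[OF S])
  have tw: "twist EC q y \<in> W" if "y \<in> W" for q y
    unfolding twist_def using W(2) that
    by (auto simp: EC.graded_def intro!: EC.subspaceD(3,4)[OF VW(2)])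
  have "\<one>\<^bsub>E2\<^esub> \<in> lspan E2 ?S" unfolding ct_one[symmetric] by (rule lspan.incl) (use VW in blast)
  moreover have "x \<otimes>\<^bsub>E2\<^esub> y \<in> lspan E2 ?S" if "x \<in> lspan E2 ?S" "y \<in> lspan E2 ?S" for x y
  proof (rule E2.lspan_mult[OF S S sub _ that])
    fix u v assume "u \<in> ?S" "v \<in> ?S"
    then obtain x y x' y' where u: "u = ct x y" "x \<in> V" "y \<in> W" and v: "v = ct x' y'" "x' \<in> V" "y' \<in> W"
      by blast
    have "ct (x \<otimes>\<^bsub>EC\<^esub> homog EC q x') (twist EC q y \<otimes>\<^bsub>EC\<^esub> y') \<in> lspan E2 ?S" if "q < 2" for q
    proof -
      have "homog EC q x' \<in> V" using V(2) v that by (auto simp: EC.graded_def)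
      then have "x \<otimes>\<^bsub>EC\<^esub> homog EC q x' \<in> V" "twist EC q y \<otimes>\<^bsub>EC\<^esub> y' \<in> W"
        using u v tw VW by auto
      then show ?thesis by (intro lspan.incl) blast
    qed
    then show "u \<otimes>\<^bsub>E2\<^esub> v \<in> lspan E2 ?S"
      unfolding u(1) v(1) using u v cl by (intro ct_mult_subspace[OF sub]) auto
  qed
  ultimately show ?thesis using sub by (auto simp: E2.subalgebra_def)
qed

end

section \<open>Matrices of power series\<close>

type_synonym 'a ser = "nat \<Rightarrow> nat \<Rightarrow> nat \<Rightarrow> 'a"

definition ser_mult :: "('a, 'x) ring_scheme \<Rightarrow> nat set \<Rightarrow> 'a ser \<Rightarrow> 'a ser \<Rightarrow> 'a ser" where
  "ser_mult R K M L = (\<lambda>r i j. \<Oplus>\<^bsub>R\<^esub>k\<in>K. \<Oplus>\<^bsub>R\<^esub>a\<in>{..r}. M a i k \<otimes>\<^bsub>R\<^esub> L (r - a) k j)"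

definition ser_const :: "('a, 'x) ring_scheme \<Rightarrow> (nat \<Rightarrow> nat \<Rightarrow> 'a) \<Rightarrow> 'a ser" where
  "ser_const R g = (\<lambda>r i j. if r = 0 then g i j else \<zero>\<^bsub>R\<^esub>)"

definition ser_one :: "('a, 'x) ring_scheme \<Rightarrow> 'a ser" where
  "ser_one R = ser_const R (\<lambda>i j. if i = j then \<one>\<^bsub>R\<^esub> else \<zero>\<^bsub>R\<^esub>)"

text \<open>Agreement is required on \<open>K\<close> only, since entries outside are unconstrained,
  in particular those of a chosen inverse.\<close>

definition ser_eq :: "nat set \<Rightarrow> 'a ser \<Rightarrow> 'a ser \<Rightarrow> bool" where
  "ser_eq K M N \<longleftrightarrow> (\<forall>r. \<forall>i\<in>K. \<forall>j\<in>K. M r i j = N r i j)"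

definition entries_in :: "nat set \<Rightarrow> (nat \<Rightarrow> nat \<Rightarrow> 'a set) \<Rightarrow> 'a ser \<Rightarrow> bool" where
  "entries_in K V M \<longleftrightarrow> (\<forall>r. \<forall>i\<in>K. \<forall>j\<in>K. M r i j \<in> V i j)"

lemma ser_eq_sym: "ser_eq K M N \<Longrightarrow> ser_eq K N M"
  and ser_eq_trans [trans]: "ser_eq K M N \<Longrightarrow> ser_eq K N L \<Longrightarrow> ser_eq K M L"
  and ser_eq_refl: "ser_eq K M M"
  by (auto simp: ser_eq_def)

text \<open>
  The example to keep in mind: \<open>V i j\<close> consists of the elements of parity \<open>|i| + |j|\<close>.
\<close>

definition (in ring) entry_family :: "(nat \<Rightarrow> nat \<Rightarrow> 'a set) \<Rightarrow> bool" where
  "entry_family V \<longleftrightarrow> (\<forall>i j. V i j \<subseteq> carrier R \<and> \<zero> \<in> V i j \<and> \<one> \<in> V i i \<and>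
     (\<forall>x\<in>V i j. \<forall>y\<in>V i j. x \<oplus> y \<in> V i j) \<and> (\<forall>x\<in>V i j. \<ominus> x \<in> V i j)) \<and>
     (\<forall>i k j. \<forall>x\<in>V i k. \<forall>y\<in>V k j. x \<otimes> y \<in> V i j)"

lemma (in abelian_monoid) finsum_Sigma:
  assumes "finite A" "\<And>x. x \<in> A \<Longrightarrow> finite (B x)" "\<And>x y. x \<in> A \<Longrightarrow> y \<in> B x \<Longrightarrow> f x y \<in> carrier G"
  shows "(\<Oplus>x\<in>A. \<Oplus>y\<in>B x. f x y) = (\<Oplus>p\<in>Sigma A B. f (fst p) (snd p))"
  using assms
proof (induction A)
  case (insert x A)
  have "(\<Oplus>p\<in>Sigma (insert x A) B. f (fst p) (snd p)) = (\<Oplus>p\<in>Pair x ` B x \<union> Sigma A B. f (fst p) (snd p))"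
    by (rule arg_cong[of _ _ "finsum G _"]) auto
  also have "\<dots> = (\<Oplus>p\<in>Pair x ` B x. f (fst p) (snd p)) \<oplus> (\<Oplus>p\<in>Sigma A B. f (fst p) (snd p))"
    by (rule finsum_Un_disjoint) (use insert in auto)
  also have "(\<Oplus>p\<in>Pair x ` B x. f (fst p) (snd p)) = (\<Oplus>y\<in>B x. f x y)"
    by (subst finsum_reindex) (use insert in \<open>auto simp: inj_on_def\<close>)
  also have "(\<Oplus>p\<in>Sigma A B. f (fst p) (snd p)) = (\<Oplus>x\<in>A. \<Oplus>y\<in>B x. f x y)"
    using insert by simp
  finally show ?case using insert by (subst finsum_insert) (auto intro!: finsum_closed)
qed simp

context ring
begin

abbreviation carrier_ser :: "nat set \<Rightarrow> 'a ser \<Rightarrow> bool" where "carrier_ser K \<equiv> entries_in K (\<lambda>_ _. carrier R)"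

lemma carrier_serD: "carrier_ser K M \<Longrightarrow> i \<in> K \<Longrightarrow> j \<in> K \<Longrightarrow> M r i j \<in> carrier R"
  by (auto simp: entries_in_def)

lemma entry_family_carrier: "entry_family (\<lambda>_ _. carrier R)"
  by (auto simp: entry_family_def)

lemma entry_family_finsum:
  assumes "entry_family V" "\<And>x. x \<in> A \<Longrightarrow> f x \<in> V i j"
  shows "finsum R f A \<in> V i j"
proof -
  have V: "\<zero> \<in> V i j" "V i j \<subseteq> carrier R" "\<And>x y. x \<in> V i j \<Longrightarrow> y \<in> V i j \<Longrightarrow> x \<oplus> y \<in> V i j"
    using assms(1) by (auto simp: entry_family_def)
  show ?thesis
  proof (cases "finite A")
    case True
    then show ?thesis using assms(2)
    proof (induction A)
      case (insert a A)
      then have "f \<in> A \<rightarrow> carrier R" "f a \<in> carrier R" using V(2) by auto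
      then show ?case using insert V(3) by simp
    qed (simp add: V)
  qed (simp add: V)
qed

lemma entries_in_ser_mult:
  assumes "entry_family V" "entries_in K V M" "entries_in K V L"
  shows "entries_in K V (ser_mult R K M L)"
  unfolding entries_in_def ser_mult_def
proof (intro allI ballI entry_family_finsum[OF assms(1)])
  fix r i j k a assume "i \<in> K" "j \<in> K" "k \<in> K"
  then show "M a i k \<otimes> L (r - a) k j \<in> V i j"
    using assms unfolding entry_family_def entries_in_def by blast
qed

lemma entries_in_cmat: "entry_family V \<Longrightarrow> entries_in K V M \<Longrightarrow> carrier_ser K M"
  unfolding entries_in_def entry_family_def by blast

lemma entries_in_ser_one: "entry_family V \<Longrightarrow> entries_in K V (ser_one R)"
  by (auto simp: entries_in_def ser_one_def ser_const_def entry_family_def)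

lemma ser_mult_closed: "carrier_ser K M \<Longrightarrow> carrier_ser K L \<Longrightarrow> carrier_ser K (ser_mult R K M L)"
  by (rule entries_in_ser_mult[OF entry_family_carrier])

lemma ser_one_closed: "carrier_ser K (ser_one R)"
  by (rule entries_in_ser_one[OF entry_family_carrier])

lemma ser_mult_cong:
  assumes "ser_eq K M M'" "ser_eq K L L'" "carrier_ser K M'" "carrier_ser K L'"
  shows "ser_eq K (ser_mult R K M L) (ser_mult R K M' L')"
  unfolding ser_eq_def
proof (intro allI ballI)
  fix r i j assume ij: "i \<in> K" "j \<in> K"
  show "ser_mult R K M L r i j = ser_mult R K M' L' r i j"
    unfolding ser_mult_def
    by (intro finsum_cong' funcsetI finsum_closed refl)
      (use assms ij in \<open>auto simp: ser_eq_def entries_in_def\<close>)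
qed

lemma ser_mult_pairs:
  assumes "finite K" "carrier_ser K M" "carrier_ser K L" "i \<in> K" "j \<in> K"
  shows "ser_mult R K M L r i j = (\<Oplus>p\<in>K \<times> {..r}. M (snd p) i (fst p) \<otimes> L (r - snd p) (fst p) j)"
  unfolding ser_mult_def by (rule finsum_Sigma) (use assms in \<open>auto simp: entries_in_def\<close>)

lemma ser_mult_assoc:
  assumes K: "finite K" and M: "carrier_ser K M" and L: "carrier_ser K L" and N: "carrier_ser K N"
  shows "ser_eq K (ser_mult R K (ser_mult R K M L) N) (ser_mult R K M (ser_mult R K L N))"
  unfolding ser_eq_def
proof (intro allI ballI)
  fix r i j assume ij: "i \<in> K" "j \<in> K"
  define f where "f b k c l = M b i k \<otimes> L c k l \<otimes> N (r - b - c) l j" for b k c l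
  have f: "f b k c l \<in> carrier R" if "k \<in> K" "l \<in> K" for b k c l
    unfolding f_def using that ij M L N by (auto simp: entries_in_def)
  let ?A = "Sigma (K \<times> {..r}) (\<lambda>p. K \<times> {..snd p})"
  let ?B = "Sigma (K \<times> {..r}) (\<lambda>p. K \<times> {..r - snd p})"
  \<comment> \<open>\<open>b\<close> and \<open>c\<close> are the exponents taken from
    \<open>M\<close> and \<open>L\<close>; the left bracketing sums over the total
    \<open>b + c\<close> first. In both bracketings \<open>N\<close> receives
    \<open>r - b - c\<close>.\<close>
  let ?h = "\<lambda>((k, b), (l, c)). ((l, b + c), (k, b :: nat))"
  have "ser_mult R K (ser_mult R K M L) N r i j =
      (\<Oplus>p\<in>K \<times> {..r}. \<Oplus>q\<in>K \<times> {..snd p}. f (snd q) (fst q) (snd p - snd q) (fst p))"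
    unfolding ser_mult_pairs[OF K ser_mult_closed[OF M L] N ij]
  proof (rule finsum_cong'[OF refl])
    show "(\<lambda>p. \<Oplus>q\<in>K \<times> {..snd p}. f (snd q) (fst q) (snd p - snd q) (fst p)) \<in> K \<times> {..r} \<rightarrow> carrier R"
      using f by (auto intro!: finsum_closed)
    fix p assume p: "p \<in> K \<times> {..r}"
    then obtain l a where la: "p = (l, a)" "l \<in> K" "a \<le> r" by auto
    have Nc: "N (r - a) l j \<in> carrier R" using N la ij by (auto simp: entries_in_def)
    have "ser_mult R K M L a i l \<otimes> N (r - a) l j =
        (\<Oplus>q\<in>K \<times> {..a}. M (snd q) i (fst q) \<otimes> L (a - snd q) (fst q) l \<otimes> N (r - a) l j)"
      unfolding ser_mult_pairs[OF K M L ij(1) la(2)]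
      by (rule finsum_ldistr) (use K Nc M L la ij in \<open>auto simp: entries_in_def\<close>)
    also have "\<dots> = (\<Oplus>q\<in>K \<times> {..a}. f (snd q) (fst q) (a - snd q) l)"
      by (rule finsum_cong'[OF refl]) (use la ij M L Nc in \<open>auto simp: f_def entries_in_def\<close>)
    finally show "ser_mult R K M L (snd p) i (fst p) \<otimes> N (r - snd p) (fst p) j =
        (\<Oplus>q\<in>K \<times> {..snd p}. f (snd q) (fst q) (snd p - snd q) (fst p))"
      by (simp add: la)
  qed
  also have "\<dots> = (\<Oplus>p\<in>?A. f (snd (snd p)) (fst (snd p)) (snd (fst p) - snd (snd p)) (fst (fst p)))"
    by (rule finsum_Sigma) (use K f in auto)
  also have "?A = ?h ` ?B"
  proof
    show "?A \<subseteq> ?h ` ?B"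
    proof
      fix p assume "p \<in> ?A"
      then obtain l a k b where p: "p = ((l, a), (k, b))" "l \<in> K" "k \<in> K" "a \<le> r" "b \<le> a" by auto
      then have "p = ?h ((k, b), (l, a - b))" "((k, b), (l, a - b)) \<in> ?B" by auto
      then show "p \<in> ?h ` ?B" by blast
    qed
  qed auto
  also have "(\<Oplus>p\<in>?h ` ?B. f (snd (snd p)) (fst (snd p)) (snd (fst p) - snd (snd p)) (fst (fst p))) =
      (\<Oplus>p\<in>?B. f (snd (fst p)) (fst (fst p)) (snd (snd p)) (fst (snd p)))"
  proof (subst finsum_reindex)
    show "inj_on ?h ?B" by (auto simp: inj_on_def)
    show "(\<Oplus>x\<in>?B. f (snd (snd (?h x))) (fst (snd (?h x))) (snd (fst (?h x)) - snd (snd (?h x))) (fst (fst (?h x)))) =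
      (\<Oplus>p\<in>?B. f (snd (fst p)) (fst (fst p)) (snd (snd p)) (fst (snd p)))"
      by (rule finsum_cong'[OF refl]) (use f in auto)
  qed (use f in auto)
  also have "\<dots> = (\<Oplus>p\<in>K \<times> {..r}. \<Oplus>q\<in>K \<times> {..r - snd p}. f (snd p) (fst p) (snd q) (fst q))"
    by (rule finsum_Sigma[symmetric]) (use K f in auto)
  also have "\<dots> = ser_mult R K M (ser_mult R K L N) r i j"
    unfolding ser_mult_pairs[OF K M ser_mult_closed[OF L N] ij]
  proof (rule finsum_cong'[OF refl])
    show "(\<lambda>p. M (snd p) i (fst p) \<otimes> ser_mult R K L N (r - snd p) (fst p) j) \<in> K \<times> {..r} \<rightarrow> carrier R"
      using M ser_mult_closed[OF L N] ij by (auto simp: entries_in_def)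
    fix p assume p: "p \<in> K \<times> {..r}"
    then obtain k b where kb: "p = (k, b)" "k \<in> K" "b \<le> r" by auto
    have Mc: "M b i k \<in> carrier R" using M kb ij by (auto simp: entries_in_def)
    have "M b i k \<otimes> ser_mult R K L N (r - b) k j =
        (\<Oplus>q\<in>K \<times> {..r - b}. M b i k \<otimes> (L (snd q) k (fst q) \<otimes> N (r - b - snd q) (fst q) j))"
      unfolding ser_mult_pairs[OF K L N kb(2) ij(2)]
      by (rule finsum_rdistr) (use K Mc N L kb ij in \<open>auto simp: entries_in_def\<close>)
    also have "\<dots> = (\<Oplus>q\<in>K \<times> {..r - b}. f b k (snd q) (fst q))"
      by (rule finsum_cong'[OF refl])
        (use f kb in auto, use kb ij M L N in \<open>auto simp: f_def m_assoc entries_in_def\<close>)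
    finally show "(\<Oplus>q\<in>K \<times> {..r - snd p}. f (snd p) (fst p) (snd q) (fst q)) =
        M (snd p) i (fst p) \<otimes> ser_mult R K L N (r - snd p) (fst p) j"
      by (simp add: kb)
  qed
  finally show "ser_mult R K (ser_mult R K M L) N r i j = ser_mult R K M (ser_mult R K L N) r i j" .
qed

lemma finsum_ser_const_l:
  assumes "i \<in> K" "finite K" "\<And>k. k \<in> K \<Longrightarrow> x k \<in> carrier R"
  shows "(\<Oplus>k\<in>K. (if i = k then \<one> else \<zero>) \<otimes> x k) = x i"
proof -
  have "(\<Oplus>k\<in>K. (if i = k then \<one> else \<zero>) \<otimes> x k) = (\<Oplus>k\<in>K. if i = k then x k else \<zero>)"
    by (rule finsum_cong'[OF refl]) (use assms in auto)
  also have "\<dots> = x i" by (rule add.finprod_singleton) (use assms in auto)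
  finally show ?thesis .
qed

lemma ser_mult_ser_const_l:
  assumes "finite K" "carrier_ser K M" "\<And>i j. i \<in> K \<Longrightarrow> j \<in> K \<Longrightarrow> g i j \<in> carrier R" "i \<in> K" "j \<in> K"
  shows "ser_mult R K (ser_const R g) M r i j = (\<Oplus>k\<in>K. g i k \<otimes> M r k j)"
  unfolding ser_mult_def
proof (rule finsum_cong'[OF refl])
  show "(\<lambda>k. g i k \<otimes> M r k j) \<in> K \<rightarrow> carrier R" using assms by (auto simp: entries_in_def)
  fix k assume k: "k \<in> K"
  have "(\<Oplus>a\<in>{..r}. ser_const R g a i k \<otimes> M (r - a) k j) =
      (\<Oplus>a\<in>{..r}. if 0 = a then g i k \<otimes> M (r - a) k j else \<zero>)"
    by (rule finsum_cong'[OF refl]) (use assms k in \<open>auto simp: entries_in_def ser_const_def\<close>)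
  also have "\<dots> = g i k \<otimes> M (r - 0) k j"
    by (rule add.finprod_singleton) (use assms k in \<open>auto simp: entries_in_def\<close>)
  finally show "(\<Oplus>a\<in>{..r}. ser_const R g a i k \<otimes> M (r - a) k j) = g i k \<otimes> M r k j" by simp
qed

lemma ser_mult_ser_const_r:
  assumes "finite K" "carrier_ser K M" "\<And>i j. i \<in> K \<Longrightarrow> j \<in> K \<Longrightarrow> g i j \<in> carrier R" "i \<in> K" "j \<in> K"
  shows "ser_mult R K M (ser_const R g) r i j = (\<Oplus>k\<in>K. M r i k \<otimes> g k j)"
  unfolding ser_mult_def
proof (rule finsum_cong'[OF refl])
  show "(\<lambda>k. M r i k \<otimes> g k j) \<in> K \<rightarrow> carrier R" using assms by (auto simp: entries_in_def)
  fix k assume k: "k \<in> K"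
  have "(\<Oplus>a\<in>{..r}. M a i k \<otimes> ser_const R g (r - a) k j) =
      (\<Oplus>a\<in>{..r}. if r = a then M a i k \<otimes> g k j else \<zero>)"
    by (rule finsum_cong'[OF refl]) (use assms k in \<open>auto simp: entries_in_def ser_const_def\<close>)
  also have "\<dots> = M r i k \<otimes> g k j"
    by (rule add.finprod_singleton) (use assms k in \<open>auto simp: entries_in_def\<close>)
  finally show "(\<Oplus>a\<in>{..r}. M a i k \<otimes> ser_const R g (r - a) k j) = M r i k \<otimes> g k j" .
qed

lemma ser_mult_ser_one_l: "finite K \<Longrightarrow> carrier_ser K M \<Longrightarrow> ser_eq K (ser_mult R K (ser_one R) M) M"
  unfolding ser_eq_def ser_one_def by (auto simp: ser_mult_ser_const_l finsum_ser_const_l entries_in_def)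

lemma ser_mult_ser_one_r:
  assumes "finite K" "carrier_ser K M"
  shows "ser_eq K (ser_mult R K M (ser_one R)) M"
  unfolding ser_eq_def
proof (intro allI ballI)
  fix r i j assume ij: "i \<in> K" "j \<in> K"
  have "ser_mult R K M (ser_one R) r i j = (\<Oplus>k\<in>K. M r i k \<otimes> (if k = j then \<one> else \<zero>))"
    unfolding ser_one_def by (rule ser_mult_ser_const_r) (use assms ij in auto)
  also have "\<dots> = (\<Oplus>k\<in>K. if j = k then M r i k else \<zero>)"
    by (rule finsum_cong'[OF refl]) (use assms ij in \<open>auto simp: entries_in_def\<close>)
  also have "\<dots> = M r i j"
    by (rule add.finprod_singleton) (use assms ij in \<open>auto simp: entries_in_def\<close>)
  finally show "ser_mult R K M (ser_one R) r i j = M r i j" .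
qed

text \<open>Compare \<open>(L M) N\<close> with \<open>L (M N)\<close>. This later identifies chosen
  inverses, and images of inverses under a homomorphism, with explicit ones.\<close>

lemma ser_mult_inverse_unique:
  assumes K: "finite K" and cl: "carrier_ser K L" "carrier_ser K M" "carrier_ser K N"
    and LM: "ser_eq K (ser_mult R K L M) (ser_one R)" and MN: "ser_eq K (ser_mult R K M N) (ser_one R)"
  shows "ser_eq K L N"
proof -
  have "ser_eq K L (ser_mult R K L (ser_one R))" by (rule ser_eq_sym[OF ser_mult_ser_one_r[OF K cl(1)]])
  also have "ser_eq K \<dots> (ser_mult R K L (ser_mult R K M N))"
    by (rule ser_mult_cong[OF ser_eq_refl ser_eq_sym[OF MN] cl(1) ser_mult_closed[OF cl(2,3)]])
  also have "ser_eq K \<dots> (ser_mult R K (ser_mult R K L M) N)" by (rule ser_eq_sym[OF ser_mult_assoc[OF K cl]])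
  also have "ser_eq K \<dots> (ser_mult R K (ser_one R) N)" by (rule ser_mult_cong[OF LM ser_eq_refl ser_one_closed cl(3)])
  also have "ser_eq K \<dots> N" by (rule ser_mult_ser_one_l[OF K cl(3)])
  finally show ?thesis .
qed

text \<open>The coefficients of \<open>inv_approx K M n\<close> are those of the inverse only up to order \<open>n\<close>.\<close>

primrec inv_approx :: "nat set \<Rightarrow> 'a ser \<Rightarrow> nat \<Rightarrow> 'a ser" where
  "inv_approx K M 0 = ser_one R"
| "inv_approx K M (Suc n) = (inv_approx K M n)
    (Suc n := \<lambda>i j. \<ominus> (\<Oplus>k\<in>K. \<Oplus>a\<in>{1..Suc n}. M a i k \<otimes> inv_approx K M n (Suc n - a) k j))"

lemma inv_approx_eq: "r \<le> n \<Longrightarrow> inv_approx K M n r = inv_approx K M r r"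
  by (induction n) (auto simp: le_Suc_eq)

lemma inv_approx_in:
  assumes V: "entry_family V" and M: "entries_in K V M"
  shows "entries_in K V (inv_approx K M n)"
proof (induction n)
  case (Suc n)
  have "(\<Oplus>k\<in>K. \<Oplus>a\<in>{1..Suc n}. M a i k \<otimes> inv_approx K M n (Suc n - a) k j) \<in> V i j"
    if "i \<in> K" "j \<in> K" for i j
    by (intro entry_family_finsum[OF V])
      (use that V M Suc in \<open>unfold entries_in_def entry_family_def, blast\<close>)
  then show ?case using Suc V by (auto simp: entries_in_def entry_family_def)
qed (simp add: entries_in_ser_one[OF V])

text \<open>As the constant term is 1, the equation at order \<open>r > 0\<close> determines
  \<open>L r\<close> from the earlier coefficients: it is minus the sum of the products of
  \<open>M a\<close> with \<open>L (r - a)\<close> over \<open>a \<ge> 1\<close>.\<close>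

lemma right_inverse_exists:
  assumes K: "finite K" and V: "entry_family V" and M: "entries_in K V M"
    and M0: "\<And>i j. i \<in> K \<Longrightarrow> j \<in> K \<Longrightarrow> M 0 i j = ser_one R 0 i j"
  shows "\<exists>L. entries_in K V L \<and> (\<forall>i\<in>K. \<forall>j\<in>K. L 0 i j = ser_one R 0 i j) \<and> ser_eq K (ser_mult R K M L) (ser_one R)"
proof (intro exI conjI)
  \<comment> \<open>The diagonal of the approximations: coefficient \<open>r\<close> is final from
    stage \<open>r\<close> on.\<close>
  define L where "L = (\<lambda>r. inv_approx K M r r)"
  show L: "entries_in K V L"
    using inv_approx_in[OF V M] by (auto simp: entries_in_def L_def)
  show "\<forall>i\<in>K. \<forall>j\<in>K. L 0 i j = ser_one R 0 i j" by (simp add: L_def)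
  note cl = carrier_serD[OF entries_in_cmat[OF V M]] carrier_serD[OF entries_in_cmat[OF V L]]
  show "ser_eq K (ser_mult R K M L) (ser_one R)"
    unfolding ser_eq_def
  proof (intro allI ballI)
    fix r i j assume ij: "i \<in> K" "j \<in> K"
    have in1: "(\<Oplus>k\<in>K. M 0 i k \<otimes> L r k j) = L r i j"
    proof -
      have "(\<Oplus>k\<in>K. M 0 i k \<otimes> L r k j) = (\<Oplus>k\<in>K. (if i = k then \<one> else \<zero>) \<otimes> L r k j)"
        by (rule finsum_cong'[OF refl]) (use ij cl M0 in \<open>auto simp: ser_one_def ser_const_def\<close>)
      also have "\<dots> = L r i j" by (rule finsum_ser_const_l) (use ij cl K in auto)
      finally show ?thesis .
    qed
    show "ser_mult R K M L r i j = ser_one R r i j"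
    proof (cases r)
      case 0
      have "ser_mult R K M L r i j = (\<Oplus>k\<in>K. M 0 i k \<otimes> L r k j)"
        unfolding ser_mult_def 0 by (rule finsum_cong'[OF refl]) (use cl ij in auto)
      then show ?thesis unfolding in1 by (simp add: 0 L_def)
    next
      case (Suc n)
      let ?X = "\<lambda>k. \<Oplus>a\<in>{1..Suc n}. M a i k \<otimes> L (Suc n - a) k j"
      have X: "?X k \<in> carrier R" if "k \<in> K" for k
        using cl ij that by (auto intro!: finsum_closed)
      have "ser_mult R K M L r i j = (\<Oplus>k\<in>K. M 0 i k \<otimes> L r k j \<oplus> ?X k)"
        unfolding ser_mult_def
      proof (rule finsum_cong'[OF refl])
        show "(\<lambda>k. M 0 i k \<otimes> L r k j \<oplus> ?X k) \<in> K \<rightarrow> carrier R" using cl ij X by auto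
        fix k assume k: "k \<in> K"
        have "{..r} = insert 0 {1..Suc n}" using Suc by auto
        then show "(\<Oplus>a\<in>{..r}. M a i k \<otimes> L (r - a) k j) = M 0 i k \<otimes> L r k j \<oplus> ?X k"
          using cl ij k Suc by (simp only: Suc) (subst finsum_insert, auto)
      qed
      also have "\<dots> = (\<Oplus>k\<in>K. M 0 i k \<otimes> L r k j) \<oplus> (\<Oplus>k\<in>K. ?X k)"
        by (rule finsum_addf) (use cl ij X in auto)
      also have "(\<Oplus>k\<in>K. M 0 i k \<otimes> L r k j) = L r i j" by (rule in1)
      also have "L r i j = \<ominus> (\<Oplus>k\<in>K. ?X k)"
      proof -
        have "(\<Oplus>k\<in>K. \<Oplus>a\<in>{1..Suc n}. M a i k \<otimes> inv_approx K M n (Suc n - a) k j) = (\<Oplus>k\<in>K. ?X k)"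
        proof (intro finsum_cong'[OF refl])
          fix k a assume "k \<in> K" "a \<in> {1..Suc n}"
          then show "M a i k \<otimes> inv_approx K M n (Suc n - a) k j = M a i k \<otimes> L (Suc n - a) k j"
            using inv_approx_eq[of "Suc n - a" n K M] by (auto simp: L_def)
        qed (use cl ij X in auto)
        then show ?thesis by (simp add: L_def Suc)
      qed
      also have "\<ominus> (\<Oplus>k\<in>K. ?X k) \<oplus> (\<Oplus>k\<in>K. ?X k) = \<zero>"
        using X by (intro l_neg finsum_closed) auto
      finally show ?thesis by (simp add: Suc ser_one_def ser_const_def)
    qed
  qed
qed

definition is_inv :: "nat set \<Rightarrow> 'a ser \<Rightarrow> 'a ser \<Rightarrow> bool" where
  "is_inv K M L \<longleftrightarrow> ser_eq K (ser_mult R K M L) (ser_one R) \<and> ser_eq K (ser_mult R K L M) (ser_one R)"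

text \<open>The right inverse \<open>L\<close> again has constant term 1, so it has a right inverse
  \<open>N\<close> itself. Then \<open>M\<close> and \<open>N\<close> are a left and a right inverse
  of \<open>L\<close> and coincide.\<close>

lemma unit_inverse_exists:
  assumes K: "finite K" and V: "entry_family V" and M: "entries_in K V M"
    and M0: "\<And>i j. i \<in> K \<Longrightarrow> j \<in> K \<Longrightarrow> M 0 i j = ser_one R 0 i j"
  shows "\<exists>L. entries_in K V L \<and> is_inv K M L"
proof -
  obtain L where L: "entries_in K V L" "\<forall>i\<in>K. \<forall>j\<in>K. L 0 i j = ser_one R 0 i j" "ser_eq K (ser_mult R K M L) (ser_one R)"
    using right_inverse_exists[OF assms] by blast
  obtain N where N: "entries_in K V N" "ser_eq K (ser_mult R K L N) (ser_one R)"
    using right_inverse_exists[OF K V L(1)] L(2) by blast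
  note cl = entries_in_cmat[OF V M] entries_in_cmat[OF V L(1)] entries_in_cmat[OF V N(1)]
  have "ser_eq K M N" by (rule ser_mult_inverse_unique[OF K cl L(3) N(2)])
  then have "ser_eq K (ser_mult R K L M) (ser_mult R K L N)" by (rule ser_mult_cong[OF ser_eq_refl _ cl(2,3)])
  from ser_eq_trans[OF this N(2)] show ?thesis using L by (auto simp: is_inv_def)
qed

lemma is_inv_prod:
  assumes K: "finite K" and cl: "carrier_ser K M" "carrier_ser K M'" "carrier_ser K N" "carrier_ser K N'"
    and i: "is_inv K M M'" "is_inv K N N'"
  shows "ser_eq K (ser_mult R K (ser_mult R K M N) (ser_mult R K N' M')) (ser_one R)"
proof -
  note c = ser_mult_closed[OF cl(1,3)] ser_mult_closed[OF cl(4,2)] ser_mult_closed[OF cl(3,4)]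
  have "ser_eq K (ser_mult R K (ser_mult R K M N) (ser_mult R K N' M')) (ser_mult R K M (ser_mult R K N (ser_mult R K N' M')))"
    by (rule ser_mult_assoc[OF K cl(1,3) c(2)])
  also have "ser_eq K \<dots> (ser_mult R K M (ser_mult R K (ser_mult R K N N') M'))"
    by (rule ser_mult_cong[OF ser_eq_refl ser_eq_sym[OF ser_mult_assoc[OF K cl(3,4,2)]] cl(1) ser_mult_closed[OF c(3) cl(2)]])
  also have "ser_eq K \<dots> (ser_mult R K M (ser_mult R K (ser_one R) M'))"
    by (rule ser_mult_cong[OF ser_eq_refl ser_mult_cong[OF _ ser_eq_refl ser_one_closed cl(2)] cl(1) ser_mult_closed[OF ser_one_closed cl(2)]])
      (use i in \<open>simp add: is_inv_def\<close>)
  also have "ser_eq K \<dots> (ser_mult R K M M')"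
    by (rule ser_mult_cong[OF ser_eq_refl ser_mult_ser_one_l[OF K cl(2)] cl(1,2)])
  also have "ser_eq K \<dots> (ser_one R)" using i by (simp add: is_inv_def)
  finally show ?thesis .
qed

lemma is_inv_sym: "is_inv K M L \<Longrightarrow> is_inv K L M"
  by (simp add: is_inv_def)

lemma is_inv_mult:
  assumes K: "finite K" and cl: "carrier_ser K M" "carrier_ser K M'" "carrier_ser K N" "carrier_ser K N'"
    and i: "is_inv K M M'" "is_inv K N N'"
  shows "is_inv K (ser_mult R K M N) (ser_mult R K N' M')"
  using is_inv_prod[OF K cl i] is_inv_prod[OF K cl(4,3,2,1) is_inv_sym[OF i(2)] is_inv_sym[OF i(1)]]
  by (simp add: is_inv_def)

lemma is_inv_cong:
  assumes "is_inv K M L" "ser_eq K M N" "carrier_ser K M" "carrier_ser K N" "carrier_ser K L"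
  shows "is_inv K N L"
  using assms ser_mult_cong[OF ser_eq_sym[OF assms(2)] ser_eq_refl assms(3,5)]
    ser_mult_cong[OF ser_eq_refl ser_eq_sym[OF assms(2)] assms(5,3)] ser_eq_trans
  unfolding is_inv_def by blast

text \<open>Normalisation: with \<open>N\<close> inverse to the constant term \<open>M 0\<close>,
  the product \<open>U = N M\<close> has constant term 1 and an inverse \<open>L\<close>, and
  \<open>M = (M 0) U\<close> has the inverse \<open>L N\<close>.\<close>

lemma inverse_exists:
  assumes K: "finite K" and V: "entry_family V" and M: "entries_in K V M" and N: "entries_in K V (ser_const R N)"
    and inv: "\<And>i j. i \<in> K \<Longrightarrow> j \<in> K \<Longrightarrow> (\<Oplus>k\<in>K. N i k \<otimes> M 0 k j) = ser_one R 0 i j"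
      "\<And>i j. i \<in> K \<Longrightarrow> j \<in> K \<Longrightarrow> (\<Oplus>k\<in>K. M 0 i k \<otimes> N k j) = ser_one R 0 i j"
  shows "\<exists>L. entries_in K V L \<and> is_inv K M L"
proof -
  let ?N = "ser_const R N" and ?M0 = "ser_const R (M 0)"
  let ?U = "ser_mult R K ?N M"
  have M0: "entries_in K V ?M0" using M V by (auto simp: entries_in_def ser_const_def entry_family_def)
  have U: "entries_in K V ?U" by (rule entries_in_ser_mult[OF V N M])
  note cl = entries_in_cmat[OF V M] entries_in_cmat[OF V N] entries_in_cmat[OF V M0] entries_in_cmat[OF V U]
  have Nc: "N i j \<in> carrier R" if "i \<in> K" "j \<in> K" for i j
    using carrier_serD[OF cl(2) that, of 0] by (simp add: ser_const_def)
  note Mc = carrier_serD[OF cl(1)]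
  have "?U 0 i j = ser_one R 0 i j" if "i \<in> K" "j \<in> K" for i j
    using inv(1)[OF that] ser_mult_ser_const_l[OF K cl(1), of N i j 0] Nc that by simp
  then obtain L where L: "entries_in K V L" "is_inv K ?U L"
    using unit_inverse_exists[OF K V U] by blast
  have c: "ser_eq K (ser_mult R K ?N ?M0) (ser_one R)" "ser_eq K (ser_mult R K ?M0 ?N) (ser_one R)"
  proof -
    show "ser_eq K (ser_mult R K ?N ?M0) (ser_one R)"
      unfolding ser_eq_def
    proof (intro allI ballI)
      fix r i j assume ij: "i \<in> K" "j \<in> K"
      have z: "(\<Oplus>k\<in>K. N i k \<otimes> ?M0 r k j) = (\<Oplus>k\<in>K. \<zero>)" if "r \<noteq> 0"
        by (rule finsum_cong'[OF refl]) (use that ij Nc in \<open>auto simp: ser_const_def\<close>)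
      have "ser_mult R K ?N ?M0 r i j = (\<Oplus>k\<in>K. N i k \<otimes> ?M0 r k j)"
        by (rule ser_mult_ser_const_l) (use K cl Nc ij in auto)
      also have "\<dots> = ser_one R r i j"
        using inv(1)[OF ij] z by (cases "r = 0") (simp_all add: ser_const_def ser_one_def)
      finally show "ser_mult R K ?N ?M0 r i j = ser_one R r i j" .
    qed
    show "ser_eq K (ser_mult R K ?M0 ?N) (ser_one R)"
      unfolding ser_eq_def
    proof (intro allI ballI)
      fix r i j assume ij: "i \<in> K" "j \<in> K"
      have z: "(\<Oplus>k\<in>K. M 0 i k \<otimes> ?N r k j) = (\<Oplus>k\<in>K. \<zero>)" if "r \<noteq> 0"
        by (rule finsum_cong'[OF refl]) (use that ij Mc in \<open>auto simp: ser_const_def\<close>)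
      have "ser_mult R K ?M0 ?N r i j = (\<Oplus>k\<in>K. M 0 i k \<otimes> ?N r k j)"
        by (rule ser_mult_ser_const_l) (use K cl Mc ij in auto)
      also have "\<dots> = ser_one R r i j"
        using inv(2)[OF ij] z by (cases "r = 0") (simp_all add: ser_const_def ser_one_def)
      finally show "ser_mult R K ?M0 ?N r i j = ser_one R r i j" .
    qed
  qed
  have "is_inv K (ser_mult R K ?M0 ?U) (ser_mult R K L ?N)"
    by (rule is_inv_mult[OF K cl(3,2,4) entries_in_cmat[OF V L(1)]]) (use c L in \<open>auto simp: is_inv_def\<close>)
  moreover have "ser_eq K (ser_mult R K ?M0 ?U) M"
  proof -
    have "ser_eq K (ser_mult R K ?M0 ?U) (ser_mult R K (ser_mult R K ?M0 ?N) M)"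
      by (rule ser_eq_sym[OF ser_mult_assoc[OF K cl(3,2,1)]])
    also have "ser_eq K \<dots> (ser_mult R K (ser_one R) M)" by (rule ser_mult_cong[OF c(2) ser_eq_refl ser_one_closed cl(1)])
    also have "ser_eq K \<dots> M" by (rule ser_mult_ser_one_l[OF K cl(1)])
    finally show ?thesis .
  qed
  ultimately have "is_inv K M (ser_mult R K L ?N)"
    using is_inv_cong ser_mult_closed entries_in_cmat[OF V L(1)] cl by blast
  then show ?thesis using entries_in_ser_mult[OF V L(1) N] by blast
qed

end

section \<open>Algebras with a triangular decomposition\<close>

text \<open>
  The abstract situation of the double Yangian: \<open>D 0\<close> is the positive half with its filtration,
  \<open>Y\<close> the other half, and an element of \<open>Y\<close> moves past the filtration at the cost of a bounded
  shift and with only finitely many elements of \<open>Y\<close> appearing on the right.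
\<close>

locale triangular = superalgebra A for A :: "'a superalg" (structure) +
  fixes D :: "nat \<Rightarrow> 'a set" and Y :: "'a set"
  assumes D_sub: "subspace (D p)"
    and D_Suc: "D (Suc p) \<subseteq> D p"
    and D_graded: "graded (D p)"
    and D_mult: "x \<in> D p \<Longrightarrow> y \<in> D q \<Longrightarrow> x \<otimes> y \<in> D (p + q)"
    and D_one: "\<one> \<in> D 0"
    and Y_subalg: "subalgebra Y"
    and Y_graded: "graded Y"
    and reorder: "y \<in> Y \<Longrightarrow> \<exists>R Z. finite Z \<and> Z \<subseteq> Y \<and>
      (\<forall>p. \<forall>x\<in>D p. y \<otimes> x \<in> lspan A {c \<otimes> z | c z. c \<in> D (p - R) \<and> z \<in> Z})"
    and generated: "subalgebra V \<Longrightarrow> D 0 \<subseteq> V \<Longrightarrow> Y \<subseteq> V \<Longrightarrow> carrier A \<subseteq> V"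
begin

definition Fil :: "nat \<Rightarrow> 'a set" where
  "Fil p = lspan A {x \<otimes> y | x y. x \<in> D p \<and> y \<in> Y}"

lemma D_mono: "p \<le> q \<Longrightarrow> D q \<subseteq> D p"
  by (rule lift_Suc_antimono_le[of D]) (use D_Suc in auto)

lemma D_carrier: "x \<in> D p \<Longrightarrow> x \<in> carrier A"
  using subspaceD(1)[OF D_sub] .

lemma Y_props: "subspace Y" "\<one> \<in> Y" "x \<in> Y \<Longrightarrow> y \<in> Y \<Longrightarrow> x \<otimes> y \<in> Y"
  using Y_subalg by (auto simp: subalgebra_def)

lemma Y_carrier: "y \<in> Y \<Longrightarrow> y \<in> carrier A"
  using subspaceD(1)[OF Y_props(1)] .

lemma DY_gens: "{x \<otimes> y | x y. x \<in> D p \<and> y \<in> Y} \<subseteq> carrier A"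
  using D_carrier Y_carrier by blast

lemma Fil_sub: "subspace (Fil p)"
  unfolding Fil_def by (rule lspan_subspace[OF DY_gens])

lemma Fil_prod: "x \<in> D p \<Longrightarrow> y \<in> Y \<Longrightarrow> x \<otimes> y \<in> Fil p"
  unfolding Fil_def by (rule lspan.incl) blast

lemma D_Fil: "D p \<subseteq> Fil p"
proof
  fix x assume x: "x \<in> D p"
  show "x \<in> Fil p" using Fil_prod[OF x Y_props(2)] D_carrier[OF x] by simp
qed

lemma Fil_least:
  assumes "subspace V" "\<And>x y. x \<in> D p \<Longrightarrow> y \<in> Y \<Longrightarrow> x \<otimes> y \<in> V"
  shows "Fil p \<subseteq> V"
  unfolding Fil_def by (rule lspan_least[OF assms(1)]) (use assms(2) in blast)

text \<open>The degree loss \<open>R\<close> depends on \<open>y\<close> alone. With truncated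
  subtraction the bound never drops below \<open>p\<close>, the degree contributed by
  \<open>x\<close>; this is what makes the terms right ideals.\<close>

lemma Fil_mult_aux:
  assumes "y \<in> Y"
  shows "\<exists>R. \<forall>p q. \<forall>x\<in>D p. \<forall>x'\<in>D q. \<forall>y'\<in>Y. (x \<otimes> y) \<otimes> (x' \<otimes> y') \<in> Fil (p + (q - R))"
proof -
  obtain R Z where RZ: "finite Z" "Z \<subseteq> Y"
    "\<And>p x. x \<in> D p \<Longrightarrow> y \<otimes> x \<in> lspan A {c \<otimes> z | c z. c \<in> D (p - R) \<and> z \<in> Z}"
    using reorder[OF assms] by blast
  have "(x \<otimes> y) \<otimes> (x' \<otimes> y') \<in> Fil (p + (q - R))"
    if x: "x \<in> D p" and x': "x' \<in> D q" and y': "y' \<in> Y" for p q x x' y'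
  proof -
    note cl = D_carrier[OF x] D_carrier[OF x'] Y_carrier[OF y'] Y_carrier[OF assms]
    let ?V = "{w \<in> carrier A. x \<otimes> w \<otimes> y' \<in> Fil (p + (q - R))}"
    have V: "subspace ?V"
      using subspaceD[OF Fil_sub] cl
      by (auto simp: subspace_def distr_l distr_r scal_mult_l scal_mult_r)
    have "lspan A {c \<otimes> z | c z. c \<in> D (q - R) \<and> z \<in> Z} \<subseteq> ?V"
    proof (rule lspan_least[OF V], safe)
      fix c z assume cz: "c \<in> D (q - R)" "z \<in> Z"
      then have z: "z \<in> Y" using RZ(2) by auto
      note cl' = D_carrier[OF cz(1)] Y_carrier[OF z]
      show "c \<otimes> z \<in> carrier A" using cl' by simp
      have "x \<otimes> (c \<otimes> z) \<otimes> y' = (x \<otimes> c) \<otimes> (z \<otimes> y')" using cl cl' by (simp add: m_assoc)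
      also have "\<dots> \<in> Fil (p + (q - R))" by (intro Fil_prod D_mult x cz Y_props z y')
      finally show "x \<otimes> (c \<otimes> z) \<otimes> y' \<in> Fil (p + (q - R))" .
    qed
    then have "x \<otimes> (y \<otimes> x') \<otimes> y' \<in> Fil (p + (q - R))" using RZ(3)[OF x'] by auto
    then show ?thesis using cl by (simp add: m_assoc)
  qed
  then show ?thesis by blast
qed

lemma Fil_mono: "p \<le> q \<Longrightarrow> Fil q \<subseteq> Fil p"
  by (rule Fil_least[OF Fil_sub]) (use D_mono Fil_prod in blast)

lemma Fil_mult_0:
  assumes "u \<in> Fil p" "v \<in> Fil 0"
  shows "u \<otimes> v \<in> Fil p"
proof (rule lspan_mult[OF DY_gens DY_gens Fil_sub _ assms[unfolded Fil_def]])
  fix u v assume "u \<in> {x \<otimes> y | x y. x \<in> D p \<and> y \<in> Y}" "v \<in> {x \<otimes> y | x y. x \<in> D 0 \<and> y \<in> Y}"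
  then show "u \<otimes> v \<in> Fil p" using Fil_mult_aux by fastforce
qed

text \<open>The products with the factor from \<open>D 0\<close> on the left span a subalgebra, by
  \<open>Fil_mult_0\<close>, and it contains both halves.\<close>

lemma Fil_0: "Fil 0 = carrier A"
proof
  show "Fil 0 \<subseteq> carrier A" using subspaceD(1)[OF Fil_sub] by auto
  show "carrier A \<subseteq> Fil 0"
  proof (rule generated)
    have "\<one> \<in> Fil 0" using D_Fil D_one by auto
    then show "subalgebra (Fil 0)" using Fil_sub Fil_mult_0 by (auto simp: subalgebra_def)
    show "D 0 \<subseteq> Fil 0" by (rule D_Fil)
    show "Y \<subseteq> Fil 0"
    proof
      fix y assume y: "y \<in> Y"
      show "y \<in> Fil 0" using Fil_prod[OF D_one y] Y_carrier[OF y] by simp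
    qed
  qed
qed

lemma graded_prod:
  assumes "graded V" "graded W" "subspace U" "\<And>x y. x \<in> V \<Longrightarrow> y \<in> W \<Longrightarrow> x \<otimes> y \<in> U"
    and "V \<subseteq> carrier A" "W \<subseteq> carrier A" "x \<in> V" "y \<in> W" "p < 2"
  shows "homog A p (x \<otimes> y) \<in> U"
proof -
  have "homog A q x \<in> V" "homog A q y \<in> W" if "q < 2" for q
    using assms that by (auto simp: graded_def)
  moreover have "x \<in> carrier A" "y \<in> carrier A" using assms by auto
  ultimately show ?thesis
    using \<open>p < 2\<close> assms(4) subspaceD(3)[OF assms(3)]
    by (auto simp: less_2_cases_iff homog_prod)
qed

lemma filtered_Fil: "filtered_superalgebra A Fil"
proof unfold_locales
  fix p
  show "subspace (Fil p)" by (rule Fil_sub)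
  show "Fil (Suc p) \<subseteq> Fil p" by (rule Fil_mono) simp
  show "graded (Fil p)"
    unfolding graded_def
  proof (intro allI impI ballI)
    fix r x assume r: "r < (2::nat)" and x: "x \<in> Fil p"
    have "homog A r (x \<otimes> y) \<in> Fil p" if "x \<in> D p" "y \<in> Y" for x y
      by (rule graded_prod[OF D_graded Y_graded Fil_sub Fil_prod])
        (use that r D_carrier Y_carrier in auto)
    then have "Fil p \<subseteq> {x \<in> carrier A. homog A r x \<in> Fil p}"
      using D_carrier Y_carrier by (intro Fil_least subspace_homog Fil_sub r) auto
    then show "homog A r x \<in> Fil p" using x by auto
  qed
  show "x \<otimes> y \<in> Fil p" if "x \<in> Fil p" "y \<in> carrier A" for x y
    using Fil_mult_0 that by (simp add: Fil_0)
  show "\<exists>q. \<forall>x\<in>Fil q. y \<otimes> x \<in> Fil p" if "y \<in> carrier A" for y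
  proof -
    let ?V = "{y \<in> carrier A. \<exists>q. \<forall>x\<in>Fil q. y \<otimes> x \<in> Fil p}"
    have Fc: "x \<in> carrier A" if "x \<in> Fil q" for x q using subspaceD(1)[OF Fil_sub that] .
    have "Fil 0 \<subseteq> ?V"
    proof (rule Fil_least)
      show "subspace ?V"
        unfolding subspace_def
      proof (intro conjI ballI allI)
        show "\<zero> \<in> ?V" using Fc subspaceD(2)[OF Fil_sub] by auto
        fix x y assume "x \<in> ?V" "y \<in> ?V"
        then obtain i j where ij: "x \<in> carrier A" "y \<in> carrier A"
          "\<forall>z\<in>Fil i. x \<otimes> z \<in> Fil p" "\<forall>z\<in>Fil j. y \<otimes> z \<in> Fil p" by auto
        have "Fil (max i j) \<subseteq> Fil i" "Fil (max i j) \<subseteq> Fil j" by (auto intro!: Fil_mono)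
        then have "\<forall>z\<in>Fil (max i j). (x \<oplus> y) \<otimes> z \<in> Fil p"
          using ij Fc by (auto simp: distr_r intro!: subspaceD(3)[OF Fil_sub])
        then show "x \<oplus> y \<in> ?V" using ij by auto
        fix c
        have "\<forall>z\<in>Fil i. scal A c x \<otimes> z \<in> Fil p"
          using ij Fc by (auto simp: scal_mult_l intro!: subspaceD(4)[OF Fil_sub])
        then show "scal A c x \<in> ?V" using ij by auto
      qed auto
      fix x y assume xy: "x \<in> D 0" "y \<in> Y"
      obtain R where R: "\<forall>p q. \<forall>x\<in>D p. \<forall>x'\<in>D q. \<forall>y'\<in>Y. (x \<otimes> y) \<otimes> (x' \<otimes> y') \<in> Fil (p + (q - R))"
        using Fil_mult_aux[OF xy(2)] by blast
      have xyc: "x \<otimes> y \<in> carrier A" using xy D_carrier Y_carrier by auto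
      \<comment> \<open>Starting \<open>R\<close> degrees higher compensates the loss:
        \<open>0 + ((p + R) - R) = p\<close>.\<close>
      have "(x \<otimes> y) \<otimes> (x' \<otimes> y') \<in> Fil p" if "x' \<in> D (p + R)" "y' \<in> Y" for x' y'
        using R xy(1) that by fastforce
      then have "Fil (p + R) \<subseteq> {z \<in> carrier A. (x \<otimes> y) \<otimes> z \<in> Fil p}"
        using D_carrier Y_carrier
        by (intro Fil_least subspace_mult_l[OF Fil_sub xyc]) auto
      then show "x \<otimes> y \<in> ?V" using xyc by blast
    qed
    then show ?thesis using that by (auto simp: Fil_0)
  qed
qed

sublocale tensor_square A Fil
  by (intro tensor_square.intro filtered_Fil tensor_square_axioms.intro Fil_0)

text \<open>Over a finite \<open>Z\<close> the terms with the same right factor can be collected.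
  All elements of the span are thus described by coefficient families on one index set, whose
  convergence can be discussed entry by entry.\<close>

lemma lspan_coeffs:
  assumes "finite Z" "Z \<subseteq> carrier A" "subspace V" "x \<in> lspan A {c \<otimes> z | c z. c \<in> V \<and> z \<in> Z}"
  shows "\<exists>f. (\<forall>z\<in>Z. f z \<in> V) \<and> x = (\<Oplus>z\<in>Z. f z \<otimes> z)"
proof -
  let ?W = "{x. \<exists>f. (\<forall>z\<in>Z. f z \<in> V) \<and> x = (\<Oplus>z\<in>Z. f z \<otimes> z)}"
  note V = subspaceD[OF assms(3)]
  have "subspace ?W"
    unfolding subspace_def
  proof (intro conjI ballI allI)
    show "?W \<subseteq> carrier A" using V assms by (auto intro!: finsum_closed)
    have "\<zero> = (\<Oplus>z\<in>Z. \<zero> \<otimes> z)"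
    proof -
      have "(\<Oplus>z\<in>Z. \<zero> \<otimes> z) = (\<Oplus>z\<in>Z. \<zero>)" by (rule finsum_cong'[OF refl]) (use assms in auto)
      then show ?thesis by simp
    qed
    then show "\<zero> \<in> ?W" using V(2) by (intro CollectI exI[of _ "\<lambda>z. \<zero>"] conjI ballI)
    fix x y assume "x \<in> ?W" "y \<in> ?W"
    then obtain f g where fg: "\<forall>z\<in>Z. f z \<in> V" "x = (\<Oplus>z\<in>Z. f z \<otimes> z)"
      "\<forall>z\<in>Z. g z \<in> V" "y = (\<Oplus>z\<in>Z. g z \<otimes> z)" by auto
    have "x \<oplus> y = (\<Oplus>z\<in>Z. f z \<otimes> z \<oplus> g z \<otimes> z)"
      unfolding fg(2,4) by (rule finsum_addf[symmetric]) (use fg V assms in auto)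
    also have "\<dots> = (\<Oplus>z\<in>Z. (f z \<oplus> g z) \<otimes> z)"
      by (rule finsum_cong'[OF refl]) (use fg V assms in \<open>auto simp: distr_r subset_iff\<close>)
    finally show "x \<oplus> y \<in> ?W"
      using fg V(3) by (intro CollectI exI[of _ "\<lambda>z. f z \<oplus> g z"] conjI ballI) simp_all
    fix c
    have "scal A c \<one> \<otimes> x = (\<Oplus>z\<in>Z. scal A c \<one> \<otimes> (f z \<otimes> z))"
      unfolding fg(2) by (rule finsum_rdistr) (use fg V assms in auto)
    also have "\<dots> = (\<Oplus>z\<in>Z. scal A c (f z) \<otimes> z)"
      by (rule finsum_cong'[OF refl]) (use fg V assms in \<open>auto simp: scal_mult_l subset_iff\<close>)
    also have "scal A c \<one> \<otimes> x = scal A c x"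
    proof -
      have "x \<in> carrier A" unfolding fg(2) by (rule finsum_closed) (use fg V assms in auto)
      then show ?thesis by (simp add: scal_mult_l)
    qed
    finally show "scal A c x \<in> ?W"
      using fg V(4) by (intro CollectI exI[of _ "\<lambda>z. scal A c (f z)"] conjI ballI) simp_all
  qed
  moreover have "{c \<otimes> z | c z. c \<in> V \<and> z \<in> Z} \<subseteq> ?W"
  proof safe
    fix c z assume cz: "c \<in> V" "z \<in> Z"
    have "(\<Oplus>w\<in>Z. (if z = w then c else \<zero>) \<otimes> w) = (\<Oplus>w\<in>Z. if z = w then c \<otimes> w else \<zero>)"
      by (rule finsum_cong'[OF refl]) (use cz V assms in auto)
    also have "\<dots> = c \<otimes> z"
      by (rule add.finprod_singleton) (use cz V assms in auto)
    finally show "\<exists>f. (\<forall>z\<in>Z. f z \<in> V) \<and> c \<otimes> z = (\<Oplus>z\<in>Z. f z \<otimes> z)"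
      using cz V by (intro exI[of _ "\<lambda>w. if z = w then c else \<zero>"]) auto
  qed
  ultimately show ?thesis using lspan_least assms(4) by blast
qed

text \<open>These sequences represent the completion of \<open>D 0\<close> for its own filtration;
  as \<open>D p\<close> lies in \<open>Fil p\<close>, they are also Cauchy in the whole
  algebra.\<close>

definition cauchyD :: "(nat \<Rightarrow> 'a) \<Rightarrow> bool" where
  "cauchyD s \<longleftrightarrow> (\<forall>k. s k \<in> D 0) \<and> (\<forall>p. \<exists>K. \<forall>k\<ge>K. \<forall>l\<ge>K. s k \<ominus> s l \<in> D p)"

lemma cauchyD_cauchy:
  assumes "cauchyD s"
  shows "s \<in> cauchy_seqs A Fil"
proof (rule cauchyI)
  show "s k \<in> carrier A" for k using assms D_carrier unfolding cauchyD_def by metis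
  show "\<exists>K. \<forall>k\<ge>K. \<forall>l\<ge>K. s k \<ominus> s l \<in> Fil p" for p
    using assms D_Fil[of p] unfolding cauchyD_def by (metis subsetD)
qed

lemma cauchyD_mult:
  assumes s: "cauchyD s" and t: "cauchyD t"
  shows "cauchyD (\<lambda>k. s k \<otimes> t k)"
  unfolding cauchyD_def
proof (intro conjI allI)
  have st: "s k \<in> D 0" "t k \<in> D 0" for k using s t by (auto simp: cauchyD_def)
  then have stc: "s k \<in> carrier A" "t k \<in> carrier A" for k using D_carrier by blast+
  show "s k \<otimes> t k \<in> D 0" for k using st D_mult[OF st(1) st(2), of k k] by simp
  fix p
  obtain K L where KL: "\<forall>k\<ge>K. \<forall>l\<ge>K. s k \<ominus> s l \<in> D p" "\<forall>k\<ge>L. \<forall>l\<ge>L. t k \<ominus> t l \<in> D p"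
    using s t unfolding cauchyD_def by metis
  have "s k \<otimes> t k \<ominus> s l \<otimes> t l \<in> D p" if "k \<ge> max K L" "l \<ge> max K L" for k l
  proof -
    have "s k \<otimes> t k \<ominus> s l \<otimes> t l = (s k \<ominus> s l) \<otimes> t k \<oplus> s l \<otimes> (t k \<ominus> t l)"
      using stc by (simp add: minus_distr_l minus_distr_r minus_telescope)
    also have "\<dots> \<in> D p"
      using D_mult[of "s k \<ominus> s l" p "t k" 0] D_mult[of "s l" 0 "t k \<ominus> t l" p] KL that st
      by (intro subspaceD(3)[OF D_sub]) auto
    finally show ?thesis .
  qed
  then show "\<exists>K. \<forall>k\<ge>K. \<forall>l\<ge>K. s k \<otimes> t k \<ominus> s l \<otimes> t l \<in> D p" by blast
qed

lemma add_minus_cancel: "x \<in> carrier A \<Longrightarrow> y \<in> carrier A \<Longrightarrow> (x \<oplus> y) \<ominus> x = y"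
  by (simp add: minus_eq a_comm[of x y] a_assoc r_neg)

lemma add_minus: "x \<in> carrier A \<Longrightarrow> y \<in> carrier A \<Longrightarrow> x \<oplus> (y \<ominus> x) = y"
  by (simp add: minus_eq a_comm[of y] r_neg2)

lemma cauchyD_const: "x \<in> D 0 \<Longrightarrow> cauchyD (\<lambda>k. x)"
  unfolding cauchyD_def using subspaceD(6)[OF D_sub] subspaceD(2)[OF D_sub] D_carrier
  by (auto simp: minus_eq r_neg)

lemma cauchyD_homog: "p < 2 \<Longrightarrow> cauchyD s \<Longrightarrow> cauchyD (\<lambda>k. homog A p (s k))"
  unfolding cauchyD_def
proof (intro conjI allI; elim conjE)
  assume p: "p < 2" and s: "\<forall>k. s k \<in> D 0" "\<forall>p. \<exists>K. \<forall>k\<ge>K. \<forall>l\<ge>K. s k \<ominus> s l \<in> D p"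
  show "homog A p (s k) \<in> D 0" for k using D_graded s p by (auto simp: graded_def)
  fix q
  obtain K where "\<forall>k\<ge>K. \<forall>l\<ge>K. s k \<ominus> s l \<in> D q" using s by blast
  then have "\<forall>k\<ge>K. \<forall>l\<ge>K. homog A p (s k) \<ominus> homog A p (s l) \<in> D q"
    using D_graded s p D_carrier by (metis graded_def homog_minus)
  then show "\<exists>K. \<forall>k\<ge>K. \<forall>l\<ge>K. homog A p (s k) \<ominus> homog A p (s l) \<in> D q" by blast
qed

text \<open>The terms \<open>D p\<close> are subspaces, so as in an ultrametric space a sequence is
  Cauchy once its steps tend to zero.\<close>

lemma cauchyD_steps:
  assumes "\<And>k. u k \<in> D 0" "\<And>k. u (Suc k) \<ominus> u k \<in> D (q k)" "\<And>p. \<exists>K. \<forall>k\<ge>K. p \<le> q k"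
  shows "cauchyD u"
  unfolding cauchyD_def
proof (intro conjI allI)
  show "u k \<in> D 0" for k by fact
  fix p
  obtain K where K: "\<forall>k\<ge>K. p \<le> q k" using assms(3) by blast
  have cl: "u k \<in> carrier A" for k using assms(1) D_carrier by blast
  have step: "u (K + d) \<ominus> u K \<in> D p" for d
  proof (induction d)
    case 0
    then show ?case using cl subspaceD(2)[OF D_sub] by (simp add: minus_eq r_neg)
  next
    case (Suc d)
    have "u (K + Suc d) \<ominus> u (K + d) \<in> D p"
      using assms(2)[of "K + d"] D_mono[of p "q (K + d)"] K by auto
    from subspaceD(3)[OF D_sub this Suc] show ?case using cl by (simp add: minus_telescope)
  qed
  have "u k \<ominus> u l \<in> D p" if "k \<ge> K" "l \<ge> K" for k l
  proof -
    have "u k \<ominus> u l = (u k \<ominus> u K) \<oplus> \<ominus> (u l \<ominus> u K)"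
      using cl minus_telescope[of "u k" "u K" "u l"] by (simp add: minus_eq minus_add a_comm)
    also have "\<dots> \<in> D p"
      using step[of "k - K"] step[of "l - K"] that by (intro subspaceD(3,5)[OF D_sub]) auto
    finally show ?thesis .
  qed
  then show "\<exists>K. \<forall>k\<ge>K. \<forall>l\<ge>K. u k \<ominus> u l \<in> D p" by blast
qed

abbreviation emb :: "'a \<Rightarrow> (nat \<Rightarrow> 'a) set" where "emb \<equiv> cembed A Fil"

definition Ext :: "(nat \<Rightarrow> 'a) set set" where
  "Ext = lspan EC {lim s \<otimes>\<^bsub>EC\<^esub> emb y | s y. cauchyD s \<and> y \<in> Y}"

lemmas emb_hom = salg_homD[OF salg_hom_cembed]

lemma lim_closed: "cauchyD s \<Longrightarrow> lim s \<in> carrier EC"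
  using lim_hom(1) cauchyD_cauchy by blast

lemma emb_closed: "y \<in> Y \<Longrightarrow> emb y \<in> carrier EC"
  using emb_hom(1) Y_carrier by blast

lemma Ext_gens: "{lim s \<otimes>\<^bsub>EC\<^esub> emb y | s y. cauchyD s \<and> y \<in> Y} \<subseteq> carrier EC"
  using lim_closed emb_closed by blast

lemma Ext_sub: "EC.subspace Ext"
  unfolding Ext_def by (rule EC.lspan_subspace[OF Ext_gens])

lemma Ext_prod: "cauchyD s \<Longrightarrow> y \<in> Y \<Longrightarrow> lim s \<otimes>\<^bsub>EC\<^esub> emb y \<in> Ext"
  unfolding Ext_def by (rule lspan.incl) blast

lemma Ext_lim: "cauchyD s \<Longrightarrow> lim s \<in> Ext"
  using Ext_prod[OF _ Y_props(2)] emb_hom(5) lim_closed by (simp add: EC.r_one)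

lemma Ext_emb: "y \<in> Y \<Longrightarrow> emb y \<in> Ext"
  using Ext_prod[OF cauchyD_const[OF D_one]] emb_hom(5) emb_closed by (simp flip: cembed_def)

lemma cauchy_speed:
  assumes "cauchyD s"
  obtains q where "\<And>k. s (Suc k) \<ominus> s k \<in> D (q k)" "\<And>p. \<exists>K. \<forall>k\<ge>K. p \<le> q k"
proof -
  \<comment> \<open>The best degree of step \<open>k\<close>, capped by \<open>k\<close> so that the
    maximum exists even if the step lies in every \<open>D p\<close>, for instance when it is
    zero.\<close>
  define q where "q k = Max {p. p \<le> k \<and> s (Suc k) \<ominus> s k \<in> D p}" for k
  have fin: "finite {p. p \<le> k \<and> s (Suc k) \<ominus> s k \<in> D p}" for k by simp
  have "0 \<in> {p. p \<le> k \<and> s (Suc k) \<ominus> s k \<in> D p}" for k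
    using assms subspaceD(6)[OF D_sub] by (auto simp: cauchyD_def)
  then have "q k \<in> {p. p \<le> k \<and> s (Suc k) \<ominus> s k \<in> D p}" for k
    unfolding q_def using Max_in[OF fin] by blast
  then have 1: "s (Suc k) \<ominus> s k \<in> D (q k)" for k by auto
  have 2: "\<exists>K. \<forall>k\<ge>K. p \<le> q k" for p
  proof -
    obtain K where "\<forall>k\<ge>K. \<forall>l\<ge>K. s k \<ominus> s l \<in> D p"
      using assms unfolding cauchyD_def by blast
    then have "p \<le> q k" if "k \<ge> max K p" for k
      unfolding q_def using that by (intro Max_ge[OF fin]) auto
    then show ?thesis by blast
  qed
  show ?thesis by (rule that[OF 1 2])
qed

text \<open>An expression of an element as a sum of products \<open>c z\<close> need not be unique,
  so reordering each \<open>y \<otimes> s k\<close> separately need not give convergent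
  coefficients. Instead the increments of \<open>s\<close> are reordered, with coefficients in
  \<open>D (q k - R)\<close>, and these are added up; \<open>Z\<close> is the same for all
  \<open>k\<close>.\<close>

lemma Ext_commute:
  assumes y: "y \<in> Y" and s: "cauchyD s"
  shows "emb y \<otimes>\<^bsub>EC\<^esub> lim s \<in> lspan EC {lim u \<otimes>\<^bsub>EC\<^esub> emb z | u z. cauchyD u \<and> z \<in> Y}"
proof -
  have yc: "y \<in> carrier A" using Y_carrier y .
  have sc: "s k \<in> D 0" "s k \<in> carrier A" for k using s D_carrier by (auto simp: cauchyD_def)
  obtain R Z where RZ: "finite Z" "Z \<subseteq> Y"
    "\<And>p x. x \<in> D p \<Longrightarrow> y \<otimes> x \<in> lspan A {c \<otimes> z | c z. c \<in> D (p - R) \<and> z \<in> Z}"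
    using reorder[OF y] by blast
  have Zc: "Z \<subseteq> carrier A" using RZ(2) Y_carrier by auto
  obtain q where q: "\<And>k. s (Suc k) \<ominus> s k \<in> D (q k)" "\<And>p. \<exists>K. \<forall>k\<ge>K. p \<le> q k"
    using cauchy_speed[OF s] by blast
  obtain c0 where c0: "\<forall>z\<in>Z. c0 z \<in> D 0" "y \<otimes> s 0 = (\<Oplus>z\<in>Z. c0 z \<otimes> z)"
    using lspan_coeffs[OF RZ(1) Zc D_sub RZ(3)[OF sc(1)]] by auto
  have "\<exists>f. (\<forall>z\<in>Z. f z \<in> D (q k - R)) \<and> y \<otimes> (s (Suc k) \<ominus> s k) = (\<Oplus>z\<in>Z. f z \<otimes> z)" for k
    by (rule lspan_coeffs[OF RZ(1) Zc D_sub RZ(3)[OF q(1)]])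
  then obtain c where c: "\<And>k z. z \<in> Z \<Longrightarrow> c k z \<in> D (q k - R)"
    "\<And>k. y \<otimes> (s (Suc k) \<ominus> s k) = (\<Oplus>z\<in>Z. c k z \<otimes> z)"
    by metis
  \<comment> \<open>Partial sums of the coefficients of the increments; they express
    \<open>y \<otimes> s k\<close> for every \<open>k\<close> and form a Cauchy sequence for each
    \<open>z\<close>.\<close>
  define u where "u = rec_nat c0 (\<lambda>k f z. f z \<oplus> c k z)"
  have u0: "u 0 = c0" and uS: "u (Suc k) = (\<lambda>z. u k z \<oplus> c k z)" for k by (simp_all add: u_def)
  have cD: "c k z \<in> D 0" if "z \<in> Z" for k z using c(1)[OF that] D_mono[of 0] by blast
  have uD: "u k z \<in> D 0" if "z \<in> Z" for k z
    by (induction k) (use that c0 cD subspaceD(3)[OF D_sub] in \<open>auto simp: u0 uS\<close>)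
  have uc: "cauchyD (\<lambda>k. u k z)" if z: "z \<in> Z" for z
  proof (rule cauchyD_steps[of _ "\<lambda>k. q k - R"])
    show "u k z \<in> D 0" for k using uD z .
    show "u (Suc k) z \<ominus> u k z \<in> D (q k - R)" for k
    proof -
      have "u (Suc k) z \<ominus> u k z = c k z"
        using D_carrier[OF uD[OF z]] D_carrier[OF cD[OF z]] by (simp add: uS add_minus_cancel)
      then show ?thesis using c(1)[OF z] by simp
    qed
    fix p
    obtain K where "\<forall>k\<ge>K. p + R \<le> q k" using q(2) by blast
    then show "\<exists>K. \<forall>k\<ge>K. p \<le> q k - R" by (metis le_diff_conv2 add_leD2)
  qed
  have ys: "y \<otimes> s k = (\<Oplus>z\<in>Z. u k z \<otimes> z)" for k
  proof (induction k)
    case (Suc k)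
    have "y \<otimes> s (Suc k) = y \<otimes> s k \<oplus> y \<otimes> (s (Suc k) \<ominus> s k)"
      using yc sc(2) by (simp flip: distr_l add: add_minus)
    also have "\<dots> = (\<Oplus>z\<in>Z. u k z \<otimes> z) \<oplus> (\<Oplus>z\<in>Z. c k z \<otimes> z)" by (simp only: Suc c(2))
    also have "\<dots> = (\<Oplus>z\<in>Z. u k z \<otimes> z \<oplus> c k z \<otimes> z)"
      by (rule finsum_addf[symmetric]) (use uD cD D_carrier Zc in blast)+
    also have "\<dots> = (\<Oplus>z\<in>Z. u (Suc k) z \<otimes> z)"
      by (rule finsum_cong'[OF refl])
        (use D_carrier[OF uD] D_carrier[OF cD] Zc in \<open>auto simp: uS distr_r subset_iff Pi_iff\<close>)
    finally show ?case .
  qed (simp add: u0 c0)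
  have part: "(\<lambda>k. \<Oplus>z\<in>Z'. u k z \<otimes> z) \<in> cauchy_seqs A Fil \<and> lim (\<lambda>k. \<Oplus>z\<in>Z'. u k z \<otimes> z) \<in> Ext"
    if "Z' \<subseteq> Z" "finite Z'" for Z'
    using that(2,1)
  proof (induction Z')
    case empty
    show ?case using lim_hom(4) EC.subspaceD(2)[OF Ext_sub] cauchy_const[of \<zero>] by simp
  next
    case (insert w Z')
    have w: "w \<in> Z" "w \<in> Y" "w \<in> carrier A" using insert RZ(2) Zc by auto
    have uw: "(\<lambda>k. u k w) \<in> cauchy_seqs A Fil" using cauchyD_cauchy[OF uc[OF w(1)]] .
    then have uww: "(\<lambda>k. u k w \<otimes> w) \<in> cauchy_seqs A Fil"
      using cauchy_mult[OF uw cauchy_const[OF w(3)]] by simp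
    have eq: "(\<lambda>k. \<Oplus>z\<in>insert w Z'. u k z \<otimes> z) = (\<lambda>k. u k w \<otimes> w \<oplus> (\<Oplus>z\<in>Z'. u k z \<otimes> z))"
    proof
      fix k
      have "(\<lambda>z. u k z \<otimes> z) \<in> Z' \<rightarrow> carrier A" "u k w \<otimes> w \<in> carrier A"
        using uD D_carrier Zc insert by blast+
      then show "(\<Oplus>z\<in>insert w Z'. u k z \<otimes> z) = u k w \<otimes> w \<oplus> (\<Oplus>z\<in>Z'. u k z \<otimes> z)"
        using insert by simp
    qed
    have "lim (\<lambda>k. u k w \<otimes> w) = lim (\<lambda>k. u k w) \<otimes>\<^bsub>EC\<^esub> emb w"
      unfolding cembed_def using lim_hom(3)[OF uw cauchy_const[OF w(3)]] .
    then have "lim (\<lambda>k. u k w \<otimes> w) \<in> Ext" using Ext_prod[OF uc[OF w(1)] w(2)] by simp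
    then show ?case
      unfolding eq using insert uww lim_hom(2)[OF uww] cauchy_add EC.subspaceD(3)[OF Ext_sub] by auto
  qed
  have "emb y \<otimes>\<^bsub>EC\<^esub> lim s = lim (\<lambda>k. y \<otimes> s k)"
    unfolding cembed_def using lim_hom(3)[OF cauchy_const[OF yc] cauchyD_cauchy[OF s]] by simp
  also have "\<dots> \<in> Ext" unfolding ys using part[of Z] RZ(1) by simp
  finally show ?thesis by (simp add: Ext_def)
qed

text \<open>In a product of two generators only the inner factors \<open>emb y\<close> and
  \<open>lim s'\<close> are out of order. Once \<open>Ext_commute\<close> has exchanged them, the
  two halves multiply separately.\<close>

lemma Ext_subalgebra: "EC.subalgebra Ext"
  unfolding EC.subalgebra_def
proof (intro conjI ballI)
  show "EC.subspace Ext" by (rule Ext_sub)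
  show "\<one>\<^bsub>EC\<^esub> \<in> Ext" using Ext_emb[OF Y_props(2)] by (simp add: emb_hom)
  fix a b assume ab: "a \<in> Ext" "b \<in> Ext"
  show "a \<otimes>\<^bsub>EC\<^esub> b \<in> Ext"
  proof (rule EC.lspan_mult[OF Ext_gens Ext_gens Ext_sub _ ab[unfolded Ext_def]])
    fix a b assume "a \<in> {lim s \<otimes>\<^bsub>EC\<^esub> emb y | s y. cauchyD s \<and> y \<in> Y}"
      "b \<in> {lim s \<otimes>\<^bsub>EC\<^esub> emb y | s y. cauchyD s \<and> y \<in> Y}"
    then obtain s y s' y' where ab: "a = lim s \<otimes>\<^bsub>EC\<^esub> emb y" "b = lim s' \<otimes>\<^bsub>EC\<^esub> emb y'"
      and sy: "cauchyD s" "y \<in> Y" "cauchyD s'" "y' \<in> Y" by blast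
    note cl = lim_closed[OF sy(1)] lim_closed[OF sy(3)] emb_closed[OF sy(2)] emb_closed[OF sy(4)]
    let ?V = "{w \<in> carrier EC. lim s \<otimes>\<^bsub>EC\<^esub> w \<otimes>\<^bsub>EC\<^esub> emb y' \<in> Ext}"
    have V: "EC.subspace ?V"
      using EC.subspaceD[OF Ext_sub] cl
      by (auto simp: EC.subspace_def EC.distr_l EC.distr_r EC.scal_mult_l EC.scal_mult_r)
    have "lspan EC {lim u \<otimes>\<^bsub>EC\<^esub> emb z | u z. cauchyD u \<and> z \<in> Y} \<subseteq> ?V"
    proof (rule EC.lspan_least[OF V], safe)
      fix u z assume uz: "cauchyD u" "z \<in> Y"
      note cl' = lim_closed[OF uz(1)] emb_closed[OF uz(2)]
      show "lim u \<otimes>\<^bsub>EC\<^esub> emb z \<in> carrier EC" using cl' by simp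
      have "lim s \<otimes>\<^bsub>EC\<^esub> (lim u \<otimes>\<^bsub>EC\<^esub> emb z) \<otimes>\<^bsub>EC\<^esub> emb y' =
          (lim s \<otimes>\<^bsub>EC\<^esub> lim u) \<otimes>\<^bsub>EC\<^esub> (emb z \<otimes>\<^bsub>EC\<^esub> emb y')"
        using cl cl' by (simp add: EC.m_assoc)
      also have "\<dots> = lim (\<lambda>k. s k \<otimes> u k) \<otimes>\<^bsub>EC\<^esub> emb (z \<otimes> y')"
        using lim_hom(3) cauchyD_cauchy uz sy emb_hom(3) Y_carrier by simp
      also have "\<dots> \<in> Ext" by (intro Ext_prod cauchyD_mult Y_props uz sy)
      finally show "lim s \<otimes>\<^bsub>EC\<^esub> (lim u \<otimes>\<^bsub>EC\<^esub> emb z) \<otimes>\<^bsub>EC\<^esub> emb y' \<in> Ext" .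
    qed
    then have "lim s \<otimes>\<^bsub>EC\<^esub> (emb y \<otimes>\<^bsub>EC\<^esub> lim s') \<otimes>\<^bsub>EC\<^esub> emb y' \<in> Ext"
      using Ext_commute[OF sy(2,3)] by auto
    then show "a \<otimes>\<^bsub>EC\<^esub> b \<in> Ext" unfolding ab using cl by (simp add: EC.m_assoc)
  qed
qed

lemma Ext_graded: "EC.graded Ext"
  unfolding EC.graded_def
proof (intro allI impI ballI)
  fix p x assume p: "p < (2::nat)" and x: "x \<in> Ext"
  have "Ext \<subseteq> {x \<in> carrier EC. homog EC p x \<in> Ext}"
    unfolding Ext_def
  proof (rule EC.lspan_least[OF EC.subspace_homog[OF EC.lspan_subspace[OF Ext_gens] p]], safe)
    fix s y assume sy: "cauchyD s" "y \<in> Y"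
    note cl = lim_closed[OF sy(1)] emb_closed[OF sy(2)]
    show "lim s \<otimes>\<^bsub>EC\<^esub> emb y \<in> carrier EC" using cl by simp
    have "homog EC q (lim s) = lim (\<lambda>k. homog A q (s k))" "homog EC q (emb y) = emb (homog A q y)"
      if "q < 2" for q
      using that sy lim_hom(7) emb_hom(7) cauchyD_cauchy Y_carrier by auto
    moreover have "homog A q y \<in> Y" if "q < 2" for q using Y_graded sy that by (auto simp: graded_def)
    ultimately have "homog EC p (lim s \<otimes>\<^bsub>EC\<^esub> emb y) \<in> Ext"
      using p cl sy
      by (auto simp: less_2_cases_iff EC.homog_prod
          intro!: EC.subspaceD(3)[OF Ext_sub] Ext_prod cauchyD_homog)
    then show "homog EC p (lim s \<otimes>\<^bsub>EC\<^esub> emb y) \<in> lspan EC {lim s \<otimes>\<^bsub>EC\<^esub> emb y |s y. cauchyD s \<and> y \<in> Y}"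
      by (simp add: Ext_def)
  qed
  then show "homog EC p x \<in> Ext" using x by auto
qed

definition XA :: "(nat \<Rightarrow> 'a) set superalg" where "XA = EC\<lparr>carrier := Ext\<rparr>"

lemma superalgebra_XA: "superalgebra XA"
  unfolding XA_def by (rule EC.superalgebra_sub[OF Ext_subalgebra Ext_graded])

sublocale XA: superalgebra XA by (rule superalgebra_XA)

end

section \<open>The free superalgebra and the double Yangian\<close>

text \<open>Scalars are central although words do not commute: the empty word is neutral for
  concatenation, and the coefficients are complex numbers.\<close>

lemma single_0_comm: "f * Poly_Mapping.single 0 c = Poly_Mapping.single 0 c * (f :: 'a free_alg)"
proof -
  have "f = (\<Sum>x\<in>Poly_Mapping.keys f. Poly_Mapping.single x (Poly_Mapping.lookup f x))"
    using poly_mapping_sum_single[of f] by (simp add: cscal_single)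
  then have "f * Poly_Mapping.single 0 c =
      (\<Sum>x\<in>Poly_Mapping.keys f. Poly_Mapping.single x (Poly_Mapping.lookup f x) * Poly_Mapping.single 0 c)"
    by (metis sum_distrib_right)
  also have "\<dots> = (\<Sum>x\<in>Poly_Mapping.keys f. Poly_Mapping.single 0 c * Poly_Mapping.single x (Poly_Mapping.lookup f x))"
    by (simp add: mult_single mult.commute)
  also have "\<dots> = Poly_Mapping.single 0 c * f"
    using \<open>f = _\<close> by (metis sum_distrib_left)
  finally show ?thesis .
qed

lemma cscal_mult: "cscal c f * g = cscal c (f * g)" "f * cscal c g = cscal c (f * (g :: 'a free_alg))"
  unfolding mult_map_scale_conv_mult
  by (simp_all add: mult.assoc[symmetric] single_0_comm)

text \<open>The signs in \<open>mat2_mult\<close>, \<open>in_first\<close>, \<open>in_second\<close>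
  and \<open>Pmat\<close> are powers of -1 in the free algebra itself; this turns them into
  scalars.\<close>

lemma neg1_power_mult: "(-1) ^ e * f = cscal ((-1) ^ e) (f :: 'a free_alg)"
  by (cases "even e") (auto intro!: poly_mapping_eqI simp: lookup_minus)

lemma word_parity_add: "word_parity \<pi> (v + w) = (word_parity \<pi> v + word_parity \<pi> w) mod 2"
  by (cases v; cases w) (simp add: mod_add_eq)

lemma word_parity_less: "word_parity \<pi> w < 2"
  by (cases w) simp

locale free_salg =
  fixes S :: "'g set" and \<pi> :: "'g \<Rightarrow> nat"
begin

abbreviation Fr :: "'g free_alg superalg" where "Fr \<equiv> free_superalg S \<pi>"

lemma lookup_homog:
  "Poly_Mapping.lookup (homog Fr p f) w = (if word_parity \<pi> w = p then Poly_Mapping.lookup f w else 0)"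
  by (auto simp: free_superalg_def lookup_sum lookup_single when_def in_keys_iff sum.delta')

lemma Fr_simps:
  "carrier Fr = {f. Poly_Mapping.keys f \<subseteq> Word ` lists S}" "f \<otimes>\<^bsub>Fr\<^esub> g = f * g" "\<one>\<^bsub>Fr\<^esub> = 1"
  "\<zero>\<^bsub>Fr\<^esub> = 0" "f \<oplus>\<^bsub>Fr\<^esub> g = f + g" "scal Fr = cscal"
  by (auto simp: free_superalg_def fun_eq_iff)

lemma word_add: "v \<in> Word ` lists S \<Longrightarrow> w \<in> Word ` lists S \<Longrightarrow> v + w \<in> Word ` lists S"
  by (cases v; cases w) (auto intro!: imageI)

lemma presuperalgebra_Fr: "presuperalgebra Fr"
proof -
  have grp: "abelian_group Fr"
  proof (rule abelian_groupI)
    fix f assume "f \<in> carrier Fr"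
    then have "- f \<in> carrier Fr" "(- f) \<oplus>\<^bsub>Fr\<^esub> f = \<zero>\<^bsub>Fr\<^esub>"
      by (auto simp: Fr_simps in_keys_iff)
    then show "\<exists>g\<in>carrier Fr. g \<oplus>\<^bsub>Fr\<^esub> f = \<zero>\<^bsub>Fr\<^esub>" by blast
  qed (use keys_add in \<open>fastforce simp: Fr_simps add_ac\<close>)+
  then interpret Fr: abelian_group Fr .
  show ?thesis
  proof unfold_locales
    fix x y assume "x \<in> carrier Fr" "y \<in> carrier Fr"
    then have xy: "Poly_Mapping.keys x \<subseteq> Word ` lists S" "Poly_Mapping.keys y \<subseteq> Word ` lists S"
      by (simp_all add: Fr_simps)
    have "a + b \<in> Word ` lists S" if "a \<in> Poly_Mapping.keys x" "b \<in> Poly_Mapping.keys y" for a b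
      by (rule word_add[OF subsetD[OF xy(1) that(1)] subsetD[OF xy(2) that(2)]])
    then have "{a + b | a b. a \<in> Poly_Mapping.keys x \<and> b \<in> Poly_Mapping.keys y} \<subseteq> Word ` lists S"
      by blast
    then show "x \<otimes>\<^bsub>Fr\<^esub> y \<in> carrier Fr"
      using keys_mult[of x y] unfolding Fr_simps mem_Collect_eq by (rule subset_trans[rotated])
  next
    show "\<one>\<^bsub>Fr\<^esub> \<in> carrier Fr" by (auto simp: Fr_simps zero_word_def)
  next
    fix p :: nat and x assume "x \<in> carrier Fr"
    then show "homog Fr p x \<in> carrier Fr"
      by (auto simp: Fr_simps in_keys_iff lookup_homog split: if_splits)
  next
    fix p :: nat and x y c
    show "homog Fr p (x \<oplus>\<^bsub>Fr\<^esub> y) = homog Fr p x \<oplus>\<^bsub>Fr\<^esub> homog Fr p y"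
      by (rule poly_mapping_eqI) (simp add: Fr_simps lookup_homog lookup_add)
    show "homog Fr p (scal Fr c x) = scal Fr c (homog Fr p x)"
      by (rule poly_mapping_eqI) (simp add: Fr_simps lookup_homog)
  qed (use keys_cscal in \<open>fastforce simp: Fr_simps cscal_simps cscal_mult algebra_simps\<close>)+
qed

sublocale Fr: presuperalgebra Fr by (rule presuperalgebra_Fr)

abbreviation mon :: "'g list \<Rightarrow> 'g free_alg" where "mon w \<equiv> Poly_Mapping.single (Word w) 1"

lemma mon_closed: "w \<in> lists S \<Longrightarrow> mon w \<in> carrier Fr"
  by (auto simp: Fr_simps)

lemma mon_append: "mon (v @ w) = mon v * mon w"
  by (simp add: mult_single)

lemma mon_span: "carrier Fr \<subseteq> lspan Fr (mon ` lists S)"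
proof
  fix f assume f: "f \<in> carrier Fr"
  let ?g = "\<lambda>x. cscal (Poly_Mapping.lookup f x) (Poly_Mapping.single x 1)"
  have sub: "Fr.subspace (lspan Fr (mon ` lists S))"
    by (rule Fr.lspan_subspace) (use mon_closed in auto)
  have "sum ?g J \<in> lspan Fr (mon ` lists S)" if "finite J" "J \<subseteq> Poly_Mapping.keys f" for J
    using that
  proof (induction J)
    case (insert x J)
    then obtain w where w: "x = Word w" "w \<in> lists S" using f by (auto simp: Fr_simps)
    have "mon w \<in> lspan Fr (mon ` lists S)" using w by (auto intro: lspan.incl)
    moreover have "?g x = scal Fr (Poly_Mapping.lookup f x) (mon w)" by (simp add: w Fr_simps)
    ultimately have "?g x \<in> lspan Fr (mon ` lists S)"
      using Fr.subspaceD(4)[OF sub] by metis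
    then show ?case using insert Fr.subspaceD(3)[OF sub] by (simp add: Fr_simps)
  qed (use Fr.subspaceD(2)[OF sub] in \<open>simp add: Fr_simps\<close>)
  from this[of "Poly_Mapping.keys f"] show "f \<in> lspan Fr (mon ` lists S)"
    by (metis poly_mapping_sum_single finite_keys order_refl)
qed

lemma homog_mon: "homog Fr p (mon w) = (if p = word_parity \<pi> (Word w) then mon w else \<zero>\<^bsub>Fr\<^esub>)"
  by (rule poly_mapping_eqI) (auto simp: Fr_simps lookup_homog lookup_single when_def)

lemma superalgebra_Fr: "superalgebra Fr"
proof (rule Fr.superalgebra_spanI[OF _ mon_span,
      where H = "\<lambda>r x. \<exists>w. w \<in> lists S \<and> x = mon w \<and> r = word_parity \<pi> (Word w)"])
  show "mon ` lists S \<subseteq> carrier Fr" using mon_closed by auto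
  show "homog Fr 0 \<one>\<^bsub>Fr\<^esub> = \<one>\<^bsub>Fr\<^esub>"
    using homog_mon[of 0 "[]"] by (simp add: Fr_simps single_one[symmetric] zero_word_def del: single_one)
  show "homog Fr ((r + s) mod 2) (x \<otimes>\<^bsub>Fr\<^esub> y) = x \<otimes>\<^bsub>Fr\<^esub> y"
    if xy: "\<exists>w. w \<in> lists S \<and> x = mon w \<and> r = word_parity \<pi> (Word w)"
      "\<exists>w. w \<in> lists S \<and> y = mon w \<and> s = word_parity \<pi> (Word w)" for r s x y
  proof -
    obtain v w where vw: "x = mon v" "r = word_parity \<pi> (Word v)" "y = mon w" "s = word_parity \<pi> (Word w)"
      using xy by blast
    have "word_parity \<pi> (Word (v @ w)) = (r + s) mod 2"
      unfolding vw(2,4) using word_parity_add[of \<pi> "Word v" "Word w"] by simp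
    then show ?thesis using homog_mon[of "(r + s) mod 2" "v @ w"] by (simp add: vw(1,3) Fr_simps mult_single)
  qed
qed (auto simp: Fr_simps(2,3) mult.assoc homog_mon word_parity_less)

end

lemma (in superalgebra) ishom_image:
  assumes "salg_hom A B f" "superalgebra B" "ishom p x"
  shows "superalgebra.ishom B p (f x)"
  using assms(3) salg_homD(1,7)[OF assms(1)] unfolding ishom_def superalgebra.ishom_def[OF assms(2)]
  by metis

locale yangian =
  fixes m n :: nat
begin

abbreviation K :: "nat set" where "K \<equiv> {1..m + n}"
abbreviation par :: "nat \<Rightarrow> nat \<Rightarrow> nat" where "par i j \<equiv> (bar m i + bar m j) mod 2"
abbreviation Fr :: "ygen free_alg superalg" where "Fr \<equiv> FreeY m n"

sublocale FS: free_salg "ygens m n" "ygen_parity m" .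

lemma Fr_eq: "FS.Fr = Fr" by (simp add: FreeY_def)

sublocale Fr: superalgebra Fr
  using FS.superalgebra_Fr by (simp add: FreeY_def)

lemmas Fr_simps = FS.Fr_simps[unfolded Fr_eq]

lemma ishom_mon: "w \<in> lists (ygens m n) \<Longrightarrow> Fr.ishom (word_parity (ygen_parity m) (Word w)) (FS.mon w)"
  using FS.homog_mon[of _ w, unfolded Fr_eq] FS.mon_closed[unfolded Fr_eq] word_parity_less
  by (auto simp: Fr.ishom_def)

lemma ishom_gen: "(i, j, r) \<in> ygens m n \<Longrightarrow> Fr.ishom (par i j) (gen_elem (i, j, r))"
  using ishom_mon[of "[(i, j, r)]"] by (simp add: gen_elem_def)

lemma par_less: "par i j < 2" by simp

lemma Fr_minus: "f \<in> carrier Fr \<Longrightarrow> g \<in> carrier Fr \<Longrightarrow> f \<ominus>\<^bsub>Fr\<^esub> g = f - g"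
  using Fr.minus_scal[of f g] by (auto simp: Fr_simps lookup_add lookup_minus intro!: poly_mapping_eqI)

lemma ishom_Fr_minus: "Fr.ishom p f \<Longrightarrow> Fr.ishom p g \<Longrightarrow> Fr.ishom p (f - g)"
  using Fr.ishom_add[OF _ Fr.ishom_scal, of p f g "-1"] Fr.ishom_closed Fr_minus[of f g] Fr.minus_scal[of f g]
  by auto

lemma ishom_delta: "Fr.ishom (par i j) (if i = j then 1 else 0)"
  using Fr.ishom_one Fr.ishom_zero[OF par_less] by (auto simp: Fr_simps)

lemma ishom_t: "i \<in> K \<Longrightarrow> j \<in> K \<Longrightarrow> Fr.ishom (par i j) (t_coeff i j r)"
  using ishom_delta[of i j] ishom_gen[of i j "int r"] by (auto simp: t_coeff_def ygens_def)

lemma ishom_tp: "i \<in> K \<Longrightarrow> j \<in> K \<Longrightarrow> Fr.ishom (par i j) (tp_coeff i j r)"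
  using ishom_delta[of i j] ishom_gen[of i j "- int (Suc r)"] Fr.ishom_zero[OF par_less, of i j]
  unfolding tp_coeff_def
  by (intro ishom_Fr_minus) (auto simp: ygens_def Fr_simps)

lemma ishom_t_ser: "i \<in> K \<Longrightarrow> j \<in> K \<Longrightarrow> Fr.ishom (par i j) (t_ser a i j)"
  using ishom_t Fr.ishom_zero[OF par_less] by (auto simp: t_ser_def Fr_simps)

lemma ishom_tp_ser: "i \<in> K \<Longrightarrow> j \<in> K \<Longrightarrow> Fr.ishom (par i j) (tp_ser a i j)"
  using ishom_tp Fr.ishom_zero[OF par_less] by (auto simp: tp_ser_def Fr_simps)

subsection \<open>The defining relations in components\<close>

text \<open>Exponent of the sign that \<open>T(u)\<close> puts in front of the entry
  \<open>i j\<close>.\<close>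

definition sg :: "nat \<Rightarrow> nat \<Rightarrow> nat" where
  "sg i j = bar m i * bar m j + bar m j"

lemma twist_Fr_scal: "Fr.ishom p x \<Longrightarrow> twist Fr d (cscal c x) = cscal ((-1) ^ (d * p) * c) x"
  using Fr.twist_ishom[OF Fr.ishom_scal, of p x d c] by (simp add: Fr_simps cscal_simps)

lemma twist_Fr_zero: "twist Fr d 0 = 0"
  using Fr.twist_ishom[OF Fr.ishom_zero[of 0], of d] by (simp add: Fr_simps cscal_simps)

lemma sum2_delta:
  assumes "a \<in> K" "b \<in> K" "\<And>j l. j \<in> K \<Longrightarrow> l \<in> K \<Longrightarrow> \<not> (j = a \<and> l = b) \<Longrightarrow> f j l = (0 :: ygen free_alg)"
  shows "(\<Sum>j\<in>K. \<Sum>l\<in>K. f j l) = f a b"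
proof -
  have "(\<Sum>j\<in>K. \<Sum>l\<in>K. f j l) = (\<Sum>j\<in>K. if j = a then \<Sum>l\<in>K. f j l else 0)"
    by (rule sum.cong) (use assms in \<open>auto intro!: sum.neutral\<close>)
  also have "\<dots> = (\<Sum>l\<in>K. f a l)" using assms by simp
  also have "\<dots> = (\<Sum>l\<in>K. if l = b then f a l else 0)"
    by (rule sum.cong) (use assms in auto)
  also have "\<dots> = f a b" using assms by simp
  finally show ?thesis .
qed

text \<open>Sign of the component \<open>i j k l\<close> of \<open>T_1 T'_2\<close>, as
  \<open>e2\<close> is for \<open>T'_2 T_1\<close>. The reordering rests on two facts: both signs
  agree for \<open>k = l\<close>, and \<open>e1\<close> can be inverted.\<close>

definition e1 :: "nat \<Rightarrow> nat \<Rightarrow> nat \<Rightarrow> nat \<Rightarrow> complex" where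
  "e1 i j k l = (-1) ^ (sg i j + sg k l + (bar m i + bar m j) * (bar m k + bar m l))"

definition e2 :: "nat \<Rightarrow> nat \<Rightarrow> nat \<Rightarrow> nat \<Rightarrow> complex" where
  "e2 i j k l = (-1) ^ (sg i j + sg k l)"

lemma mult_first_second:
  assumes T: "\<And>i j. i \<in> K \<Longrightarrow> j \<in> K \<Longrightarrow> Fr.ishom (par i j) (T i j)"
    and ij: "i \<in> K" "j \<in> K" "k \<in> K" "l \<in> K"
  shows "mat2_mult m n (in_first m T) (in_second m T') i j k l = cscal (e1 i j k l) (T i j * T' k l)"
proof -
  have "mat2_mult m n (in_first m T) (in_second m T') i j k l =
      (-1) ^ ((bar m k + bar m k) * (bar m j + bar m j)) *
      twist Fr (bar m j + bar m j + bar m k + bar m l) (in_first m T i j k k) * in_second m T' j j k l"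
    unfolding mat2_mult_def
    by (rule sum2_delta[OF ij(2,3)]) (auto simp: in_first_def in_second_def twist_Fr_zero)
  also have "\<dots> = cscal ((-1) ^ ((bar m k + bar m k) * (bar m j + bar m j)) *
      ((-1) ^ ((bar m j + bar m j + bar m k + bar m l) * par i j) * (-1) ^ sg i j) * (-1) ^ sg k l)
      (T i j * T' k l)"
    by (simp only: in_first_def in_second_def simp_thms if_True neg1_power_mult
        sg_def[symmetric] twist_Fr_scal[OF T[OF ij(1,2)]] cscal_mult cscal_simps(4) mult_ac)
  also have "(-1) ^ ((bar m k + bar m k) * (bar m j + bar m j)) *
      ((-1) ^ ((bar m j + bar m j + bar m k + bar m l) * par i j) * (-1) ^ sg i j) * (-1) ^ sg k l = e1 i j k l"
    by (simp add: bar_def e1_def sg_def)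
  finally show ?thesis .
qed

lemma mult_second_first:
  assumes T: "\<And>i j. i \<in> K \<Longrightarrow> j \<in> K \<Longrightarrow> Fr.ishom (par i j) (T' i j)"
    and ij: "i \<in> K" "j \<in> K" "k \<in> K" "l \<in> K"
  shows "mat2_mult m n (in_second m T') (in_first m T) i j k l = cscal (e2 i j k l) (T' k l * T i j)"
proof -
  have "mat2_mult m n (in_second m T') (in_first m T) i j k l =
      (-1) ^ ((bar m k + bar m l) * (bar m i + bar m j)) *
      twist Fr (bar m i + bar m j + bar m l + bar m l) (in_second m T' i i k l) * in_first m T i j l l"
    unfolding mat2_mult_def
    by (rule sum2_delta[OF ij(1,4)]) (auto simp: in_first_def in_second_def twist_Fr_zero)
  also have "\<dots> = cscal ((-1) ^ ((bar m k + bar m l) * (bar m i + bar m j)) *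
      ((-1) ^ ((bar m i + bar m j + bar m l + bar m l) * par k l) * (-1) ^ sg k l) * (-1) ^ sg i j)
      (T' k l * T i j)"
    by (simp only: in_first_def in_second_def simp_thms if_True neg1_power_mult
        sg_def[symmetric] twist_Fr_scal[OF T[OF ij(3,4)]] cscal_mult cscal_simps(4) mult_ac)
  also have "(-1) ^ ((bar m k + bar m l) * (bar m i + bar m j)) *
      ((-1) ^ ((bar m i + bar m j + bar m l + bar m l) * par k l) * (-1) ^ sg k l) * (-1) ^ sg i j = e2 i j k l"
    by (simp add: bar_def e2_def sg_def)
  finally show ?thesis .
qed

end

context yangian
begin

lemma neg1_power_cscal: "(-1) ^ e = cscal ((-1) ^ e) (1 :: ygen free_alg)"
  using neg1_power_mult[of e 1] by simp

text \<open>Multiplication by \<open>P\<close> on the left exchanges the row indices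
  \<open>i\<close> and \<open>k\<close> up to a sign, kept as an unspecified scalar that does not
  depend on \<open>X\<close>.\<close>

lemma mult_P_left:
  assumes "i \<in> K" "j \<in> K" "k \<in> K" "l \<in> K"
  shows "\<exists>c. \<forall>X. mat2_mult m n (Pmat m) X i j k l = cscal c (X k j i l)"
proof (intro exI allI)
  fix X
  have P: "twist Fr d ((-1) ^ e) = (-1) ^ e" for d e
    using twist_Fr_scal[OF Fr.ishom_one, of d "(-1) ^ e"] by (simp add: Fr_simps flip: neg1_power_cscal)
  have "mat2_mult m n (Pmat m) X i j k l = (-1) ^ ((bar m k + bar m i) * (bar m k + bar m j)) *
      twist Fr (bar m k + bar m j + bar m i + bar m l) (Pmat m i k k i) * X k j i l"
    unfolding mat2_mult_def
    by (rule sum2_delta[OF assms(3,1)]) (auto simp: Pmat_def twist_Fr_zero)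
  also have "\<dots> = cscal ((-1) ^ ((bar m k + bar m i) * (bar m k + bar m j)) * (-1) ^ bar m k) (X k j i l)"
    by (simp only: Pmat_def simp_thms if_True P neg1_power_mult cscal_mult(1) cscal_simps(4))
  finally show "mat2_mult m n (Pmat m) X i j k l =
      cscal ((-1) ^ ((bar m k + bar m i) * (bar m k + bar m j)) * (-1) ^ bar m k) (X k j i l)" .
qed

lemma mult_P_right:
  assumes "i \<in> K" "j \<in> K" "k \<in> K" "l \<in> K"
  shows "\<exists>c. \<forall>Z p e x. Z i l k j = cscal e x \<longrightarrow> Fr.ishom p x \<longrightarrow>
    mat2_mult m n Z (Pmat m) i j k l = cscal c (cscal e x)"
proof (intro exI allI impI)
  fix Z :: mat2 and p e x assume Z: "Z i l k j = cscal e x" and x: "Fr.ishom p x"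
  have "mat2_mult m n Z (Pmat m) i j k l = (-1) ^ ((bar m k + bar m j) * (bar m l + bar m j)) *
      twist Fr (bar m l + bar m j + bar m j + bar m l) (Z i l k j) * Pmat m l j j l"
    unfolding mat2_mult_def
    by (rule sum2_delta[OF assms(4,2)]) (auto simp: Pmat_def twist_Fr_zero)
  also have "\<dots> = (-1) ^ ((bar m k + bar m j) * (bar m l + bar m j)) *
      cscal ((-1) ^ ((bar m l + bar m j + bar m j + bar m l) * p) * e) x * cscal ((-1) ^ bar m j) 1"
    unfolding Z by (simp only: Pmat_def simp_thms if_True twist_Fr_scal[OF x] flip: neg1_power_cscal)
  \<comment> \<open>The twist exponent is twice \<open>bar m l + bar m j\<close>, so the parity of
    the entry has no influence and one scalar serves all entries.\<close>
  also have "(-1 :: complex) ^ ((bar m l + bar m j + bar m j + bar m l) * p) = 1"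
    by (simp add: bar_def)
  finally show "mat2_mult m n Z (Pmat m) i j k l =
      cscal ((-1) ^ ((bar m k + bar m j) * (bar m l + bar m j)) * (-1) ^ bar m j) (cscal e x)"
    by (simp only: neg1_power_mult cscal_mult cscal_simps(4) mult_1_right mult_1_left)
      (rule arg_cong[where f = "\<lambda>c. cscal c x"], simp)
qed

text \<open>Component of \<open>(u - v - P) T_1 T'_2 - T'_2 T_1 (u - v - P)\<close> at
  \<open>u^a v^b\<close>: a factor \<open>u\<close> or \<open>v\<close> shifts the index by one,
  while \<open>P\<close> exchanges \<open>i\<close> with \<open>k\<close> on the left and
  \<open>j\<close> with \<open>l\<close> on the right.\<close>

definition rel :: "complex \<Rightarrow> complex \<Rightarrow> (int \<Rightarrow> nat \<Rightarrow> nat \<Rightarrow> ygen free_alg) \<Rightarrow>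
    (int \<Rightarrow> nat \<Rightarrow> nat \<Rightarrow> ygen free_alg) \<Rightarrow> int \<Rightarrow> int \<Rightarrow> nat \<Rightarrow> nat \<Rightarrow> nat \<Rightarrow> nat \<Rightarrow> ygen free_alg" where
  "rel c d T T' a b i j k l =
     (cscal (e1 i j k l) (T (a - 1) i j * T' b k l) - cscal (e1 i j k l) (T a i j * T' (b - 1) k l)
        - cscal c (T a k j * T' b i l))
     - (cscal (e2 i j k l) (T' b k l * T (a - 1) i j) - cscal (e2 i j k l) (T' (b - 1) k l * T a i j)
        - cscal d (T' b k j * T a i l))"

lemma RTT_term:
  assumes T: "\<And>a i j. i \<in> K \<Longrightarrow> j \<in> K \<Longrightarrow> Fr.ishom (par i j) (T a i j)"
    and T': "\<And>a i j. i \<in> K \<Longrightarrow> j \<in> K \<Longrightarrow> Fr.ishom (par i j) (T' a i j)"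
    and ij: "i \<in> K" "j \<in> K" "k \<in> K" "l \<in> K"
  defines "X \<equiv> \<lambda>a b. mat2_mult m n (in_first m (T a)) (in_second m (T' b))"
    and "Z \<equiv> \<lambda>a b. mat2_mult m n (in_second m (T' b)) (in_first m (T a))"
  shows "\<exists>c d. \<forall>a b. (X (a - 1) b i j k l - X a (b - 1) i j k l - mat2_mult m n (Pmat m) (X a b) i j k l)
    - (Z (a - 1) b i j k l - Z a (b - 1) i j k l - mat2_mult m n (Z a b) (Pmat m) i j k l) =
    rel c d T T' a b i j k l"
proof -
  have X: "X a b i j k l = cscal (e1 i j k l) (T a i j * T' b k l)"
    if "i \<in> K" "j \<in> K" "k \<in> K" "l \<in> K" for a b i j k l
    unfolding X_def by (rule mult_first_second[of "T a", OF T that])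
  have Z: "Z a b i j k l = cscal (e2 i j k l) (T' b k l * T a i j)"
    if "i \<in> K" "j \<in> K" "k \<in> K" "l \<in> K" for a b i j k l
    unfolding Z_def by (rule mult_second_first[of "T' b", OF T' that])
  obtain c where c: "\<And>X. mat2_mult m n (Pmat m) X i j k l = cscal c (X k j i l)"
    using mult_P_left[OF ij] by blast
  obtain d where d: "\<And>Z p e x. Z i l k j = cscal e x \<Longrightarrow> Fr.ishom p x \<Longrightarrow>
    mat2_mult m n Z (Pmat m) i j k l = cscal d (cscal e x)" using mult_P_right[OF ij] by metis
  have h: "Fr.ishom ((par k j + par i l) mod 2) (T' b k j * T a i l)" for a b
    using Fr.ishom_mult[OF T'[OF ij(3,2)] T[OF ij(1,4)]] by (simp only: Fr_simps)
  have "mat2_mult m n (Z a b) (Pmat m) i j k l = cscal d (cscal (e2 i l k j) (T' b k j * T a i l))" for a b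
    by (rule d[of "Z a b", OF Z[OF ij(1,4,3,2)] h])
  then have "\<forall>a b. (X (a - 1) b i j k l - X a (b - 1) i j k l - mat2_mult m n (Pmat m) (X a b) i j k l)
    - (Z (a - 1) b i j k l - Z a (b - 1) i j k l - mat2_mult m n (Z a b) (Pmat m) i j k l) =
    rel (c * e1 k j i l) (d * e2 i l k j) T T' a b i j k l"
    by (simp only: c X[OF ij] X[OF ij(3,2,1,4)] Z[OF ij] rel_def cscal_simps simp_thms)
  then show ?thesis by blast
qed

lemma ishom_Fr_scal: "Fr.ishom p f \<Longrightarrow> Fr.ishom p (cscal c f)"
  using Fr.ishom_scal[of p f c] by (simp add: Fr_simps)

lemma ishom_Fr_mult: "Fr.ishom p f \<Longrightarrow> Fr.ishom q g \<Longrightarrow> Fr.ishom ((p + q) mod 2) (f * g)"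
  using Fr.ishom_mult[of p f q g] by (simp add: Fr_simps)

text \<open>Every term contains the indices \<open>i\<close>, \<open>j\<close>, \<open>k\<close>,
  \<open>l\<close> once each, so all have the same total parity. Homogeneity of the relations is
  what makes the ideal graded.\<close>

lemma ishom_rel:
  assumes T: "\<And>a i j. i \<in> K \<Longrightarrow> j \<in> K \<Longrightarrow> Fr.ishom (par i j) (T a i j)"
    and T': "\<And>a i j. i \<in> K \<Longrightarrow> j \<in> K \<Longrightarrow> Fr.ishom (par i j) (T' a i j)"
    and ij: "i \<in> K" "j \<in> K" "k \<in> K" "l \<in> K"
  shows "Fr.ishom ((par i j + par k l) mod 2) (rel c d T T' a b i j k l)"
proof -
  have p: "(par i j + par k l) mod 2 = (par k l + par i j) mod 2"
    "(par i j + par k l) mod 2 = (par k j + par i l) mod 2"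
    unfolding mod_add_eq by (simp_all only: ac_simps)
  note [intro] = ishom_Fr_minus ishom_Fr_scal
  show ?thesis unfolding rel_def
    using ishom_Fr_mult[OF T[OF ij(1,2)] T'[OF ij(3,4)]] ishom_Fr_mult[OF T'[OF ij(3,4)] T[OF ij(1,2)]]
      ishom_Fr_mult[OF T[OF ij(3,2)] T'[OF ij(1,4)]] ishom_Fr_mult[OF T'[OF ij(3,2)] T[OF ij(1,4)]]
    unfolding p(1)[symmetric] p(2)[symmetric] by blast
qed

lemma RTT_rels_hom:
  assumes T: "\<And>a i j. i \<in> K \<Longrightarrow> j \<in> K \<Longrightarrow> Fr.ishom (par i j) (T a i j)"
    and T': "\<And>a i j. i \<in> K \<Longrightarrow> j \<in> K \<Longrightarrow> Fr.ishom (par i j) (T' a i j)"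
    and x: "x \<in> RTT_rels m n T T'"
  shows "\<exists>p. Fr.ishom p x"
proof -
  from x obtain a b i j k l where ij: "i \<in> K" "j \<in> K" "k \<in> K" "l \<in> K" and
    "x = (mat2_mult m n (in_first m (T (a - 1))) (in_second m (T' b)) i j k l
      - mat2_mult m n (in_first m (T a)) (in_second m (T' (b - 1))) i j k l
      - mat2_mult m n (Pmat m) (mat2_mult m n (in_first m (T a)) (in_second m (T' b))) i j k l)
      - (mat2_mult m n (in_second m (T' b)) (in_first m (T (a - 1))) i j k l
      - mat2_mult m n (in_second m (T' (b - 1))) (in_first m (T a)) i j k l
      - mat2_mult m n (mat2_mult m n (in_second m (T' b)) (in_first m (T a))) (Pmat m) i j k l)"
    unfolding RTT_rels_def Let_def by auto
  then show ?thesis using RTT_term[of T T', OF T T' ij] ishom_rel[of T T', OF T T' ij] by metis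
qed

lemma rel_mem:
  assumes T: "\<And>a i j. i \<in> K \<Longrightarrow> j \<in> K \<Longrightarrow> Fr.ishom (par i j) (T a i j)"
    and T': "\<And>a i j. i \<in> K \<Longrightarrow> j \<in> K \<Longrightarrow> Fr.ishom (par i j) (T' a i j)"
    and ij: "i \<in> K" "j \<in> K" "k \<in> K" "l \<in> K"
  shows "\<exists>c d. \<forall>a b. rel c d T T' a b i j k l \<in> RTT_rels m n T T'"
proof -
  have "{i, j, k, l} \<subseteq> K" using ij by auto
  then show ?thesis
    using RTT_term[of T T', OF T T' ij] unfolding RTT_rels_def Let_def by (smt (verit) mem_Collect_eq)
qed

section \<open>The ideal of relations and the double Yangian as its quotient\<close>

definition rels :: "ygen free_alg set" where
  "rels = RTT_rels m n t_ser t_ser \<union> RTT_rels m n tp_ser tp_ser \<union> RTT_rels m n t_ser tp_ser"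

lemma rels_hom: "x \<in> rels \<Longrightarrow> \<exists>p. Fr.ishom p x"
  unfolding rels_def using RTT_rels_hom ishom_t_ser ishom_tp_ser by (elim UnE) blast+

lemma rels_closed: "rels \<subseteq> carrier Fr"
  using rels_hom Fr.ishom_closed by blast

lemma DY_ideal_eq: "DY_ideal m n = Idl\<^bsub>Fr\<^esub> rels"
  by (simp add: DY_ideal_def rels_def)

lemma ideal_DY: "ideal (DY_ideal m n) Fr"
  unfolding DY_ideal_eq by (rule Fr.genideal_ideal[OF rels_closed])

lemma rels_DY: "rels \<subseteq> DY_ideal m n"
  unfolding DY_ideal_eq by (rule Fr.genideal_self[OF rels_closed])

text \<open>\<open>Idl\<close> is a plain ring ideal. Scalars are recovered as multiples of the
  unit. For the grading, the elements with both components in the ideal form an ideal that contains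
  the relations, and the generated ideal is the smallest such.\<close>

lemma superideal_DY: "superideal Fr (DY_ideal m n)"
proof -
  interpret J: ideal "DY_ideal m n" Fr by (rule ideal_DY)
  have sc: "scal Fr c x \<in> DY_ideal m n" if "x \<in> DY_ideal m n" for c x
    using J.I_l_closed[OF that, of "scal Fr c \<one>\<^bsub>Fr\<^esub>"] J.a_subset that
    by (auto simp: Fr.scal_mult_l)
  have sub: "Fr.subspace (DY_ideal m n)"
    unfolding Fr.subspace_def using J.a_subset J.zero_closed J.a_closed sc by auto
  let ?V = "{x \<in> carrier Fr. homog Fr 0 x \<in> DY_ideal m n \<and> homog Fr (Suc 0) x \<in> DY_ideal m n}"
  have "ideal ?V Fr"
  proof (rule idealI)
    show "ring Fr" by unfold_locales
    show "subgroup ?V (add_monoid Fr)"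
      by (rule Fr.add.subgroupI)
        (auto simp: Fr.homog_add Fr.homog_scal J.a_closed sc simp flip: Fr.scal_neg1
          intro!: exI[of _ "\<zero>\<^bsub>Fr\<^esub>"] J.zero_closed)
    fix a x assume "a \<in> ?V" "x \<in> carrier Fr"
    then show "x \<otimes>\<^bsub>Fr\<^esub> a \<in> ?V" "a \<otimes>\<^bsub>Fr\<^esub> x \<in> ?V"
      by (auto simp: Fr.homog_prod intro!: J.a_closed intro: J.I_l_closed J.I_r_closed)
  qed
  moreover have "rels \<subseteq> ?V"
  proof
    fix x assume x: "x \<in> rels"
    then obtain p where p: "Fr.ishom p x" using rels_hom by blast
    then show "x \<in> ?V" using x rels_DY J.zero_closed Fr.ishom_closed[OF p] by (auto simp: Fr.ishomD[OF p])
  qed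
  ultimately have "DY_ideal m n \<subseteq> ?V" unfolding DY_ideal_eq by (rule Fr.genideal_minimal)
  then show ?thesis
    by unfold_locales (use sub J.I_l_closed J.I_r_closed in \<open>auto simp: less_2_cases_iff\<close>)
qed

sublocale DI: superideal Fr "DY_ideal m n" by (rule superideal_DY)

abbreviation A :: "ygen free_alg set superalg" where "A \<equiv> DY m n"

lemma superalgebra_DY: "superalgebra A"
  unfolding DY_def by (rule DI.superalgebra_quot) unfold_locales

sublocale A: superalgebra A by (rule superalgebra_DY)

abbreviation cl :: "ygen free_alg \<Rightarrow> ygen free_alg set" where "cl \<equiv> DY_class m n"

lemma salg_hom_cl: "salg_hom Fr A cl"
  using DI.salg_hom_cls by (simp add: DY_def DY_class_def[abs_def])

lemmas cl_hom = salg_homD[OF salg_hom_cl]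

lemma carrier_A: "carrier A = cl ` carrier Fr"
  using DI.carrier_quot by (simp add: DY_def DY_class_def[abs_def])

lemma cl_zero: "x \<in> DY_ideal m n \<Longrightarrow> cl x = \<zero>\<^bsub>A\<^esub>"
  using DI.cls_eq_zero_iff[of x] DI.I.a_Hcarr[of x] by (simp add: DY_def DY_class_def)

lemma ishom_cl: "Fr.ishom p x \<Longrightarrow> A.ishom p (cl x)"
  by (rule Fr.ishom_image[OF salg_hom_cl superalgebra_DY])

definition t :: "nat \<Rightarrow> nat \<Rightarrow> nat \<Rightarrow> ygen free_alg set" where "t r i j = cl (t_coeff i j r)"
definition tp :: "nat \<Rightarrow> nat \<Rightarrow> nat \<Rightarrow> ygen free_alg set" where "tp s i j = cl (tp_coeff i j s)"
text \<open>The generator with upper index \<open>-(s+1)\<close>, numbered by the power of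
  \<open>u\<close> at which it occurs in \<open>t^+\<close>; its filtration degree is
  \<open>Suc s\<close>.\<close>

definition g :: "nat \<Rightarrow> nat \<Rightarrow> nat \<Rightarrow> ygen free_alg set" where "g s i j = cl (gen_elem (i, j, - int (Suc s)))"

lemma t_hom: "i \<in> K \<Longrightarrow> j \<in> K \<Longrightarrow> A.ishom (par i j) (t r i j)"
  unfolding t_def by (intro ishom_cl ishom_t)

lemma tp_hom: "i \<in> K \<Longrightarrow> j \<in> K \<Longrightarrow> A.ishom (par i j) (tp s i j)"
  unfolding tp_def by (intro ishom_cl ishom_tp)

lemma g_hom: "i \<in> K \<Longrightarrow> j \<in> K \<Longrightarrow> A.ishom (par i j) (g s i j)"
  unfolding g_def by (intro ishom_cl ishom_gen) (simp add: ygens_def)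

lemma t_closed [simp]: "i \<in> K \<Longrightarrow> j \<in> K \<Longrightarrow> t r i j \<in> carrier A"
  and tp_closed [simp]: "i \<in> K \<Longrightarrow> j \<in> K \<Longrightarrow> tp r i j \<in> carrier A"
  and g_closed [simp]: "i \<in> K \<Longrightarrow> j \<in> K \<Longrightarrow> g r i j \<in> carrier A"
  using t_hom tp_hom g_hom A.ishom_closed by blast+

definition dl :: "nat \<Rightarrow> nat \<Rightarrow> ygen free_alg set" where
  "dl i j = (if i = j then \<one>\<^bsub>A\<^esub> else \<zero>\<^bsub>A\<^esub>)"

lemma t_0: "t 0 i j = dl i j"
  using cl_hom(4,5) by (simp add: t_def t_coeff_def dl_def Fr_simps)

lemma cl_minus: "x \<in> carrier Fr \<Longrightarrow> y \<in> carrier Fr \<Longrightarrow> cl (x - y) = cl x \<ominus>\<^bsub>A\<^esub> cl y"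
  by (simp flip: Fr_minus add: Fr.minus_scal A.minus_scal cl_hom)

lemma tp_eq:
  assumes "i \<in> K" "j \<in> K"
  shows "tp s i j = (if s = 0 then dl i j else \<zero>\<^bsub>A\<^esub>) \<ominus>\<^bsub>A\<^esub> g s i j"
proof -
  have gc: "gen_elem (i, j, - int (Suc s)) \<in> carrier Fr"
    using ishom_gen[of i j "- int (Suc s)"] assms Fr.ishom_closed by (simp add: ygens_def)
  have "(if s = 0 \<and> i = j then 1 else 0) \<in> carrier Fr" "cl (if s = 0 \<and> i = j then 1 else 0) =
      (if s = 0 then dl i j else \<zero>\<^bsub>A\<^esub>)"
    using cl_hom(4,5) Fr.one_mem Fr.zero_closed by (auto simp: Fr_simps dl_def)
  then show ?thesis using gc by (simp add: tp_def tp_coeff_def g_def cl_minus)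
qed

lemma t_gen: "r > 0 \<Longrightarrow> t r i j = cl (gen_elem (i, j, int r))"
  by (simp add: t_def t_coeff_def)

text \<open>The factor \<open>v\<close> of the cleared relation lowers the index by one, and below
  its constant term the series \<open>t^+\<close> has coefficient zero.\<close>

definition tpm :: "nat \<Rightarrow> nat \<Rightarrow> nat \<Rightarrow> ygen free_alg set" where
  "tpm s i j = (if s = 0 then \<zero>\<^bsub>A\<^esub> else tp (s - 1) i j)"

text \<open>The coefficient of \<open>u^-r v^s\<close> in the relation between \<open>T\<close> and
  \<open>T^+\<close>, solved for the product with the highest \<open>t\<close> on the left. All
  summands after the first contain \<open>t\<close> of order \<open>r\<close> only, which drives an
  induction. The two terms with \<open>tpm\<close> are kept together because their constant parts
  cancel.\<close>

lemma mixed_relation: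
  assumes ij: "i \<in> K" "j \<in> K" "k \<in> K" "l \<in> K"
  shows "\<exists>c d. \<forall>r s. scal A (e1 i j k l) (t (Suc r) i j \<otimes>\<^bsub>A\<^esub> tp s k l) =
    scal A (e2 i j k l) (tp s k l \<otimes>\<^bsub>A\<^esub> t (Suc r) i j)
    \<oplus>\<^bsub>A\<^esub> (scal A (e1 i j k l) (t r i j \<otimes>\<^bsub>A\<^esub> tpm s k l) \<ominus>\<^bsub>A\<^esub> scal A (e2 i j k l) (tpm s k l \<otimes>\<^bsub>A\<^esub> t r i j))
    \<oplus>\<^bsub>A\<^esub> scal A c (t r k j \<otimes>\<^bsub>A\<^esub> tp s i l) \<ominus>\<^bsub>A\<^esub> scal A d (tp s k j \<otimes>\<^bsub>A\<^esub> t r i l)"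
proof -
  obtain c d where cd: "\<And>a b. rel c d t_ser tp_ser a b i j k l \<in> RTT_rels m n t_ser tp_ser"
    using rel_mem[of t_ser tp_ser, OF ishom_t_ser ishom_tp_ser ij] by blast
  have "scal A (e1 i j k l) (t (Suc r) i j \<otimes>\<^bsub>A\<^esub> tp s k l) =
    scal A (e2 i j k l) (tp s k l \<otimes>\<^bsub>A\<^esub> t (Suc r) i j)
    \<oplus>\<^bsub>A\<^esub> (scal A (e1 i j k l) (t r i j \<otimes>\<^bsub>A\<^esub> tpm s k l) \<ominus>\<^bsub>A\<^esub> scal A (e2 i j k l) (tpm s k l \<otimes>\<^bsub>A\<^esub> t r i j))
    \<oplus>\<^bsub>A\<^esub> scal A c (t r k j \<otimes>\<^bsub>A\<^esub> tp s i l) \<ominus>\<^bsub>A\<^esub> scal A d (tp s k j \<otimes>\<^bsub>A\<^esub> t r i l)" for r s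
  proof -
    let ?a = "- int r" and ?b = "int s"
    have z: "cl (rel c d t_ser tp_ser ?a ?b i j k l) = \<zero>\<^bsub>A\<^esub>"
      using cd rels_DY by (intro cl_zero) (auto simp: rels_def)
    have ts: "t_ser ?a = (\<lambda>i j. t_coeff i j r)" "t_ser (?a - 1) = (\<lambda>i j. t_coeff i j (Suc r))"
      "tp_ser ?b = (\<lambda>i j. tp_coeff i j s)"
      by (auto simp: t_ser_def tp_ser_def fun_eq_iff nat_add_distrib intro!: arg_cong[of _ _ "t_coeff _ _"])
    have tsm: "cl (tp_ser (?b - 1) k l) = tpm s k l"
      using cl_hom(4) by (auto simp: tp_ser_def tpm_def tp_def Fr_simps nat_diff_distrib)
    have tsc: "tp_ser (?b - 1) k l \<in> carrier Fr" using ishom_tp_ser ij Fr.ishom_closed by blast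
    note Fc = Fr.ishom_closed[OF ishom_t] Fr.ishom_closed[OF ishom_tp]
    have clm: "cl (x * y) = cl x \<otimes>\<^bsub>A\<^esub> cl y" "x * y \<in> carrier Fr" "x - y \<in> carrier Fr"
      if "x \<in> carrier Fr" "y \<in> carrier Fr" for x y
      using that cl_hom(3)[of x y] Fr.mult_closed[of x y] Fr.minus_closed[of x y] Fr_minus[of x y]
      by (simp_all only: Fr_simps)
    have cls: "cl (cscal e x) = scal A e (cl x)" "cscal e x \<in> carrier Fr" if "x \<in> carrier Fr" for x e
      using that cl_hom(6)[of x e] Fr.scal_closed[of x e] by (simp_all only: Fr_simps)
    have e: "(scal A (e1 i j k l) (t (Suc r) i j \<otimes>\<^bsub>A\<^esub> tp s k l)
        \<ominus>\<^bsub>A\<^esub> scal A (e1 i j k l) (t r i j \<otimes>\<^bsub>A\<^esub> tpm s k l) \<ominus>\<^bsub>A\<^esub> scal A c (t r k j \<otimes>\<^bsub>A\<^esub> tp s i l))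
        \<ominus>\<^bsub>A\<^esub> (scal A (e2 i j k l) (tp s k l \<otimes>\<^bsub>A\<^esub> t (Suc r) i j)
        \<ominus>\<^bsub>A\<^esub> scal A (e2 i j k l) (tpm s k l \<otimes>\<^bsub>A\<^esub> t r i j) \<ominus>\<^bsub>A\<^esub> scal A d (tp s k j \<otimes>\<^bsub>A\<^esub> t r i l)) = \<zero>\<^bsub>A\<^esub>"
      using z unfolding rel_def ts t_def tp_def tsm[symmetric]
      by (simp only: clm cls cl_minus Fc ij tsc)
    have tpmc: "tpm s k l \<in> carrier A" using ij by (simp add: tpm_def)
    have alg: "x1 = y1 \<oplus>\<^bsub>A\<^esub> (x2 \<ominus>\<^bsub>A\<^esub> y2) \<oplus>\<^bsub>A\<^esub> x3 \<ominus>\<^bsub>A\<^esub> y3"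
      if "(x1 \<ominus>\<^bsub>A\<^esub> x2 \<ominus>\<^bsub>A\<^esub> x3) \<ominus>\<^bsub>A\<^esub> (y1 \<ominus>\<^bsub>A\<^esub> y2 \<ominus>\<^bsub>A\<^esub> y3) = \<zero>\<^bsub>A\<^esub>"
        "x1 \<in> carrier A" "x2 \<in> carrier A" "x3 \<in> carrier A" "y1 \<in> carrier A" "y2 \<in> carrier A" "y3 \<in> carrier A"
      for x1 x2 x3 y1 y2 y3
    proof -
      have "x1 \<ominus>\<^bsub>A\<^esub> x2 \<ominus>\<^bsub>A\<^esub> x3 = y1 \<ominus>\<^bsub>A\<^esub> y2 \<ominus>\<^bsub>A\<^esub> y3" using that by (simp add: A.r_right_minus_eq)
      then have "(x1 \<ominus>\<^bsub>A\<^esub> x2 \<ominus>\<^bsub>A\<^esub> x3) \<oplus>\<^bsub>A\<^esub> (x2 \<oplus>\<^bsub>A\<^esub> x3) = (y1 \<ominus>\<^bsub>A\<^esub> y2 \<ominus>\<^bsub>A\<^esub> y3) \<oplus>\<^bsub>A\<^esub> (x2 \<oplus>\<^bsub>A\<^esub> x3)" by simp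
      moreover have "(x1 \<ominus>\<^bsub>A\<^esub> x2 \<ominus>\<^bsub>A\<^esub> x3) \<oplus>\<^bsub>A\<^esub> (x2 \<oplus>\<^bsub>A\<^esub> x3) = x1"
      proof -
        have "x1 \<ominus>\<^bsub>A\<^esub> x2 \<ominus>\<^bsub>A\<^esub> x3 = x1 \<oplus>\<^bsub>A\<^esub> \<ominus>\<^bsub>A\<^esub> (x2 \<oplus>\<^bsub>A\<^esub> x3)"
          using that(2-4) by (simp add: A.minus_eq A.minus_add A.a_assoc)
        then show ?thesis using that(2-4) by (simp add: A.a_assoc[of x1] A.l_neg)
      qed
      moreover have "(y1 \<ominus>\<^bsub>A\<^esub> y2 \<ominus>\<^bsub>A\<^esub> y3) \<oplus>\<^bsub>A\<^esub> (x2 \<oplus>\<^bsub>A\<^esub> x3) = y1 \<oplus>\<^bsub>A\<^esub> (x2 \<ominus>\<^bsub>A\<^esub> y2) \<oplus>\<^bsub>A\<^esub> x3 \<ominus>\<^bsub>A\<^esub> y3"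
        using that by (simp add: A.minus_eq A.a_ac)
      ultimately show ?thesis by simp
    qed
    show ?thesis by (rule alg[OF e]) (use ij tpmc in auto)
  qed
  then show ?thesis by blast
qed

end

subsection \<open>Reordering\<close>

context yangian
begin

abbreviation D :: "nat \<Rightarrow> ygen free_alg set set" where "D \<equiv> Yplus_filt m n"
abbreviation Y :: "ygen free_alg set set" where "Y \<equiv> Ysub m n"
abbreviation negw :: "ygen list set" where "negw \<equiv> lists {(i, j, r) \<in> ygens m n. r < 0}"
abbreviation deg :: "ygen list \<Rightarrow> int" where "deg w \<equiv> \<Sum>(i, j, r)\<leftarrow>w. - r"
abbreviation mcl :: "ygen list \<Rightarrow> ygen free_alg set" where "mcl w \<equiv> cl (FS.mon w)"

lemma negw_lists: "w \<in> negw \<Longrightarrow> w \<in> lists (ygens m n)"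
  by auto

lemma mon_Fr: "w \<in> lists (ygens m n) \<Longrightarrow> FS.mon w \<in> carrier Fr"
  using FS.mon_closed Fr_eq by simp

lemma mcl_hom: "w \<in> lists (ygens m n) \<Longrightarrow> A.ishom (word_parity (ygen_parity m) (Word w)) (mcl w)"
  by (rule ishom_cl[OF ishom_mon])

lemma mcl_closed: "w \<in> lists (ygens m n) \<Longrightarrow> mcl w \<in> carrier A"
  using mcl_hom A.ishom_closed by blast

lemma mcl_append:
  assumes "v \<in> lists (ygens m n)" "w \<in> lists (ygens m n)"
  shows "mcl (v @ w) = mcl v \<otimes>\<^bsub>A\<^esub> mcl w"
  using cl_hom(3)[OF mon_Fr[OF assms(1)] mon_Fr[OF assms(2)]] by (simp add: Fr_simps FS.mon_append)

lemma mcl_Nil: "mcl [] = \<one>\<^bsub>A\<^esub>"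
  using cl_hom(5) by (simp add: Fr_simps single_one[symmetric] zero_word_def del: single_one)

lemma D_eq: "D p = lspan A {mcl w | w. w \<in> negw \<and> int p \<le> deg w}"
  by (simp add: Yplus_filt_def)

lemma D_gens: "{mcl w | w. w \<in> negw \<and> int p \<le> deg w} \<subseteq> carrier A"
  using mcl_closed negw_lists by blast

lemma D_sub: "A.subspace (D p)"
  unfolding D_eq by (rule A.lspan_subspace[OF D_gens])

lemma D_cm: "w \<in> negw \<Longrightarrow> int p \<le> deg w \<Longrightarrow> mcl w \<in> D p"
  unfolding D_eq by (rule lspan.incl) blast

lemma D_least: "A.subspace V \<Longrightarrow> (\<And>w. w \<in> negw \<Longrightarrow> int p \<le> deg w \<Longrightarrow> mcl w \<in> V) \<Longrightarrow> D p \<subseteq> V"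
  unfolding D_eq by (rule A.lspan_least) blast+

lemma D_mono: "p \<le> q \<Longrightarrow> D q \<subseteq> D p"
  by (rule D_least[OF D_sub]) (auto intro: D_cm)

lemma D_closed: "x \<in> D p \<Longrightarrow> x \<in> carrier A"
  using A.subspaceD(1)[OF D_sub] .

lemma D_mult:
  assumes "x \<in> D p" "y \<in> D q"
  shows "x \<otimes>\<^bsub>A\<^esub> y \<in> D (p + q)"
proof (rule A.lspan_mult[OF D_gens D_gens D_sub _ assms[unfolded D_eq]])
  fix x y assume "x \<in> {mcl w | w. w \<in> negw \<and> int p \<le> deg w}" "y \<in> {mcl w | w. w \<in> negw \<and> int q \<le> deg w}"
  then obtain v w where vw: "x = mcl v" "v \<in> negw" "int p \<le> deg v" "y = mcl w" "w \<in> negw" "int q \<le> deg w"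
    by blast
  have "mcl (v @ w) \<in> D (p + q)" by (rule D_cm) (use vw in auto)
  then show "x \<otimes>\<^bsub>A\<^esub> y \<in> D (p + q)"
    unfolding vw(1,4) using mcl_append[OF negw_lists[OF vw(2)] negw_lists[OF vw(5)]] by simp
qed

lemma D_one: "\<one>\<^bsub>A\<^esub> \<in> D 0"
  using D_cm[of "[]" 0] by (simp add: mcl_Nil)

lemma D_graded: "A.graded (D p)"
  unfolding A.graded_def D_eq
proof (intro allI impI ballI)
  let ?S = "{mcl w | w. w \<in> negw \<and> int p \<le> deg w}"
  fix q x assume q: "q < (2::nat)" and x: "x \<in> lspan A ?S"
  have "homog A q y \<in> lspan A ?S" if y: "y \<in> ?S" for y
  proof -
    from y obtain w where w: "y = mcl w" "w \<in> negw" by (elim CollectE exE conjE)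
    define r where "r = word_parity (ygen_parity m) (Word w)"
    have "A.ishom r y" unfolding w(1) r_def by (rule mcl_hom[OF negw_lists[OF w(2)]])
    then have "homog A q y = y \<or> homog A q y = \<zero>\<^bsub>A\<^esub>" using A.ishomD[OF _ q] by simp
    then show ?thesis
    proof
      assume h: "homog A q y = y"
      show ?thesis unfolding h by (rule lspan.incl[OF y])
    next
      assume h: "homog A q y = \<zero>\<^bsub>A\<^esub>"
      show ?thesis unfolding h by (rule lspan.zero)
    qed
  qed
  from A.lspan_homog[OF D_gens q this x] show "homog A q x \<in> lspan A ?S" .
qed

lemma single_gen: "mcl [(i, j, r)] = cl (gen_elem (i, j, r))"
  by (simp add: gen_elem_def)

lemma g_D: "i \<in> K \<Longrightarrow> j \<in> K \<Longrightarrow> g s i j \<in> D (Suc s)"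
  unfolding g_def single_gen[symmetric] by (rule D_cm) (auto simp: ygens_def)

lemma Y_gens: "{cl (gen_elem (i, j, r)) | i j r. (i, j, r) \<in> ygens m n \<and> r > 0} \<subseteq> carrier A"
  using ishom_cl[OF ishom_gen] A.ishom_closed by blast

lemma Y_subalg: "A.subalgebra Y"
  unfolding Ysub_def by (rule A.subalg_subalgebra(1)[OF Y_gens])

lemma Y_graded: "A.graded Y"
  unfolding Ysub_def by (rule A.subalg_graded) (use ishom_cl[OF ishom_gen] in blast)

lemma Y_closed: "x \<in> Y \<Longrightarrow> x \<in> carrier A"
  and Y_sub: "A.subspace Y" and Y_one: "\<one>\<^bsub>A\<^esub> \<in> Y"
  and Y_mult: "x \<in> Y \<Longrightarrow> y \<in> Y \<Longrightarrow> x \<otimes>\<^bsub>A\<^esub> y \<in> Y"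
  using Y_subalg A.subspaceD(1) by (auto simp: A.subalgebra_def)

lemma t_Y:
  assumes "i \<in> K" "j \<in> K"
  shows "t r i j \<in> Y"
proof (cases "r = 0")
  case True
  then show ?thesis using Y_one A.subspaceD(2)[OF Y_sub] by (simp add: t_0 dl_def)
next
  case False
  then have "(i, j, int r) \<in> ygens m n \<and> int r > 0" using assms by (auto simp: ygens_def)
  then have "cl (gen_elem (i, j, int r)) \<in> Y"
    unfolding Ysub_def by (intro subsetD[OF A.subalg_subalgebra(2)[OF Y_gens]]) blast
  then show ?thesis using False by (simp add: t_gen)
qed

text \<open>Each degree lost by the left factor is paid for by a drop of the order of
  \<open>t\<close> from \<open>r\<close> to \<open>r'\<close>. This bounds the loss by
  \<open>r\<close>, however many generators are passed.\<close>

definition shift_span :: "nat \<Rightarrow> nat \<Rightarrow> ygen free_alg set set" where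
  "shift_span r p = lspan A {c \<otimes>\<^bsub>A\<^esub> t r' i j | c r' i j. r' \<le> r \<and> i \<in> K \<and> j \<in> K \<and> c \<in> D (p - (r - r'))}"

lemma shift_span_gens: "{c \<otimes>\<^bsub>A\<^esub> t r' i j | c r' i j. r' \<le> r \<and> i \<in> K \<and> j \<in> K \<and> c \<in> D (p - (r - r'))} \<subseteq> carrier A"
  using D_closed t_closed by blast

lemma shift_span_sub: "A.subspace (shift_span r p)"
  unfolding shift_span_def by (rule A.lspan_subspace[OF shift_span_gens])

lemma shift_span_mem: "r' \<le> r \<Longrightarrow> i \<in> K \<Longrightarrow> j \<in> K \<Longrightarrow> c \<in> D q \<Longrightarrow> p - (r - r') \<le> q \<Longrightarrow> c \<otimes>\<^bsub>A\<^esub> t r' i j \<in> shift_span r p"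
  unfolding shift_span_def by (rule lspan.incl) (use D_mono in blast)

lemma shift_span_least:
  "A.subspace V \<Longrightarrow> (\<And>c r' i j. r' \<le> r \<Longrightarrow> i \<in> K \<Longrightarrow> j \<in> K \<Longrightarrow> c \<in> D (p - (r - r')) \<Longrightarrow> c \<otimes>\<^bsub>A\<^esub> t r' i j \<in> V) \<Longrightarrow>
    shift_span r p \<subseteq> V"
  unfolding shift_span_def by (rule A.lspan_least) blast+

lemma shift_span_mono:
  assumes "r \<le> r'" "\<And>k. k \<le> r \<Longrightarrow> p' - (r' - k) \<le> p - (r - k)"
  shows "shift_span r p \<subseteq> shift_span r' p'"
  by (rule shift_span_least[OF shift_span_sub], rule shift_span_mem) (use assms in auto)

lemma e1_e2_same: "e1 i j k k = e2 i j k k"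
  by (simp add: e1_def e2_def power_add)

lemma e1_nonzero: "e1 i j k l \<noteq> 0"
  by (simp add: e1_def)

text \<open>\<open>tp\<close> and \<open>-g\<close> differ by a scalar matrix, which drops out
  because the two signs agree on the diagonal \<open>k = l\<close>. What remains contains only
  genuine generators, of positive degree.\<close>

lemma commutator:
  assumes ij: "i \<in> K" "j \<in> K" "k \<in> K" "l \<in> K"
  shows "scal A (e1 i j k l) (t r i j \<otimes>\<^bsub>A\<^esub> tp s k l) \<ominus>\<^bsub>A\<^esub> scal A (e2 i j k l) (tp s k l \<otimes>\<^bsub>A\<^esub> t r i j) =
    scal A (e2 i j k l) (g s k l \<otimes>\<^bsub>A\<^esub> t r i j) \<ominus>\<^bsub>A\<^esub> scal A (e1 i j k l) (t r i j \<otimes>\<^bsub>A\<^esub> g s k l)"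
proof -
  define d where "d = (if s = 0 then dl k l else \<zero>\<^bsub>A\<^esub>)"
  have d: "d \<in> carrier A" by (simp add: d_def dl_def)
  have tp: "tp s k l = d \<ominus>\<^bsub>A\<^esub> g s k l" unfolding d_def by (rule tp_eq[OF ij(3,4)])
  have c: "scal A (e1 i j k l) (t r i j \<otimes>\<^bsub>A\<^esub> d) = scal A (e2 i j k l) (d \<otimes>\<^bsub>A\<^esub> t r i j)"
    using ij by (auto simp: d_def dl_def e1_e2_same)
  have alg: "(x \<ominus>\<^bsub>A\<^esub> y) \<ominus>\<^bsub>A\<^esub> (x \<ominus>\<^bsub>A\<^esub> z) = z \<ominus>\<^bsub>A\<^esub> y"
    if "x \<in> carrier A" "y \<in> carrier A" "z \<in> carrier A" for x y z
  proof -
    have "(x \<ominus>\<^bsub>A\<^esub> y) \<ominus>\<^bsub>A\<^esub> (x \<ominus>\<^bsub>A\<^esub> z) = (z \<ominus>\<^bsub>A\<^esub> x) \<oplus>\<^bsub>A\<^esub> (x \<ominus>\<^bsub>A\<^esub> y)"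
      using that by (simp add: A.minus_eq A.minus_add A.a_ac)
    then show ?thesis using that by (simp add: A.minus_telescope)
  qed
  have "scal A (e1 i j k l) (t r i j \<otimes>\<^bsub>A\<^esub> tp s k l) =
      scal A (e2 i j k l) (d \<otimes>\<^bsub>A\<^esub> t r i j) \<ominus>\<^bsub>A\<^esub> scal A (e1 i j k l) (t r i j \<otimes>\<^bsub>A\<^esub> g s k l)"
    using ij d by (simp add: tp A.minus_distr_l A.scal_minus c)
  moreover have "scal A (e2 i j k l) (tp s k l \<otimes>\<^bsub>A\<^esub> t r i j) =
      scal A (e2 i j k l) (d \<otimes>\<^bsub>A\<^esub> t r i j) \<ominus>\<^bsub>A\<^esub> scal A (e2 i j k l) (g s k l \<otimes>\<^bsub>A\<^esub> t r i j)"
    using ij d by (simp add: tp A.minus_distr_r A.scal_minus)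
  ultimately show ?thesis using ij d by (simp add: alg)
qed

text \<open>Induction on \<open>r\<close> with the mixed relation. Among the terms of order
  \<open>r\<close>, those with \<open>tpm\<close> have degree \<open>s\<close> instead of
  \<open>Suc s\<close>, and for \<open>s = 0\<close> the constant part of \<open>tp\<close> leaves a
  bare \<open>t\<close>. In each case one degree is lost while the order drops by one, as
  \<open>shift_span\<close> permits.\<close>

lemma t_g_reorder:
  assumes "i \<in> K" "j \<in> K" "k \<in> K" "l \<in> K"
  shows "t r i j \<otimes>\<^bsub>A\<^esub> g s k l \<in> shift_span r (Suc s)"
  using assms
proof (induction r arbitrary: i j k l s)
  case 0
  show ?case
  proof (cases "i = j")
    case True
    have "g s k l \<otimes>\<^bsub>A\<^esub> t 0 i i \<in> shift_span 0 (Suc s)"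
      by (rule shift_span_mem[OF _ _ _ g_D]) (use 0 in auto)
    then show ?thesis using True 0 by (simp add: t_0 dl_def)
  next
    case False
    then show ?thesis using 0 A.subspaceD(2)[OF shift_span_sub] by (simp add: t_0 dl_def)
  qed
next
  case (Suc r)
  note ij = Suc.prems
  let ?V = "shift_span (Suc r) (Suc s)"
  note V = A.subspaceD[OF shift_span_sub[of "Suc r" "Suc s"]]
  obtain c d where rel: "scal A (e1 i j k l) (t (Suc r) i j \<otimes>\<^bsub>A\<^esub> tp s k l) =
    scal A (e2 i j k l) (tp s k l \<otimes>\<^bsub>A\<^esub> t (Suc r) i j)
    \<oplus>\<^bsub>A\<^esub> (scal A (e1 i j k l) (t r i j \<otimes>\<^bsub>A\<^esub> tpm s k l) \<ominus>\<^bsub>A\<^esub> scal A (e2 i j k l) (tpm s k l \<otimes>\<^bsub>A\<^esub> t r i j))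
    \<oplus>\<^bsub>A\<^esub> scal A c (t r k j \<otimes>\<^bsub>A\<^esub> tp s i l) \<ominus>\<^bsub>A\<^esub> scal A d (tp s k j \<otimes>\<^bsub>A\<^esub> t r i l)"
    using mixed_relation[OF ij] by blast
  have gt: "g s k l \<otimes>\<^bsub>A\<^esub> t r' i j \<in> ?V" if "r' \<le> Suc r" "i \<in> K" "j \<in> K" "k \<in> K" "l \<in> K" for r' i j k l
    by (rule shift_span_mem[OF that(1-3) g_D[OF that(4,5)]]) auto
  have tg: "t r i j \<otimes>\<^bsub>A\<^esub> g s k l \<in> ?V" if "i \<in> K" "j \<in> K" "k \<in> K" "l \<in> K" for i j k l
    by (rule subsetD[OF shift_span_mono Suc.IH[OF that]]) auto
  \<comment> \<open>Only for \<open>s = 0\<close> does \<open>tp s\<close> have a constant part; the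
    degree then falls from 1 to 0, matched by the order going from \<open>Suc r\<close> to
    \<open>r\<close>.\<close>
  have one_t: "s = 0 \<Longrightarrow> t r i j \<in> ?V" if "i \<in> K" "j \<in> K" for i j
    using shift_span_mem[OF _ that D_one, of r "Suc r" "Suc s"] that by simp
  have M: "scal A (e1 i j k l) (t r i j \<otimes>\<^bsub>A\<^esub> tpm s k l) \<ominus>\<^bsub>A\<^esub> scal A (e2 i j k l) (tpm s k l \<otimes>\<^bsub>A\<^esub> t r i j) \<in> ?V"
  proof (cases s)
    case 0
    then show ?thesis using ij V(2) by (simp add: tpm_def)
  next
    case (Suc s')
    have "t r i j \<otimes>\<^bsub>A\<^esub> g s' k l \<in> ?V"
      by (rule subsetD[OF shift_span_mono Suc.IH[OF ij]]) (use Suc in auto)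
    moreover have "g s' k l \<otimes>\<^bsub>A\<^esub> t r i j \<in> ?V"
      by (rule shift_span_mem[OF _ _ _ g_D]) (use ij Suc in auto)
    ultimately show ?thesis
      using commutator[OF ij, of r s'] V(4,6) by (simp add: tpm_def Suc)
  qed
  have U: "t r k j \<otimes>\<^bsub>A\<^esub> tp s i l \<in> ?V"
    unfolding tp_eq[OF ij(1,4)] dl_def
    using ij tg[OF ij(3,2,1,4)] one_t[OF ij(3,2)] V(2,6)
    by (auto simp: A.minus_distr_l)
  have W: "tp s k j \<otimes>\<^bsub>A\<^esub> t r i l \<in> ?V"
    unfolding tp_eq[OF ij(3,2)] dl_def
    using ij gt[of r, OF _ ij(1,4,3,2)] one_t[OF ij(1,4)] V(2,6)
    by (auto simp: A.minus_distr_r)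
  \<comment> \<open>This signed commutator lies in the span by the mixed relation, and by
    \<open>commutator\<close> it is the signed difference of \<open>g t\<close> and
    \<open>t g\<close>. As \<open>g t\<close> is in the span already, so is
    \<open>t g\<close>.\<close>
  define x where "x = scal A (e1 i j k l) (t (Suc r) i j \<otimes>\<^bsub>A\<^esub> tp s k l) \<ominus>\<^bsub>A\<^esub>
    scal A (e2 i j k l) (tp s k l \<otimes>\<^bsub>A\<^esub> t (Suc r) i j)"
  have "x \<in> ?V"
  proof -
    have alg: "(y \<oplus>\<^bsub>A\<^esub> z \<oplus>\<^bsub>A\<^esub> u \<ominus>\<^bsub>A\<^esub> w) \<ominus>\<^bsub>A\<^esub> y = z \<oplus>\<^bsub>A\<^esub> u \<ominus>\<^bsub>A\<^esub> w"
      if "y \<in> carrier A" "z \<in> carrier A" "u \<in> carrier A" "w \<in> carrier A" for y z u w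
    proof -
      have "(y \<oplus>\<^bsub>A\<^esub> z \<oplus>\<^bsub>A\<^esub> u \<ominus>\<^bsub>A\<^esub> w) \<ominus>\<^bsub>A\<^esub> y = (z \<oplus>\<^bsub>A\<^esub> u \<ominus>\<^bsub>A\<^esub> w) \<oplus>\<^bsub>A\<^esub> (y \<ominus>\<^bsub>A\<^esub> y)"
        using that by (simp add: A.minus_eq A.a_ac)
      then show ?thesis using that by (simp add: A.minus_eq A.r_neg)
    qed
    have "x = (scal A (e1 i j k l) (t r i j \<otimes>\<^bsub>A\<^esub> tpm s k l) \<ominus>\<^bsub>A\<^esub> scal A (e2 i j k l) (tpm s k l \<otimes>\<^bsub>A\<^esub> t r i j))
      \<oplus>\<^bsub>A\<^esub> scal A c (t r k j \<otimes>\<^bsub>A\<^esub> tp s i l) \<ominus>\<^bsub>A\<^esub> scal A d (tp s k j \<otimes>\<^bsub>A\<^esub> t r i l)"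
      unfolding x_def rel by (rule alg) (use ij V(1)[OF M] in auto)
    then show ?thesis using M U W V(3,4,6) by simp
  qed
  then have "scal A (e2 i j k l) (g s k l \<otimes>\<^bsub>A\<^esub> t (Suc r) i j) \<ominus>\<^bsub>A\<^esub> x \<in> ?V"
    using gt[of "Suc r", OF _ ij] V(4,6) by simp
  also have "scal A (e2 i j k l) (g s k l \<otimes>\<^bsub>A\<^esub> t (Suc r) i j) \<ominus>\<^bsub>A\<^esub> x =
      scal A (e1 i j k l) (t (Suc r) i j \<otimes>\<^bsub>A\<^esub> g s k l)"
  proof -
    have alg: "y \<ominus>\<^bsub>A\<^esub> (y \<ominus>\<^bsub>A\<^esub> z) = z" if "y \<in> carrier A" "z \<in> carrier A" for y z
      using that by (simp add: A.minus_eq A.minus_add A.r_neg2)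
    show ?thesis unfolding x_def commutator[OF ij] by (rule alg) (use ij in auto)
  qed
  finally have "scal A (inverse (e1 i j k l)) (scal A (e1 i j k l) (t (Suc r) i j \<otimes>\<^bsub>A\<^esub> g s k l)) \<in> ?V"
    by (rule V(4))
  then show ?case using ij e1_nonzero by (simp add: A.scal_scal)
qed

text \<open>Generators are passed one at a time. The order of \<open>t\<close> never increases on
  the way, so the losses telescope and amount to at most \<open>r\<close>.\<close>

lemma t_mcl_reorder:
  assumes "w \<in> negw" "i \<in> K" "j \<in> K"
  shows "t r i j \<otimes>\<^bsub>A\<^esub> mcl w \<in> shift_span r (nat (deg w))"
  using assms
proof (induction w arbitrary: r i j rule: list.induct)
  case Nil
  then show ?case using shift_span_mem[OF _ _ _ D_one, of r r i j 0] by (simp add: mcl_Nil)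
next
  case (Cons x w)
  obtain k l q where x: "x = (k, l, q)" by (cases x)
  \<comment> \<open>The head of the word has upper index \<open>q = -(s+1)\<close>, so its class is
    \<open>g s k l\<close>.\<close>
  define s where "s = nat (- q - 1)"
  have xs: "k \<in> K" "l \<in> K" "q = - int (Suc s)" "w \<in> negw"
    using Cons.prems by (auto simp: x ygens_def s_def)
  have dw: "0 \<le> deg w" using xs(4) by (induction w) auto
  have deg: "nat (deg (x # w)) = Suc s + nat (deg w)" using dw by (simp add: x xs(3) nat_add_distrib)
  let ?V = "shift_span r (Suc s + nat (deg w))"
  have cw: "mcl w \<in> carrier A" using mcl_closed negw_lists xs by blast
  have "mcl (x # w) = g s k l \<otimes>\<^bsub>A\<^esub> mcl w"
  proof -
    have "[x] \<in> lists (ygens m n)" "w \<in> lists (ygens m n)"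
      using xs negw_lists by (auto simp: x ygens_def)
    from mcl_append[OF this] show ?thesis by (simp add: x g_def single_gen xs(3))
  qed
  moreover have "shift_span r (Suc s) \<subseteq> {y \<in> carrier A. y \<otimes>\<^bsub>A\<^esub> mcl w \<in> ?V}"
  proof (rule shift_span_least[OF A.subspace_mult_r[OF shift_span_sub cw]])
    fix c r' i' j' assume c: "r' \<le> r" "i' \<in> K" "j' \<in> K" "c \<in> D (Suc s - (r - r'))"
    note cc = D_closed[OF c(4)]
    have "shift_span r' (nat (deg w)) \<subseteq> {y \<in> carrier A. c \<otimes>\<^bsub>A\<^esub> y \<in> ?V}"
    proof (rule shift_span_least[OF A.subspace_mult_l[OF shift_span_sub cc]])
      fix d r'' k' l' assume d: "r'' \<le> r'" "k' \<in> K" "l' \<in> K" "d \<in> D (nat (deg w) - (r' - r''))"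
      have "(c \<otimes>\<^bsub>A\<^esub> d) \<otimes>\<^bsub>A\<^esub> t r'' k' l' \<in> ?V"
        by (rule shift_span_mem[OF _ d(2,3) D_mult[OF c(4) d(4)]]) (use c d in auto)
      then show "d \<otimes>\<^bsub>A\<^esub> t r'' k' l' \<in> {y \<in> carrier A. c \<otimes>\<^bsub>A\<^esub> y \<in> ?V}"
        using cc D_closed[OF d(4)] d by (simp add: A.m_assoc)
    qed
    then have "c \<otimes>\<^bsub>A\<^esub> (t r' i' j' \<otimes>\<^bsub>A\<^esub> mcl w) \<in> ?V" using Cons.IH[OF xs(4) c(2,3)] by auto
    then show "c \<otimes>\<^bsub>A\<^esub> t r' i' j' \<in> {y \<in> carrier A. y \<otimes>\<^bsub>A\<^esub> mcl w \<in> ?V}"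
      using cc c cw by (simp add: A.m_assoc)
  qed
  then have "(t r i j \<otimes>\<^bsub>A\<^esub> g s k l) \<otimes>\<^bsub>A\<^esub> mcl w \<in> ?V"
    using t_g_reorder[OF Cons.prems(2,3) xs(1,2)] by blast
  ultimately show ?case unfolding deg using Cons.prems xs cw by (simp add: A.m_assoc)
qed

lemma t_reorder:
  assumes "x \<in> D p" "i \<in> K" "j \<in> K"
  shows "t r i j \<otimes>\<^bsub>A\<^esub> x \<in> shift_span r p"
proof -
  have "D p \<subseteq> {x \<in> carrier A. t r i j \<otimes>\<^bsub>A\<^esub> x \<in> shift_span r p}"
  proof (rule D_least[OF A.subspace_mult_l[OF shift_span_sub t_closed[OF assms(2,3)]]])
    fix w assume w: "w \<in> negw" "int p \<le> deg w"
    have "shift_span r (nat (deg w)) \<subseteq> shift_span r p" by (rule shift_span_mono) (use w in auto)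
    then show "mcl w \<in> {x \<in> carrier A. t r i j \<otimes>\<^bsub>A\<^esub> x \<in> shift_span r p}"
      using t_mcl_reorder[OF w(1) assms(2,3)] mcl_closed negw_lists w by blast
  qed
  then show ?thesis using assms(1) by auto
qed

definition right_span :: "nat \<Rightarrow> ygen free_alg set set \<Rightarrow> nat \<Rightarrow> ygen free_alg set set" where
  "right_span R Z p = lspan A {c \<otimes>\<^bsub>A\<^esub> z | c z. c \<in> D (p - R) \<and> z \<in> Z}"

text \<open>The \<open>reorder\<close> property of \<open>triangular\<close> for one element: the
  loss \<open>R\<close> and the finite set \<open>Z\<close> serve all degrees at once.\<close>

definition reord :: "ygen free_alg set \<Rightarrow> bool" where
  "reord y \<longleftrightarrow> (\<exists>R Z. finite Z \<and> Z \<subseteq> Y \<and> (\<forall>p. \<forall>x\<in>D p. y \<otimes>\<^bsub>A\<^esub> x \<in> right_span R Z p))"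

lemma right_span_sub: "Z \<subseteq> Y \<Longrightarrow> A.subspace (right_span R Z p)"
  unfolding right_span_def by (rule A.lspan_subspace) (use D_closed Y_closed in blast)

lemma right_span_mem: "c \<in> D (p - R) \<Longrightarrow> z \<in> Z \<Longrightarrow> c \<otimes>\<^bsub>A\<^esub> z \<in> right_span R Z p"
  unfolding right_span_def by (rule lspan.incl) blast

lemma right_span_least: "A.subspace V \<Longrightarrow> (\<And>c z. c \<in> D (p - R) \<Longrightarrow> z \<in> Z \<Longrightarrow> c \<otimes>\<^bsub>A\<^esub> z \<in> V) \<Longrightarrow> right_span R Z p \<subseteq> V"
  unfolding right_span_def by (rule A.lspan_least) blast+

lemma right_span_mono:
  assumes "R \<le> R'" "Z \<subseteq> Z'" "Z' \<subseteq> Y"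
  shows "right_span R Z p \<subseteq> right_span R' Z' p"
proof (rule right_span_least[OF right_span_sub[OF assms(3)] right_span_mem])
  show "c \<in> D (p - R')" if "c \<in> D (p - R)" for c
    using that D_mono[OF diff_le_mono2[OF assms(1)]] by blast
qed (use assms in auto)

lemma reordI:
  "finite Z \<Longrightarrow> Z \<subseteq> Y \<Longrightarrow> (\<And>p x. x \<in> D p \<Longrightarrow> y \<otimes>\<^bsub>A\<^esub> x \<in> right_span R Z p) \<Longrightarrow> reord y"
  unfolding reord_def by (intro exI[of _ R] exI[of _ Z]) simp

lemma reordE:
  assumes "reord y"
  obtains R Z where "finite Z" "Z \<subseteq> Y" "\<And>p x. x \<in> D p \<Longrightarrow> y \<otimes>\<^bsub>A\<^esub> x \<in> right_span R Z p"
proof -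
  obtain R Z where "finite Z" "Z \<subseteq> Y" "\<forall>p. \<forall>x\<in>D p. y \<otimes>\<^bsub>A\<^esub> x \<in> right_span R Z p"
    using assms unfolding reord_def by (elim exE conjE)
  then show ?thesis by (intro that[of Z R]) simp_all
qed

text \<open>Sums take the larger loss and the union of the two sets; products add the losses and
  take all products of the two sets. So only the generators of \<open>Y\<close> remain to be
  treated.\<close>

lemma reord_subalgebra: "A.subalgebra {y \<in> Y. reord y}"
  unfolding A.subalgebra_def A.subspace_def
proof (intro conjI ballI allI)
  show "{y \<in> Y. reord y} \<subseteq> carrier A" using Y_closed by auto
  have "\<zero>\<^bsub>A\<^esub> \<otimes>\<^bsub>A\<^esub> x \<in> right_span 0 {} p" if "x \<in> D p" for p x
    using D_closed[OF that] A.subspaceD(2)[OF right_span_sub, of "{}"] by simp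
  then show "\<zero>\<^bsub>A\<^esub> \<in> {y \<in> Y. reord y}"
    using A.subspaceD(2)[OF Y_sub] by (intro CollectI conjI reordI[of "{}"]) auto
  have "\<one>\<^bsub>A\<^esub> \<otimes>\<^bsub>A\<^esub> x \<in> right_span 0 {\<one>\<^bsub>A\<^esub>} p" if "x \<in> D p" for p x
    using right_span_mem[of x p 0 "\<one>\<^bsub>A\<^esub>" "{\<one>\<^bsub>A\<^esub>}"] that D_closed[OF that] by simp
  then show "\<one>\<^bsub>A\<^esub> \<in> {y \<in> Y. reord y}" using Y_one by (intro CollectI conjI reordI[of "{\<one>\<^bsub>A\<^esub>}"]) auto
  fix x y assume "x \<in> {y \<in> Y. reord y}" "y \<in> {y \<in> Y. reord y}"
  then have xy: "x \<in> Y" "reord x" "y \<in> Y" "reord y" by simp_all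
  obtain R Z where x: "finite Z" "Z \<subseteq> Y" "\<And>p u. u \<in> D p \<Longrightarrow> x \<otimes>\<^bsub>A\<^esub> u \<in> right_span R Z p"
    using reordE[OF xy(2)] by metis
  obtain R' Z' where y: "finite Z'" "Z' \<subseteq> Y" "\<And>p u. u \<in> D p \<Longrightarrow> y \<otimes>\<^bsub>A\<^esub> u \<in> right_span R' Z' p"
    using reordE[OF xy(4)] by metis
  note x = xy(1) x and y = xy(3) y
  note xy = Y_closed[OF x(1)] Y_closed[OF y(1)]
  have ZZ: "Z \<union> Z' \<subseteq> Y" using x y by auto
  have "(x \<oplus>\<^bsub>A\<^esub> y) \<otimes>\<^bsub>A\<^esub> u \<in> right_span (max R R') (Z \<union> Z') p" if u: "u \<in> D p" for p u
  proof -
    have "x \<otimes>\<^bsub>A\<^esub> u \<in> right_span (max R R') (Z \<union> Z') p" "y \<otimes>\<^bsub>A\<^esub> u \<in> right_span (max R R') (Z \<union> Z') p"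
      using x(4)[OF u] y(4)[OF u] right_span_mono[OF _ _ ZZ] by (meson max.cobounded1 max.cobounded2 sup_ge1 sup_ge2 subsetD)+
    then show ?thesis using A.subspaceD(3)[OF right_span_sub[OF ZZ]] xy D_closed[OF u] by (simp add: A.distr_r)
  qed
  then show "x \<oplus>\<^bsub>A\<^esub> y \<in> {y \<in> Y. reord y}"
    using A.subspaceD(3)[OF Y_sub x(1) y(1)] x(2) y(2) ZZ
    by (intro CollectI conjI reordI[of "Z \<union> Z'"]) auto
  fix c
  have "scal A c x \<otimes>\<^bsub>A\<^esub> u \<in> right_span R Z p" if "u \<in> D p" for p u
    using x(4)[OF that] A.subspaceD(4)[OF right_span_sub[OF x(3)]] xy D_closed[OF that] by (simp add: A.scal_mult_l)
  then show "scal A c x \<in> {y \<in> Y. reord y}"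
    using A.subspaceD(4)[OF Y_sub x(1)] x(2,3) by (intro CollectI conjI reordI[of Z]) auto
next
  fix x y assume "x \<in> {y \<in> Y. reord y}" "y \<in> {y \<in> Y. reord y}"
  then have xy: "x \<in> Y" "reord x" "y \<in> Y" "reord y" by simp_all
  obtain R Z where x: "finite Z" "Z \<subseteq> Y" "\<And>p u. u \<in> D p \<Longrightarrow> x \<otimes>\<^bsub>A\<^esub> u \<in> right_span R Z p"
    using reordE[OF xy(2)] by metis
  obtain R' Z' where y: "finite Z'" "Z' \<subseteq> Y" "\<And>p u. u \<in> D p \<Longrightarrow> y \<otimes>\<^bsub>A\<^esub> u \<in> right_span R' Z' p"
    using reordE[OF xy(4)] by metis
  note x = xy(1) x and y = xy(3) y
  note xy = Y_closed[OF x(1)] Y_closed[OF y(1)]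
  let ?Z = "(\<lambda>(a, b). a \<otimes>\<^bsub>A\<^esub> b) ` (Z \<times> Z')"
  have ZY: "?Z \<subseteq> Y" using x(3) y(3) Y_mult by auto
  have "(x \<otimes>\<^bsub>A\<^esub> y) \<otimes>\<^bsub>A\<^esub> u \<in> right_span (R + R') ?Z p" if u: "u \<in> D p" for p u
  proof -
    have "right_span R' Z' p \<subseteq> {v \<in> carrier A. x \<otimes>\<^bsub>A\<^esub> v \<in> right_span (R + R') ?Z p}"
    proof (rule right_span_least[OF A.subspace_mult_l[OF right_span_sub[OF ZY] xy(1)]])
      fix c z assume c: "c \<in> D (p - R')" and z: "z \<in> Z'"
      have zc: "z \<in> carrier A" using z y(3) Y_closed by auto
      have "right_span R Z (p - R') \<subseteq> {v \<in> carrier A. v \<otimes>\<^bsub>A\<^esub> z \<in> right_span (R + R') ?Z p}"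
      proof (rule right_span_least[OF A.subspace_mult_r[OF right_span_sub[OF ZY] zc]])
        fix c' z' assume c': "c' \<in> D (p - R' - R)" and z': "z' \<in> Z"
        have zc': "z' \<in> carrier A" using z' x(3) Y_closed by auto
        have "c' \<otimes>\<^bsub>A\<^esub> (z' \<otimes>\<^bsub>A\<^esub> z) \<in> right_span (R + R') ?Z p"
          using c' z z' by (intro right_span_mem) (auto simp: add.commute)
        then show "c' \<otimes>\<^bsub>A\<^esub> z' \<in> {v \<in> carrier A. v \<otimes>\<^bsub>A\<^esub> z \<in> right_span (R + R') ?Z p}"
          using D_closed[OF c'] zc zc' by (simp add: A.m_assoc)
      qed
      then have "(x \<otimes>\<^bsub>A\<^esub> c) \<otimes>\<^bsub>A\<^esub> z \<in> right_span (R + R') ?Z p" using x(4)[OF c] by auto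
      then show "c \<otimes>\<^bsub>A\<^esub> z \<in> {v \<in> carrier A. x \<otimes>\<^bsub>A\<^esub> v \<in> right_span (R + R') ?Z p}"
        using D_closed[OF c] zc xy by (simp add: A.m_assoc)
    qed
    then have "x \<otimes>\<^bsub>A\<^esub> (y \<otimes>\<^bsub>A\<^esub> u) \<in> right_span (R + R') ?Z p" using y(4)[OF u] by auto
    then show ?thesis using xy D_closed[OF u] by (simp add: A.m_assoc)
  qed
  moreover have "finite ?Z" using x(2) y(2) by simp
  ultimately show "x \<otimes>\<^bsub>A\<^esub> y \<in> {y \<in> Y. reord y}"
    using Y_mult[OF x(1) y(1)] ZY by (intro CollectI conjI reordI[of ?Z]) auto
qed

text \<open>\<open>shift_span r\<close> involves only the finitely many \<open>t\<close> of order at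
  most \<open>r\<close>, and its variable loss \<open>r - r'\<close> is at most
  \<open>r\<close>.\<close>

lemma reord_t:
  assumes "i \<in> K" "j \<in> K"
  shows "reord (t r i j)"
proof -
  let ?Z = "(\<lambda>(r', i, j). t r' i j) ` ({..r} \<times> K \<times> K)"
  have ZY: "?Z \<subseteq> Y" using t_Y by auto
  have "shift_span r p \<subseteq> right_span r ?Z p" for p
  proof (rule shift_span_least[OF right_span_sub[OF ZY]])
    fix c r' i j assume c: "r' \<le> r" "i \<in> K" "j \<in> K" "c \<in> D (p - (r - r'))"
    have "c \<in> D (p - r)" by (rule subsetD[OF D_mono c(4)]) simp
    moreover have "t r' i j \<in> ?Z" using c by (intro image_eqI[of _ _ "(r', i, j)"]) auto
    ultimately show "c \<otimes>\<^bsub>A\<^esub> t r' i j \<in> right_span r ?Z p" by (rule right_span_mem)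
  qed
  then have "t r i j \<otimes>\<^bsub>A\<^esub> x \<in> right_span r ?Z p" if "x \<in> D p" for p x
    using t_reorder[OF that assms] by blast
  then show ?thesis by (intro reordI[OF _ ZY]) auto
qed

lemma reord_Y: "y \<in> Y \<Longrightarrow> reord y"
proof -
  have "{cl (gen_elem (i, j, r)) | i j r. (i, j, r) \<in> ygens m n \<and> r > 0} \<subseteq> {y \<in> Y. reord y}"
  proof safe
    fix i j and r :: int assume ij: "(i, j, r) \<in> ygens m n" "r > 0"
    then have "i \<in> K" "j \<in> K" "cl (gen_elem (i, j, r)) = t (nat r) i j"
      by (auto simp: ygens_def t_gen)
    then show "cl (gen_elem (i, j, r)) \<in> Y" "reord (cl (gen_elem (i, j, r)))"
      using t_Y reord_t by simp_all
  qed
  from A.subalg_least[OF reord_subalgebra this] show "y \<in> Y \<Longrightarrow> reord y"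
    by (auto simp: Ysub_def)
qed

lemma generated_DY:
  assumes V: "A.subalgebra V" "D 0 \<subseteq> V" "Y \<subseteq> V"
  shows "carrier A \<subseteq> V"
proof -
  have Vs: "A.subspace V" "\<one>\<^bsub>A\<^esub> \<in> V" "\<And>x y. x \<in> V \<Longrightarrow> y \<in> V \<Longrightarrow> x \<otimes>\<^bsub>A\<^esub> y \<in> V"
    using V(1) by (auto simp: A.subalgebra_def)
  have "Fr.subspace {f \<in> carrier Fr. cl f \<in> V}"
    unfolding Fr.subspace_def using A.subspaceD[OF Vs(1)] cl_hom by auto
  moreover have "mcl w \<in> V" if "w \<in> lists (ygens m n)" for w
    using that
  proof (induction w)
    case Nil
    then show ?case using Vs by (simp add: mcl_Nil)
  next
    case (Cons x w)
    obtain i j r where x: "x = (i, j, r)" by (cases x)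
    have "mcl [x] \<in> V"
    proof (cases "r < 0")
      case True
      then have "mcl [x] \<in> D 0" using Cons by (intro D_cm) (auto simp: x)
      then show ?thesis using V by auto
    next
      case False
      then have "mcl [x] = t (nat r) i j" "i \<in> K" "j \<in> K" using Cons by (auto simp: x t_gen single_gen ygens_def)
      then show ?thesis using t_Y V by auto
    qed
    then show ?case using mcl_append[of "[x]" w] Cons Vs(3) by simp
  qed
  then have "FS.mon ` lists (ygens m n) \<subseteq> {f \<in> carrier Fr. cl f \<in> V}" using mon_Fr by auto
  ultimately have "lspan Fr (FS.mon ` lists (ygens m n)) \<subseteq> {f \<in> carrier Fr. cl f \<in> V}"
    by (rule Fr.lspan_least)
  then show ?thesis using FS.mon_span[unfolded Fr_eq] carrier_A by auto
qed

lemma triangular_DY: "triangular A D Y"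
proof unfold_locales
  fix p q x y
  show "A.subspace (D p)" by (rule D_sub)
  show "D (Suc p) \<subseteq> D p" by (rule D_mono) simp
  show "A.graded (D p)" by (rule D_graded)
  show "x \<in> D p \<Longrightarrow> y \<in> D q \<Longrightarrow> x \<otimes>\<^bsub>A\<^esub> y \<in> D (p + q)" by (rule D_mult)
  show "\<one>\<^bsub>A\<^esub> \<in> D 0" by (rule D_one)
  show "A.subalgebra Y" by (rule Y_subalg)
  show "A.graded Y" by (rule Y_graded)
  show "y \<in> Y \<Longrightarrow> \<exists>R Z. finite Z \<and> Z \<subseteq> Y \<and>
    (\<forall>p. \<forall>x\<in>D p. y \<otimes>\<^bsub>A\<^esub> x \<in> lspan A {c \<otimes>\<^bsub>A\<^esub> z |c z. c \<in> D (p - R) \<and> z \<in> Z})"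
    using reord_Y[of y] unfolding reord_def right_span_def .
  fix V
  show "A.subalgebra V \<Longrightarrow> D 0 \<subseteq> V \<Longrightarrow> Y \<subseteq> V \<Longrightarrow> carrier A \<subseteq> V" by (rule generated_DY)
qed

lemma Yplus_eq: "Yplus m n = D 0"
proof
  let ?S = "{cl (gen_elem (i, j, r)) | i j r. (i, j, r) \<in> ygens m n \<and> r < 0}"
  have S: "?S \<subseteq> carrier A" using ishom_cl[OF ishom_gen] A.ishom_closed by blast
  have "A.subalgebra (D 0)"
    unfolding A.subalgebra_def using D_sub D_one D_mult[of _ 0 _ 0] by auto
  moreover have "?S \<subseteq> D 0"
  proof safe
    fix i j and r :: int assume "(i, j, r) \<in> ygens m n" "r < 0"
    then show "cl (gen_elem (i, j, r)) \<in> D 0" using D_cm[of "[(i, j, r)]" 0] by (simp add: single_gen)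
  qed
  ultimately show "Yplus m n \<subseteq> D 0" unfolding Yplus_def by (rule A.subalg_least)
  have Yp: "A.subalgebra (Yplus m n)" "?S \<subseteq> Yplus m n"
    unfolding Yplus_def using A.subalg_subalgebra[OF S] by auto
  show "D 0 \<subseteq> Yplus m n"
  proof (rule D_least)
    show "A.subspace (Yplus m n)" using Yp by (simp add: A.subalgebra_def)
    fix w assume "w \<in> negw"
    then show "mcl w \<in> Yplus m n"
    proof (induction w)
      case Nil
      then show ?case using Yp by (simp add: mcl_Nil A.subalgebra_def)
    next
      case (Cons x w)
      then have "mcl [x] \<in> Yplus m n" using Yp(2) by (cases x) (auto simp: single_gen)
      then show ?case
        using mcl_append[of "[x]" w] Cons Yp(1) negw_lists[of w] by (auto simp: A.subalgebra_def)
    qed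
  qed
qed

end

section \<open>Homomorphisms and scalars acting on matrices of series\<close>

lemma hom_finsum:
  assumes "ring R" "ring S" "h \<in> ring_hom R S" "\<And>x. x \<in> A \<Longrightarrow> f x \<in> carrier R"
  shows "h (finsum R f A) = finsum S (\<lambda>x. h (f x)) A"
proof -
  interpret R: ring R by fact
  interpret S: ring S by fact
  have z: "h \<zero>\<^bsub>R\<^esub> = \<zero>\<^bsub>S\<^esub>" using ring_hom_zero[OF assms(3,1,2)] .
  show ?thesis
  proof (cases "finite A")
    case True
    then show ?thesis using assms(4)
    proof (induction A)
      case (insert a A)
      then have "f \<in> A \<rightarrow> carrier R" "f a \<in> carrier R" by auto
      moreover from this have "(\<lambda>x. h (f x)) \<in> A \<rightarrow> carrier S" "h (f a) \<in> carrier S"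
        using ring_hom_closed[OF assms(3)] by auto
      ultimately show ?case using insert ring_hom_add[OF assms(3)] by simp
    qed (simp add: z)
  qed (simp add: z)
qed

lemma hom_ser_mult:
  assumes "ring R" "ring S" "h \<in> ring_hom R S" "ring.carrier_ser R K M" "ring.carrier_ser R K L" "i \<in> K" "j \<in> K"
  shows "h (ser_mult R K M L r i j) = ser_mult S K (\<lambda>r i j. h (M r i j)) (\<lambda>r i j. h (L r i j)) r i j"
proof -
  interpret R: ring R by fact
  interpret S: ring S by fact
  have c: "M a i k \<in> carrier R" "L a k j \<in> carrier R" if "k \<in> K" for a k
    using that assms by (auto simp: entries_in_def)
  have hc: "h x \<in> carrier S" if "x \<in> carrier R" for x using ring_hom_closed[OF assms(3) that] .
  have "h (ser_mult R K M L r i j) = (\<Oplus>\<^bsub>S\<^esub>k\<in>K. h (\<Oplus>\<^bsub>R\<^esub>a\<in>{..r}. M a i k \<otimes>\<^bsub>R\<^esub> L (r - a) k j))"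
    unfolding ser_mult_def by (rule hom_finsum[OF assms(1-3)]) (use c in \<open>auto intro!: R.finsum_closed\<close>)
  also have "\<dots> = ser_mult S K (\<lambda>r i j. h (M r i j)) (\<lambda>r i j. h (L r i j)) r i j"
    unfolding ser_mult_def
  proof (rule S.finsum_cong'[OF refl])
    show "(\<lambda>k. \<Oplus>\<^bsub>S\<^esub>a\<in>{..r}. h (M a i k) \<otimes>\<^bsub>S\<^esub> h (L (r - a) k j)) \<in> K \<rightarrow> carrier S"
      using c hc by (auto intro!: S.finsum_closed)
    fix k assume k: "k \<in> K"
    have "h (\<Oplus>\<^bsub>R\<^esub>a\<in>{..r}. M a i k \<otimes>\<^bsub>R\<^esub> L (r - a) k j) = (\<Oplus>\<^bsub>S\<^esub>a\<in>{..r}. h (M a i k \<otimes>\<^bsub>R\<^esub> L (r - a) k j))"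
      by (rule hom_finsum[OF assms(1-3)]) (use c k in auto)
    also have "\<dots> = (\<Oplus>\<^bsub>S\<^esub>a\<in>{..r}. h (M a i k) \<otimes>\<^bsub>S\<^esub> h (L (r - a) k j))"
      by (rule S.finsum_cong'[OF refl]) (use c k hc ring_hom_mult[OF assms(3)] in auto)
    finally show "h (\<Oplus>\<^bsub>R\<^esub>a\<in>{..r}. M a i k \<otimes>\<^bsub>R\<^esub> L (r - a) k j) =
        (\<Oplus>\<^bsub>S\<^esub>a\<in>{..r}. h (M a i k) \<otimes>\<^bsub>S\<^esub> h (L (r - a) k j))" .
  qed
  finally show ?thesis .
qed

lemma hom_is_inv:
  assumes R: "ring R" and S: "ring S" and h: "h \<in> ring_hom R S" and M: "ring.carrier_ser R K M" "ring.carrier_ser R K L"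
    and inv: "ring.is_inv R K M L"
  shows "ring.is_inv S K (\<lambda>r i j. h (M r i j)) (\<lambda>r i j. h (L r i j))"
proof -
  have o: "h (ser_one R r i j) = ser_one S r i j" for r i j
    using ring_hom_one[OF h] ring_hom_zero[OF h R S] by (simp add: ser_one_def ser_const_def)
  show ?thesis
    using inv hom_ser_mult[OF R S h M] hom_ser_mult[OF R S h M(2,1)] o
    unfolding ring.is_inv_def[OF R] ring.is_inv_def[OF S] ser_eq_def by metis
qed

context ring
begin

lemma finsum_ser_const_r:
  assumes "j \<in> K" "finite K" "\<And>k. k \<in> K \<Longrightarrow> x k \<in> carrier R"
  shows "(\<Oplus>k\<in>K. x k \<otimes> (if k = j then \<one> else \<zero>)) = x j"
proof -
  have "(\<Oplus>k\<in>K. x k \<otimes> (if k = j then \<one> else \<zero>)) = (\<Oplus>k\<in>K. if j = k then x k else \<zero>)"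
    by (rule finsum_cong'[OF refl]) (use assms in auto)
  also have "\<dots> = x j" by (rule add.finprod_singleton) (use assms in auto)
  finally show ?thesis .
qed

lemma ser_mult_0:
  assumes "carrier_ser K M" "carrier_ser K L" "i \<in> K" "j \<in> K"
  shows "ser_mult R K M L 0 i j = (\<Oplus>k\<in>K. M 0 i k \<otimes> L 0 k j)"
  unfolding ser_mult_def
  by (rule finsum_cong'[OF refl]) (use assms in \<open>auto simp: entries_in_def\<close>)

end

context superalgebra
begin

lemma finsum_scal:
  assumes "\<And>x. x \<in> B \<Longrightarrow> f x \<in> carrier A"
  shows "scal A c (finsum A f B) = (\<Oplus>x\<in>B. scal A c (f x))"
proof (cases "finite B")
  case True
  then show ?thesis using assms
  proof (induction B)
    case (insert b B)
    then have "f \<in> B \<rightarrow> carrier A" "f b \<in> carrier A" "(\<lambda>x. scal A c (f x)) \<in> B \<rightarrow> carrier A" by auto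
    then show ?case using insert by (simp add: scal_add)
  qed simp
qed simp

text \<open>The factors \<open>M'\<close> and \<open>L'\<close> may carry signs depending on the
  summation indices, provided that the combined sign of each product is the same
  \<open>c\<close>.\<close>

lemma ser_mult_scal:
  assumes "carrier_ser K M" "carrier_ser K L" "i \<in> K" "j \<in> K"
    and "\<And>a k. k \<in> K \<Longrightarrow> M' a i k \<otimes> L' (r - a) k j = scal A c (M a i k \<otimes> L (r - a) k j)"
  shows "ser_mult A K M' L' r i j = scal A c (ser_mult A K M L r i j)"
proof -
  have cl: "M a i k \<otimes> L (r - a) k j \<in> carrier A" if "k \<in> K" for a k
    using that assms(1-4) by (auto simp: entries_in_def)
  have "scal A c (ser_mult A K M L r i j) = (\<Oplus>k\<in>K. scal A c (\<Oplus>a\<in>{..r}. M a i k \<otimes> L (r - a) k j))"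
    unfolding ser_mult_def by (rule finsum_scal) (use cl in \<open>auto intro!: finsum_closed\<close>)
  also have "\<dots> = ser_mult A K M' L' r i j"
    unfolding ser_mult_def
  proof (rule finsum_cong'[OF refl])
    show "(\<lambda>k. \<Oplus>a\<in>{..r}. M' a i k \<otimes> L' (r - a) k j) \<in> K \<rightarrow> carrier A"
      using cl assms(5) by (auto intro!: finsum_closed)
    fix k assume k: "k \<in> K"
    have "scal A c (\<Oplus>a\<in>{..r}. M a i k \<otimes> L (r - a) k j) = (\<Oplus>a\<in>{..r}. scal A c (M a i k \<otimes> L (r - a) k j))"
      by (rule finsum_scal) (use cl k in auto)
    then show "scal A c (\<Oplus>a\<in>{..r}. M a i k \<otimes> L (r - a) k j) = (\<Oplus>a\<in>{..r}. M' a i k \<otimes> L' (r - a) k j)"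
      by (simp add: assms(5)[OF k])
  qed
  finally show ?thesis by simp
qed

lemma entry_family_ishom:
  "entry_family (\<lambda>i j. {x. ishom ((bar m i + bar m j) mod 2) x})"
  unfolding entry_family_def
proof (intro conjI allI ballI)
  fix i j k x y
  show "{x. ishom ((bar m i + bar m j) mod 2) x} \<subseteq> carrier A" using ishom_closed by auto
  show "\<zero> \<in> {x. ishom ((bar m i + bar m j) mod 2) x}" by (simp add: ishom_zero)
  show "\<one> \<in> {x. ishom ((bar m i + bar m i) mod 2) x}" using ishom_one by (simp add: mult_2[symmetric])
  show "x \<oplus> y \<in> {x. ishom ((bar m i + bar m j) mod 2) x}"
    if "x \<in> {x. ishom ((bar m i + bar m j) mod 2) x}" "y \<in> {x. ishom ((bar m i + bar m j) mod 2) x}"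
    using that ishom_add by auto
  show "\<ominus> x \<in> {x. ishom ((bar m i + bar m j) mod 2) x}" if "x \<in> {x. ishom ((bar m i + bar m j) mod 2) x}"
    using that ishom_scal[of _ x "-1"] ishom_closed by (auto simp: scal_neg1)
  show "x \<otimes> y \<in> {x. ishom ((bar m i + bar m j) mod 2) x}"
    if "x \<in> {x. ishom ((bar m i + bar m k) mod 2) x}" "y \<in> {x. ishom ((bar m k + bar m j) mod 2) x}"
  proof -
    have "((bar m i + bar m k) mod 2 + (bar m k + bar m j) mod 2) mod 2 = (bar m i + bar m j) mod 2"
      by (auto simp: bar_def)
    then show ?thesis using that ishom_mult by (metis mem_Collect_eq)
  qed
qed

end

section \<open>The extended double Yangian\<close>

context yangian
begin

sublocale TR: triangular A D Y by (rule triangular_DY)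

lemma Fil_eq: "TR.Fil = DY_filt m n"
  by (simp add: TR.Fil_def[abs_def] DY_filt_def[abs_def])

lemma EC_eq: "DYc m n = TR.EC"
  by (simp add: DYc_def Fil_eq)

lemma F2_eq: "TR.F2 = DY2_filt m n"
proof (rule ext)
  show "TR.F2 p = DY2_filt m n p" for p
    unfolding TR.F2_def unfolding DY2_filt_def DY2_def Fil_eq ..
qed

lemma E2_eq: "DY2c m n = TR.E2"
  by (simp add: DY2c_def F2_eq DY2_def)

lemma ctens_eq: "ctens m n = TR.ct"
  by (simp add: ctens_def[abs_def] TR.ct_def[abs_def] F2_eq DY2_def)

abbreviation E :: "dyc superalg" where "E \<equiv> EDY m n"

lemma Yplus_compl_eq: "Yplus_compl m n = TR.lim ` {s. TR.cauchyD s}"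
proof -
  have "{s \<in> cauchy_seqs A D. \<forall>k. s k \<in> Yplus m n} = {s. TR.cauchyD s}"
    unfolding cauchy_seqs_def TR.cauchyD_def Yplus_eq using D_closed by blast
  then show ?thesis by (simp add: Yplus_compl_def Fil_eq)
qed

lemma E_eq: "E = TR.XA"
proof -
  have "{x \<otimes>\<^bsub>TR.EC\<^esub> cembed A (DY_filt m n) y | x y. x \<in> Yplus_compl m n \<and> y \<in> Y} =
      {TR.lim s \<otimes>\<^bsub>TR.EC\<^esub> TR.emb y | s y. TR.cauchyD s \<and> y \<in> Y}"
    unfolding Yplus_compl_eq Fil_eq by blast
  then show ?thesis by (simp add: EDY_def TR.XA_def TR.Ext_def EC_eq)
qed

sublocale E: superalgebra E
  unfolding E_eq by (rule TR.superalgebra_XA)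

lemma E_simps:
  "carrier E = TR.Ext" "x \<oplus>\<^bsub>E\<^esub> y = x \<oplus>\<^bsub>TR.EC\<^esub> y" "x \<otimes>\<^bsub>E\<^esub> y = x \<otimes>\<^bsub>TR.EC\<^esub> y"
  "\<zero>\<^bsub>E\<^esub> = \<zero>\<^bsub>TR.EC\<^esub>" "\<one>\<^bsub>E\<^esub> = \<one>\<^bsub>TR.EC\<^esub>" "scal E = scal TR.EC" "homog E = homog TR.EC"
  by (simp_all add: E_eq TR.XA_def)

lemma E_EC: "x \<in> carrier E \<Longrightarrow> x \<in> carrier TR.EC"
  using TR.EC.subspaceD(1)[OF TR.Ext_sub] by (simp add: E_simps)

lemma E_subalgebra: "E.subalgebra V \<Longrightarrow> TR.EC.subalgebra V"
  using E_EC unfolding E.subalgebra_def E.subspace_def TR.EC.subalgebra_def TR.EC.subspace_def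
  by (auto simp: E_simps)

lemma E_graded: "E.graded V \<Longrightarrow> TR.EC.graded V"
  unfolding E.graded_def TR.EC.graded_def by (simp add: E_simps)

abbreviation Vf :: "nat \<Rightarrow> nat \<Rightarrow> dyc set" where "Vf i j \<equiv> {x. E.ishom (par i j) x}"

lemma Vf: "E.entry_family Vf"
  by (rule E.entry_family_ishom)

lemma lim_ishom:
  assumes "TR.cauchyD s" "\<And>k. A.ishom p (s k)"
  shows "E.ishom p (TR.lim s)"
proof -
  have p: "p < 2" using assms(2)[of 0] by (simp add: A.ishom_def)
  have s: "s \<in> cauchy_seqs A TR.Fil" by (rule TR.cauchyD_cauchy[OF assms(1)])
  have "homog TR.EC p (TR.lim s) = TR.lim (\<lambda>k. homog A p (s k))" using TR.lim_hom(7)[OF p s] by simp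
  also have "\<dots> = TR.lim s" using assms(2) by (simp add: A.ishom_def)
  finally show ?thesis using p TR.Ext_lim[OF assms(1)] by (simp add: E.ishom_def E_simps)
qed

lemma EDY_class_eq: "EDY_class m n x = TR.emb (cl x)"
  by (simp add: EDY_class_def Fil_eq)

text \<open>Plain coefficients without the sign of \<open>T(u)\<close>; the signed matrices are
  recovered as \<open>sgd et\<close> and \<open>sgd ep\<close>.\<close>

definition et :: "dyc ser" where "et r i j = EDY_class m n (t_coeff i j r)"
definition ep :: "dyc ser" where "ep r i j = EDY_class m n (tp_coeff i j r)"

lemma emb_ishom:
  assumes "A.ishom p x" "TR.emb x \<in> carrier E"
  shows "E.ishom p (TR.emb x)"
  using assms TR.emb_hom(7)[of p x] by (auto simp: E.ishom_def A.ishom_def E_simps)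

lemma et_Vf: "entries_in K Vf et"
  unfolding entries_in_def et_def EDY_class_eq
  using TR.Ext_emb[OF t_Y] emb_ishom[OF t_hom] by (auto simp: E_simps t_def)

lemma tp_D: "i \<in> K \<Longrightarrow> j \<in> K \<Longrightarrow> tp s i j \<in> D 0"
  unfolding tp_eq dl_def using g_D D_mono[of 0 "Suc s"] D_one A.subspaceD(2,6)[OF D_sub]
  by (auto simp: subset_iff)

lemma ep_lim: "ep r i j = TR.lim (\<lambda>k. tp r i j)"
  by (simp add: ep_def EDY_class_eq tp_def cembed_def)

lemma ep_Vf: "entries_in K Vf ep"
  unfolding entries_in_def ep_lim
  using lim_ishom[OF TR.cauchyD_const[OF tp_D] tp_hom] by blast

lemma et_0:
  assumes "i \<in> K" "j \<in> K"
  shows "et 0 i j = ser_one E 0 i j"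
  using TR.emb_hom(4,5) t_0[of i j] by (simp add: et_def EDY_class_eq ser_one_def ser_const_def dl_def E_simps t_def)

subsection \<open>The constant term of the positive half\<close>

text \<open>The constant term is \<open>1 - X\<close> with \<open>X\<close> of degree one; its inverse is the geometric series.\<close>

definition X :: "ygen free_alg set ser" where "X = ser_const A (g 0)"

primrec Xp :: "nat \<Rightarrow> ygen free_alg set ser" where
  "Xp 0 = ser_one A"
| "Xp (Suc k) = ser_mult A K X (Xp k)"

abbreviation VA :: "nat \<Rightarrow> nat \<Rightarrow> ygen free_alg set set" where "VA i j \<equiv> {x. A.ishom (par i j) x}"

lemma VA: "A.entry_family VA"
  by (rule A.entry_family_ishom)

lemma X_VA: "entries_in K VA X"
  using g_hom A.ishom_zero[OF par_less] by (auto simp: entries_in_def X_def ser_const_def)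

lemma Xp_VA: "entries_in K VA (Xp k)"
proof (induction k)
  case 0
  show ?case unfolding Xp.simps by (rule A.entries_in_ser_one[OF VA])
next
  case (Suc k)
  then show ?case unfolding Xp.simps by (rule A.entries_in_ser_mult[OF VA X_VA])
qed

lemmas X_carrier_ser = A.entries_in_cmat[OF VA X_VA]
lemmas Xp_carrier_ser = A.entries_in_cmat[OF VA Xp_VA]

lemma Xp_Suc: "i \<in> K \<Longrightarrow> j \<in> K \<Longrightarrow> Xp (Suc k) r i j = (\<Oplus>\<^bsub>A\<^esub>l\<in>K. g 0 i l \<otimes>\<^bsub>A\<^esub> Xp k r l j)"
  unfolding Xp.simps X_def by (rule A.ser_mult_ser_const_l) (use Xp_carrier_ser in auto)

text \<open>The powers are built by left multiplication; that they commute with \<open>X\<close>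
  lets the same geometric series invert \<open>1 - X\<close> from the other side too.\<close>

lemma Xp_comm: "ser_eq K (ser_mult A K (Xp k) X) (Xp (Suc k))"
proof (induction k)
  case 0
  have "ser_eq K (ser_mult A K (ser_one A) X) X" "ser_eq K (ser_mult A K X (ser_one A)) X"
    using A.ser_mult_ser_one_l[OF _ X_carrier_ser] A.ser_mult_ser_one_r[OF _ X_carrier_ser] by simp_all
  then show ?case using ser_eq_trans ser_eq_sym by fastforce
next
  case (Suc k)
  have "ser_eq K (ser_mult A K (ser_mult A K X (Xp k)) X) (ser_mult A K X (ser_mult A K (Xp k) X))"
    by (rule A.ser_mult_assoc) (use X_carrier_ser Xp_carrier_ser in auto)
  also have "ser_eq K \<dots> (ser_mult A K X (Xp (Suc k)))"
    by (rule A.ser_mult_cong[OF ser_eq_refl Suc X_carrier_ser Xp_carrier_ser])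
  finally show ?case by simp
qed

lemma Xp_Suc': "i \<in> K \<Longrightarrow> j \<in> K \<Longrightarrow> Xp (Suc k) r i j = (\<Oplus>\<^bsub>A\<^esub>l\<in>K. Xp k r i l \<otimes>\<^bsub>A\<^esub> g 0 l j)"
  using Xp_comm[of k] A.ser_mult_ser_const_r[OF _ Xp_carrier_ser, of "g 0" i j k r] by (simp add: ser_eq_def X_def)

lemma Xp_D: "i \<in> K \<Longrightarrow> j \<in> K \<Longrightarrow> Xp k r i j \<in> D k"
proof (induction k arbitrary: i j)
  case 0
  then show ?case using D_one A.subspaceD(2)[OF D_sub] by (simp add: ser_one_def ser_const_def)
next
  case (Suc k)
  show ?case unfolding Xp_Suc[OF Suc.prems]
  proof (rule A.subspace_finsum[OF D_sub])
    fix l assume "l \<in> K"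
    then show "g 0 i l \<otimes>\<^bsub>A\<^esub> Xp k r l j \<in> D (Suc k)"
      using D_mult[OF g_D Suc.IH, of i l l j 0] Suc.prems by simp
  qed
qed

text \<open>Partial sums of the geometric series, still in the uncompleted algebra; the inverse is
  their limit.\<close>

definition geo :: "nat \<Rightarrow> nat \<Rightarrow> nat \<Rightarrow> ygen free_alg set" where
  "geo k i j = (\<Oplus>\<^bsub>A\<^esub>a\<in>{..k}. Xp a 0 i j)"

lemma Xp_closed: "i \<in> K \<Longrightarrow> j \<in> K \<Longrightarrow> Xp k r i j \<in> carrier A"
  using Xp_D D_closed by blast

lemma geo_Suc: "i \<in> K \<Longrightarrow> j \<in> K \<Longrightarrow> geo (Suc k) i j = geo k i j \<oplus>\<^bsub>A\<^esub> Xp (Suc k) 0 i j"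
  using Xp_closed A.finsum_Suc[of "\<lambda>a. Xp a 0 i j" k]
    A.a_comm[of "Xp (Suc k) 0 i j" "\<Oplus>\<^bsub>A\<^esub>a\<in>{..k}. Xp a 0 i j"]
  by (simp add: geo_def Pi_def del: Xp.simps)

lemma geo_hom: "i \<in> K \<Longrightarrow> j \<in> K \<Longrightarrow> A.ishom (par i j) (geo k i j)"
  unfolding geo_def by (rule A.ishom_finsum) (use Xp_VA in \<open>auto simp: entries_in_def\<close>)

lemma geo_closed: "i \<in> K \<Longrightarrow> j \<in> K \<Longrightarrow> geo k i j \<in> carrier A"
  using geo_hom A.ishom_closed by blast

lemma geo_D: "i \<in> K \<Longrightarrow> j \<in> K \<Longrightarrow> geo k i j \<in> D 0"
  unfolding geo_def by (rule A.subspace_finsum[OF D_sub]) (use Xp_D D_mono in blast)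

lemma geo_cauchy: "i \<in> K \<Longrightarrow> j \<in> K \<Longrightarrow> TR.cauchyD (\<lambda>k. geo k i j)"
proof (rule TR.cauchyD_steps[of _ "\<lambda>k. Suc k"])
  assume ij: "i \<in> K" "j \<in> K"
  show "geo k i j \<in> D 0" for k by (rule geo_D[OF ij])
  show "geo (Suc k) i j \<ominus>\<^bsub>A\<^esub> geo k i j \<in> D (Suc k)" for k
    using Xp_D[OF ij, of "Suc k" 0] TR.add_minus_cancel[OF geo_closed[OF ij] Xp_closed[OF ij]]
    by (simp only: geo_Suc[OF ij])
  show "\<exists>K. \<forall>k\<ge>K. p \<le> Suc k" for p by (intro exI[of _ p]) auto
qed

lemma tp_0: "i \<in> K \<Longrightarrow> j \<in> K \<Longrightarrow> tp 0 i j = dl i j \<ominus>\<^bsub>A\<^esub> g 0 i j"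
  by (simp add: tp_eq)

lemma dl_eq: "dl i j = (if i = j then \<one>\<^bsub>A\<^esub> else \<zero>\<^bsub>A\<^esub>)"
  by (rule dl_def)

lemma dl_closed: "dl i j \<in> carrier A"
  by (simp add: dl_def)

lemma finsum_minus:
  assumes "\<And>x. x \<in> B \<Longrightarrow> f x \<in> carrier A" "\<And>x. x \<in> B \<Longrightarrow> h x \<in> carrier A" "finite B"
  shows "(\<Oplus>\<^bsub>A\<^esub>x\<in>B. f x \<ominus>\<^bsub>A\<^esub> h x) = finsum A f B \<ominus>\<^bsub>A\<^esub> finsum A h B"
  using assms(3,1,2)
proof (induction B)
  case (insert b B)
  then have *: "f \<in> B \<rightarrow> carrier A" "h \<in> B \<rightarrow> carrier A" "f b \<in> carrier A" "h b \<in> carrier A"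
    "(\<lambda>x. f x \<ominus>\<^bsub>A\<^esub> h x) \<in> B \<rightarrow> carrier A" by auto
  then have "finsum A f B \<in> carrier A" "finsum A h B \<in> carrier A" by simp_all
  then show ?case using insert * by (simp add: A.minus_eq A.minus_add A.a_ac)
qed (simp add: A.minus_eq)

text \<open>Telescoping: \<open>(1 - X) X^a = X^a - X^(a+1)\<close>, so the partial sum up to
  \<open>k\<close> inverts \<open>1 - X\<close> with error \<open>X^(k+1)\<close>.\<close>

lemma geo_left:
  assumes ij: "i \<in> K" "j \<in> K"
  shows "(\<Oplus>\<^bsub>A\<^esub>l\<in>K. tp 0 i l \<otimes>\<^bsub>A\<^esub> geo k l j) = dl i j \<ominus>\<^bsub>A\<^esub> Xp (Suc k) 0 i j"
proof -
  have step: "(\<Oplus>\<^bsub>A\<^esub>l\<in>K. tp 0 i l \<otimes>\<^bsub>A\<^esub> Xp k 0 l j) = Xp k 0 i j \<ominus>\<^bsub>A\<^esub> Xp (Suc k) 0 i j" for k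
  proof -
    have "(\<Oplus>\<^bsub>A\<^esub>l\<in>K. tp 0 i l \<otimes>\<^bsub>A\<^esub> Xp k 0 l j) =
        (\<Oplus>\<^bsub>A\<^esub>l\<in>K. dl i l \<otimes>\<^bsub>A\<^esub> Xp k 0 l j \<ominus>\<^bsub>A\<^esub> g 0 i l \<otimes>\<^bsub>A\<^esub> Xp k 0 l j)"
      by (rule A.finsum_cong'[OF refl])
        (use ij Xp_closed dl_closed in \<open>auto simp: tp_0 A.minus_distr_r\<close>)
    also have "\<dots> = (\<Oplus>\<^bsub>A\<^esub>l\<in>K. dl i l \<otimes>\<^bsub>A\<^esub> Xp k 0 l j) \<ominus>\<^bsub>A\<^esub> (\<Oplus>\<^bsub>A\<^esub>l\<in>K. g 0 i l \<otimes>\<^bsub>A\<^esub> Xp k 0 l j)"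
      by (rule finsum_minus) (use ij Xp_closed dl_closed in auto)
    also have "(\<Oplus>\<^bsub>A\<^esub>l\<in>K. dl i l \<otimes>\<^bsub>A\<^esub> Xp k 0 l j) = Xp k 0 i j"
      unfolding dl_eq by (rule A.finsum_ser_const_l) (use ij Xp_closed in auto)
    finally show ?thesis by (simp only: Xp_Suc[OF ij])
  qed
  show ?thesis
  proof (induction k)
    case 0
    have "(\<Oplus>\<^bsub>A\<^esub>l\<in>K. tp 0 i l \<otimes>\<^bsub>A\<^esub> geo 0 l j) = (\<Oplus>\<^bsub>A\<^esub>l\<in>K. tp 0 i l \<otimes>\<^bsub>A\<^esub> Xp 0 0 l j)"
      by (rule A.finsum_cong'[OF refl]) (use ij Xp_closed[of _ _ 0 0] in \<open>auto simp: geo_def simp del: Xp.simps\<close>)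
    then show ?case unfolding step by (simp add: ser_one_def ser_const_def dl_eq)
  next
    case (Suc k)
    have "(\<Oplus>\<^bsub>A\<^esub>l\<in>K. tp 0 i l \<otimes>\<^bsub>A\<^esub> geo (Suc k) l j) =
        (\<Oplus>\<^bsub>A\<^esub>l\<in>K. tp 0 i l \<otimes>\<^bsub>A\<^esub> geo k l j \<oplus>\<^bsub>A\<^esub> tp 0 i l \<otimes>\<^bsub>A\<^esub> Xp (Suc k) 0 l j)"
      by (rule A.finsum_cong'[OF refl])
        (use ij Xp_closed geo_closed in \<open>auto simp: geo_Suc A.distr_l simp del: Xp.simps\<close>)
    also have "\<dots> = (\<Oplus>\<^bsub>A\<^esub>l\<in>K. tp 0 i l \<otimes>\<^bsub>A\<^esub> geo k l j) \<oplus>\<^bsub>A\<^esub> (\<Oplus>\<^bsub>A\<^esub>l\<in>K. tp 0 i l \<otimes>\<^bsub>A\<^esub> Xp (Suc k) 0 l j)"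
      by (rule A.finsum_addf) (use ij Xp_closed geo_closed in \<open>auto simp del: Xp.simps\<close>)
    also have "\<dots> = dl i j \<ominus>\<^bsub>A\<^esub> Xp (Suc (Suc k)) 0 i j"
      unfolding Suc step by (rule A.minus_telescope) (use ij Xp_closed dl_closed in \<open>auto simp del: Xp.simps\<close>)
    finally show ?case .
  qed
qed

lemma geo_right:
  assumes ij: "i \<in> K" "j \<in> K"
  shows "(\<Oplus>\<^bsub>A\<^esub>l\<in>K. geo k i l \<otimes>\<^bsub>A\<^esub> tp 0 l j) = dl i j \<ominus>\<^bsub>A\<^esub> Xp (Suc k) 0 i j"
proof -
  have step: "(\<Oplus>\<^bsub>A\<^esub>l\<in>K. Xp k 0 i l \<otimes>\<^bsub>A\<^esub> tp 0 l j) = Xp k 0 i j \<ominus>\<^bsub>A\<^esub> Xp (Suc k) 0 i j" for k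
  proof -
    have "(\<Oplus>\<^bsub>A\<^esub>l\<in>K. Xp k 0 i l \<otimes>\<^bsub>A\<^esub> tp 0 l j) =
        (\<Oplus>\<^bsub>A\<^esub>l\<in>K. Xp k 0 i l \<otimes>\<^bsub>A\<^esub> dl l j \<ominus>\<^bsub>A\<^esub> Xp k 0 i l \<otimes>\<^bsub>A\<^esub> g 0 l j)"
      by (rule A.finsum_cong'[OF refl])
        (use ij Xp_closed dl_closed in \<open>auto simp: tp_0 A.minus_distr_l\<close>)
    also have "\<dots> = (\<Oplus>\<^bsub>A\<^esub>l\<in>K. Xp k 0 i l \<otimes>\<^bsub>A\<^esub> dl l j) \<ominus>\<^bsub>A\<^esub> (\<Oplus>\<^bsub>A\<^esub>l\<in>K. Xp k 0 i l \<otimes>\<^bsub>A\<^esub> g 0 l j)"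
      by (rule finsum_minus) (use ij Xp_closed dl_closed in auto)
    also have "(\<Oplus>\<^bsub>A\<^esub>l\<in>K. Xp k 0 i l \<otimes>\<^bsub>A\<^esub> dl l j) = Xp k 0 i j"
      unfolding dl_eq by (rule A.finsum_ser_const_r) (use ij Xp_closed in auto)
    finally show ?thesis by (simp only: Xp_Suc'[OF ij])
  qed
  show ?thesis
  proof (induction k)
    case 0
    have "(\<Oplus>\<^bsub>A\<^esub>l\<in>K. geo 0 i l \<otimes>\<^bsub>A\<^esub> tp 0 l j) = (\<Oplus>\<^bsub>A\<^esub>l\<in>K. Xp 0 0 i l \<otimes>\<^bsub>A\<^esub> tp 0 l j)"
      by (rule A.finsum_cong'[OF refl]) (use ij Xp_closed[of _ _ 0 0] in \<open>auto simp: geo_def simp del: Xp.simps\<close>)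
    then show ?case unfolding step by (simp add: ser_one_def ser_const_def dl_eq)
  next
    case (Suc k)
    have "(\<Oplus>\<^bsub>A\<^esub>l\<in>K. geo (Suc k) i l \<otimes>\<^bsub>A\<^esub> tp 0 l j) =
        (\<Oplus>\<^bsub>A\<^esub>l\<in>K. geo k i l \<otimes>\<^bsub>A\<^esub> tp 0 l j \<oplus>\<^bsub>A\<^esub> Xp (Suc k) 0 i l \<otimes>\<^bsub>A\<^esub> tp 0 l j)"
      by (rule A.finsum_cong'[OF refl])
        (use ij Xp_closed geo_closed in \<open>auto simp: geo_Suc A.distr_r simp del: Xp.simps\<close>)
    also have "\<dots> = (\<Oplus>\<^bsub>A\<^esub>l\<in>K. geo k i l \<otimes>\<^bsub>A\<^esub> tp 0 l j) \<oplus>\<^bsub>A\<^esub> (\<Oplus>\<^bsub>A\<^esub>l\<in>K. Xp (Suc k) 0 i l \<otimes>\<^bsub>A\<^esub> tp 0 l j)"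
      by (rule A.finsum_addf) (use ij Xp_closed geo_closed in \<open>auto simp del: Xp.simps\<close>)
    also have "\<dots> = dl i j \<ominus>\<^bsub>A\<^esub> Xp (Suc (Suc k)) 0 i j"
      unfolding Suc step by (rule A.minus_telescope) (use ij Xp_closed dl_closed in \<open>auto simp del: Xp.simps\<close>)
    finally show ?case .
  qed
qed

lemma E_finsum_lim:
  assumes "finite S" "\<And>l. l \<in> S \<Longrightarrow> TR.cauchyD (u l)"
  shows "(\<lambda>k. \<Oplus>\<^bsub>A\<^esub>l\<in>S. u l k) \<in> cauchy_seqs A TR.Fil \<and>
    (\<Oplus>\<^bsub>E\<^esub>l\<in>S. TR.lim (u l)) = TR.lim (\<lambda>k. \<Oplus>\<^bsub>A\<^esub>l\<in>S. u l k)"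
  using assms
proof (induction S)
  case empty
  then show ?case using TR.lim_hom(4) TR.cauchy_const[of "\<zero>\<^bsub>A\<^esub>"] by (simp add: E_simps)
next
  case (insert x S)
  have u: "u l k \<in> carrier A" if "l \<in> insert x S" for l k
    using insert.prems[OF that] D_closed by (auto simp: TR.cauchyD_def)
  have eq: "(\<lambda>k. \<Oplus>\<^bsub>A\<^esub>l\<in>insert x S. u l k) = (\<lambda>k. u x k \<oplus>\<^bsub>A\<^esub> (\<Oplus>\<^bsub>A\<^esub>l\<in>S. u l k))"
    using insert u by (intro ext A.finsum_insert) auto
  have ux: "u x \<in> cauchy_seqs A TR.Fil" using TR.cauchyD_cauchy insert.prems by auto
  have "(\<Oplus>\<^bsub>E\<^esub>l\<in>insert x S. TR.lim (u l)) = TR.lim (u x) \<oplus>\<^bsub>E\<^esub> (\<Oplus>\<^bsub>E\<^esub>l\<in>S. TR.lim (u l))"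
    using insert TR.Ext_lim by (intro E.finsum_insert) (auto simp: E_simps)
  then show ?case
    unfolding eq using insert ux TR.lim_hom(2)[OF ux] TR.cauchy_add[OF ux] by (simp add: E_simps)
qed

text \<open>Each factor \<open>X\<close> contributes one degree, so the error lies in
  \<open>D (Suc k)\<close> and tends to zero.\<close>

lemma lim_geo:
  assumes "i \<in> K" "j \<in> K"
  shows "TR.lim (\<lambda>k. dl i j \<ominus>\<^bsub>A\<^esub> Xp (Suc k) 0 i j) = ser_one E 0 i j"
proof -
  have X: "Xp (Suc k) 0 i j \<in> D (Suc k)" "Xp (Suc k) 0 i j \<in> carrier A" for k
    using Xp_D Xp_closed assms by blast+
  have null: "(\<lambda>k. Xp (Suc k) 0 i j) \<in> TR.null"
  proof (rule TR.nullI)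
    show "Xp (Suc k) 0 i j \<in> carrier A" for k by (rule X)
    show "\<exists>K. \<forall>k\<ge>K. Xp (Suc k) 0 i j \<in> TR.Fil p" for p
    proof (intro exI allI impI)
      fix k assume "k \<ge> p"
      then have "D (Suc k) \<subseteq> TR.Fil p" using D_mono[of p "Suc k"] TR.D_Fil[of p] by auto
      then show "Xp (Suc k) 0 i j \<in> TR.Fil p" using X by blast
    qed
  qed
  have c: "(\<lambda>k. dl i j) \<in> cauchy_seqs A TR.Fil" by (rule TR.cauchy_const[OF dl_closed])
  have m: "(\<lambda>k. dl i j \<ominus>\<^bsub>A\<^esub> Xp (Suc k) 0 i j) = (\<lambda>k. dl i j) \<ominus>\<^bsub>TR.C\<^esub> (\<lambda>k. Xp (Suc k) 0 i j)"
    using TR.C_minus[OF c TR.null_cauchy[OF null]] by simp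
  have "TR.lim (\<lambda>k. dl i j) = TR.lim (\<lambda>k. dl i j \<ominus>\<^bsub>A\<^esub> Xp (Suc k) 0 i j)"
  proof (rule TR.lim_eqI[OF c])
    show "(\<lambda>k. dl i j \<ominus>\<^bsub>A\<^esub> Xp (Suc k) 0 i j) \<in> cauchy_seqs A TR.Fil"
      unfolding m using TR.C.minus_closed c TR.null_cauchy[OF null] by simp
    have "dl i j \<ominus>\<^bsub>A\<^esub> (dl i j \<ominus>\<^bsub>A\<^esub> Xp (Suc k) 0 i j) = Xp (Suc k) 0 i j" for k
      using X dl_closed by (simp add: A.minus_eq A.minus_add A.r_neg2)
    then show "(\<lambda>k. dl i j \<ominus>\<^bsub>A\<^esub> (dl i j \<ominus>\<^bsub>A\<^esub> Xp (Suc k) 0 i j)) \<in> TR.null" using null by simp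
  qed
  moreover have "TR.lim (\<lambda>k. dl i j) = ser_one E 0 i j"
    using TR.lim_hom(4,5) by (simp add: dl_def ser_one_def ser_const_def E_simps)
  ultimately show ?thesis by simp
qed

text \<open>Products and finite sums of limits are computed termwise on the representing sequences,
  so the identities for partial sums pass to the limit.\<close>

lemma ep_0_inverse:
  assumes ij: "i \<in> K" "j \<in> K"
  shows "(\<Oplus>\<^bsub>E\<^esub>l\<in>K. ep 0 i l \<otimes>\<^bsub>E\<^esub> TR.lim (\<lambda>k. geo k l j)) = ser_one E 0 i j"
    and "(\<Oplus>\<^bsub>E\<^esub>l\<in>K. TR.lim (\<lambda>k. geo k i l) \<otimes>\<^bsub>E\<^esub> ep 0 l j) = ser_one E 0 i j"
proof -
  have tp: "TR.cauchyD (\<lambda>k. tp 0 i j)" if "i \<in> K" "j \<in> K" for i j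
    by (rule TR.cauchyD_const[OF tp_D[OF that]])
  have "(\<Oplus>\<^bsub>E\<^esub>l\<in>K. ep 0 i l \<otimes>\<^bsub>E\<^esub> TR.lim (\<lambda>k. geo k l j)) =
      (\<Oplus>\<^bsub>E\<^esub>l\<in>K. TR.lim (\<lambda>k. tp 0 i l \<otimes>\<^bsub>A\<^esub> geo k l j))"
  proof (rule E.finsum_cong'[OF refl])
    show "(\<lambda>l. TR.lim (\<lambda>k. tp 0 i l \<otimes>\<^bsub>A\<^esub> geo k l j)) \<in> K \<rightarrow> carrier E"
      using TR.Ext_lim[OF TR.cauchyD_mult[OF tp geo_cauchy]] ij by (auto simp: E_simps)
    show "ep 0 i l \<otimes>\<^bsub>E\<^esub> TR.lim (\<lambda>k. geo k l j) = TR.lim (\<lambda>k. tp 0 i l \<otimes>\<^bsub>A\<^esub> geo k l j)" if "l \<in> K" for l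
      unfolding ep_lim E_simps
      using TR.lim_hom(3)[OF TR.cauchyD_cauchy[OF tp] TR.cauchyD_cauchy[OF geo_cauchy]] ij that by simp
  qed
  also have "\<dots> = TR.lim (\<lambda>k. \<Oplus>\<^bsub>A\<^esub>l\<in>K. tp 0 i l \<otimes>\<^bsub>A\<^esub> geo k l j)"
    using E_finsum_lim[of K "\<lambda>l k. tp 0 i l \<otimes>\<^bsub>A\<^esub> geo k l j"] TR.cauchyD_mult[OF tp geo_cauchy] ij by simp
  also have "\<dots> = ser_one E 0 i j" unfolding geo_left[OF ij] by (rule lim_geo[OF ij])
  finally show "(\<Oplus>\<^bsub>E\<^esub>l\<in>K. ep 0 i l \<otimes>\<^bsub>E\<^esub> TR.lim (\<lambda>k. geo k l j)) = ser_one E 0 i j" .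
  have "(\<Oplus>\<^bsub>E\<^esub>l\<in>K. TR.lim (\<lambda>k. geo k i l) \<otimes>\<^bsub>E\<^esub> ep 0 l j) =
      (\<Oplus>\<^bsub>E\<^esub>l\<in>K. TR.lim (\<lambda>k. geo k i l \<otimes>\<^bsub>A\<^esub> tp 0 l j))"
  proof (rule E.finsum_cong'[OF refl])
    show "(\<lambda>l. TR.lim (\<lambda>k. geo k i l \<otimes>\<^bsub>A\<^esub> tp 0 l j)) \<in> K \<rightarrow> carrier E"
      using TR.Ext_lim[OF TR.cauchyD_mult[OF geo_cauchy tp]] ij by (auto simp: E_simps)
    show "TR.lim (\<lambda>k. geo k i l) \<otimes>\<^bsub>E\<^esub> ep 0 l j = TR.lim (\<lambda>k. geo k i l \<otimes>\<^bsub>A\<^esub> tp 0 l j)" if "l \<in> K" for l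
      unfolding ep_lim E_simps
      using TR.lim_hom(3)[OF TR.cauchyD_cauchy[OF geo_cauchy] TR.cauchyD_cauchy[OF tp]] ij that by simp
  qed
  also have "\<dots> = TR.lim (\<lambda>k. \<Oplus>\<^bsub>A\<^esub>l\<in>K. geo k i l \<otimes>\<^bsub>A\<^esub> tp 0 l j)"
    using E_finsum_lim[of K "\<lambda>l k. geo k i l \<otimes>\<^bsub>A\<^esub> tp 0 l j"] TR.cauchyD_mult[OF geo_cauchy tp] ij by simp
  also have "\<dots> = ser_one E 0 i j" unfolding geo_right[OF ij] by (rule lim_geo[OF ij])
  finally show "(\<Oplus>\<^bsub>E\<^esub>l\<in>K. TR.lim (\<lambda>k. geo k i l) \<otimes>\<^bsub>E\<^esub> ep 0 l j) = ser_one E 0 i j" .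
qed

section \<open>Inverses of \<open>t(-u)\<close> and \<open>t^+(-u)\<close>\<close>

definition neg :: "dyc ser \<Rightarrow> dyc ser" where
  "neg M r i j = scal E ((-1) ^ r) (M r i j)"

lemma neg_Vf: "entries_in K Vf M \<Longrightarrow> entries_in K Vf (neg M)"
  by (auto simp: entries_in_def neg_def E.ishom_scal)

lemma Vf_closed: "entries_in K Vf M \<Longrightarrow> i \<in> K \<Longrightarrow> j \<in> K \<Longrightarrow> M r i j \<in> carrier E"
  unfolding entries_in_def using E.ishom_closed by blast

lemma neg_0: "entries_in K Vf M \<Longrightarrow> i \<in> K \<Longrightarrow> j \<in> K \<Longrightarrow> neg M 0 i j = M 0 i j"
  using Vf_closed by (simp add: neg_def)

lemma et_inverse: "\<exists>l. entries_in K Vf l \<and> E.is_inv K (neg et) l"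
proof (rule E.unit_inverse_exists[OF _ Vf neg_Vf[OF et_Vf]])
  fix i j assume ij: "i \<in> K" "j \<in> K"
  then show "neg et 0 i j = ser_one E 0 i j"
    using neg_0[OF et_Vf] et_0 by simp
qed simp

text \<open>Substituting \<open>-u\<close> leaves the constant term alone, so the limit of
  \<open>geo\<close> still inverts it; the higher coefficients come from the recursion behind
  \<open>inverse_exists\<close>.\<close>

lemma ep_inverse: "\<exists>l. entries_in K Vf l \<and> E.is_inv K (neg ep) l"
proof (rule E.inverse_exists[OF _ Vf neg_Vf[OF ep_Vf], of "\<lambda>i j. TR.lim (\<lambda>k. geo k i j)"])
  show "entries_in K Vf (ser_const E (\<lambda>i j. TR.lim (\<lambda>k. geo k i j)))"
    using lim_ishom[OF geo_cauchy geo_hom] E.ishom_zero[OF par_less] by (auto simp: entries_in_def ser_const_def)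
  have n: "neg ep 0 i j = ep 0 i j" if "i \<in> K" "j \<in> K" for i j
    by (rule neg_0[OF ep_Vf that])
  have lc: "TR.lim (\<lambda>k. geo k i j) \<in> carrier E" if "i \<in> K" "j \<in> K" for i j
    using TR.Ext_lim[OF geo_cauchy[OF that]] by (simp add: E_simps)
  have ec: "ep 0 i j \<in> carrier E" if "i \<in> K" "j \<in> K" for i j
    by (rule Vf_closed[OF ep_Vf that])
  fix i j assume ij: "i \<in> K" "j \<in> K"
  have "(\<Oplus>\<^bsub>E\<^esub>k\<in>K. TR.lim (\<lambda>ka. geo ka i k) \<otimes>\<^bsub>E\<^esub> neg ep 0 k j) =
      (\<Oplus>\<^bsub>E\<^esub>k\<in>K. TR.lim (\<lambda>ka. geo ka i k) \<otimes>\<^bsub>E\<^esub> ep 0 k j)"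
    by (rule E.finsum_cong'[OF refl]) (use ij n lc ec in auto)
  then show "(\<Oplus>\<^bsub>E\<^esub>k\<in>K. TR.lim (\<lambda>ka. geo ka i k) \<otimes>\<^bsub>E\<^esub> neg ep 0 k j) = ser_one E 0 i j"
    using ep_0_inverse(2)[OF ij] by simp
  have "(\<Oplus>\<^bsub>E\<^esub>k\<in>K. neg ep 0 i k \<otimes>\<^bsub>E\<^esub> TR.lim (\<lambda>ka. geo ka k j)) =
      (\<Oplus>\<^bsub>E\<^esub>k\<in>K. ep 0 i k \<otimes>\<^bsub>E\<^esub> TR.lim (\<lambda>ka. geo ka k j))"
    by (rule E.finsum_cong'[OF refl]) (use ij n lc ec in auto)
  then show "(\<Oplus>\<^bsub>E\<^esub>k\<in>K. neg ep 0 i k \<otimes>\<^bsub>E\<^esub> TR.lim (\<lambda>ka. geo ka k j)) = ser_one E 0 i j"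
    using ep_0_inverse(1)[OF ij] by simp
qed simp

end

section \<open>The reflection algebra\<close>

context yangian
begin

text \<open>Attaches to plain entries the sign that goes with \<open>e_ij\<close>; being an
  involution, it also removes this sign.\<close>

definition sgd :: "dyc ser \<Rightarrow> dyc ser" where
  "sgd M r i j = scal E ((-1) ^ sg i j) (M r i j)"

lemma E_twist:
  assumes "E.ishom p x" "y \<in> carrier E"
  shows "twist E d (scal E c x) \<otimes>\<^bsub>E\<^esub> scal E c' y = scal E ((-1) ^ (d * p) * c * c') (x \<otimes>\<^bsub>E\<^esub> y)"
  using assms E.ishom_closed
  by (simp add: E.twist_ishom[OF E.ishom_scal[OF assms(1)]] E.scal_scal E.scal_mult_l E.scal_mult_r mult_ac)

lemma smat_mult_closed_cong:
  assumes "ser_eq K M M'" "ser_eq K L L'" "E.carrier_ser K M'" "E.carrier_ser K L'"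
  shows "ser_eq K (smat_mult m n M L) (smat_mult m n M' L')"
  unfolding ser_eq_def
proof (intro allI ballI)
  fix r i j assume ij: "i \<in> K" "j \<in> K"
  show "smat_mult m n M L r i j = smat_mult m n M' L' r i j"
    unfolding smat_mult_def
    by (intro E.finsum_cong' funcsetI E.finsum_closed refl)
      (use assms ij E.twist_closed in \<open>auto simp: ser_eq_def entries_in_def\<close>)
qed

text \<open>The twist acts on the left factor, whose entries are therefore taken homogeneous. The
  right factor may be arbitrary, a freedom used for an inverse about whose parities nothing is
  known.\<close>

lemma smat_mult_sgn:
  assumes M: "entries_in K Vf M" and L: "E.carrier_ser K L"
  shows "ser_eq K (smat_mult m n (sgd M) (sgd L)) (sgd (ser_mult E K M L))"
  unfolding ser_eq_def
proof (intro allI ballI)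
  fix r i j assume ij: "i \<in> K" "j \<in> K"
  have Mc: "E.carrier_ser K M" by (rule E.entries_in_cmat[OF Vf M])
  have "smat_mult m n (sgd M) (sgd L) r i j = ser_mult E K (\<lambda>a i k. twist E (bar m k + bar m j) (sgd M a i k)) (sgd L) r i j"
    by (simp add: smat_mult_def ser_mult_def)
  also have "\<dots> = scal E ((-1) ^ sg i j) (ser_mult E K M L r i j)"
  proof (rule E.ser_mult_scal[OF Mc L ij])
    fix a k assume k: "k \<in> K"
    have "E.ishom (par i k) (M a i k)" using M ij k by (auto simp: entries_in_def)
    moreover have "L (r - a) k j \<in> carrier E" using L ij k by (auto simp: entries_in_def)
    ultimately have "twist E (bar m k + bar m j) (sgd M a i k) \<otimes>\<^bsub>E\<^esub> sgd L (r - a) k j =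
        scal E ((-1) ^ ((bar m k + bar m j) * par i k) * (-1) ^ sg i k * (-1) ^ sg k j) (M a i k \<otimes>\<^bsub>E\<^esub> L (r - a) k j)"
      unfolding sgd_def by (rule E_twist)
    \<comment> \<open>With indices standing for their parities and \<open>k k = k\<close>, the
      exponent \<open>(k + j)(i + k) + (i k + k) + (k j + j)\<close> is congruent to
      \<open>i j + j\<close> modulo 2.\<close>
    also have "(-1) ^ ((bar m k + bar m j) * par i k) * (-1) ^ sg i k * (-1) ^ sg k j = ((-1) ^ sg i j :: complex)"
      by (simp add: bar_def sg_def)
    finally show "twist E (bar m k + bar m j) (sgd M a i k) \<otimes>\<^bsub>E\<^esub> sgd L (r - a) k j =
        scal E ((-1) ^ sg i j) (M a i k \<otimes>\<^bsub>E\<^esub> L (r - a) k j)" .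
  qed
  finally show "smat_mult m n (sgd M) (sgd L) r i j = sgd (ser_mult E K M L) r i j" by (simp add: sgd_def)
qed

lemma sgn_sgn: "M r i j \<in> carrier E \<Longrightarrow> sgd (sgd M) r i j = M r i j"
  by (simp add: sgd_def E.scal_scal flip: power_add mult_2)

lemma sgn_cmat: "E.carrier_ser K M \<Longrightarrow> E.carrier_ser K (sgd M)"
  by (auto simp: entries_in_def sgd_def)

lemma sgn_ser_eq: "ser_eq K M M' \<Longrightarrow> ser_eq K (sgd M) (sgd M')"
  by (auto simp: ser_eq_def sgd_def)

lemma sgn_sgn_ser_eq: "E.carrier_ser K M \<Longrightarrow> ser_eq K (sgd (sgd M)) M"
  by (auto simp: ser_eq_def entries_in_def sgn_sgn)

definition G :: "nat \<Rightarrow> dyc ser" where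
  "G ell = ser_const E (\<lambda>i j. scal E (gmat ell i j) \<one>\<^bsub>E\<^esub>)"

lemma G_const: "smat_const m n (gmat ell) = G ell"
  by (auto simp: smat_const_def G_def ser_const_def fun_eq_iff)

lemma ser_one_const: "smat_const m n (\<lambda>i j. of_bool (i = j)) = ser_one E"
  by (auto simp: smat_const_def ser_one_def ser_const_def fun_eq_iff)

lemma sgn_diag: "sg i i = 0 \<or> sg i i = 2"
  by (simp add: sg_def bar_def)

lemma sgn_ser_one: "sgd (ser_one E) = ser_one E"
proof -
  have "(-1 :: complex) ^ sg i i = 1" for i using sgn_diag[of i] by auto
  then show ?thesis by (auto simp: sgd_def ser_one_def ser_const_def fun_eq_iff)
qed

lemma sgn_G: "sgd (G ell) = G ell"
proof -
  have "(-1 :: complex) ^ sg i i = 1" for i using sgn_diag[of i] by auto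
  then show ?thesis by (auto simp: sgd_def G_def ser_const_def fun_eq_iff gmat_def E.scal_scal)
qed

lemma G_Vf: "entries_in K Vf (G ell)"
  using E.ishom_one E.ishom_scal[OF E.ishom_one] E.ishom_zero[OF par_less]
  by (auto simp: entries_in_def G_def ser_const_def gmat_def)

lemma Tmat_eq: "Tmat m n = sgd et" "Tpmat m n = sgd ep"
  by (auto simp: Tmat_def Tpmat_def sgd_def et_def ep_def sg_def fun_eq_iff)

lemma neg_sgn:
  assumes "E.carrier_ser K M"
  shows "ser_eq K (smat_neg m n (sgd M)) (sgd (neg M))"
  using assms by (auto simp: ser_eq_def smat_neg_def sgd_def neg_def E.scal_scal entries_in_def mult.commute)

lemma is_inverse_sgn:
  assumes M: "entries_in K Vf M" and l: "entries_in K Vf l" "E.is_inv K M l"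
    and M': "ser_eq K M' (sgd M)"
  shows "smat_is_inverse m n M' (sgd l)"
proof -
  note c = E.entries_in_cmat[OF Vf M] E.entries_in_cmat[OF Vf l(1)]
  have "ser_eq K (smat_mult m n M' (sgd l)) (smat_mult m n (sgd M) (sgd l))"
    by (rule smat_mult_closed_cong[OF M' ser_eq_refl sgn_cmat[OF c(1)] sgn_cmat[OF c(2)]])
  also have "ser_eq K \<dots> (sgd (ser_mult E K M l))" by (rule smat_mult_sgn[OF M c(2)])
  also have "ser_eq K \<dots> (sgd (ser_one E))" using l(2) by (intro sgn_ser_eq) (simp add: E.is_inv_def)
  finally have 1: "ser_eq K (smat_mult m n M' (sgd l)) (ser_one E)" by (simp add: sgn_ser_one)
  have "ser_eq K (smat_mult m n (sgd l) M') (smat_mult m n (sgd l) (sgd M))"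
    by (rule smat_mult_closed_cong[OF ser_eq_refl M' sgn_cmat[OF c(2)] sgn_cmat[OF c(1)]])
  also have "ser_eq K \<dots> (sgd (ser_mult E K l M))" by (rule smat_mult_sgn[OF l(1) c(1)])
  also have "ser_eq K \<dots> (sgd (ser_one E))" using l(2) by (intro sgn_ser_eq) (simp add: E.is_inv_def)
  finally have 2: "ser_eq K (smat_mult m n (sgd l) M') (ser_one E)" by (simp add: sgn_ser_one)
  show ?thesis
    unfolding smat_is_inverse_def ser_one_const using 1 2 sgn_cmat[OF c(2)]
    by (simp add: ser_eq_def entries_in_def)
qed

text \<open>\<open>smat_inv\<close> chooses some inverse, known only through its closedness and its
  two equations. Stripping the signs turns it into a plain right inverse of \<open>M\<close>, and
  the left inverse \<open>l\<close> must coincide with it.\<close>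

lemma smat_inv_sgn:
  assumes M: "entries_in K Vf M" and l: "entries_in K Vf l" "E.is_inv K M l"
    and M': "ser_eq K M' (sgd M)"
  shows "ser_eq K (smat_inv m n M') (sgd l)"
proof -
  define L where "L = smat_inv m n M'"
  have L: "smat_is_inverse m n M' L"
    unfolding L_def smat_inv_def by (rule someI[of _ "sgd l"]) (rule is_inverse_sgn[OF assms])
  have Lc: "E.carrier_ser K L" using L by (auto simp: smat_is_inverse_def entries_in_def)
  have minv: "ser_eq K (smat_mult m n M' L) (ser_one E)"
    using L unfolding smat_is_inverse_def ser_one_const by (simp add: ser_eq_def)
  note c = E.entries_in_cmat[OF Vf M] E.entries_in_cmat[OF Vf l(1)] sgn_cmat[OF Lc]
  have "ser_eq K (ser_mult E K M (sgd L)) (sgd (sgd (ser_mult E K M (sgd L))))"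
    by (rule ser_eq_sym[OF sgn_sgn_ser_eq[OF E.ser_mult_closed[OF c(1,3)]]])
  also have "ser_eq K \<dots> (sgd (smat_mult m n (sgd M) (sgd (sgd L))))"
    by (rule sgn_ser_eq[OF ser_eq_sym[OF smat_mult_sgn[OF M c(3)]]])
  also have "ser_eq K \<dots> (sgd (smat_mult m n M' L))"
    by (rule sgn_ser_eq[OF ser_eq_sym[OF smat_mult_closed_cong[OF M' ser_eq_sym[OF sgn_sgn_ser_eq[OF Lc]] sgn_cmat[OF c(1)] sgn_cmat[OF c(3)]]]])
  also have "ser_eq K \<dots> (ser_one E)" using sgn_ser_eq[OF minv] by (simp add: sgn_ser_one)
  finally have "ser_eq K l (sgd L)"
    using l(2) by (intro E.ser_mult_inverse_unique[OF _ c(2,1,3)]) (auto simp: E.is_inv_def)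
  then have "ser_eq K (sgd l) (sgd (sgd L))" by (rule sgn_ser_eq)
  then have "ser_eq K (sgd l) L" using sgn_sgn_ser_eq[OF Lc] ser_eq_trans by blast
  then show ?thesis unfolding L_def by (rule ser_eq_sym)
qed

lemma reflection_plain:
  assumes a: "entries_in K Vf a" and l: "entries_in K Vf l" "E.is_inv K (neg a) l"
  shows "ser_eq K (sgd (smat_mult m n (smat_mult m n (sgd a) (smat_const m n (gmat ell)))
      (smat_inv m n (smat_neg m n (sgd a))))) (ser_mult E K (ser_mult E K a (G ell)) l)"
proof -
  note c = E.entries_in_cmat[OF Vf a] E.entries_in_cmat[OF Vf l(1)] E.entries_in_cmat[OF Vf G_Vf[of ell]]
  have aG: "entries_in K Vf (ser_mult E K a (G ell))" by (rule E.entries_in_ser_mult[OF Vf a G_Vf])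
  note c' = E.entries_in_cmat[OF Vf aG]
  have 1: "ser_eq K (smat_mult m n (sgd a) (smat_const m n (gmat ell))) (sgd (ser_mult E K a (G ell)))"
    using smat_mult_sgn[OF a c(3)] by (simp add: G_const sgn_G)
  have 2: "ser_eq K (smat_inv m n (smat_neg m n (sgd a))) (sgd l)"
    by (rule smat_inv_sgn[OF neg_Vf[OF a] l neg_sgn[OF c(1)]])
  have "ser_eq K (smat_mult m n (smat_mult m n (sgd a) (smat_const m n (gmat ell)))
      (smat_inv m n (smat_neg m n (sgd a)))) (smat_mult m n (sgd (ser_mult E K a (G ell))) (sgd l))"
    by (rule smat_mult_closed_cong[OF 1 2 sgn_cmat[OF c'] sgn_cmat[OF c(2)]])
  also have "ser_eq K \<dots> (sgd (ser_mult E K (ser_mult E K a (G ell)) l))" by (rule smat_mult_sgn[OF aG c(2)])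
  finally have "ser_eq K (sgd (smat_mult m n (smat_mult m n (sgd a) (smat_const m n (gmat ell)))
      (smat_inv m n (smat_neg m n (sgd a))))) (sgd (sgd (ser_mult E K (ser_mult E K a (G ell)) l)))"
    by (rule sgn_ser_eq)
  also have "ser_eq K \<dots> (ser_mult E K (ser_mult E K a (G ell)) l)"
    by (rule sgn_sgn_ser_eq[OF E.ser_mult_closed[OF c' c(2)]])
  finally show ?thesis .
qed

end

section \<open>Coproducts of the reflection matrices and the coideal property\<close>

locale coproduct = yangian +
  fixes ell :: nat and \<Delta> :: "dyc \<Rightarrow> (nat \<Rightarrow> dyt) set"
  assumes coproduct: "is_coproduct m n \<Delta>"
begin

abbreviation E2 :: "(nat \<Rightarrow> dyt) set superalg" where "E2 \<equiv> TR.E2"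

lemma \<Delta>_hom: "\<Delta> \<in> ring_hom E E2"
  and \<Delta>_scal: "x \<in> carrier E \<Longrightarrow> \<Delta> (scal E c x) = scal E2 c (\<Delta> x)"
  using coproduct by (auto simp: is_coproduct_def E2_eq)

lemma E_ring: "ring E" and E2_ring: "ring E2"
  by unfold_locales

lemma \<Delta>_t:
  assumes "i \<in> K" "j \<in> K"
  shows "\<Delta> (et r i j) = (\<Oplus>\<^bsub>E2\<^esub>k\<in>K. \<Oplus>\<^bsub>E2\<^esub>a\<in>{..r}. TR.ct (et a i k) (et (r - a) k j))"
    "\<Delta> (ep r i j) = (\<Oplus>\<^bsub>E2\<^esub>k\<in>K. \<Oplus>\<^bsub>E2\<^esub>a\<in>{..r}. TR.ct (ep a i k) (ep (r - a) k j))"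
  using coproduct assms unfolding is_coproduct_def et_def ep_def E2_eq ctens_eq by blast+

text \<open>The embeddings \<open>lt\<close> and \<open>rt\<close> of the two tensor factors are
  ring homomorphisms because the unit is even, so identities between matrices of series can be
  transported along them.\<close>

definition lt :: "dyc \<Rightarrow> (nat \<Rightarrow> dyt) set" where "lt x = TR.ct x \<one>\<^bsub>E\<^esub>"
definition rt :: "dyc \<Rightarrow> (nat \<Rightarrow> dyt) set" where "rt x = TR.ct \<one>\<^bsub>E\<^esub> x"

lemma E_one_EC: "\<one>\<^bsub>E\<^esub> \<in> carrier TR.EC"
  using E_EC E.one_mem by blast

lemma lt_hom: "lt \<in> ring_hom E E2"
  by (rule ring_hom_memI)
    (use E_EC E_one_EC TR.ct_one in
      \<open>auto simp: lt_def E_simps TR.ct_l_hom TR.ct_add_l\<close>)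

lemma rt_hom: "rt \<in> ring_hom E E2"
  by (rule ring_hom_memI)
    (use E_EC E_one_EC TR.ct_one in
      \<open>auto simp: rt_def E_simps TR.ct_r_hom TR.ct_add_r\<close>)

lemma lt_rt: "x \<in> carrier E \<Longrightarrow> y \<in> carrier E \<Longrightarrow> lt x \<otimes>\<^bsub>E2\<^esub> rt y = TR.ct x y"
  using TR.ct_split E_EC by (simp add: lt_def rt_def E_simps)

abbreviation W :: "(nat \<Rightarrow> dyt) set set" where
  "W \<equiv> tensor_subspace m n (carrier E) (DB m n ell)"

abbreviation lift :: "(dyc \<Rightarrow> (nat \<Rightarrow> dyt) set) \<Rightarrow> dyc ser \<Rightarrow> (nat \<Rightarrow> dyt) set ser" where
  "lift h M \<equiv> \<lambda>r i j. h (M r i j)"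

lemma lift_closed: "h \<in> ring_hom E E2 \<Longrightarrow> E.carrier_ser K M \<Longrightarrow> TR.E2.carrier_ser K (lift h M)"
  unfolding entries_in_def using ring_hom_closed[of h E E2] by blast

lemma lift_ser_mult:
  "h \<in> ring_hom E E2 \<Longrightarrow> E.carrier_ser K M \<Longrightarrow> E.carrier_ser K L \<Longrightarrow>
    ser_eq K (lift h (ser_mult E K M L)) (ser_mult E2 K (lift h M) (lift h L))"
  unfolding ser_eq_def using hom_ser_mult[OF E_ring E2_ring] by blast

lemma lift_inv:
  "h \<in> ring_hom E E2 \<Longrightarrow> E.carrier_ser K M \<Longrightarrow> E.carrier_ser K L \<Longrightarrow> E.is_inv K M L \<Longrightarrow>
    TR.E2.is_inv K (lift h M) (lift h L)"
  by (rule hom_is_inv[OF E_ring E2_ring])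

text \<open>Stated once for both halves, with \<open>a\<close> standing for \<open>et\<close> or
  \<open>ep\<close>. Of \<open>W\<close> it uses that it is a subalgebra containing
  \<open>x \<otimes> 1\<close> for all \<open>x\<close> and \<open>1 \<otimes> b\<close> for
  \<open>b\<close> in \<open>DB\<close>.\<close>

lemma coideal_series:
  assumes a: "entries_in K Vf a" and l: "entries_in K Vf l" "E.is_inv K (neg a) l"
    and \<Delta>a: "\<And>r i j. i \<in> K \<Longrightarrow> j \<in> K \<Longrightarrow>
      \<Delta> (a r i j) = (\<Oplus>\<^bsub>E2\<^esub>k\<in>K. \<Oplus>\<^bsub>E2\<^esub>c\<in>{..r}. TR.ct (a c i k) (a (r - c) k j))"
    and W: "TR.E2.subalgebra W" "\<And>x. x \<in> carrier E \<Longrightarrow> lt x \<in> W" "\<And>x. x \<in> DB m n ell \<Longrightarrow> rt x \<in> W"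
    and b: "\<And>r i j. i \<in> K \<Longrightarrow> j \<in> K \<Longrightarrow> ser_mult E K (ser_mult E K a (G ell)) l r i j \<in> DB m n ell"
    and ij: "i \<in> K" "j \<in> K"
  shows "\<Delta> (ser_mult E K (ser_mult E K a (G ell)) l r i j) \<in> W"
proof -
  note fin = finite_atLeastAtMost[of 1 "m + n"]
  let ?n = "neg a" and ?G = "G ell"
  note c = E.entries_in_cmat[OF Vf a] E.entries_in_cmat[OF Vf l(1)] E.entries_in_cmat[OF Vf G_Vf[of ell]]
    E.entries_in_cmat[OF Vf neg_Vf[OF a]]
  note ca = lift_closed[OF lt_hom c(1)] lift_closed[OF rt_hom c(1)]
  note cl = lift_closed[OF lt_hom c(2)] lift_closed[OF rt_hom c(2)]
  note cn = lift_closed[OF lt_hom c(4)] lift_closed[OF rt_hom c(4)]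
  note cG = lift_closed[OF rt_hom c(3)]
  note sc = TR.E2.ser_mult_closed
  have ac: "a r i j \<in> carrier E" if "i \<in> K" "j \<in> K" for r i j by (rule Vf_closed[OF a that])
  have \<Delta>P: "ser_eq K (lift \<Delta> a) (ser_mult E2 K (lift lt a) (lift rt a))"
    unfolding ser_eq_def
  proof (intro allI ballI)
    fix r i j assume ij: "i \<in> K" "j \<in> K"
    show "\<Delta> (a r i j) = ser_mult E2 K (lift lt a) (lift rt a) r i j"
      unfolding \<Delta>a[OF ij] ser_mult_def
      by (intro TR.E2.finsum_cong' refl funcsetI TR.E2.finsum_closed)
        (use ij ac E_EC in \<open>auto simp: lt_rt\<close>)
  qed
  have lt_scal: "lt (scal E c x) = scal E2 c (lt x)" and rt_scal: "rt (scal E c x) = scal E2 c (rt x)"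
    if "x \<in> carrier E" for c x
    using that E_EC E_one_EC by (simp_all add: lt_def rt_def E_simps TR.ct_scal)
  \<comment> \<open>Substituting \<open>-u\<close> respects products of series, since
    \<open>(-1)^c (-1)^(r-c) = (-1)^r\<close>; so the coproduct of \<open>a(-u)\<close> factors as
    that of \<open>a(u)\<close> does.\<close>
  have \<Delta>n: "ser_eq K (lift \<Delta> ?n) (ser_mult E2 K (lift lt ?n) (lift rt ?n))"
    unfolding ser_eq_def
  proof (intro allI ballI)
    fix r i j assume ij: "i \<in> K" "j \<in> K"
    have "ser_mult E2 K (lift lt ?n) (lift rt ?n) r i j = scal E2 ((-1) ^ r) (ser_mult E2 K (lift lt a) (lift rt a) r i j)"
      unfolding ser_mult_def
    proof (subst TR.E2.finsum_scal)
      have p: "lt (a c i k) \<otimes>\<^bsub>E2\<^esub> rt (a (r - c) k j) \<in> carrier E2" if "k \<in> K" for c k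
        using that ij ac E_EC by (simp add: lt_rt)
      show "(\<Oplus>\<^bsub>E2\<^esub>c\<in>{..r}. lt (a c i k) \<otimes>\<^bsub>E2\<^esub> rt (a (r - c) k j)) \<in> carrier E2" if "k \<in> K" for k
        using p[OF that] by (intro TR.E2.finsum_closed) auto
      show "(\<Oplus>\<^bsub>E2\<^esub>k\<in>K. \<Oplus>\<^bsub>E2\<^esub>c\<in>{..r}. lt (?n c i k) \<otimes>\<^bsub>E2\<^esub> rt (?n (r - c) k j)) =
        (\<Oplus>\<^bsub>E2\<^esub>k\<in>K. scal E2 ((-1) ^ r) (\<Oplus>\<^bsub>E2\<^esub>c\<in>{..r}. lt (a c i k) \<otimes>\<^bsub>E2\<^esub> rt (a (r - c) k j)))"
      proof (rule TR.E2.finsum_cong'[OF refl])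
        show "(\<lambda>k. scal E2 ((-1) ^ r) (\<Oplus>\<^bsub>E2\<^esub>c\<in>{..r}. lt (a c i k) \<otimes>\<^bsub>E2\<^esub> rt (a (r - c) k j))) \<in> K \<rightarrow> carrier E2"
          using p by (auto intro!: TR.E2.finsum_closed)
        fix k assume k: "k \<in> K"
        have "scal E2 ((-1) ^ r) (\<Oplus>\<^bsub>E2\<^esub>c\<in>{..r}. lt (a c i k) \<otimes>\<^bsub>E2\<^esub> rt (a (r - c) k j)) =
          (\<Oplus>\<^bsub>E2\<^esub>c\<in>{..r}. scal E2 ((-1) ^ r) (lt (a c i k) \<otimes>\<^bsub>E2\<^esub> rt (a (r - c) k j)))"
          by (rule TR.E2.finsum_scal) (use p[OF k] in auto)
        also have "\<dots> = (\<Oplus>\<^bsub>E2\<^esub>c\<in>{..r}. lt (?n c i k) \<otimes>\<^bsub>E2\<^esub> rt (?n (r - c) k j))"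
        proof (rule TR.E2.finsum_cong'[OF refl])
          show "(\<lambda>c. lt (?n c i k) \<otimes>\<^bsub>E2\<^esub> rt (?n (r - c) k j)) \<in> {..r} \<rightarrow> carrier E2"
            using cn ij k by (auto simp: entries_in_def)
          fix d assume "d \<in> {..r}"
          then have "(-1 :: complex) ^ (r - d) * (-1) ^ d = (-1) ^ r" by (simp flip: power_add)
          then show "scal E2 ((-1) ^ r) (lt (a d i k) \<otimes>\<^bsub>E2\<^esub> rt (a (r - d) k j)) =
              lt (?n d i k) \<otimes>\<^bsub>E2\<^esub> rt (?n (r - d) k j)"
            using ij k ac ca by (simp add: neg_def lt_scal rt_scal TR.E2.scal_mult_l TR.E2.scal_mult_r
                TR.E2.scal_scal entries_in_def)
        qed
        finally show "(\<Oplus>\<^bsub>E2\<^esub>c\<in>{..r}. lt (?n c i k) \<otimes>\<^bsub>E2\<^esub> rt (?n (r - c) k j)) =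
          scal E2 ((-1) ^ r) (\<Oplus>\<^bsub>E2\<^esub>c\<in>{..r}. lt (a c i k) \<otimes>\<^bsub>E2\<^esub> rt (a (r - c) k j))" by simp
      qed
    qed
    also have "\<dots> = \<Delta> (?n r i j)"
      using \<Delta>P ij ac by (simp add: neg_def \<Delta>_scal ser_eq_def)
    finally show "\<Delta> (?n r i j) = ser_mult E2 K (lift lt ?n) (lift rt ?n) r i j" by simp
  qed
  have inv: "TR.E2.is_inv K (ser_mult E2 K (lift lt ?n) (lift rt ?n)) (ser_mult E2 K (lift rt l) (lift lt l))"
    by (rule TR.E2.is_inv_mult[OF fin cn(1) cl(1) cn(2) cl(2)])
      (rule lift_inv[OF lt_hom c(4,2) l(2)], rule lift_inv[OF rt_hom c(4,2) l(2)])
  \<comment> \<open>The lifted \<open>l\<close> is a left inverse, and the explicit product a right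
    inverse, of one and the same matrix, so they agree.\<close>
  have \<Delta>l: "ser_eq K (lift \<Delta> l) (ser_mult E2 K (lift rt l) (lift lt l))"
  proof (rule TR.E2.ser_mult_inverse_unique[OF fin lift_closed[OF \<Delta>_hom c(2)] sc[OF cn] sc[OF cl(2,1)]])
    have "ser_eq K (ser_mult E2 K (lift \<Delta> l) (ser_mult E2 K (lift lt ?n) (lift rt ?n))) (ser_mult E2 K (lift \<Delta> l) (lift \<Delta> ?n))"
      by (rule TR.E2.ser_mult_cong[OF ser_eq_refl ser_eq_sym[OF \<Delta>n] lift_closed[OF \<Delta>_hom c(2)] lift_closed[OF \<Delta>_hom c(4)]])
    also have "ser_eq K \<dots> (ser_one E2)"
      using lift_inv[OF \<Delta>_hom c(4,2) l(2)] by (simp add: TR.E2.is_inv_def)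
    finally show "ser_eq K (ser_mult E2 K (lift \<Delta> l) (ser_mult E2 K (lift lt ?n) (lift rt ?n))) (ser_one E2)" .
    show "ser_eq K (ser_mult E2 K (ser_mult E2 K (lift lt ?n) (lift rt ?n)) (ser_mult E2 K (lift rt l) (lift lt l))) (ser_one E2)"
      using inv by (simp add: TR.E2.is_inv_def)
  qed
  \<comment> \<open>The entries of \<open>G\<close> are scalars, on which \<open>\<Delta>\<close>
    and \<open>rt\<close> agree; writing them with \<open>rt\<close> lets \<open>G\<close> merge
    with its two neighbours, which come from the second factor.\<close>
  have \<Delta>G: "lift \<Delta> ?G = lift rt ?G"
  proof -
    have "\<Delta> \<one>\<^bsub>E\<^esub> = rt \<one>\<^bsub>E\<^esub>" "\<Delta> \<zero>\<^bsub>E\<^esub> = rt \<zero>\<^bsub>E\<^esub>"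
      using ring_hom_one[OF \<Delta>_hom] ring_hom_one[OF rt_hom] ring_hom_zero[OF \<Delta>_hom E_ring E2_ring]
        ring_hom_zero[OF rt_hom E_ring E2_ring] by simp_all
    then show ?thesis by (auto simp: G_def ser_const_def fun_eq_iff \<Delta>_scal rt_scal)
  qed
  let ?P = "lift lt a" and ?Q = "lift rt a" and ?P' = "lift lt l" and ?Q' = "lift rt l" and ?g = "lift rt ?G"
  let ?b = "ser_mult E K (ser_mult E K a ?G) l"
  note caG = E.ser_mult_closed[OF c(1,3)]
  have "ser_eq K (lift \<Delta> ?b) (ser_mult E2 K (lift \<Delta> (ser_mult E K a ?G)) (lift \<Delta> l))"
    by (rule lift_ser_mult[OF \<Delta>_hom caG c(2)])
  also have "ser_eq K \<dots> (ser_mult E2 K (ser_mult E2 K (ser_mult E2 K ?P ?Q) ?g) (ser_mult E2 K ?Q' ?P'))"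
  proof (rule TR.E2.ser_mult_cong[OF _ \<Delta>l sc[OF sc[OF ca] cG] sc[OF cl(2,1)]])
    have "ser_eq K (lift \<Delta> (ser_mult E K a ?G)) (ser_mult E2 K (lift \<Delta> a) (lift \<Delta> ?G))" by (rule lift_ser_mult[OF \<Delta>_hom c(1,3)])
    also have "ser_eq K \<dots> (ser_mult E2 K (ser_mult E2 K ?P ?Q) ?g)"
      unfolding \<Delta>G by (rule TR.E2.ser_mult_cong[OF \<Delta>P ser_eq_refl sc[OF ca] cG])
    finally show "ser_eq K (lift \<Delta> (ser_mult E K a ?G)) (ser_mult E2 K (ser_mult E2 K ?P ?Q) ?g)" .
  qed
  also have "ser_eq K \<dots> (ser_mult E2 K (ser_mult E2 K ?P (ser_mult E2 K ?Q ?g)) (ser_mult E2 K ?Q' ?P'))"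
    by (rule TR.E2.ser_mult_cong[OF TR.E2.ser_mult_assoc[OF fin ca cG] ser_eq_refl sc[OF ca(1) sc[OF ca(2) cG]] sc[OF cl(2,1)]])
  also have "ser_eq K \<dots> (ser_mult E2 K ?P (ser_mult E2 K (ser_mult E2 K ?Q ?g) (ser_mult E2 K ?Q' ?P')))"
    by (rule TR.E2.ser_mult_assoc[OF fin ca(1) sc[OF ca(2) cG] sc[OF cl(2,1)]])
  also have "ser_eq K \<dots> (ser_mult E2 K ?P (ser_mult E2 K (ser_mult E2 K (ser_mult E2 K ?Q ?g) ?Q') ?P'))"
    by (rule TR.E2.ser_mult_cong[OF ser_eq_refl ser_eq_sym[OF TR.E2.ser_mult_assoc[OF fin sc[OF ca(2) cG] cl(2,1)]] ca(1)
          sc[OF sc[OF sc[OF ca(2) cG] cl(2)] cl(1)]])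
  also have "ser_eq K \<dots> (ser_mult E2 K ?P (ser_mult E2 K (lift rt ?b) ?P'))"
  proof (rule TR.E2.ser_mult_cong[OF ser_eq_refl TR.E2.ser_mult_cong[OF _ ser_eq_refl] ca(1)])
    have "ser_eq K (ser_mult E2 K (ser_mult E2 K ?Q ?g) ?Q') (ser_mult E2 K (lift rt (ser_mult E K a ?G)) ?Q')"
      by (rule TR.E2.ser_mult_cong[OF ser_eq_sym[OF lift_ser_mult[OF rt_hom c(1,3)]] ser_eq_refl lift_closed[OF rt_hom caG] cl(2)])
    also have "ser_eq K \<dots> (lift rt ?b)" by (rule ser_eq_sym[OF lift_ser_mult[OF rt_hom caG c(2)]])
    finally show "ser_eq K (ser_mult E2 K (ser_mult E2 K ?Q ?g) ?Q') (lift rt ?b)" .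
    show "TR.E2.carrier_ser K (lift rt ?b)" "TR.E2.carrier_ser K ?P'" "TR.E2.carrier_ser K (ser_mult E2 K (lift rt ?b) ?P')"
      using lift_closed[OF rt_hom E.ser_mult_closed[OF caG c(2)]] cl sc by simp_all
  qed
  finally have eq: "\<Delta> (?b r i j) = ser_mult E2 K ?P (ser_mult E2 K (lift rt ?b) ?P') r i j"
    using ij by (simp add: ser_eq_def)
  have Ws: "TR.E2.subspace W" "\<one>\<^bsub>E2\<^esub> \<in> W" "\<And>x y. x \<in> W \<Longrightarrow> y \<in> W \<Longrightarrow> x \<otimes>\<^bsub>E2\<^esub> y \<in> W"
    using W(1) by (auto simp: TR.E2.subalgebra_def)
  \<comment> \<open>A subalgebra is an entry family that does not depend on the indices, so the
    product has its entries in \<open>W\<close> without any exchange of tensor factors.\<close>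
  have fam: "TR.E2.entry_family (\<lambda>_ _. W)"
    unfolding TR.E2.entry_family_def using Ws TR.E2.subspaceD[OF Ws(1)] by auto
  have "entries_in K (\<lambda>_ _. W) (ser_mult E2 K ?P (ser_mult E2 K (lift rt ?b) ?P'))"
    by (intro TR.E2.entries_in_ser_mult[OF fam])
      (use W(2,3) b ac Vf_closed[OF l(1)] in \<open>auto simp: entries_in_def\<close>)
  then show ?thesis unfolding eq using ij by (simp add: entries_in_def)
qed

definition gens :: "dyc set" where
  "gens = {b_coeff m n ell i j r | i j r. i \<in> K \<and> j \<in> K \<and> r \<ge> 1} \<union>
    {b_neg m n ell i j r | i j r. i \<in> K \<and> j \<in> K \<and> r \<ge> 1}"

lemma DB_eq: "DB m n ell = subalg E gens"
  by (simp add: DB_def gens_def)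

theorem coideal: "\<Delta> ` DB m n ell \<subseteq> W"
proof -
  note fin = finite_atLeastAtMost[of 1 "m + n"]
  obtain lT where lT: "entries_in K Vf lT" "E.is_inv K (neg et) lT" using et_inverse by blast
  obtain lP where lP: "entries_in K Vf lP" "E.is_inv K (neg ep) lP" using ep_inverse by blast
  define B where "B = ser_mult E K (ser_mult E K et (G ell)) lT"
  define P where "P = ser_mult E K (ser_mult E K ep (G ell)) lP"
  have BV: "entries_in K Vf B" and PV: "entries_in K Vf P"
    unfolding B_def P_def by (intro E.entries_in_ser_mult[OF Vf] et_Vf ep_Vf G_Vf lT lP)+
  have b: "b_coeff m n ell i j r = B r i j" if "i \<in> K" "j \<in> K" for i j r
  proof -
    have "b_coeff m n ell i j r = sgd (Bmat m n ell) r i j" by (simp add: b_coeff_def sgd_def sg_def)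
    also have "\<dots> = B r i j"
      using reflection_plain[OF et_Vf lT, of ell] that unfolding ser_eq_def B_def Bmat_def Tmat_eq by blast
    finally show ?thesis .
  qed
  have bp: "bp_coeff m n ell i j r = P r i j" if "i \<in> K" "j \<in> K" for i j r
  proof -
    have "bp_coeff m n ell i j r = sgd (Bpmat m n ell) r i j" by (simp add: bp_coeff_def sgd_def sg_def)
    also have "\<dots> = P r i j"
      using reflection_plain[OF ep_Vf lP, of ell] that unfolding ser_eq_def P_def Bpmat_def Tmat_eq by blast
    finally show ?thesis .
  qed
  \<comment> \<open>The generator with upper index \<open>-(r+1)\<close> sits at \<open>u^r\<close>;
    writing the index as \<open>Suc r\<close> includes the constant term
    \<open>r = 0\<close>.\<close>
  have bn: "b_neg m n ell i j (Suc r) = G ell r i j \<ominus>\<^bsub>E\<^esub> P r i j" if "i \<in> K" "j \<in> K" for i j r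
    by (simp add: b_neg_def bp[OF that] G_const)
  have Bc: "B r i j \<in> carrier E" and Pc: "P r i j \<in> carrier E" and Gc: "G ell r i j \<in> carrier E"
    if "i \<in> K" "j \<in> K" for r i j
    using Vf_closed[OF BV that] Vf_closed[OF PV that] Vf_closed[OF G_Vf that] by blast+
  have gens_cases: "(\<exists>i j r. i \<in> K \<and> j \<in> K \<and> x = B r i j) \<or>
      (\<exists>i j r. i \<in> K \<and> j \<in> K \<and> x = G ell r i j \<ominus>\<^bsub>E\<^esub> P r i j)" if "x \<in> gens" for x
    using that unfolding gens_def
  proof (elim UnE CollectE exE conjE)
    fix i j r assume "x = b_coeff m n ell i j r" and ij: "i \<in> K" "j \<in> K"
    then have "x = B r i j" by (simp only: b[OF ij])
    with ij show ?thesis by blast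
  next
    fix i j r assume x: "x = b_neg m n ell i j r" and ij: "i \<in> K" "j \<in> K" and r: "1 \<le> r"
    obtain r' where "r = Suc r'" using r by (cases r) auto
    then have "x = G ell r' i j \<ominus>\<^bsub>E\<^esub> P r' i j" by (simp only: x bn[OF ij])
    with ij show ?thesis by blast
  qed
  have gens: "\<exists>p. E.ishom p x" if "x \<in> gens" for x
  proof -
    from that consider i j r where "i \<in> K" "j \<in> K" "x = B r i j"
      | i j r where "i \<in> K" "j \<in> K" "x = G ell r i j \<ominus>\<^bsub>E\<^esub> P r i j"
      using gens_cases by blast
    then show ?thesis
    proof cases
      case 1
      have "E.ishom (par i j) (B r i j)" using BV 1 unfolding entries_in_def by blast
      then show ?thesis unfolding 1(3) ..
    next
      case 2
      have "E.ishom (par i j) (G ell r i j)" "E.ishom (par i j) (P r i j)"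
        using 2 PV G_Vf[of ell] unfolding entries_in_def by blast+
      then have "E.ishom (par i j) x"
        unfolding 2(3) E.minus_scal[OF Gc[OF 2(1,2)] Pc[OF 2(1,2)]]
        by (intro E.ishom_add E.ishom_scal)
      then show ?thesis ..
    qed
  qed
  then have gc: "gens \<subseteq> carrier E" using E.ishom_closed by blast
  have DB: "E.subalgebra (DB m n ell)" "gens \<subseteq> DB m n ell" "E.graded (DB m n ell)"
    unfolding DB_eq using E.subalg_subalgebra[OF gc] E.subalg_graded gens by blast+
  have DBs: "E.subspace (DB m n ell)" "\<one>\<^bsub>E\<^esub> \<in> DB m n ell" using DB(1) by (auto simp: E.subalgebra_def)
  note DBD = E.subspaceD[OF DBs(1)]
  have GDB: "G ell r i j \<in> DB m n ell" for r i j
    using DBs(2) DBD(2,4) by (simp add: G_def ser_const_def)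
  \<comment> \<open>\<open>P\<close> is recovered as \<open>G - (G - P)\<close> from a scalar and a
    generator, for the constant term as well.\<close>
  have PDB: "P r i j \<in> DB m n ell" if "i \<in> K" "j \<in> K" for r i j
  proof -
    have "\<exists>i' j' r'. b_neg m n ell i j (Suc r) = b_neg m n ell i' j' r' \<and> i' \<in> K \<and> j' \<in> K \<and> 1 \<le> r'"
      using that by (intro exI[of _ i] exI[of _ j] exI[of _ "Suc r"]) simp
    then have "b_neg m n ell i j (Suc r) \<in> gens" unfolding gens_def by (intro UnI2 CollectI)
    then have "G ell r i j \<ominus>\<^bsub>E\<^esub> (G ell r i j \<ominus>\<^bsub>E\<^esub> P r i j) \<in> DB m n ell"
      using DB(2) GDB DBD(6) bn[OF that] by auto
    then show ?thesis
      using Gc[OF that] Pc[OF that] by (simp add: E.minus_eq E.minus_add E.r_neg2)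
  qed
  have BDB: "B r i j \<in> DB m n ell" if ij: "i \<in> K" "j \<in> K" for r i j
  proof (cases r)
    case (Suc r')
    have "\<exists>i' j' r'. b_coeff m n ell i j r = b_coeff m n ell i' j' r' \<and> i' \<in> K \<and> j' \<in> K \<and> 1 \<le> r'"
      using that Suc by (intro exI[of _ i] exI[of _ j] exI[of _ r]) simp
    then have "b_coeff m n ell i j r \<in> gens" unfolding gens_def by (intro UnI1 CollectI)
    then show ?thesis using DB(2) b[OF that] by auto
  next
    \<comment> \<open>Generators of the first kind start at order 1. The constant term is instead
      computed: \<open>et\<close> and \<open>lT\<close> have constant term 1, so that of
      \<open>B\<close> is the scalar matrix \<open>G\<close>.\<close>
    case 0
    note c = E.entries_in_cmat[OF Vf et_Vf] E.entries_in_cmat[OF Vf lT(1)] E.entries_in_cmat[OF Vf G_Vf[of ell]]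
      E.entries_in_cmat[OF Vf neg_Vf[OF et_Vf]]
    note caG = E.ser_mult_closed[OF c(1,3)]
    have et0: "et 0 i k = (if i = k then \<one>\<^bsub>E\<^esub> else \<zero>\<^bsub>E\<^esub>)" if "i \<in> K" "k \<in> K" for i k
      using et_0[OF that] by (simp add: ser_one_def ser_const_def)
    have lT0: "lT 0 i j = (if i = j then \<one>\<^bsub>E\<^esub> else \<zero>\<^bsub>E\<^esub>)" if ij: "i \<in> K" "j \<in> K" for i j
    proof -
      have "(\<Oplus>\<^bsub>E\<^esub>k\<in>K. neg et 0 i k \<otimes>\<^bsub>E\<^esub> lT 0 k j) = ser_one E 0 i j"
        using lT(2) E.ser_mult_0[OF c(4,2) ij] ij by (simp add: E.is_inv_def ser_eq_def)
      also have "(\<Oplus>\<^bsub>E\<^esub>k\<in>K. neg et 0 i k \<otimes>\<^bsub>E\<^esub> lT 0 k j) =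
          (\<Oplus>\<^bsub>E\<^esub>k\<in>K. (if i = k then \<one>\<^bsub>E\<^esub> else \<zero>\<^bsub>E\<^esub>) \<otimes>\<^bsub>E\<^esub> lT 0 k j)"
        by (rule E.finsum_cong'[OF refl])
          (use ij neg_0[OF et_Vf] et0 Vf_closed[OF lT(1)] in auto)
      also have "\<dots> = lT 0 i j" by (rule E.finsum_ser_const_l) (use ij Vf_closed[OF lT(1)] in auto)
      finally show ?thesis by (simp add: ser_one_def ser_const_def)
    qed
    have aGc: "ser_mult E K et (G ell) 0 i k \<in> carrier E" if "k \<in> K" for k
      using caG ij(1) that by (auto simp: entries_in_def)
    have "B 0 i j = (\<Oplus>\<^bsub>E\<^esub>k\<in>K. ser_mult E K et (G ell) 0 i k \<otimes>\<^bsub>E\<^esub> lT 0 k j)"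
      unfolding B_def by (rule E.ser_mult_0[OF caG c(2) ij])
    also have "\<dots> = (\<Oplus>\<^bsub>E\<^esub>k\<in>K. ser_mult E K et (G ell) 0 i k \<otimes>\<^bsub>E\<^esub> (if k = j then \<one>\<^bsub>E\<^esub> else \<zero>\<^bsub>E\<^esub>))"
      by (rule E.finsum_cong'[OF refl]) (use ij aGc lT0 in auto)
    also have "\<dots> = ser_mult E K et (G ell) 0 i j" by (rule E.finsum_ser_const_r[OF ij(2) fin aGc])
    also have "\<dots> = (\<Oplus>\<^bsub>E\<^esub>k\<in>K. et 0 i k \<otimes>\<^bsub>E\<^esub> G ell 0 k j)" by (rule E.ser_mult_0[OF c(1,3) ij])
    also have "\<dots> = (\<Oplus>\<^bsub>E\<^esub>k\<in>K. (if i = k then \<one>\<^bsub>E\<^esub> else \<zero>\<^bsub>E\<^esub>) \<otimes>\<^bsub>E\<^esub> G ell 0 k j)"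
      by (rule E.finsum_cong'[OF refl]) (use ij et0 Gc in auto)
    also have "\<dots> = G ell 0 i j" by (rule E.finsum_ser_const_l) (use ij Gc in auto)
    finally show ?thesis using GDB by (simp add: 0)
  qed
  have Weq: "W = lspan E2 {TR.ct x y | x y. x \<in> carrier E \<and> y \<in> DB m n ell}"
    by (simp add: tensor_subspace_def E2_eq ctens_eq)
  have Wsub: "TR.E2.subalgebra W"
    unfolding Weq
  proof (rule TR.subalgebra_ct)
    show "TR.EC.subalgebra (carrier E)" "TR.EC.graded (carrier E)"
      using TR.Ext_subalgebra TR.Ext_graded by (simp_all add: E_simps)
    show "TR.EC.subalgebra (DB m n ell)" "TR.EC.graded (DB m n ell)"
      using E_subalgebra[OF DB(1)] E_graded[OF DB(3)] .
  qed
  have Wlt: "lt x \<in> W" if "x \<in> carrier E" for x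
    unfolding Weq lt_def by (rule lspan.incl) (use that DBs in blast)
  have Wrt: "rt x \<in> W" if "x \<in> DB m n ell" for x
    unfolding Weq rt_def by (rule lspan.incl) (use that E.one_mem in blast)
  have \<Delta>B: "\<Delta> (B r i j) \<in> W" if "i \<in> K" "j \<in> K" for r i j
    unfolding B_def
    by (rule coideal_series[OF et_Vf lT \<Delta>_t(1) Wsub Wlt Wrt]) (use that BDB in \<open>auto simp: B_def\<close>)
  have \<Delta>P: "\<Delta> (P r i j) \<in> W" if "i \<in> K" "j \<in> K" for r i j
    unfolding P_def
    by (rule coideal_series[OF ep_Vf lP \<Delta>_t(2) Wsub Wlt Wrt]) (use that PDB in \<open>auto simp: P_def\<close>)
  have Ws: "TR.E2.subspace W" "\<one>\<^bsub>E2\<^esub> \<in> W" "\<And>x y. x \<in> W \<Longrightarrow> y \<in> W \<Longrightarrow> x \<otimes>\<^bsub>E2\<^esub> y \<in> W"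
    using Wsub by (auto simp: TR.E2.subalgebra_def)
  note WD = TR.E2.subspaceD[OF Ws(1)]
  have \<Delta>1: "\<Delta> \<one>\<^bsub>E\<^esub> = \<one>\<^bsub>E2\<^esub>" "\<Delta> \<zero>\<^bsub>E\<^esub> = \<zero>\<^bsub>E2\<^esub>"
    using ring_hom_one[OF \<Delta>_hom] ring_hom_zero[OF \<Delta>_hom E_ring E2_ring] .
  \<comment> \<open>The elements whose coproduct lies in \<open>W\<close> form a subalgebra, so it
    remains to treat the generators of \<open>DB\<close>.\<close>
  have V: "E.subalgebra {x \<in> carrier E. \<Delta> x \<in> W}"
    unfolding E.subalgebra_def E.subspace_def
    using Ws(2,3) WD(2,3,4) \<Delta>1 ring_hom_add[OF \<Delta>_hom] ring_hom_mult[OF \<Delta>_hom] \<Delta>_scal by auto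
  have VG: "G ell r i j \<in> {x \<in> carrier E. \<Delta> x \<in> W}" for r i j
    using WD(2) WD(4)[OF Ws(2)] \<Delta>1 \<Delta>_scal[OF E.one_mem] by (simp add: G_def ser_const_def)
  have "gens \<subseteq> {x \<in> carrier E. \<Delta> x \<in> W}"
  proof
    fix x assume "x \<in> gens"
    then consider i j r where "i \<in> K" "j \<in> K" "x = B r i j"
      | i j r where "i \<in> K" "j \<in> K" "x = G ell r i j \<ominus>\<^bsub>E\<^esub> P r i j"
      using gens_cases by blast
    then show "x \<in> {x \<in> carrier E. \<Delta> x \<in> W}"
    proof cases
      case 1
      then show ?thesis using \<Delta>B Bc by auto
    next
      case 2
      have "P r i j \<in> {x \<in> carrier E. \<Delta> x \<in> W}" using \<Delta>P Pc 2 by auto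
      then show ?thesis
        unfolding 2(3) using V VG E.subspaceD(6) unfolding E.subalgebra_def by blast
    qed
  qed
  from E.subalg_least[OF V this] show ?thesis unfolding DB_eq by auto
qed

end

theorem proposition3p4:
  fixes m n ell :: nat
    and \<Delta> :: "dyc \<Rightarrow> (nat \<Rightarrow> dyt) set"
  assumes "m \<noteq> n"
    and "ell \<in> {1..m + n}"
    and "is_coproduct m n \<Delta>"
  shows "\<Delta> ` DB m n ell \<subseteq> tensor_subspace m n (carrier (EDY m n)) (DB m n ell)"
proof -
  interpret coproduct m n ell \<Delta> by unfold_locales fact
  show ?thesis by (rule coideal)
qed

end
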